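(* Suppose $f$ is a real function on $[1, \infty)$ such that the following conditions are satisfied: (a) $0 < f(x) \leq 1$ for all $x \in [1, \infty)$; (b) $f$ is continuous and strictly decreasing on $[1, \infty)$, and $\lim_{x \to \infty} f(x) = 0$; (c) $f$ is twice continuously differentiable on the open half line $(1, \infty)$; (d) for every positive number $c$, $\lim_{x \to \infty} [e^{cx} f(x)] = \infty$; (e) there exists $w \in (1, \infty)$ such that the function $x \mapsto x \cdot f(x)$, $x \in [1,\infty)$, is nonincreasing on $[w, \infty)$; (f) the function $x \mapsto \log f(x)$ for $x \in [1, \infty)$ is convex. Suppose $g: [1, \infty) \to [1, \infty)$ is a function such that $\lim_{x \to \infty} g(x) = \infty$. Then there exists a real-valued strictly stationary, countable-state, irreducible, aperiodic Markov chain $X := (X_k, k \in \mathbb{Z})$ which is reversible, such that $E[X_0^2] < \infty$ and $E[X_0] = 0$, and such that all of the following hold: (1) $\displaystyle \int_0^{f(x)} Q_{|X(0)|}^2(u)\, du \ll \frac{-f'(x)}{f(x)} \cdot g(x)$ as $x \to \infty$; (2) $\alpha_X(n) \leq \beta_X(n) \leq f(n)$ for all $n \in \mathbb{N}$; (3) $\lim_{n \to \infty} n^{-1}\,\mathrm{Var}\bigl(\sum_{k=1}^n X_k\bigr) = \infty$, and for every $c > 0$, $$\lim_{n \to \infty} \Bigl[\, \sup_{r \in \mathbb{R}} P\Bigl(r - c < n^{-1/2} \sum_{k=1}^n X_k < r + c\Bigr)\Bigr] = 0;$$ (4) there exist a strictly increasing sequence $(J(1), J(2), J(3), \dots)$ of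 positive integers and a sequence $(b_1, b_2, b_3, \dots)$ of positive constants satisfying $b_n \to \infty$ as $n \to \infty$, such that $$b_n^{-1} \sum_{k=1}^{J(n)} X_k \to \mu_{\mathrm{P1sL}} \quad \text{in distribution as } n \to \infty;$$ (5) defining $\mathbf{h}(n) := n^{-1}\,\mathrm{Var}\bigl(\sum_{k=1}^n X_k\bigr)$ for every $n \in \mathbb{N}$, one has $\mathbf{h}(n) \leq g(n)$ for every $n \in \mathbb{N}$, and for every $N \in \mathbb{N}$, $\limsup_{n \to \infty} \mathbf{h}(Nn)/\mathbf{h}(n) = N$.
   Context: $\mathbb{N}$ is the set of positive integers. Markov chains are indexed by the set $\mathbb{Z}$ of all integers; "countable-state" means that the state space is a finite or countably infinite subset of $\mathbb{R}$. The notation $a(x) \ll b(x)$ as $x \to \infty$ means $a(x) = O(b(x))$ as $x \to \infty$. Reversible: a strictly stationary Markov chain $(X_k, k \in \mathbb{Z})$ is reversible if the time-reversed sequence $(X_{-k}, k \in \mathbb{Z})$ has the same distribution on $\mathbb{R}^{\mathbb{Z}}$ as $(X_k, k\in\mathbb{Z})$ (equivalently, $(X_1, X_0)$ has the same distribution as $(X_0, X_1)$). Quantile function: for a nonnegative random variable $W$, $Q_W: (0,1) \to [0,\infty)$ is defined by $Q_W(u) := \inf\{t \geq 0 : P(W > t) \leq u\}$. $Q_{|X(0)|}$ denotes $Q_W$ for $W = |X_0|$. Dependence coefficients: for $\sigma$-fields $\mathcal{A}, \mathcal{B}$ on the probability space, $\alpha(\mathcal{A},\mathcal{B}) := \sup_{A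 \in \mathcal{A}, B \in \mathcal{B}} |P(A \cap B) - P(A)P(B)|$ and $\beta(\mathcal{A}, \mathcal{B}) := \sup \frac12 \sum_{i=1}^I \sum_{j=1}^J |P(A_i \cap B_j) - P(A_i)P(B_j)|$, the latter supremum being over all pairs of finite partitions $\{A_1,\dots,A_I\}$, $\{B_1,\dots,B_J\}$ of $\Omega$ with $A_i \in \mathcal{A}$, $B_j \in \mathcal{B}$. For a strictly stationary sequence $X$ and $n \in \mathbb{N}$, $\alpha_X(n) := \alpha(\sigma(X_k, k \le 0), \sigma(X_k, k \ge n))$ and $\beta_X(n) := \beta(\sigma(X_k, k \le 0), \sigma(X_k, k \ge n))$. The distribution $\mu_{\mathrm{P1sL}}$: the distribution of the random variable $Y := \sum_{k=1}^{N} \eta_k$ (with empty sum equal to $0$), where $\eta_1, \eta_2, \dots$ are i.i.d. with the Laplace density $\frac12 e^{-|x|}$, $x \in \mathbb{R}$, and $N$ is a Poisson random variable with mean $1$, independent of $(\eta_1, \eta_2, \dots)$. *)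

theory Defs
  imports "HOL-Probability.Probability" "HOL-Library.Landau_Symbols"
begin

section \<open>Stationary processes indexed by the integers\<close>

definition process_law :: "'a measure \<Rightarrow> (int \<Rightarrow> 'a \<Rightarrow> real) \<Rightarrow> (int \<Rightarrow> real) measure" where
  "process_law M X = distr M (PiM UNIV (\<lambda>_. borel)) (\<lambda>\<omega> k. X k \<omega>)"

definition strictly_stationary :: "'a measure \<Rightarrow> (int \<Rightarrow> 'a \<Rightarrow> real) \<Rightarrow> bool" where
  "strictly_stationary M X \<longleftrightarrow>
     (\<forall>k. X k \<in> borel_measurable M) \<and>
     (\<forall>m. process_law M (\<lambda>k. X (k + m)) = process_law M X)"

definition reversible :: "'a measure \<Rightarrow> (int \<Rightarrow> 'a \<Rightarrow> real) \<Rightarrow> bool" where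
  "reversible M X \<longleftrightarrow> process_law M (\<lambda>k. X (- k)) = process_law M X"


section \<open>Countable-state Markov chains\<close>

text \<open>The Markov property is the elementary one for a countable state space: conditioning on a
  finite stretch of the past (whenever that event has positive probability) is the same as
  conditioning on the present state.\<close>

definition countable_state_markov_chain ::
    "'a measure \<Rightarrow> (int \<Rightarrow> 'a \<Rightarrow> real) \<Rightarrow> real set \<Rightarrow> bool" where
  "countable_state_markov_chain M X S \<longleftrightarrow>
     countable S \<and>
     (\<forall>k. X k \<in> borel_measurable M) \<and>
     (\<forall>k. \<forall>\<omega>\<in>space M. X k \<omega> \<in> S) \<and>
     (\<forall>(m::int) (n::nat) (s::int \<Rightarrow> real).
        (\<forall>k. s k \<in> S) \<longrightarrow>
        measure M {\<omega>\<in>space M. \<forall>k\<in>{m - int n..m}. X k \<omega> = s k} > 0 \<longrightarrow>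
        cond_prob M (\<lambda>\<omega>. X (m + 1) \<omega> = s (m + 1)) (\<lambda>\<omega>. \<forall>k\<in>{m - int n..m}. X k \<omega> = s k) =
        cond_prob M (\<lambda>\<omega>. X (m + 1) \<omega> = s (m + 1)) (\<lambda>\<omega>. X m \<omega> = s m))"

text \<open>For a strictly stationary chain this is the \<open>n\<close>-step transition probability from \<open>i\<close> to
  \<open>j\<close>. It is \<open>0\<close> if \<open>X 0 = i\<close> has probability \<open>0\<close>, so that irreducibility below also forces
  every state to have positive probability.\<close>

definition trans_prob :: "'a measure \<Rightarrow> (int \<Rightarrow> 'a \<Rightarrow> real) \<Rightarrow> nat \<Rightarrow> real \<Rightarrow> real \<Rightarrow> real" where
  "trans_prob M X n i j = cond_prob M (\<lambda>\<omega>. X (int n) \<omega> = j) (\<lambda>\<omega>. X 0 \<omega> = i)"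

definition irreducible_chain :: "'a measure \<Rightarrow> (int \<Rightarrow> 'a \<Rightarrow> real) \<Rightarrow> real set \<Rightarrow> bool" where
  "irreducible_chain M X S \<longleftrightarrow> (\<forall>i\<in>S. \<forall>j\<in>S. \<exists>n\<ge>1. trans_prob M X n i j > 0)"

definition aperiodic_chain :: "'a measure \<Rightarrow> (int \<Rightarrow> 'a \<Rightarrow> real) \<Rightarrow> real set \<Rightarrow> bool" where
  "aperiodic_chain M X S \<longleftrightarrow> (\<forall>i\<in>S. Gcd {n. n \<ge> 1 \<and> trans_prob M X n i i > 0} = 1)"


section \<open>Quantile function\<close>

definition quantile_fun :: "'a measure \<Rightarrow> ('a \<Rightarrow> real) \<Rightarrow> real \<Rightarrow> real" where
  "quantile_fun M W u = Inf {t. t \<ge> 0 \<and> measure M {\<omega>\<in>space M. W \<omega> > t} \<le> u}"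


section \<open>Dependence coefficients\<close>

definition generated_sigma :: "'a measure \<Rightarrow> (int \<Rightarrow> 'a \<Rightarrow> real) \<Rightarrow> int set \<Rightarrow> 'a set set" where
  "generated_sigma M X K =
     sigma_sets (space M) {X k -` B \<inter> space M | k B. k \<in> K \<and> B \<in> sets borel}"

definition alpha_dep :: "'a measure \<Rightarrow> 'a set set \<Rightarrow> 'a set set \<Rightarrow> real" where
  "alpha_dep M \<A> \<B> =
     (SUP (A, B) \<in> \<A> \<times> \<B>. \<bar>measure M (A \<inter> B) - measure M A * measure M B\<bar>)"

definition finite_partitions :: "'a measure \<Rightarrow> 'a set set \<Rightarrow> 'a set set set" where
  "finite_partitions M \<A> = {P. finite P \<and> partition_on (space M) P \<and> P \<subseteq> \<A>}"

text \<open>Parts of \<^const>\<open>partition_on\<close> are nonempty; empty parts would contribute \<open>0\<close> to the sum.\<close>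

definition beta_dep :: "'a measure \<Rightarrow> 'a set set \<Rightarrow> 'a set set \<Rightarrow> real" where
  "beta_dep M \<A> \<B> =
     (SUP (P, Q) \<in> finite_partitions M \<A> \<times> finite_partitions M \<B>.
        1/2 * (\<Sum>A\<in>P. \<Sum>B\<in>Q. \<bar>measure M (A \<inter> B) - measure M A * measure M B\<bar>))"

definition alpha_mixing :: "'a measure \<Rightarrow> (int \<Rightarrow> 'a \<Rightarrow> real) \<Rightarrow> nat \<Rightarrow> real" where
  "alpha_mixing M X n =
     alpha_dep M (generated_sigma M X {..0}) (generated_sigma M X {int n..})"

definition beta_mixing :: "'a measure \<Rightarrow> (int \<Rightarrow> 'a \<Rightarrow> real) \<Rightarrow> nat \<Rightarrow> real" where
  "beta_mixing M X n =
     beta_dep M (generated_sigma M X {..0}) (generated_sigma M X {int n..})"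


section \<open>Partial sums\<close>

definition partial_sum :: "(int \<Rightarrow> 'a \<Rightarrow> real) \<Rightarrow> nat \<Rightarrow> 'a \<Rightarrow> real" where
  "partial_sum X n \<omega> = (\<Sum>k=1..int n. X k \<omega>)"

definition norm_var :: "'a measure \<Rightarrow> (int \<Rightarrow> 'a \<Rightarrow> real) \<Rightarrow> nat \<Rightarrow> real" where
  "norm_var M X n = prob_space.variance M (partial_sum X n) / real n"


section \<open>The compound Poisson law with Laplace summands\<close>

definition laplace_measure :: "real measure" where
  "laplace_measure = density lborel (\<lambda>x. ennreal (1/2 * exp (- \<bar>x\<bar>)))"

definition mu_P1sL :: "real measure" where
  "mu_P1sL =
     distr (measure_pmf (poisson_pmf 1) \<Otimes>\<^sub>M PiM {1..} (\<lambda>_::nat. laplace_measure)) borel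
       (\<lambda>(N, \<eta>). \<Sum>k=1..N. \<eta> k)"

text \<open>The random variable above is measurable and the law of each summand is a probability
  measure, so \<^const>\<open>distr\<close> and \<^const>\<open>PiM\<close> have their intended meaning.\<close>

lemma prob_space_laplace_measure: "prob_space laplace_measure"
proof
  let ?e = "\<lambda>x::real. ennreal (exponential_density 1 x)"
  have m: "?e \<in> borel_measurable borel" by simp
  have i1: "(\<integral>\<^sup>+x. ?e x \<partial>lborel) = 1"
    using prob_space.emeasure_space_1[OF prob_space_exponential_density[of 1]]
    by (simp add: emeasure_density)
  have i2: "(\<integral>\<^sup>+x. ?e (- x) \<partial>lborel) = 1"
    using nn_integral_real_affine[OF m, of "-1" 0] i1 by simp
  have "AE x in lborel. x \<noteq> (0::real)"
    by (rule AE_lborel_singleton)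
  then have "(\<integral>\<^sup>+x. ennreal (1/2 * exp (- \<bar>x\<bar>)) \<partial>lborel)
      = (\<integral>\<^sup>+x. ennreal (1/2) * (?e x + ?e (- x)) \<partial>lborel)"
    by (intro nn_integral_cong_AE)
       (auto elim!: eventually_mono simp: exponential_density_def ennreal_mult[symmetric]
             simp del: ennreal_half simp flip: ennreal_plus)
  also have "\<dots> = ennreal (1/2) * (1 + 1)"
    by (simp add: nn_integral_cmult nn_integral_add i1 i2 del: ennreal_half)
  also have "\<dots> = 1"
    by (simp add: ennreal_mult[symmetric] del: ennreal_half ennreal_1 ennreal_numeral
        flip: ennreal_plus ennreal_1)
  finally show "emeasure laplace_measure (space laplace_measure) = 1"
    by (simp add: laplace_measure_def emeasure_density)
qed

lemma measurable_random_sum: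
  "(\<lambda>(N, \<eta>). \<Sum>k=1..N. \<eta> k) \<in> borel_measurable
     (measure_pmf (poisson_pmf 1) \<Otimes>\<^sub>M PiM {1..} (\<lambda>_::nat. laplace_measure))"
proof -
  have "(\<lambda>x. \<Sum>k=1..fst x. snd x k) \<in> borel_measurable
      (count_space UNIV \<Otimes>\<^sub>M PiM {1..} (\<lambda>_::nat. laplace_measure))"
  proof (rule measurable_compose_countable'[where I = UNIV and g = fst])
    fix n :: nat
    have s: "sets laplace_measure = sets borel"
      by (simp add: laplace_measure_def)
    have "(\<lambda>x. x k) \<in> borel_measurable (PiM {1..} (\<lambda>_::nat. laplace_measure))" if "k \<in> {1..n}" for k
      using measurable_component_singleton[of k "{1..}" "\<lambda>_. laplace_measure"] that
      by (simp add: measurable_cong_sets[OF refl s])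
    then show "(\<lambda>x. \<Sum>k=1..n. snd x k) \<in> borel_measurable
        (count_space (UNIV::nat set) \<Otimes>\<^sub>M PiM {1..} (\<lambda>_::nat. laplace_measure))"
      by (intro borel_measurable_sum measurable_compose[OF measurable_snd]) auto
  qed auto
  then show ?thesis
    by (simp add: case_prod_beta' cong: measurable_cong_sets sets_pair_measure_cong)
qed

end

theory Submission
  imports Defs
begin

text \<open>The chain is symmetric and has a simple refresh structure: in state \<open>x\<close> it stays put with probability
  \<open>1 - p x\<close> and otherwise draws a new state from a fixed symmetric law. Besides \<open>0\<close> there are states
  \<open>\<plusminus>amp j\<close> of stationary mass proportional to \<open>2\<^sup>-\<^sup>j f (x\<^sub>j)\<close> and refresh rate \<open>2 \<theta> (x\<^sub>j)\<close>, where
  \<open>\<theta> = - f' / f\<close> and the points \<open>x\<^sub>j\<close> tend to infinity very fast. A renewal argument bounds the mixing rate by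
  the tail of the holding times, which is a mixture of exponentials lying below \<open>f\<close> because \<open>ln f\<close> lies above
  its tangents. Odd functions have covariances \<open>\<integral> h\<^sup>2 (1 - p)\<^sup>n\<close>, so all variances are explicit; level \<open>j\<close>
  contributes about \<open>((j + 1)!)\<^sup>4\<close> to the variance per step once \<open>n\<close> exceeds its holding time, and the extreme
  separation of the levels makes a single level dominate on suitable time scales. On the scale on which this
  level is visited a Poisson number of times, the partial sums are nearly compound Poisson with Laplace summands.\<close>

section \<open>Two-sided paths of a reversible kernel\<close>

text \<open>The obstacle is that \<open>f\<close> and \<open>g\<close> pull against each other. A
  slowly growing \<open>g\<close> limits the variance and the tail of the states, \<open>f\<close>
  limits how long memory may last, and yet the variance per step must diverge. The refresh rate is
  twice \<theta> because the decay of a holding time is used twice. One factor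
  \<open>exp (- \<theta> n)\<close> follows the tangent of \<open>ln f\<close> and so stays below
  \<open>f\<close>; the other makes the renewal convolution summable with a bound that does not
  depend on the levels. This convolution contains products \<open>f k * f (n - k)\<close>, which
  log-convexity compares with \<open>f (n - 1) * f 1\<close>; the constant
  \<open>f 2 / (16 * f 1)\<close> in the masses pays for the shift from n - 1 back to n. Prescribing
  the variance contribution of each level fixes its amplitude. The quantile bound at a point y then
  asks that \<open>f / \<theta>\<close> at y be at most a constant times its value at the preceding
  tangent point. The monotonicity of \<open>x * f x\<close> makes \<open>f / \<theta>\<close>
  bounded, so such points exist arbitrarily far out.\<close>

primrec path :: "('a \<Rightarrow> 'a pmf) \<Rightarrow> nat \<Rightarrow> 'a \<Rightarrow> 'a list pmf" where
  "path K 0 x = return_pmf [x]"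
| "path K (Suc n) x = bind_pmf (K x) (\<lambda>y. map_pmf ((#) x) (path K n y))"

definition window :: "(int \<Rightarrow> 'a \<Rightarrow> real) \<Rightarrow> int \<Rightarrow> nat \<Rightarrow> 'a \<Rightarrow> real list" where
  "window X a n \<omega> = map (\<lambda>i. X (a + int i) \<omega>) [0..<Suc n]"

lemma length_path: "xs \<in> set_pmf (path K n x) \<Longrightarrow> length xs = Suc n"
  by (induction n arbitrary: x xs) auto

lemma pmf_bind_supported_on:
  assumes "\<And>y. y \<noteq> z \<Longrightarrow> pmf (f y) i = 0"
  shows "pmf (bind_pmf p f) i = pmf p z * pmf (f z) i"
proof -
  have "pmf (bind_pmf p f) i = (\<integral>y. pmf (f y) i \<partial>measure_pmf p)"
    by (rule pmf_bind)
  also have "\<dots> = (\<Sum>y\<in>{z}. pmf (f y) i * pmf p y)"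
    by (rule integral_measure_pmf_real) (use assms in auto)
  finally show ?thesis by simp
qed

lemma pmf_path:
  "pmf (path K n (s 0)) (map s [0..<Suc n]) = (\<Prod>i<n. pmf (K (s i)) (s (Suc i)))"
proof (induction n arbitrary: s)
  case (Suc n)
  have eq: "map s [0..<Suc (Suc n)] = s 0 # map (s \<circ> Suc) [0..<Suc n]"
    by (simp add: map_upt_Suc del: upt_Suc)
  have z: "pmf (path K n y) (map (s \<circ> Suc) [0..<Suc n]) = 0" if "y \<noteq> s (Suc 0)" for y
  proof -
    have "hd xs = y" if "xs \<in> set_pmf (path K n y)" for xs
      using that by (cases n) auto
    then have "map (s \<circ> Suc) [0..<Suc n] \<notin> set_pmf (path K n y)"
      using that by (force simp: map_upt_Suc simp del: upt_Suc)
    then show ?thesis by (simp add: set_pmf_iff)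
  qed
  have "pmf (path K (Suc n) (s 0)) (map s [0..<Suc (Suc n)])
      = pmf (K (s 0)) (s (Suc 0)) * pmf (path K n (s (Suc 0))) (map (s \<circ> Suc) [0..<Suc n])"
    unfolding eq path.simps
    by (subst pmf_bind_supported_on[where z = "s (Suc 0)"])
       (use z in \<open>auto simp: pmf_map_inj' inj_def simp del: upt_Suc\<close>)
  also have "\<dots> = (\<Prod>i<Suc n. pmf (K (s i)) (s (Suc i)))"
    using Suc.IH[of "s \<circ> Suc"]
    unfolding prod.lessThan_Suc_shift by (simp add: o_def del: upt_Suc)
  finally show ?case .
qed simp

lemma pmf_bind_path:
  "pmf (bind_pmf p (path K n)) (map s [0..<Suc n])
    = pmf p (s 0) * (\<Prod>i<n. pmf (K (s i)) (s (Suc i)))"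
proof -
  have "pmf (path K n y) (map s [0..<Suc n]) = 0" if "y \<noteq> s 0" for y
  proof -
    have "hd xs = y" if "xs \<in> set_pmf (path K n y)" for xs
      using that by (cases n) auto
    then have "map s [0..<Suc n] \<notin> set_pmf (path K n y)"
      using that by (force simp: map_upt_Suc simp del: upt_Suc)
    then show ?thesis by (simp add: set_pmf_iff)
  qed
  then show ?thesis
    by (subst pmf_bind_supported_on[where z = "s 0"]) (auto simp: pmf_path simp del: upt_Suc)
qed

lemma map_tl_path: "map_pmf tl (path K (Suc n) x) = bind_pmf (K x) (path K n)"
  by (simp add: map_bind_pmf map_pmf_comp)

text \<open>With \<open>map_tl_path\<close> this is the consistency of the path laws. Dropping the
  first entry leaves an extra step of the kernel, which is absorbed later by invariance; dropping
  the last entry costs nothing.\<close>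

lemma map_butlast_path: "map_pmf butlast (path K (Suc n) x) = path K n x"
proof (induction n arbitrary: x)
  case 0
  show ?case by (simp add: map_bind_pmf map_pmf_comp)
next
  case (Suc n)
  have "map_pmf butlast (path K (Suc (Suc n)) x)
     = bind_pmf (K x) (\<lambda>y. map_pmf (\<lambda>xs. butlast (x # xs)) (path K (Suc n) y))"
    by (subst path.simps) (simp add: map_bind_pmf map_pmf_comp del: path.simps)
  also have "\<dots> = bind_pmf (K x) (\<lambda>y. map_pmf (\<lambda>xs. x # butlast xs) (path K (Suc n) y))"
    by (intro bind_pmf_cong map_pmf_cong refl) (auto dest!: length_path)
  also have "\<dots> = bind_pmf (K x) (\<lambda>y. map_pmf ((#) x) (map_pmf butlast (path K (Suc n) y)))"
    by (simp add: map_pmf_comp del: path.simps)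
  finally show ?case unfolding Suc.IH by simp
qed

section \<open>Reversible kernels and the two-sided process driven by independent noise\<close>

locale reversible_kernel =
  fixes \<pi> :: "real pmf" and K :: "real \<Rightarrow> real pmf"
  assumes detailed_balance: "pmf \<pi> x * pmf (K x) y = pmf \<pi> y * pmf (K y) x"
begin

lemma kernel_closed: "x \<in> set_pmf \<pi> \<Longrightarrow> set_pmf (K x) \<subseteq> set_pmf \<pi>"
proof
  fix y assume "x \<in> set_pmf \<pi>" "y \<in> set_pmf (K x)"
  then have "pmf \<pi> x * pmf (K x) y \<noteq> 0" by (simp add: set_pmf_iff)
  then show "y \<in> set_pmf \<pi>" unfolding detailed_balance[of x y] by (simp add: set_pmf_iff)
qed

lemma invariant: "bind_pmf \<pi> K = \<pi>"
proof (rule pmf_eqI)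
  fix y
  have "ennreal (pmf (bind_pmf \<pi> K) y) = (\<integral>\<^sup>+x. pmf (K x) y \<partial>measure_pmf \<pi>)"
    by (rule ennreal_pmf_bind)
  also have "\<dots> = (\<integral>\<^sup>+x. ennreal (pmf \<pi> x) * ennreal (pmf (K x) y) \<partial>count_space UNIV)"
    by (rule nn_integral_measure_pmf)
  also have "\<dots> = (\<integral>\<^sup>+x. ennreal (pmf \<pi> y) * ennreal (pmf (K y) x) \<partial>count_space UNIV)"
    by (intro nn_integral_cong) (simp add: detailed_balance flip: ennreal_mult)
  also have "\<dots> = ennreal (pmf \<pi> y) * (\<integral>\<^sup>+x. pmf (K y) x \<partial>count_space UNIV)"
    by (rule nn_integral_cmult) simp
  also have "\<dots> = pmf \<pi> y"
    by (simp add: nn_integral_pmf_eq_1)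
  finally show "pmf (bind_pmf \<pi> K) y = pmf \<pi> y"
    by (simp add: ennreal_inj)
qed

text \<open>Each use of detailed balance moves the stationary weight one step along the path and
  turns one transition around.\<close>

lemma prod_reverse:
  "pmf \<pi> (s 0) * (\<Prod>i<n. pmf (K (s i)) (s (Suc i)))
    = pmf \<pi> (s n) * (\<Prod>i<n. pmf (K (s (Suc i))) (s i))" for s :: "nat \<Rightarrow> real"
proof (induction n)
  case (Suc n)
  have "pmf \<pi> (s 0) * (\<Prod>i<Suc n. pmf (K (s i)) (s (Suc i)))
      = (pmf \<pi> (s n) * pmf (K (s n)) (s (Suc n))) * (\<Prod>i<n. pmf (K (s (Suc i))) (s i))"
    using Suc by (simp add: mult_ac)
  then show ?case
    unfolding detailed_balance[of "s n" "s (Suc n)"] by (simp add: mult_ac)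
qed simp

lemma path_reverse: "map_pmf rev (bind_pmf \<pi> (path K n)) = bind_pmf \<pi> (path K n)"
proof (rule pmf_eqI)
  fix xs :: "real list"
  let ?P = "bind_pmf \<pi> (path K n)"
  have rv: "pmf (map_pmf rev ?P) xs = pmf ?P (rev xs)"
    using pmf_map_inj'[of rev ?P "rev xs"] by (simp add: inj_on_rev inj_def)
  show "pmf (map_pmf rev ?P) xs = pmf ?P xs"
  proof (cases "length xs = Suc n")
    case True
    define s where "s i = xs ! i" for i
    have xs: "xs = map s [0..<Suc n]"
      by (rule nth_equalityI) (use True in \<open>auto simp: s_def simp del: upt_Suc\<close>)
    have rxs: "rev xs = map (\<lambda>i. s (n - i)) [0..<Suc n]"
      by (rule nth_equalityI) (use True in \<open>auto simp: s_def rev_nth simp del: upt_Suc\<close>)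
    have "pmf ?P (rev xs) = pmf \<pi> (s n) * (\<Prod>i<n. pmf (K (s (n - i))) (s (n - Suc i)))"
      unfolding rxs by (subst pmf_bind_path) simp
    also have "(\<Prod>i<n. pmf (K (s (n - i))) (s (n - Suc i))) = (\<Prod>i<n. pmf (K (s (Suc i))) (s i))"
      by (subst (2) prod.nat_diff_reindex[symmetric]) (auto intro!: prod.cong simp: Suc_diff_Suc)
    also have "pmf \<pi> (s n) * \<dots> = pmf ?P xs"
      unfolding xs by (subst pmf_bind_path) (rule prod_reverse[symmetric])
    finally show ?thesis unfolding rv .
  next
    case False
    then have "xs \<notin> set_pmf ?P" "rev xs \<notin> set_pmf ?P"
      using length_path by fastforce+
    then have "pmf ?P xs = 0" "pmf ?P (rev xs) = 0"
      by (simp_all only: pmf_eq_0_set_pmf not_False_eq_True)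
    then show ?thesis unfolding rv by simp
  qed
qed

text \<open>The Markov chain predicate asks for values in the state space at every sample point, not
  just almost surely. Clipping redirects the null set of bad noise values to some fixed
  state.\<close>

definition clip :: "real \<Rightarrow> real" where
  "clip x = (if x \<in> set_pmf \<pi> then x else (SOME z. z \<in> set_pmf \<pi>))"

lemma clip_in: "clip x \<in> set_pmf \<pi>"
  by (auto simp: clip_def some_in_eq set_pmf_not_empty)

lemma clip_id: "x \<in> set_pmf \<pi> \<Longrightarrow> clip x = x"
  by (simp add: clip_def)

lemma measurable_clip [measurable]: "clip \<in> borel_measurable borel"
proof -
  have "set_pmf \<pi> \<in> sets borel"
    by (rule sets.countable[OF _ countable_set_pmf]) auto
  then show ?thesis
    unfolding clip_def[abs_def] by (intro measurable_If_set) auto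
qed

lemma prob_clip:
  assumes "set_pmf q \<subseteq> set_pmf \<pi>" "y \<in> set_pmf \<pi>"
  shows "measure (measure_pmf q) {v. clip v = y} = pmf q y"
proof -
  have "measure (measure_pmf q) {v. clip v = y} = measure (measure_pmf q) ({v. clip v = y} \<inter> set_pmf q)"
    by (simp add: measure_Int_set_pmf)
  also have "{v. clip v = y} \<inter> set_pmf q = {y} \<inter> set_pmf q"
    using assms by (auto simp: clip_id subset_eq)
  finally show ?thesis by (simp add: measure_Int_set_pmf measure_pmf_single)
qed

definition noise :: "(int \<times> real \<Rightarrow> real) measure" where
  "noise = PiM UNIV (\<lambda>(k, x). measure_pmf (if k = 0 then \<pi> else K x))"

text \<open>The coordinate \<open>(k, x)\<close> of the noise holds the state to which the process moves at time \<open>k\<close>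
  if it sits in \<open>x\<close> one step closer to time \<open>0\<close>; by reversibility the same kernel drives both
  directions of time.\<close>

primrec walk :: "int \<Rightarrow> nat \<Rightarrow> (int \<times> real \<Rightarrow> real) \<Rightarrow> real" where
  "walk d 0 \<omega> = clip (\<omega> (0, 0))"
| "walk d (Suc n) \<omega> = clip (\<omega> (d * int (Suc n), walk d n \<omega>))"

definition chain :: "int \<Rightarrow> (int \<times> real \<Rightarrow> real) \<Rightarrow> real" where
  "chain k = walk (sgn k) (nat \<bar>k\<bar>)"

lemma prob_space_noise: "prob_space noise"
  unfolding noise_def by (intro prob_space_PiM) (auto simp: measure_pmf.prob_space_axioms)

lemma chain_0: "chain 0 \<omega> = clip (\<omega> (0, 0))"
  by (simp add: chain_def)

lemma chain_step: "k \<noteq> 0 \<Longrightarrow> chain k \<omega> = clip (\<omega> (k, chain (k - sgn k) \<omega>))"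
proof -
  assume k: "k \<noteq> 0"
  then obtain n where n: "nat \<bar>k\<bar> = Suc n" by (cases "nat \<bar>k\<bar>") auto
  have "chain (k - sgn k) = walk (sgn k) n"
  proof (cases "n = 0")
    case True
    then have "k - sgn k = 0" using n k by (auto simp: sgn_if)
    then show ?thesis using True by (auto simp: chain_def fun_eq_iff)
  next
    case False
    then have "sgn (k - sgn k) = sgn k" "nat \<bar>k - sgn k\<bar> = n" using n k by (auto simp: sgn_if)
    then show ?thesis by (simp add: chain_def)
  qed
  moreover have "sgn k * int (Suc n) = k" using n k by (auto simp: sgn_if)
  ultimately show ?thesis by (simp add: chain_def n del: of_nat_Suc)
qed

lemma chain_in: "chain k \<omega> \<in> set_pmf \<pi>"
  by (cases "k = 0") (auto simp: chain_0 chain_step clip_in)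

lemma measurable_noise: "(\<lambda>\<omega>. clip (\<omega> i)) \<in> measurable noise (count_space (set_pmf \<pi>))"
proof -
  have "(\<lambda>\<omega>. \<omega> i) \<in> measurable noise (case i of (k, x) \<Rightarrow> measure_pmf (if k = 0 then \<pi> else K x))"
    unfolding noise_def by (rule measurable_component_singleton) simp
  then have "(\<lambda>\<omega>. \<omega> i) \<in> measurable noise (count_space UNIV)"
    by (cases i) simp
  then show ?thesis
    by (rule measurable_compose) (auto simp: clip_in)
qed

lemma measurable_chain: "chain k \<in> measurable noise (count_space (set_pmf \<pi>))"
proof -
  have "walk d n \<in> measurable noise (count_space (set_pmf \<pi>))" for d n
  proof (induction n)
    case 0
    show ?case using measurable_noise[of "(0,0)"] by simp
  next
    case (Suc n)
    show ?case unfolding walk.simps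
    proof (rule measurable_compose_countable'[OF _ Suc])
      show "(\<lambda>\<omega>. clip (\<omega> (d * int (Suc n), x))) \<in> measurable noise (count_space (set_pmf \<pi>))" for x
        by (rule measurable_noise)
    qed (rule countable_set_pmf)
  qed
  then show ?thesis by (simp add: chain_def)
qed

text \<open>Prescribing the path also prescribes which noise coordinate is read at each time. These
  coordinates are distinct, hence independent, and the probability is a product of transitions
  leading away from time 0 in both directions. Detailed balance turns the left half around, so that
  all transitions point forward.\<close>

lemma chain_cylinder:
  assumes s: "\<And>k. s k \<in> set_pmf \<pi>"
  shows "measure noise {\<omega>\<in>space noise. \<forall>k\<in>{-int m..int n}. chain k \<omega> = s k}
    = pmf \<pi> (s (-int m)) * (\<Prod>i<m+n. pmf (K (s (int i - int m))) (s (int (Suc i) - int m)))"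
proof -
  interpret product_prob_space "\<lambda>(k::int, x). measure_pmf (if k = 0 then \<pi> else K x)" UNIV
    by (rule product_prob_spaceI) (auto simp: measure_pmf.prob_space_axioms)
  let ?I = "{-int m..int n}"
  \<comment> \<open>At time 0 the coordinate \<open>(0, 0)\<close> is read. At any other time the
    second component is the prescribed state one step closer to 0.\<close>
  define idx where "idx k = (k, if k = 0 then 0 else s (k - sgn k))" for k :: int
  have inj: "inj_on idx ?I" by (rule inj_onI) (simp add: idx_def)
  have ev: "(\<forall>k\<in>?I. chain k \<omega> = s k) \<longleftrightarrow> (\<forall>j\<in>idx ` ?I. \<omega> j \<in> {v. clip v = s (fst j)})" for \<omega>
  proof
    assume L: "\<forall>k\<in>?I. chain k \<omega> = s k"
    have "clip (\<omega> (idx k)) = s k" if k: "k \<in> ?I" for k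
    proof (cases "k = 0")
      case True
      then show ?thesis using L k by (auto simp: idx_def chain_0[symmetric])
    next
      case False
      then have "k - sgn k \<in> ?I" using k by (auto simp: sgn_if)
      then have "chain (k - sgn k) \<omega> = s (k - sgn k)" "chain k \<omega> = s k" using L k by blast+
      then show ?thesis using chain_step[OF False, of \<omega>] False by (simp add: idx_def)
    qed
    then show "\<forall>j\<in>idx ` ?I. \<omega> j \<in> {v. clip v = s (fst j)}" by (auto simp: idx_def)
  next
    assume R: "\<forall>j\<in>idx ` ?I. \<omega> j \<in> {v. clip v = s (fst j)}"
    then have R': "clip (\<omega> (idx k)) = s k" if "k \<in> ?I" for k
      using that by (force simp: idx_def)
    have "k \<in> ?I \<Longrightarrow> chain k \<omega> = s k" for k
    proof (induction "nat \<bar>k\<bar>" arbitrary: k)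
      case 0
      then show ?case using R'[of 0] by (simp add: idx_def chain_0)
    next
      case (Suc l)
      then have "k \<noteq> 0" "l = nat \<bar>k - sgn k\<bar>" "k - sgn k \<in> ?I" by (auto simp: sgn_if)
      then show ?case using Suc(1)[of "k - sgn k"] R'[OF Suc(3)] chain_step[of k \<omega>] by (simp add: idx_def)
    qed
    then show "\<forall>k\<in>?I. chain k \<omega> = s k" by auto
  qed
  have "emeasure noise {\<omega>\<in>space noise. \<forall>k\<in>?I. chain k \<omega> = s k}
      = emeasure noise {\<omega>\<in>space noise. \<forall>j\<in>idx ` ?I. \<omega> j \<in> {v. clip v = s (fst j)}}"
    unfolding ev ..
  also have "\<dots> = (\<Prod>j\<in>idx ` ?I. emeasure (case j of (k, x) \<Rightarrow> measure_pmf (if k = 0 then \<pi> else K x))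
      {v. clip v = s (fst j)})"
    unfolding noise_def by (subst emeasure_PiM_Collect) (auto simp: split_beta)
  also have "\<dots> = (\<Prod>k\<in>?I. emeasure (measure_pmf (if k = 0 then \<pi> else K (s (k - sgn k)))) {v. clip v = s k})"
    by (subst prod.reindex[OF inj]) (auto simp: idx_def intro!: prod.cong)
  also have "\<dots> = (\<Prod>k\<in>?I. ennreal (if k = 0 then pmf \<pi> (s 0) else pmf (K (s (k - sgn k))) (s k)))"
    by (intro prod.cong refl)
       (use s kernel_closed in \<open>auto simp: measure_pmf.emeasure_eq_measure prob_clip\<close>)
  also have "\<dots> = ennreal (\<Prod>k\<in>?I. if k = 0 then pmf \<pi> (s 0) else pmf (K (s (k - sgn k))) (s k))"
    by (intro prod_ennreal) auto
  finally have *: "measure noise {\<omega>\<in>space noise. \<forall>k\<in>?I. chain k \<omega> = s k}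
     = (\<Prod>k\<in>?I. if k = 0 then pmf \<pi> (s 0) else pmf (K (s (k - sgn k))) (s k))"
    by (auto simp: measure_def intro!: enn2real_ennreal prod_nonneg)
  have I: "?I = insert 0 ((\<lambda>i. - int (Suc i)) ` {..<m} \<union> (\<lambda>i. int (Suc i)) ` {..<n})"
    (is "_ = insert 0 (?A \<union> ?B)")
  proof (intro equalityI subsetI)
    fix k assume "k \<in> ?I"
    then have "k = 0 \<or> (k < 0 \<and> k = - int (Suc (nat (-k - 1))) \<and> nat (-k - 1) < m)
      \<or> (k > 0 \<and> k = int (Suc (nat (k - 1))) \<and> nat (k - 1) < n)" by auto
    then show "k \<in> insert 0 (?A \<union> ?B)" by blast
  qed auto
  have "(\<Prod>k\<in>?I. if k = 0 then pmf \<pi> (s 0) else pmf (K (s (k - sgn k))) (s k))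
     = pmf \<pi> (s 0) * ((\<Prod>k\<in>?A. pmf (K (s (k - sgn k))) (s k)) * (\<Prod>k\<in>?B. pmf (K (s (k - sgn k))) (s k)))"
    unfolding I
    by (subst prod.insert, simp, force, subst prod.union_disjoint)
       (auto intro!: prod.cong arg_cong2[where f = "(*)"])
  also have "(\<Prod>k\<in>?A. pmf (K (s (k - sgn k))) (s k)) = (\<Prod>i<m. pmf (K (s (- int i))) (s (- int (Suc i))))"
    by (subst prod.reindex) (auto simp: inj_on_def intro!: prod.cong)
  also have "(\<Prod>k\<in>?B. pmf (K (s (k - sgn k))) (s k)) = (\<Prod>i<n. pmf (K (s (int i))) (s (int (Suc i))))"
    by (subst prod.reindex) (auto simp: inj_on_def intro!: prod.cong)
  also have "pmf \<pi> (s 0) * ((\<Prod>i<m. pmf (K (s (- int i))) (s (- int (Suc i)))) * (\<Prod>i<n. pmf (K (s (int i))) (s (int (Suc i)))))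
     = pmf \<pi> (s (- int m)) * (\<Prod>i<m. pmf (K (s (- int (Suc i)))) (s (- int i))) * (\<Prod>i<n. pmf (K (s (int i))) (s (int (Suc i))))"
    using prod_reverse[of "\<lambda>i. s (- int i)" m] by (simp add: algebra_simps)
  also have "(\<Prod>i<m. pmf (K (s (- int (Suc i)))) (s (- int i)))
      = (\<Prod>i<m. pmf (K (s (int i - int m))) (s (int (Suc i) - int m)))"
    by (subst prod.nat_diff_reindex[symmetric]) (auto intro!: prod.cong simp: of_nat_diff algebra_simps)
  also have "(\<Prod>i<n. pmf (K (s (int i))) (s (int (Suc i))))
      = (\<Prod>i\<in>{m..<m+n}. pmf (K (s (int i - int m))) (s (int (Suc i) - int m)))"
    using prod.shift_bounds_nat_ivl[of "\<lambda>i. pmf (K (s (int i - int m))) (s (int (Suc i) - int m))" 0 m n]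
    by (simp add: atLeast0LessThan add.commute algebra_simps)
  finally have "(\<Prod>k\<in>?I. if k = 0 then pmf \<pi> (s 0) else pmf (K (s (k - sgn k))) (s k))
    = pmf \<pi> (s (- int m)) * ((\<Prod>i<m. pmf (K (s (int i - int m))) (s (int (Suc i) - int m)))
      * (\<Prod>i\<in>{m..<m+n}. pmf (K (s (int i - int m))) (s (int (Suc i) - int m))))"
    by (simp only: mult.assoc)
  also have "(\<Prod>i<m. pmf (K (s (int i - int m))) (s (int (Suc i) - int m)))
      * (\<Prod>i\<in>{m..<m+n}. pmf (K (s (int i - int m))) (s (int (Suc i) - int m)))
     = (\<Prod>i<m+n. pmf (K (s (int i - int m))) (s (int (Suc i) - int m)))"
    using prod.atLeastLessThan_concat[of 0 m "m+n" "\<lambda>i. pmf (K (s (int i - int m))) (s (int (Suc i) - int m))"]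
    by (simp add: atLeast0LessThan)
  finally show ?thesis using * by simp
qed

lemma measurable_window:
  assumes "\<And>k. X k \<in> measurable M (count_space (set_pmf \<pi>))"
  shows "window X a n \<in> measurable M (count_space UNIV)"
proof -
  have "(\<lambda>\<omega>. map (\<lambda>i. X (a + int i) \<omega>) [0..<m]) \<in> measurable M (count_space (lists (set_pmf \<pi>)))" for m
  proof (induction m)
    case (Suc m)
    have "(\<lambda>\<omega>. (\<lambda>xs. xs @ [X (a + int m) \<omega>]) (map (\<lambda>i. X (a + int i) \<omega>) [0..<m]))
        \<in> measurable M (count_space (lists (set_pmf \<pi>)))"
    proof (rule measurable_compose_countable'[OF _ Suc])
      fix xs assume "xs \<in> lists (set_pmf \<pi>)"
      then have "(\<lambda>y. xs @ [y]) \<in> measurable (count_space (set_pmf \<pi>)) (count_space (lists (set_pmf \<pi>)))"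
        by auto
      then show "(\<lambda>\<omega>. xs @ [X (a + int m) \<omega>]) \<in> measurable M (count_space (lists (set_pmf \<pi>)))"
        by (rule measurable_compose[OF assms])
    qed (rule countable_lists[OF countable_set_pmf])
    then show ?case by simp
  qed simp
  from this[of "Suc n"] have "window X a n \<in> measurable M (count_space (lists (set_pmf \<pi>)))"
    by (simp add: window_def[abs_def] del: upt_Suc)
  then show ?thesis
    using measurable_compose[where g = "\<lambda>x. x" and L = "count_space UNIV"
        and N = "count_space (lists (set_pmf \<pi>))"] by auto
qed

lemma chain_window_centered:
  "distr noise (count_space UNIV) (window chain (- int m) (m + n)) = measure_pmf (bind_pmf \<pi> (path K (m + n)))"
proof (rule measure_eqI_countable_AE[where \<Omega> = "lists (set_pmf \<pi>) \<inter> {xs. length xs = Suc (m + n)}"])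
  interpret prob_space noise by (rule prob_space_noise)
  let ?W = "window chain (- int m) (m + n)"
  have W [measurable]: "?W \<in> measurable noise (count_space UNIV)"
    by (rule measurable_window[OF measurable_chain])
  show "AE x in distr noise (count_space UNIV) ?W. x \<in> lists (set_pmf \<pi>) \<inter> {xs. length xs = Suc (m + n)}"
    by (subst AE_distr_iff)
       (auto intro!: AE_I2 simp: window_def chain_in in_lists_conv_set simp del: upt_Suc)
  have sub: "set xs \<subseteq> set_pmf \<pi>" if "x \<in> set_pmf \<pi>" "xs \<in> set_pmf (path K l x)" for x xs l
    using that
  proof (induction l arbitrary: x xs)
    case (Suc l)
    then show ?case using kernel_closed[of x] by fastforce
  qed auto
  show "AE x in measure_pmf (bind_pmf \<pi> (path K (m + n))). x \<in> lists (set_pmf \<pi>) \<inter> {xs. length xs = Suc (m + n)}"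
    using sub by (fastforce simp: AE_measure_pmf_iff dest: length_path)
  show "countable (lists (set_pmf \<pi>) \<inter> {xs. length xs = Suc (m + n)})"
    by (intro countable_Int1 countable_lists countable_set_pmf)
  fix xs assume xs: "xs \<in> lists (set_pmf \<pi>) \<inter> {xs. length xs = Suc (m + n)}"
  obtain z where z: "z \<in> set_pmf \<pi>" using set_pmf_not_empty by fast
  \<comment> \<open>Outside the window the value is immaterial, but \<open>chain_cylinder\<close>
    asks for a state at every time.\<close>
  define s where "s k = (if k \<in> {- int m..int n} then xs ! nat (k + int m) else z)" for k
  have s: "s k \<in> set_pmf \<pi>" for k
    using xs z by (auto simp: s_def in_lists_conv_set)
  have xs_eq: "xs = map (\<lambda>i. s (int i - int m)) [0..<Suc (m + n)]"
    by (rule nth_equalityI) (use xs in \<open>auto simp: s_def simp del: upt_Suc\<close>)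
  have "?W \<omega> = xs \<longleftrightarrow> (\<forall>k\<in>{-int m..int n}. chain k \<omega> = s k)" for \<omega>
  proof -
    have "?W \<omega> = xs \<longleftrightarrow> (\<forall>i<Suc (m + n). chain (int i - int m) \<omega> = s (int i - int m))"
      unfolding xs_eq window_def by (auto simp del: upt_Suc simp: list_eq_iff_nth_eq)
    also have "\<dots> \<longleftrightarrow> (\<forall>k\<in>{-int m..int n}. chain k \<omega> = s k)"
    proof safe
      fix k assume *: "\<forall>i<Suc (m + n). chain (int i - int m) \<omega> = s (int i - int m)" "k \<in> {-int m..int n}"
      then show "chain k \<omega> = s k" using *(1)[rule_format, of "nat (k + int m)"] by auto
    qed auto
    finally show ?thesis .
  qed
  then have "measure noise (?W -` {xs} \<inter> space noise) =
      measure noise {\<omega>\<in>space noise. \<forall>k\<in>{-int m..int n}. chain k \<omega> = s k}"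
    by (intro arg_cong[where f = "measure noise"]) auto
  also have "\<dots> = pmf \<pi> (s (-int m)) * (\<Prod>i<m+n. pmf (K (s (int i - int m))) (s (int (Suc i) - int m)))"
    by (rule chain_cylinder[OF s])
  also have "\<dots> = pmf (bind_pmf \<pi> (path K (m + n))) xs"
    unfolding xs_eq by (subst pmf_bind_path) simp
  finally show "emeasure (distr noise (count_space UNIV) ?W) {xs} = emeasure (measure_pmf (bind_pmf \<pi> (path K (m + n)))) {xs}"
    by (simp add: emeasure_distr emeasure_eq_measure emeasure_pmf_single)
qed auto

text \<open>An arbitrary window is cut out of a large one around time 0. Trimming on the right uses
  the consistency of the path laws, trimming on the left also the invariance of \<pi>.\<close>

lemma chain_window:
  "distr noise (count_space UNIV) (window chain a n) = measure_pmf (bind_pmf \<pi> (path K n))"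
proof -
  have W: "window chain a n \<in> measurable noise (count_space UNIV)" for a n
    by (rule measurable_window[OF measurable_chain])
  have tl: "distr noise (count_space UNIV) (window chain (a + 1) n) = measure_pmf (bind_pmf \<pi> (path K n))"
    if "distr noise (count_space UNIV) (window chain a (Suc n)) = measure_pmf (bind_pmf \<pi> (path K (Suc n)))" for a n
  proof -
    have "window chain (a + 1) n = tl \<circ> window chain a (Suc n)"
      by (auto simp: window_def fun_eq_iff map_upt_Suc algebra_simps simp del: upt_Suc)
    then have "distr noise (count_space UNIV) (window chain (a + 1) n)
        = distr (distr noise (count_space UNIV) (window chain a (Suc n))) (count_space UNIV) tl"
      by (simp add: distr_distr[OF _ W])
    also have "\<dots> = measure_pmf (map_pmf tl (bind_pmf \<pi> (path K (Suc n))))"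
      unfolding that by (simp add: map_pmf_rep_eq)
    also have "map_pmf tl (bind_pmf \<pi> (path K (Suc n))) = bind_pmf \<pi> (path K n)"
      by (simp only: map_bind_pmf map_tl_path bind_assoc_pmf[symmetric] invariant)
    finally show ?thesis .
  qed
  have bl: "distr noise (count_space UNIV) (window chain a n) = measure_pmf (bind_pmf \<pi> (path K n))"
    if "distr noise (count_space UNIV) (window chain a (Suc n)) = measure_pmf (bind_pmf \<pi> (path K (Suc n)))" for a n
  proof -
    have "window chain a n = butlast \<circ> window chain a (Suc n)"
      by (auto simp: window_def fun_eq_iff butlast_append)
    then have "distr noise (count_space UNIV) (window chain a n)
        = distr (distr noise (count_space UNIV) (window chain a (Suc n))) (count_space UNIV) butlast"
      by (simp add: distr_distr[OF _ W])
    also have "\<dots> = measure_pmf (map_pmf butlast (bind_pmf \<pi> (path K (Suc n))))"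
      unfolding that by (simp add: map_pmf_rep_eq)
    also have "map_pmf butlast (bind_pmf \<pi> (path K (Suc n))) = bind_pmf \<pi> (path K n)"
      by (simp only: map_bind_pmf map_butlast_path)
    finally show ?thesis .
  qed
  let ?P = "\<lambda>a n. distr noise (count_space UNIV) (window chain a n) = measure_pmf (bind_pmf \<pi> (path K n))"
  have tls: "?P a (k + n) \<Longrightarrow> ?P (a + int k) n" for a k n
  proof (induction k arbitrary: a)
    case (Suc k)
    have "?P (a + 1) (k + n)" using tl[of a "k + n"] Suc.prems by (simp del: path.simps)
    then have "?P (a + 1 + int k) n" by (rule Suc.IH)
    then show ?case by (simp add: algebra_simps)
  qed simp
  have bls: "?P a (n + k) \<Longrightarrow> ?P a n" for a k n
  proof (induction k)
    case (Suc k)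
    then show ?case using bl[of a "n + k"] by (simp del: path.simps)
  qed simp
  \<comment> \<open>The window from \<open>- m\<close> with \<open>m + (k + n)\<close> steps loses
    its last m entries and then its first k, after which it starts at \<open>- m + k = a\<close>.
    Both cutoffs at 0 are harmless: k is positive only for positive a.\<close>
  define m where "m = nat (- a)"
  define k where "k = nat (a + int m)"
  have "?P (- int m) (m + (k + n))" by (rule chain_window_centered)
  then have "?P (- int m) ((k + n) + m)" by (simp only: add.commute)
  then have "?P (- int m) (k + n)" by (rule bls)
  then have "?P (- int m + int k) n" by (rule tls)
  also have "- int m + int k = a" by (auto simp: m_def k_def)
  finally show ?thesis .
qed

end

text \<open>From here on the process is known only through the laws of its finite windows, together
  with membership in the support at every sample point. Stationarity, reversibility and the Markov
  property all follow from these.\<close>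

locale kernel_process = reversible_kernel \<pi> K + prob_space M
  for \<pi> :: "real pmf" and K and M :: "'b measure" +
  fixes X :: "int \<Rightarrow> 'b \<Rightarrow> real"
  assumes measurable_X [measurable]: "X k \<in> borel_measurable M"
    and X_in: "\<omega> \<in> space M \<Longrightarrow> X k \<omega> \<in> set_pmf \<pi>"
    and window_law: "distr M (count_space UNIV) (window X a n) = measure_pmf (bind_pmf \<pi> (path K n))"

text \<open>The chain is carried over to the canonical path space, which removes the index type of
  the noise. The coordinates are clipped once more because path space contains all real
  sequences.\<close>

theorem (in reversible_kernel) ex_kernel_process:
  "\<exists>(M :: (int \<Rightarrow> real) measure) X. kernel_process \<pi> K M X"
proof -
  interpret N: prob_space noise by (rule prob_space_noise)
  let ?B = "PiM UNIV (\<lambda>_::int. borel :: real measure)"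
  have ch [measurable]: "chain k \<in> borel_measurable noise" for k
    using measurable_compose[OF measurable_chain, where g = "\<lambda>x. x"] by auto
  have [measurable]: "(\<lambda>\<omega> k. chain k \<omega>) \<in> measurable noise ?B"
    by (rule measurable_PiM_single') auto
  define M where "M = distr noise ?B (\<lambda>\<omega> k. chain k \<omega>)"
  define X where "X k \<omega> = clip (\<omega> k)" for k :: int and \<omega> :: "int \<Rightarrow> real"
  interpret prob_space M unfolding M_def by (rule N.prob_space_distr) simp
  have X [measurable]: "X k \<in> borel_measurable M" for k
    unfolding X_def M_def by measurable
  have XS: "X k \<in> measurable M (count_space (set_pmf \<pi>))" for k
    unfolding measurable_count_space_eq_countable[OF countable_set_pmf]
    using X by (auto simp: X_def clip_in) 
  have "distr M (count_space UNIV) (window X a n) = distr noise (count_space UNIV) (window chain a n)" for a n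
  proof -
    have "window X a n \<in> measurable ?B (count_space UNIV)"
      using measurable_window[of X M a n, OF XS] unfolding M_def by simp
    then have "distr M (count_space UNIV) (window X a n)
       = distr noise (count_space UNIV) (window X a n \<circ> (\<lambda>\<omega> k. chain k \<omega>))"
      unfolding M_def by (simp add: distr_distr)
    also have "window X a n \<circ> (\<lambda>\<omega> k. chain k \<omega>) = window chain a n"
      by (auto simp: window_def X_def fun_eq_iff clip_id chain_in)
    finally show ?thesis .
  qed
  then have "kernel_process \<pi> K M X"
    by unfold_locales (auto simp: chain_window X_def clip_in)
  then show ?thesis by blast
qed

text \<open>Adding the bound \<open>B\<close> makes the integrand nonnegative, so that the formula
  for nonnegative integrals applies.\<close>

lemma integral_bind_pmf_real:
  fixes f :: "'b \<Rightarrow> real"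
  assumes bnd: "\<And>x. \<bar>f x\<bar> \<le> B"
  shows "(\<integral>x. f x \<partial>bind_pmf p q) = (\<integral>x. (\<integral>y. f y \<partial>q x) \<partial>p)"
proof -
  have B: "0 \<le> B" using bnd[of undefined] by linarith
  have int: "integrable (measure_pmf r) f" for r
    by (rule measure_pmf.integrable_const_bound[where B = B]) (use bnd in auto)
  have nn: "0 \<le> f x + B" for x using bnd[of x] by linarith
  have r: "(\<integral>\<^sup>+x. ennreal (f x + B) \<partial>measure_pmf r) = ennreal ((\<integral>x. f x \<partial>r) + B)" for r
    using nn_integral_eq_integral[of "measure_pmf r" "\<lambda>x. f x + B"] int nn by simp
  have ge: "- B \<le> (\<integral>y. f y \<partial>measure_pmf r)" and "(\<integral>y. f y \<partial>measure_pmf r) \<le> B" for r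
    using measure_pmf.integral_ge_const[OF int[of r], where c = "- B"]
      measure_pmf.integral_le_const[OF int[of r], where c = B] bnd
    by (auto simp: abs_le_iff minus_le_iff)
  then have le: "\<bar>(\<integral>y. f y \<partial>measure_pmf (q x))\<bar> \<le> B" for x
    by (simp add: abs_le_iff minus_le_iff)
  have int': "integrable (measure_pmf p) (\<lambda>x. \<integral>y. f y \<partial>q x)"
    by (rule measure_pmf.integrable_const_bound[where B = B]) (use le in auto)
  have nn': "0 \<le> (\<integral>y. f y \<partial>q x) + B" for x using le[of x] by linarith
  have "ennreal ((\<integral>x. f x \<partial>bind_pmf p q) + B) = (\<integral>\<^sup>+x. (\<integral>\<^sup>+y. ennreal (f y + B) \<partial>q x) \<partial>p)"
    unfolding r[symmetric] by simp
  also have "\<dots> = ennreal ((\<integral>x. (\<integral>y. f y \<partial>q x) \<partial>p) + B)"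
    unfolding r using nn_integral_eq_integral[of "measure_pmf p" "\<lambda>x. (\<integral>y. f y \<partial>q x) + B"] int' nn'
    by simp
  finally have "(\<integral>x. f x \<partial>bind_pmf p q) + B = (\<integral>x. (\<integral>y. f y \<partial>q x) \<partial>p) + B"
  proof (rule ennreal_inj[THEN iffD1, rotated 2])
    show "0 \<le> (\<integral>x. f x \<partial>bind_pmf p q) + B"
      using ge[of "bind_pmf p q"] by simp
    show "0 \<le> (\<integral>x. (\<integral>y. f y \<partial>q x) \<partial>p) + B"
      using Bochner_Integration.integral_nonneg[of "measure_pmf p" "\<lambda>x. (\<integral>y. f y \<partial>q x) + B"] int' nn'
      by simp
  qed
  then show ?thesis by simp
qed

lemma integrable_pmf_bounded:
  fixes f :: "'b \<Rightarrow> 'c::{banach, second_countable_topology}"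
  assumes "\<And>x. norm (f x) \<le> B"
  shows "integrable (measure_pmf p) f"
  by (rule measure_pmf.integrable_const_bound[where B = B]) (use assms in auto)

lemma norm_integral_pmf_le:
  fixes f :: "'b \<Rightarrow> 'c::{banach, second_countable_topology}"
  assumes "\<And>x. norm (f x) \<le> B"
  shows "norm (\<integral>x. f x \<partial>measure_pmf p) \<le> B"
proof -
  have "norm (\<integral>x. f x \<partial>measure_pmf p) \<le> (\<integral>x. norm (f x) \<partial>measure_pmf p)"
    by (rule integral_norm_bound)
  also have "\<dots> \<le> (\<integral>x. B \<partial>measure_pmf p)"
    by (intro integral_mono integrable_norm integrable_pmf_bounded[OF assms] assms) auto
  finally show ?thesis by simp
qed

lemma integral_bind_pmf_complex:
  fixes f :: "'b \<Rightarrow> complex"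
  assumes bnd: "\<And>x. norm (f x) \<le> B"
  shows "(\<integral>x. f x \<partial>bind_pmf p q) = (\<integral>x. (\<integral>y. f y \<partial>q x) \<partial>p)"
proof -
  have Re: "\<bar>Re (f x)\<bar> \<le> B" and Im: "\<bar>Im (f x)\<bar> \<le> B" for x
    using bnd[of x] abs_Re_le_cmod[of "f x"] abs_Im_le_cmod[of "f x"] by linarith+
  have i: "integrable (measure_pmf r) f" for r by (rule integrable_pmf_bounded[OF bnd])
  have i': "integrable (measure_pmf p) (\<lambda>x. \<integral>y. f y \<partial>q x)"
    by (rule integrable_pmf_bounded[where B = B]) (rule norm_integral_pmf_le[OF bnd])
  show ?thesis
  proof (rule complex_eqI)
    have "Re (\<integral>x. f x \<partial>bind_pmf p q) = (\<integral>x. Re (f x) \<partial>bind_pmf p q)"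
      by (rule integral_Re[OF i, symmetric])
    also have "\<dots> = (\<integral>x. (\<integral>y. Re (f y) \<partial>q x) \<partial>p)"
      by (rule integral_bind_pmf_real[OF Re])
    also have "\<dots> = (\<integral>x. Re (\<integral>y. f y \<partial>q x) \<partial>p)"
      by (simp only: integral_Re[OF i])
    also have "\<dots> = Re (\<integral>x. (\<integral>y. f y \<partial>q x) \<partial>p)"
      by (rule integral_Re[OF i'])
    finally show "Re (\<integral>x. f x \<partial>bind_pmf p q) = Re (\<integral>x. (\<integral>y. f y \<partial>q x) \<partial>p)" .
    have "Im (\<integral>x. f x \<partial>bind_pmf p q) = (\<integral>x. Im (f x) \<partial>bind_pmf p q)"
      by (rule integral_Im[OF i, symmetric])
    also have "\<dots> = (\<integral>x. (\<integral>y. Im (f y) \<partial>q x) \<partial>p)"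
      by (rule integral_bind_pmf_real[OF Im])
    also have "\<dots> = (\<integral>x. Im (\<integral>y. f y \<partial>q x) \<partial>p)"
      by (simp only: integral_Im[OF i])
    also have "\<dots> = Im (\<integral>x. (\<integral>y. f y \<partial>q x) \<partial>p)"
      by (rule integral_Im[OF i'])
    finally show "Im (\<integral>x. f x \<partial>bind_pmf p q) = Im (\<integral>x. (\<integral>y. f y \<partial>q x) \<partial>p)" .
  qed
qed

section \<open>The refresh chain and its mixing rate\<close>

locale refresh_chain =
  fixes \<pi> :: "real pmf" and p :: "real \<Rightarrow> real"
  assumes p_pos: "0 < p x" and p_le_1: "p x \<le> 1" and p_even: "p (- x) = p x"
    and symmetric: "map_pmf uminus \<pi> = \<pi>"
begin

text \<open>At each step the chain stays where it is with probability \<open>1 - p x\<close> and otherwise forgets its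
  state and draws a fresh one from \<open>\<nu>\<close>, which is chosen so as to make \<open>\<pi>\<close> reversible.\<close>

definition Z :: real where "Z = (\<integral>x. p x \<partial>\<pi>)"

definition \<nu> :: "real pmf" where "\<nu> = embed_pmf (\<lambda>y. pmf \<pi> y * p y / Z)"

definition K :: "real \<Rightarrow> real pmf" where
  "K x = bind_pmf (bernoulli_pmf (p x)) (\<lambda>b. if b then \<nu> else return_pmf x)"

text \<open>The transition operator of \<open>K\<close>, written out. The value type is general
  because mixing needs real functions and characteristic functions need complex ones.\<close>

definition T :: "(real \<Rightarrow> 'c) \<Rightarrow> real \<Rightarrow> 'c::{banach, second_countable_topology}" where
  "T h x = (1 - p x) *\<^sub>R h x + p x *\<^sub>R (\<integral>y. h y \<partial>\<nu>)"

text \<open>Tail of the residual holding time: the stationary probability that none of the next n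
  steps is a refresh.\<close>

definition H :: "nat \<Rightarrow> real" where "H n = (\<integral>x. (1 - p x) ^ n \<partial>\<pi>)"

lemma p_bounds: "\<bar>p x\<bar> \<le> 1" "0 \<le> p x" "\<bar>1 - p x\<bar> \<le> 1" "0 \<le> 1 - p x"
  "p x \<le> 1"
  using p_pos[of x] p_le_1[of x] by auto

lemma q_power_bounds: "0 \<le> (1 - p x) ^ n" "(1 - p x) ^ n \<le> 1" "\<bar>(1 - p x) ^ n\<bar> \<le> 1"
  using p_bounds[of x] by (auto intro!: power_le_one simp: power_abs)

lemma integrable_p: "integrable (measure_pmf \<pi>) p"
  by (rule integrable_pmf_bounded[where B = 1]) (use p_bounds in auto)

lemma integrable_scale_bounded:
  fixes f :: "real \<Rightarrow> 'c::{banach, second_countable_topology}"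
  assumes "\<And>x. norm (f x) \<le> B" "\<And>x. \<bar>c x\<bar> \<le> 1"
  shows "integrable (measure_pmf r) (\<lambda>x. c x *\<^sub>R f x)"
proof (rule integrable_pmf_bounded[where B = B])
  fix x show "norm (c x *\<^sub>R f x) \<le> B"
    using mult_mono[OF assms(2)[of x] assms(1)[of x]] by simp
qed

lemma Z_pos: "0 < Z" and Z_le_1: "Z \<le> 1"
proof -
  have "0 \<le> Z" unfolding Z_def by (intro Bochner_Integration.integral_nonneg) (auto simp: p_bounds)
  moreover have "Z \<noteq> 0"
  proof
    assume "Z = 0"
    then have "AE x in measure_pmf \<pi>. p x = 0"
      using integral_nonneg_eq_0_iff_AE[OF integrable_p] by (auto simp: Z_def p_bounds)
    then show False using p_pos by (auto simp: AE_measure_pmf_iff set_pmf_not_empty less_le)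
  qed
  ultimately show "0 < Z" by simp
  show "Z \<le> 1" unfolding Z_def using measure_pmf.integral_le_const[OF integrable_p, of 1] p_le_1 by auto
qed

lemma pmf_\<nu>: "pmf \<nu> y = pmf \<pi> y * p y / Z"
  unfolding \<nu>_def
proof (rule pmf_embed_pmf)
  show "0 \<le> pmf \<pi> x * p x / Z" for x using Z_pos p_bounds by auto
  have "(\<integral>\<^sup>+x. ennreal (pmf \<pi> x * p x / Z) \<partial>count_space UNIV) = (\<integral>\<^sup>+x. ennreal (p x / Z) \<partial>\<pi>)"
    unfolding nn_integral_measure_pmf using Z_pos
    by (intro nn_integral_cong) (simp add: p_bounds flip: ennreal_mult)
  also have "\<dots> = ennreal (\<integral>x. p x / Z \<partial>\<pi>)"
    using Z_pos integrable_p by (intro nn_integral_eq_integral) (auto simp: p_bounds)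
  also have "(\<integral>x. p x / Z \<partial>\<pi>) = 1" using Z_pos by (simp add: Z_def)
  finally show "(\<integral>\<^sup>+x. ennreal (pmf \<pi> x * p x / Z) \<partial>count_space UNIV) = 1" by simp
qed

lemma measure_\<nu>: "measure_pmf \<nu> = density (measure_pmf \<pi>) (\<lambda>x. p x / Z)"
  unfolding measure_pmf_eq_density using Z_pos
  by (subst density_density_eq) (auto simp: pmf_\<nu> p_bounds simp flip: ennreal_mult)

lemma integral_\<nu>:
  fixes f :: "real \<Rightarrow> 'c::{banach, second_countable_topology}"
  shows "(\<integral>x. f x \<partial>\<nu>) = (1 / Z) *\<^sub>R (\<integral>x. p x *\<^sub>R f x \<partial>\<pi>)"
proof -
  have "(\<integral>x. f x \<partial>\<nu>) = (\<integral>x. (p x / Z) *\<^sub>R f x \<partial>\<pi>)"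
    unfolding measure_\<nu> using Z_pos by (subst integral_density) (auto simp: p_bounds)
  also have "\<dots> = (\<integral>x. (1 / Z) *\<^sub>R (p x *\<^sub>R f x) \<partial>\<pi>)"
    by simp
  finally show ?thesis by (simp only: integral_scaleR_right)
qed

lemma pmf_K: "pmf (K x) y = p x * pmf \<nu> y + (if x = y then 1 - p x else 0)"
  unfolding K_def pmf_bind using p_bounds[of x] by (simp add: indicator_def)

sublocale reversible_kernel \<pi> K
proof
  fix x y show "pmf \<pi> x * pmf (K x) y = pmf \<pi> y * pmf (K y) x"
    by (cases "x = y") (auto simp: pmf_K pmf_\<nu>)
qed

lemma set_pmf_\<nu>: "set_pmf \<nu> = set_pmf \<pi>"
  using Z_pos p_pos by (auto simp: set_pmf_iff pmf_\<nu> less_le)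

lemma K_pos: "y \<in> set_pmf \<pi> \<Longrightarrow> 0 < pmf (K x) y"
  using p_pos[of x] p_bounds[of x] pmf_positive[of y \<nu>]
  by (auto simp: pmf_K set_pmf_\<nu>[symmetric] intro!: add_pos_nonneg)

lemma integral_K_real:
  fixes f :: "real \<Rightarrow> real"
  assumes "\<And>x. \<bar>f x\<bar> \<le> B"
  shows "(\<integral>y. f y \<partial>K x) = T f x"
  unfolding K_def using p_bounds[of x]
  by (subst integral_bind_pmf_real[OF assms]) (simp add: T_def algebra_simps)

lemma expectation_bernoulli:
  fixes f :: "bool \<Rightarrow> 'c::{banach, second_countable_topology}"
  assumes "0 \<le> r" "r \<le> 1"
  shows "(\<integral>x. f x \<partial>bernoulli_pmf r) = r *\<^sub>R f True + (1 - r) *\<^sub>R f False"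
  using assms by (subst integral_measure_pmf[of UNIV]) (auto simp: UNIV_bool)

lemma integral_K_complex:
  fixes f :: "real \<Rightarrow> complex"
  assumes "\<And>x. norm (f x) \<le> B"
  shows "(\<integral>y. f y \<partial>K x) = T f x"
  unfolding K_def using p_bounds[of x]
  by (subst integral_bind_pmf_complex[OF assms]) (simp add: T_def expectation_bernoulli)

lemma norm_T_le:
  fixes h :: "real \<Rightarrow> 'c::{banach, second_countable_topology}"
  assumes "\<And>x. norm (h x) \<le> B"
  shows "norm (T h x) \<le> B"
proof -
  have "norm (T h x) \<le> (1 - p x) * norm (h x) + p x * norm (\<integral>y. h y \<partial>\<nu>)"
    unfolding T_def using p_bounds[of x] by (intro norm_triangle_le) simp
  also have "\<dots> \<le> (1 - p x) * B + p x * B"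
    using p_bounds[of x] by (intro add_mono mult_left_mono assms norm_integral_pmf_le) auto
  finally show ?thesis by (simp add: algebra_simps)
qed

lemma norm_T_pow_le:
  fixes h :: "real \<Rightarrow> 'c::{banach, second_countable_topology}"
  assumes "\<And>x. norm (h x) \<le> B"
  shows "norm ((T ^^ n) h x) \<le> B"
  by (induction n arbitrary: x) (auto intro: assms norm_T_le)

lemma integral_T:
  fixes h :: "real \<Rightarrow> 'c::{banach, second_countable_topology}"
  assumes "\<And>x. norm (h x) \<le> B"
  shows "(\<integral>x. T h x \<partial>\<pi>) = (\<integral>x. h x \<partial>\<pi>)"
proof -
  have "T h = (\<lambda>x. h x - p x *\<^sub>R h x + p x *\<^sub>R (\<integral>y. h y \<partial>\<nu>))"
    by (simp add: T_def fun_eq_iff scaleR_left_diff_distrib)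
  then have "(\<integral>x. T h x \<partial>\<pi>)
    = (\<integral>x. h x \<partial>\<pi>) - (\<integral>x. p x *\<^sub>R h x \<partial>\<pi>) + (\<integral>x. p x *\<^sub>R (\<integral>y. h y \<partial>\<nu>) \<partial>\<pi>)"
    using integrable_pmf_bounded[of h B \<pi>, OF assms]
      integrable_scale_bounded[of h B p \<pi>, OF assms] integrable_p
    by (simp add: p_bounds)
  also have "(\<integral>x. p x *\<^sub>R (\<integral>y. h y \<partial>\<nu>) \<partial>\<pi>) = Z *\<^sub>R (\<integral>y. h y \<partial>\<nu>)"
    using integrable_p by (simp add: Z_def)
  also have "\<dots> = (\<integral>x. p x *\<^sub>R h x \<partial>\<pi>)"
    using Z_pos by (simp add: integral_\<nu>)
  finally show ?thesis by simp
qed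

lemma T_self_adjoint:
  fixes f g :: "real \<Rightarrow> real"
  assumes f: "\<And>x. \<bar>f x\<bar> \<le> B" and g: "\<And>x. \<bar>g x\<bar> \<le> C"
  shows "(\<integral>x. f x * T g x \<partial>\<pi>) = (\<integral>x. T f x * g x \<partial>\<pi>)"
proof -
  have B: "0 \<le> B" using f[of 0] by linarith
  have fg: "\<bar>f x * g x\<bar> \<le> B * C" for x
    unfolding abs_mult using B by (intro mult_mono f g) auto
  have i: "integrable (measure_pmf \<pi>) (\<lambda>x. (1 - p x) * (f x * g x))"
     "integrable (measure_pmf \<pi>) (\<lambda>x. p x * f x)" "integrable (measure_pmf \<pi>) (\<lambda>x. p x * g x)"
    using integrable_scale_bounded[of "\<lambda>x. f x * g x" "B * C" "\<lambda>x. 1 - p x" \<pi>] fg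
      integrable_scale_bounded[of f B p \<pi>] f integrable_scale_bounded[of g C p \<pi>] g
    by (auto simp: p_bounds)
  have "(\<integral>x. f x * T g x \<partial>\<pi>)
      = (\<integral>x. (1 - p x) * (f x * g x) + (p x * f x) * (\<integral>y. g y \<partial>\<nu>) \<partial>\<pi>)"
    by (simp add: T_def algebra_simps)
  also have "\<dots> = (\<integral>x. (1 - p x) * (f x * g x) \<partial>\<pi>) + (\<integral>x. p x * f x \<partial>\<pi>) * (\<integral>y. g y \<partial>\<nu>)"
    using i by simp
  also have "(\<integral>x. p x * f x \<partial>\<pi>) * (\<integral>y. g y \<partial>\<nu>) = (\<integral>y. f y \<partial>\<nu>) * (\<integral>x. p x * g x \<partial>\<pi>)"
    by (simp add: integral_\<nu>)
  also have "(\<integral>x. (1 - p x) * (f x * g x) \<partial>\<pi>) + \<dots>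
      = (\<integral>x. (1 - p x) * (f x * g x) + (\<integral>y. f y \<partial>\<nu>) * (p x * g x) \<partial>\<pi>)"
    using i by simp
  also have "\<dots> = (\<integral>x. T f x * g x \<partial>\<pi>)"
    by (simp add: T_def algebra_simps)
  finally show ?thesis .
qed

lemma T_pow_self_adjoint:
  fixes f g :: "real \<Rightarrow> real"
  assumes f: "\<And>x. \<bar>f x\<bar> \<le> B" and g: "\<And>x. \<bar>g x\<bar> \<le> C"
  shows "(\<integral>x. f x * (T ^^ n) g x \<partial>\<pi>) = (\<integral>x. (T ^^ n) f x * g x \<partial>\<pi>)"
  using f
proof (induction n arbitrary: f)
  case (Suc n)
  have "(\<integral>x. f x * (T ^^ Suc n) g x \<partial>\<pi>) = (\<integral>x. T f x * (T ^^ n) g x \<partial>\<pi>)"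
    using T_self_adjoint[of f B "(T ^^ n) g" C] Suc.prems norm_T_pow_le[of g C] g by simp
  also have "\<dots> = (\<integral>x. (T ^^ n) (T f) x * g x \<partial>\<pi>)"
    by (rule Suc.IH) (use norm_T_le[of f B] Suc.prems in simp)
  finally show ?case by (simp add: funpow_swap1)
qed simp

text \<open>The kernel is a nonnegative multiplication operator plus a rank-one term. The form is
  therefore the integral of \<open>(1 - p) * f^2\<close> plus a square divided by
  \<open>Z\<close>.\<close>

lemma T_psd:
  fixes f :: "real \<Rightarrow> real"
  assumes f: "\<And>x. \<bar>f x\<bar> \<le> B"
  shows "0 \<le> (\<integral>x. f x * T f x \<partial>\<pi>)"
proof -
  have B: "0 \<le> B" using f[of 0] by linarith
  have ff: "\<bar>f x * f x\<bar> \<le> B * B" for x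
    unfolding abs_mult using B by (intro mult_mono f) auto
  have i: "integrable (measure_pmf \<pi>) (\<lambda>x. (1 - p x) * (f x * f x))"
     "integrable (measure_pmf \<pi>) (\<lambda>x. p x * f x)"
    using integrable_scale_bounded[of "\<lambda>x. f x * f x" "B * B" "\<lambda>x. 1 - p x" \<pi>] ff
      integrable_scale_bounded[of f B p \<pi>] f
    by (auto simp: p_bounds)
  have "(\<integral>x. f x * T f x \<partial>\<pi>)
      = (\<integral>x. (1 - p x) * (f x * f x) + (p x * f x) * (\<integral>y. f y \<partial>\<nu>) \<partial>\<pi>)"
    by (simp add: T_def algebra_simps)
  also have "\<dots> = (\<integral>x. (1 - p x) * (f x * f x) \<partial>\<pi>) + (\<integral>x. p x * f x \<partial>\<pi>) * (\<integral>y. f y \<partial>\<nu>)"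
    using i by simp
  also have "(\<integral>x. p x * f x \<partial>\<pi>) * (\<integral>y. f y \<partial>\<nu>) = (\<integral>x. p x * f x \<partial>\<pi>)\<^sup>2 / Z"
    by (simp add: integral_\<nu> power2_eq_square)
  finally show ?thesis
    using Z_pos by (auto intro!: add_nonneg_nonneg Bochner_Integration.integral_nonneg simp: p_bounds)
qed

lemma T_diff_const:
  fixes f :: "real \<Rightarrow> real"
  assumes "\<And>x. \<bar>f x\<bar> \<le> B"
  shows "T (\<lambda>x. f x - c) = (\<lambda>x. T f x - c)"
  using integrable_pmf_bounded[of f B \<nu>] assms by (simp add: T_def fun_eq_iff algebra_simps)

text \<open>\<open>e n x\<close> is the probability that step n + 1 is a refresh when the chain
  starts in x. Its mean under \<nu> is the renewal probability, and \<open>e n / Z\<close> is the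
  density with respect to \<pi> of the chain started from \<nu> after n steps.\<close>

definition e :: "nat \<Rightarrow> real \<Rightarrow> real" where "e n = (T ^^ n) p"

lemma e_bound: "\<bar>e n x\<bar> \<le> 1"
  using norm_T_pow_le[of p 1 n x] p_bounds by (simp add: e_def)

lemma e_mult_bound: "\<bar>e n x * e m x\<bar> \<le> 1"
  unfolding abs_mult by (rule mult_le_one) (auto simp: e_bound)

lemma integral_e: "(\<integral>x. e n x \<partial>\<pi>) = Z"
proof (induction n)
  case (Suc n)
  then show ?case using integral_T[of "e n" 1] e_bound[of n] by (simp add: e_def)
qed (simp add: e_def Z_def)

lemma e_Suc: "e (Suc n) x = (1 - p x) * e n x + p x * (\<integral>y. e n y \<partial>\<nu>)"
  by (simp add: e_def T_def)

text \<open>By self-adjointness the difference is a quadratic form of the positive operator \<open>T\<close>.\<close>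

lemma integral_e_\<nu>_ge: "Z \<le> (\<integral>x. e n x \<partial>\<nu>)"
proof -
  define k where "k = n div 2"
  let ?f = "\<lambda>x. e k x - Z"
  have fb: "\<bar>?f x\<bar> \<le> 2" for x using e_bound[of k x] Z_pos Z_le_1 by linarith
  have ie: "integrable (measure_pmf \<pi>) (e k)"
    by (rule integrable_pmf_bounded[where B = 1]) (use e_bound in auto)
  have split: "(\<integral>x. p x * e n x \<partial>\<pi>) = (\<integral>x. e k x * e (n - k) x \<partial>\<pi>)"
  proof -
    have "e n = (T ^^ k) (e (n - k))"
    proof -
      have "k + (n - k) = n" by (simp add: k_def)
      then have "e n = (T ^^ (k + (n - k))) p" by (simp add: e_def)
      then show ?thesis by (simp only: funpow_add o_apply e_def)
    qed
    then have "(\<integral>x. p x * e n x \<partial>\<pi>) = (\<integral>x. p x * (T ^^ k) (e (n - k)) x \<partial>\<pi>)" by simp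
    also have "\<dots> = (\<integral>x. (T ^^ k) p x * e (n - k) x \<partial>\<pi>)"
      by (rule T_pow_self_adjoint) (use p_bounds e_bound in auto)
    finally show ?thesis by (simp add: e_def)
  qed
  have "Z\<^sup>2 \<le> (\<integral>x. e k x * e (n - k) x \<partial>\<pi>)"
  proof (cases "even n")
    case True
    then have nk: "n - k = k" by (auto simp: k_def)
    have ee: "integrable (measure_pmf \<pi>) (\<lambda>x. e k x * e k x)"
      by (rule integrable_pmf_bounded[where B = 1]) (simp only: real_norm_def e_mult_bound)
    have "0 \<le> (\<integral>x. ?f x * ?f x \<partial>\<pi>)" by (intro Bochner_Integration.integral_nonneg) auto
    also have "\<dots> = (\<integral>x. e k x * e k x - 2 * Z * e k x + Z\<^sup>2 \<partial>\<pi>)"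
      by (simp add: algebra_simps power2_eq_square)
    also have "\<dots> = (\<integral>x. e k x * e k x \<partial>\<pi>) - Z\<^sup>2"
      using ee ie by (simp add: integral_e power2_eq_square)
    finally show ?thesis unfolding nk by simp
  next
    case False
    then have nk: "n - k = Suc k" by (auto simp: k_def elim!: oddE)
    have ee: "integrable (measure_pmf \<pi>) (\<lambda>x. e k x * e (Suc k) x)"
      by (rule integrable_pmf_bounded[where B = 1]) (simp only: real_norm_def e_mult_bound)
    have ie': "integrable (measure_pmf \<pi>) (e (Suc k))"
      by (rule integrable_pmf_bounded[where B = 1]) (use e_bound in auto)
    have "0 \<le> (\<integral>x. ?f x * T ?f x \<partial>\<pi>)" by (rule T_psd[OF fb])
    also have "T ?f = (\<lambda>x. e (Suc k) x - Z)"
      using T_diff_const[of "e k" 1 Z] e_bound[of k] by (simp add: e_def)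
    also have "(\<integral>x. ?f x * (e (Suc k) x - Z) \<partial>\<pi>)
        = (\<integral>x. e k x * e (Suc k) x - Z * e k x - Z * e (Suc k) x + Z\<^sup>2 \<partial>\<pi>)"
      by (simp add: algebra_simps power2_eq_square)
    also have "\<dots> = (\<integral>x. e k x * e (Suc k) x \<partial>\<pi>) - Z\<^sup>2"
      using ee ie ie' by (simp add: integral_e power2_eq_square)
    finally show ?thesis unfolding nk by simp
  qed
  then have "Z\<^sup>2 \<le> Z * (\<integral>x. e n x \<partial>\<nu>)"
    using Z_pos split by (simp add: integral_\<nu>)
  then show ?thesis using Z_pos by (simp add: power2_eq_square)
qed

lemma H_integrable: "integrable (measure_pmf \<pi>) (\<lambda>x. (1 - p x) ^ n)"
  by (rule integrable_pmf_bounded[where B = 1]) (use q_power_bounds in auto)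

text \<open>A function with mean \<open>Z\<close> has L1 distance to \<open>Z\<close> at most twice
  the integral of any bound on its deficit. The deficit of \<open>e n\<close> is at most
  \<open>Z * (1 - p x) ^ Suc n\<close>: this propagates through the recursion because the renewal
  probability never falls below \<open>Z\<close>.\<close>

lemma integral_abs_e_diff: "(\<integral>x. \<bar>e n x - Z\<bar> \<partial>\<pi>) \<le> 2 * Z * H (Suc n)"
proof -
  define g where "g n x = e n x - Z + Z * (1 - p x) ^ Suc n" for n x
  have g_nonneg: "0 \<le> g n x" for n x
  proof (induction n)
    case 0
    have "g 0 x = p x * (1 - Z)" by (simp add: g_def e_def algebra_simps)
    then show ?case using Z_le_1 p_bounds[of x] by simp
  next
    case (Suc n)
    have "g (Suc n) x = (1 - p x) * g n x + p x * ((\<integral>y. e n y \<partial>\<nu>) - Z)"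
      by (simp add: g_def e_Suc algebra_simps)
    then show ?case using Suc integral_e_\<nu>_ge[of n] p_bounds[of x] by simp
  qed
  have ie: "integrable (measure_pmf \<pi>) (e n)"
    by (rule integrable_pmf_bounded[where B = 1]) (use e_bound in auto)
  note ih = H_integrable[of "Suc n"]
  have "(\<integral>x. \<bar>e n x - Z\<bar> \<partial>\<pi>) \<le> (\<integral>x. g n x + Z * (1 - p x) ^ Suc n \<partial>\<pi>)"
  proof (rule integral_mono)
    fix x
    have "0 \<le> Z * (1 - p x) ^ Suc n" using Z_pos q_power_bounds by (simp del: power_Suc)
    then show "\<bar>e n x - Z\<bar> \<le> g n x + Z * (1 - p x) ^ Suc n"
      using g_nonneg[of n x] unfolding g_def by linarith
  qed (use ie ih in \<open>auto simp: g_def simp del: power_Suc\<close>)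
  also have "\<dots> = (\<integral>x. e n x - Z + 2 * Z * (1 - p x) ^ Suc n \<partial>\<pi>)"
    by (simp add: g_def algebra_simps)
  also have "\<dots> = 2 * Z * H (Suc n)"
    using ie ih by (simp add: integral_e H_def del: power_Suc)
  finally show ?thesis .
qed

text \<open>Self-adjointness moves \<open>T ^^ n\<close> from the test function onto the density
  \<open>p / Z\<close> of \<nu>; what remains is the L1 distance of \<open>e n / Z\<close> from
  1.\<close>

lemma mixing_from_\<nu>:
  fixes h :: "real \<Rightarrow> real"
  assumes h: "\<And>x. \<bar>h x\<bar> \<le> 1"
  shows "\<bar>(\<integral>x. (T ^^ n) h x \<partial>\<nu>) - (\<integral>x. h x \<partial>\<pi>)\<bar> \<le> 2 * H (Suc n)"
proof -
  have eh: "\<bar>e n x * h x\<bar> \<le> 1" for x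
    using e_bound[of n x] h[of x] by (simp add: abs_mult mult_le_one)
  have ih: "integrable (measure_pmf \<pi>) h" "integrable (measure_pmf \<pi>) (\<lambda>x. e n x * h x)"
      "integrable (measure_pmf \<pi>) (e n)"
    using integrable_pmf_bounded[of h 1 \<pi>] integrable_pmf_bounded[of "\<lambda>x. e n x * h x" 1 \<pi>] h eh
      integrable_pmf_bounded[of "e n" 1 \<pi>] e_bound by auto
  have "(\<integral>x. (T ^^ n) h x \<partial>\<nu>) = (1 / Z) * (\<integral>x. e n x * h x \<partial>\<pi>)"
    using T_pow_self_adjoint[of p 1 h 1 n] p_bounds h by (simp add: integral_\<nu> e_def)
  then have "(\<integral>x. (T ^^ n) h x \<partial>\<nu>) - (\<integral>x. h x \<partial>\<pi>) = (1 / Z) * (\<integral>x. (e n x - Z) * h x \<partial>\<pi>)"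
    using Z_pos ih by (simp add: field_simps)
  also have "\<bar>\<dots>\<bar> \<le> (1 / Z) * (\<integral>x. \<bar>e n x - Z\<bar> \<partial>\<pi>)"
  proof -
    have "\<bar>\<integral>x. (e n x - Z) * h x \<partial>\<pi>\<bar> \<le> (\<integral>x. \<bar>(e n x - Z) * h x\<bar> \<partial>\<pi>)"
      by (rule integral_abs_bound)
    also have "\<dots> \<le> (\<integral>x. \<bar>e n x - Z\<bar> \<partial>\<pi>)"
    proof (rule integral_mono)
      show "\<bar>(e n x - Z) * h x\<bar> \<le> \<bar>e n x - Z\<bar>" for x
        using h[of x] by (simp add: abs_mult mult_left_le)
      have "(\<lambda>x. (e n x - Z) * h x) = (\<lambda>x. e n x * h x - Z * h x)" by (simp add: algebra_simps)
      then show "integrable (measure_pmf \<pi>) (\<lambda>x. \<bar>(e n x - Z) * h x\<bar>)" using ih by simp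
    qed (use ih in simp)
    finally show ?thesis using Z_pos by (simp add: abs_mult divide_right_mono)
  qed
  also have "\<dots> \<le> (1 / Z) * (2 * Z * H (Suc n))"
    using Z_pos by (intro mult_left_mono integral_abs_e_diff) auto
  finally show ?thesis using Z_pos by simp
qed

text \<open>Decomposition by the first refresh: it happens in step k + 1, after which the chain runs
  for n - k - 1 steps from \<nu>.\<close>

lemma T_pow_unroll:
  fixes h :: "real \<Rightarrow> real"
  shows "(T ^^ n) h x = (1 - p x) ^ n * h x
    + (\<Sum>k<n. (1 - p x) ^ k * p x * (\<integral>y. (T ^^ (n - Suc k)) h y \<partial>\<nu>))"
proof (induction n)
  case (Suc n)
  have "(T ^^ Suc n) h x = (1 - p x) * (T ^^ n) h x + p x * (\<integral>y. (T ^^ n) h y \<partial>\<nu>)"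
    by (simp add: T_def)
  also have "\<dots> = (1 - p x) ^ Suc n * h x
     + ((\<Sum>k<n. (1 - p x) ^ Suc k * p x * (\<integral>y. (T ^^ (n - Suc k)) h y \<partial>\<nu>))
        + p x * (\<integral>y. (T ^^ n) h y \<partial>\<nu>))"
    unfolding Suc.IH by (simp add: algebra_simps sum_distrib_left)
  finally show ?case by (subst sum.lessThan_Suc_shift) (simp add: algebra_simps)
qed simp

lemma mixing_from_point:
  fixes h :: "real \<Rightarrow> real"
  assumes h: "\<And>x. \<bar>h x\<bar> \<le> 1"
  shows "\<bar>(T ^^ n) h x - (\<integral>x. h x \<partial>\<pi>)\<bar>
    \<le> 2 * (1 - p x) ^ n + (\<Sum>k<n. (1 - p x) ^ k * p x * (2 * H (n - k)))"
proof -
  let ?m = "\<integral>x. h x \<partial>\<pi>"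
  have geo: "(\<Sum>k<n. (1 - p x) ^ k * p x) = 1 - (1 - p x) ^ n"
    using one_diff_power_eq[of "1 - p x" n] by (simp add: sum_distrib_left mult.commute)
  have eq: "(T ^^ n) h x - ?m = (1 - p x) ^ n * (h x - ?m)
     + (\<Sum>k<n. (1 - p x) ^ k * p x * ((\<integral>y. (T ^^ (n - Suc k)) h y \<partial>\<nu>) - ?m))"
  proof -
    have "(\<Sum>k<n. (1 - p x) ^ k * p x * ((\<integral>y. (T ^^ (n - Suc k)) h y \<partial>\<nu>) - ?m))
      = (\<Sum>k<n. (1 - p x) ^ k * p x * (\<integral>y. (T ^^ (n - Suc k)) h y \<partial>\<nu>)) - (1 - (1 - p x) ^ n) * ?m"
      unfolding geo[symmetric] by (simp add: right_diff_distrib sum_subtractf sum_distrib_right)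
    then show ?thesis by (subst T_pow_unroll) (simp add: algebra_simps)
  qed
  have "\<bar>(T ^^ n) h x - ?m\<bar> \<le> (1 - p x) ^ n * \<bar>h x - ?m\<bar>
     + (\<Sum>k<n. (1 - p x) ^ k * p x * \<bar>(\<integral>y. (T ^^ (n - Suc k)) h y \<partial>\<nu>) - ?m\<bar>)"
    unfolding eq
  proof (rule order_trans[OF abs_triangle_ineq add_mono])
    show "\<bar>(1 - p x) ^ n * (h x - ?m)\<bar> \<le> (1 - p x) ^ n * \<bar>h x - ?m\<bar>"
      using q_power_bounds[of x] by (simp add: abs_mult)
    show "\<bar>\<Sum>k<n. (1 - p x) ^ k * p x * ((\<integral>y. (T ^^ (n - Suc k)) h y \<partial>\<nu>) - ?m)\<bar>
      \<le> (\<Sum>k<n. (1 - p x) ^ k * p x * \<bar>(\<integral>y. (T ^^ (n - Suc k)) h y \<partial>\<nu>) - ?m\<bar>)"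
      using q_power_bounds[of x] p_bounds[of x]
      by (intro order_trans[OF sum_abs] sum_mono) (simp add: abs_mult)
  qed
  also have "\<dots> \<le> 2 * (1 - p x) ^ n + (\<Sum>k<n. (1 - p x) ^ k * p x * (2 * H (n - k)))"
  proof (rule add_mono)
    have "\<bar>?m\<bar> \<le> 1" using norm_integral_pmf_le[where f = h and B = 1 and p = \<pi>] h by simp
    then have "\<bar>h x - ?m\<bar> \<le> 2" using h[of x] by linarith
    then show "(1 - p x) ^ n * \<bar>h x - ?m\<bar> \<le> 2 * (1 - p x) ^ n"
      using mult_left_mono[OF _ q_power_bounds(1)] by (metis mult.commute)
    show "(\<Sum>k<n. (1 - p x) ^ k * p x * \<bar>(\<integral>y. (T ^^ (n - Suc k)) h y \<partial>\<nu>) - ?m\<bar>)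
      \<le> (\<Sum>k<n. (1 - p x) ^ k * p x * (2 * H (n - k)))"
    proof (rule sum_mono)
      fix k assume k: "k \<in> {..<n}"
      have "0 \<le> (1 - p x) ^ k * p x" by (simp add: q_power_bounds p_bounds)
      moreover have "\<bar>(\<integral>y. (T ^^ (n - Suc k)) h y \<partial>\<nu>) - ?m\<bar> \<le> 2 * H (n - k)"
        using mixing_from_\<nu>[where h = h and n = "n - Suc k"] h k by (simp add: Suc_diff_Suc)
      ultimately show "(1 - p x) ^ k * p x * \<bar>(\<integral>y. (T ^^ (n - Suc k)) h y \<partial>\<nu>) - ?m\<bar>
        \<le> (1 - p x) ^ k * p x * (2 * H (n - k))"
        by (rule mult_left_mono[rotated])
    qed
  qed
  finally show ?thesis .
qed

text \<open>Half the stationary mean of the bound in \<open>mixing_from_point\<close>. Either no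
  refresh has happened by time n, or the first one after k steps leaves n - k steps to mix.\<close>

definition mixing_rate :: "nat \<Rightarrow> real" where
  "mixing_rate n = H n + (\<Sum>k<n. (H k - H (Suc k)) * H (n - k))"

lemma integral_q_p: "(\<integral>x. (1 - p x) ^ k * p x \<partial>\<pi>) = H k - H (Suc k)"
proof -
  have "(\<lambda>x. (1 - p x) ^ k * p x) = (\<lambda>x. (1 - p x) ^ k - (1 - p x) ^ Suc k)"
    by (simp add: algebra_simps)
  then show ?thesis
    using H_integrable[of k] H_integrable[of "Suc k"] by (simp add: H_def del: power_Suc)
qed

text \<open>Stated with test functions on pairs, this bounds the total variation distance between
  the joint law of two states at distance n and the product law. The factor 2 belongs to test
  functions with values in [-1, 1].\<close>

lemma mixing_pair:
  fixes \<Phi> :: "real \<times> real \<Rightarrow> real"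
  assumes \<Phi>: "\<And>w. \<bar>\<Phi> w\<bar> \<le> 1"
  shows "(\<integral>x. (T ^^ n) (\<lambda>y. \<Phi> (x, y)) x \<partial>\<pi>) - (\<integral>w. \<Phi> w \<partial>pair_pmf \<pi> \<pi>) \<le> 2 * mixing_rate n"
proof -
  let ?m = "\<lambda>x. \<integral>y. \<Phi> (x, y) \<partial>\<pi>"
  let ?R = "\<lambda>x. 2 * (1 - p x) ^ n + (\<Sum>k<n. (1 - p x) ^ k * p x * (2 * H (n - k)))"
  have pair: "(\<integral>w. \<Phi> w \<partial>pair_pmf \<pi> \<pi>) = (\<integral>x. ?m x \<partial>\<pi>)"
    unfolding pair_pmf_def
    by (simp add: integral_bind_pmf_real[OF \<Phi>])
  have i1: "integrable (measure_pmf \<pi>) (\<lambda>x. (T ^^ n) (\<lambda>y. \<Phi> (x, y)) x)"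
    by (rule integrable_pmf_bounded[where B = 1]) (rule norm_T_pow_le, use \<Phi> in simp)
  have i2: "integrable (measure_pmf \<pi>) ?m"
    by (rule integrable_pmf_bounded[where B = 1]) (rule norm_integral_pmf_le, use \<Phi> in simp)
  have i3: "integrable (measure_pmf \<pi>) (\<lambda>x. (1 - p x) ^ k * p x)" for k
    using integrable_scale_bounded[of p 1 "\<lambda>x. (1 - p x) ^ k" \<pi>] p_bounds q_power_bounds by simp
  have "(\<integral>x. (T ^^ n) (\<lambda>y. \<Phi> (x, y)) x \<partial>\<pi>) - (\<integral>w. \<Phi> w \<partial>pair_pmf \<pi> \<pi>)
    = (\<integral>x. (T ^^ n) (\<lambda>y. \<Phi> (x, y)) x - ?m x \<partial>\<pi>)"
    unfolding pair using i1 i2 by simp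
  also have "\<dots> \<le> (\<integral>x. ?R x \<partial>\<pi>)"
  proof (rule integral_mono)
    show "(T ^^ n) (\<lambda>y. \<Phi> (x, y)) x - ?m x \<le> ?R x" for x
      using mixing_from_point[of "\<lambda>y. \<Phi> (x, y)" n x] \<Phi> by (auto simp: abs_le_iff)
  qed (use i1 i2 i3 H_integrable in auto)
  also have "\<dots> = 2 * H n + (\<Sum>k<n. (H k - H (Suc k)) * (2 * H (n - k)))"
    using i3 H_integrable[of n] by (simp add: integral_q_p H_def[of n])
  finally show ?thesis by (simp add: mixing_rate_def algebra_simps sum_distrib_left)
qed

end

section \<open>Stationarity, the Markov property and dependence coefficients\<close>

lemma length_window [simp]: "length (window X a n \<omega>) = Suc n"
  by (simp add: window_def)

lemma nth_window: "i \<le> n \<Longrightarrow> window X a n \<omega> ! i = X (a + int i) \<omega>"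
  by (simp add: window_def del: upt_Suc)

lemma window_shift: "window (\<lambda>k. X (k + m)) a n = window X (a + m) n"
  by (auto simp: window_def fun_eq_iff algebra_simps)

lemma window_reverse:
  "window (\<lambda>k. X (- k)) (- int N) (2 * N) \<omega> = rev (window X (- int N) (2 * N) \<omega>)"
  by (rule nth_equalityI)
     (auto simp: nth_window rev_nth less_Suc_eq_le of_nat_diff intro!: arg_cong[where f = "\<lambda>k. X k \<omega>"])

text \<open>Finite-dimensional cylinders determine the law, and every finite set of times lies in a
  window around 0. Symmetric windows suit reversal as well as shifts.\<close>

lemma process_law_eqI:
  assumes "prob_space M"
    and Y [measurable]: "\<And>k. Y k \<in> borel_measurable M"
    and Y' [measurable]: "\<And>k. Y' k \<in> borel_measurable M"
    and eq: "\<And>N E. measure M {\<omega>\<in>space M. window Y (- int N) (2 * N) \<omega> \<in> E}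
      = measure M {\<omega>\<in>space M. window Y' (- int N) (2 * N) \<omega> \<in> E}"
  shows "process_law M Y = process_law M Y'"
proof -
  interpret prob_space M by fact
  have m: "(\<lambda>\<omega> k. V k \<omega>) \<in> measurable M (PiM UNIV (\<lambda>_::int. borel :: real measure))"
    if "\<And>k. V k \<in> borel_measurable M" for V
    using that by (intro measurable_PiM_single') auto
  show ?thesis
  proof (rule measure_eqI_PiM_infinite[where I = UNIV and M = "\<lambda>_. borel"])
    show "finite_measure (process_law M Y)"
      unfolding process_law_def
      by (intro prob_space.finite_measure prob_space_distr m Y)
    fix A :: "int \<Rightarrow> real set" and J :: "int set"
    assume J: "finite J" and A: "\<And>i. i \<in> J \<Longrightarrow> A i \<in> sets borel"
    \<comment> \<open>The sum of the absolute values bounds each of them and is defined for the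
      empty set too.\<close>
    define N where "N = nat (\<Sum>j\<in>J. \<bar>j\<bar>)"
    have N: "- int N \<le> j" "j \<le> int N" if "j \<in> J" for j
      using member_le_sum[of j J abs] that J unfolding N_def by (auto simp: sum_nonneg)
    define E where "E = {xs :: real list. \<forall>j\<in>J. xs ! nat (j + int N) \<in> A j}"
    have E: "(\<forall>j\<in>J. V j \<omega> \<in> A j) \<longleftrightarrow> window V (- int N) (2 * N) \<omega> \<in> E" for V \<omega>
    proof -
      have "window V (- int N) (2 * N) \<omega> ! nat (j + int N) = V j \<omega>" if "j \<in> J" for j
        using N[OF that] by (subst nth_window) (auto simp: nat_le_iff)
      then show ?thesis by (simp add: E_def)
    qed
    have e: "emeasure (process_law M V) (prod_emb UNIV (\<lambda>_. borel) J (Pi\<^sub>E J A))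
       = ennreal (measure M {\<omega>\<in>space M. window V (- int N) (2 * N) \<omega> \<in> E})"
      if V: "\<And>k. V k \<in> borel_measurable M" for V
    proof -
      have "emeasure (process_law M V) (prod_emb UNIV (\<lambda>_. borel) J (Pi\<^sub>E J A))
        = emeasure M ((\<lambda>\<omega> k. V k \<omega>) -` prod_emb UNIV (\<lambda>_. borel) J (Pi\<^sub>E J A) \<inter> space M)"
        unfolding process_law_def
        by (intro emeasure_distr m V) (use J A in \<open>auto intro!: sets_PiM_I\<close>)
      also have "(\<lambda>\<omega> k. V k \<omega>) -` prod_emb UNIV (\<lambda>_. borel) J (Pi\<^sub>E J A) \<inter> space M
        = {\<omega>\<in>space M. window V (- int N) (2 * N) \<omega> \<in> E}"
        unfolding E[symmetric] by (auto simp: prod_emb_def)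
      finally show ?thesis by (simp add: emeasure_eq_measure)
    qed
    show "emeasure (process_law M Y) (prod_emb UNIV (\<lambda>_. borel) J (Pi\<^sub>E J A))
       = emeasure (process_law M Y') (prod_emb UNIV (\<lambda>_. borel) J (Pi\<^sub>E J A))"
      by (simp add: e Y Y' eq)
  qed (auto simp: process_law_def)
qed

context kernel_process
begin

lemma measurable_X_count: "X k \<in> measurable M (count_space (set_pmf \<pi>))"
  unfolding measurable_count_space_eq_countable[OF countable_set_pmf]
  using measurable_sets[OF measurable_X] by (auto simp: X_in)

lemma measurable_window_X [measurable]: "window X a n \<in> measurable M (count_space UNIV)"
  by (rule measurable_window[OF measurable_X_count])

lemma prob_window:
  "prob {\<omega>\<in>space M. window X a n \<omega> \<in> E} = measure_pmf.prob (bind_pmf \<pi> (path K n)) E"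
  unfolding window_law[symmetric, where a = a and n = n]
  by (subst measure_distr) (auto intro!: arg_cong[where f = prob])

lemma expectation_window:
  fixes F :: "real list \<Rightarrow> 'c::{banach, second_countable_topology}"
  shows "(\<integral>\<omega>. F (window X a n \<omega>) \<partial>M) = (\<integral>xs. F xs \<partial>bind_pmf \<pi> (path K n))"
  unfolding window_law[symmetric, where a = a and n = n]
  by (subst integral_distr) auto

lemma cylinder:
  "prob {\<omega>\<in>space M. \<forall>k\<in>{a..a + int n}. X k \<omega> = s k}
    = pmf \<pi> (s a) * (\<Prod>i<n. pmf (K (s (a + int i))) (s (a + int (Suc i))))"
proof -
  let ?xs = "map (\<lambda>i. s (a + int i)) [0..<Suc n]"
  have "window X a n \<omega> = ?xs \<longleftrightarrow> (\<forall>k\<in>{a..a + int n}. X k \<omega> = s k)" for \<omega>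
  proof -
    have "window X a n \<omega> = ?xs \<longleftrightarrow> (\<forall>i\<le>n. X (a + int i) \<omega> = s (a + int i))"
      by (auto simp: list_eq_iff_nth_eq nth_window less_Suc_eq_le simp del: upt_Suc)
    also have "\<dots> \<longleftrightarrow> (\<forall>k\<in>{a..a + int n}. X k \<omega> = s k)"
    proof safe
      fix k assume *: "\<forall>i\<le>n. X (a + int i) \<omega> = s (a + int i)" "k \<in> {a..a + int n}"
      then show "X k \<omega> = s k" using *(1)[rule_format, of "nat (k - a)"] by (auto simp: nat_le_iff)
    qed auto
    finally show ?thesis .
  qed
  then have "prob {\<omega>\<in>space M. \<forall>k\<in>{a..a + int n}. X k \<omega> = s k}
      = prob {\<omega>\<in>space M. window X a n \<omega> \<in> {?xs}}" by simp
  also have "\<dots> = pmf (bind_pmf \<pi> (path K n)) ?xs"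
    by (simp only: prob_window measure_pmf_single)
  also have "\<dots> = pmf \<pi> (s a) * (\<Prod>i<n. pmf (K (s (a + int i))) (s (a + int (Suc i))))"
    by (subst pmf_bind_path) simp
  finally show ?thesis .
qed

lemma prob_state: "prob {\<omega>\<in>space M. X k \<omega> = x} = pmf \<pi> x"
  using cylinder[of k 0 "\<lambda>_. x"] by simp

lemma strictly_stationary: "strictly_stationary M X"
  unfolding strictly_stationary_def
proof (intro conjI allI)
  show "process_law M (\<lambda>k. X (k + m)) = process_law M X" for m
    by (rule process_law_eqI[OF prob_space_axioms]) (auto simp: window_shift prob_window)
qed simp

lemma reversible: "reversible M X"
  unfolding reversible_def
proof (rule process_law_eqI[OF prob_space_axioms])
  fix N and E :: "real list set"
  let ?P = "bind_pmf \<pi> (path K (2 * N))"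
  have "prob {\<omega>\<in>space M. window (\<lambda>k. X (- k)) (- int N) (2 * N) \<omega> \<in> E}
      = prob {\<omega>\<in>space M. window X (- int N) (2 * N) \<omega> \<in> rev -` E}"
    by (simp add: window_reverse)
  also have "\<dots> = measure_pmf.prob (map_pmf rev ?P) E"
    by (simp only: prob_window measure_map_pmf)
  also have "\<dots> = prob {\<omega>\<in>space M. window X (- int N) (2 * N) \<omega> \<in> E}"
    by (simp only: path_reverse prob_window)
  finally show "prob {\<omega>\<in>space M. window (\<lambda>k. X (- k)) (- int N) (2 * N) \<omega> \<in> E}
    = prob {\<omega>\<in>space M. window X (- int N) (2 * N) \<omega> \<in> E}" .
qed auto

lemma cond_prob_step:
  assumes "prob {\<omega>\<in>space M. \<forall>k\<in>{m - int n..m}. X k \<omega> = s k} > 0"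
  shows "cond_prob M (\<lambda>\<omega>. X (m + 1) \<omega> = s (m + 1)) (\<lambda>\<omega>. \<forall>k\<in>{m - int n..m}. X k \<omega> = s k)
    = pmf (K (s m)) (s (m + 1))"
proof -
  have I: "{m - int n..m - int n + int (Suc n)} = insert (m + 1) {m - int n..m}" by auto
  have "{\<omega>\<in>space M. X (m + 1) \<omega> = s (m + 1) \<and> (\<forall>k\<in>{m - int n..m}. X k \<omega> = s k)}
    = {\<omega>\<in>space M. \<forall>k\<in>{m - int n..m - int n + int (Suc n)}. X k \<omega> = s k}"
    unfolding I by auto
  then have "prob {\<omega>\<in>space M. X (m + 1) \<omega> = s (m + 1) \<and> (\<forall>k\<in>{m - int n..m}. X k \<omega> = s k)}
    = prob {\<omega>\<in>space M. \<forall>k\<in>{m - int n..m}. X k \<omega> = s k} * pmf (K (s m)) (s (m + 1))"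
    using cylinder[of "m - int n" "Suc n" s] cylinder[of "m - int n" n s] by (simp add: add.commute)
  then show ?thesis using assms by (simp add: cond_prob_def)
qed

lemma countable_state_markov_chain: "countable_state_markov_chain M X (set_pmf \<pi>)"
  unfolding countable_state_markov_chain_def
proof (intro conjI allI impI ballI)
  fix m :: int and n :: nat and s :: "int \<Rightarrow> real"
  assume s: "\<forall>k. s k \<in> set_pmf \<pi>"
    and pos: "prob {\<omega>\<in>space M. \<forall>k\<in>{m - int n..m}. X k \<omega> = s k} > 0"
  have "prob {\<omega>\<in>space M. \<forall>k\<in>{m - int 0..m}. X k \<omega> = s k} > 0"
    using s by (simp add: prob_state pmf_positive)
  from cond_prob_step[OF this] cond_prob_step[OF pos]
  show "cond_prob M (\<lambda>\<omega>. X (m + 1) \<omega> = s (m + 1)) (\<lambda>\<omega>. \<forall>k\<in>{m - int n..m}. X k \<omega> = s k) =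
        cond_prob M (\<lambda>\<omega>. X (m + 1) \<omega> = s (m + 1)) (\<lambda>\<omega>. X m \<omega> = s m)" by simp
qed (auto simp: X_in countable_set_pmf)

lemma trans_prob_1:
  assumes "i \<in> set_pmf \<pi>"
  shows "trans_prob M X 1 i j = pmf (K i) j"
proof -
  have "prob {\<omega>\<in>space M. \<forall>k\<in>{0 - int 0..0}. X k \<omega> = (if k = 0 then i else j)} > 0"
    using assms by (simp add: prob_state pmf_positive)
  from cond_prob_step[OF this] show ?thesis by (simp add: trans_prob_def)
qed

text \<open>A strictly positive kernel reaches every state in one step, so 1 is among the return
  times of every state.\<close>

lemma irreducible_aperiodic:
  assumes "\<And>i j. i \<in> set_pmf \<pi> \<Longrightarrow> j \<in> set_pmf \<pi> \<Longrightarrow> 0 < pmf (K i) j"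
  shows "irreducible_chain M X (set_pmf \<pi>)" "aperiodic_chain M X (set_pmf \<pi>)"
proof -
  show "irreducible_chain M X (set_pmf \<pi>)"
    unfolding irreducible_chain_def
    using assms trans_prob_1 by (metis order_refl)
  have "Gcd {n. n \<ge> 1 \<and> trans_prob M X n i i > 0} = (1::nat)" if "i \<in> set_pmf \<pi>" for i
    using assms[OF that that] trans_prob_1[OF that]
    by (intro Gcd_eq_1_I) auto
  then show "aperiodic_chain M X (set_pmf \<pi>)"
    by (simp add: aperiodic_chain_def)
qed

section \<open>Conditional independence of past and future given the present\<close>

lemma generated_sigma_sets: "generated_sigma M X I \<subseteq> events"
  unfolding generated_sigma_def
  by (rule sets.sigma_sets_subset) (use measurable_sets[OF measurable_X] in auto)

lemma sigma_algebra_generated: "sigma_algebra (space M) (generated_sigma M X I)"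
  unfolding generated_sigma_def by (rule sigma_algebra_sigma_sets) auto

lemma generated_sigma_mono: "I \<subseteq> J \<Longrightarrow> generated_sigma M X I \<subseteq> generated_sigma M X J"
  unfolding generated_sigma_def by (rule sigma_sets_mono') auto

lemma state_in_generated: "k \<in> I \<Longrightarrow> {\<omega>\<in>space M. X k \<omega> = x} \<in> generated_sigma M X I"
  unfolding generated_sigma_def
  by (rule sigma_sets.Basic) (auto intro!: exI[of _ k] exI[of _ "{x}"])

text \<open>\<open>d = 1\<close> looks forward from time k and \<open>d = - 1\<close> backward. Time
  k always belongs to the cylinder, and the empty set is added because two cylinders may contradict
  each other.\<close>

definition cylinders :: "int \<Rightarrow> int \<Rightarrow> 'b set set" where
  "cylinders d k = insert {} (range (\<lambda>(m::nat, s). {\<omega>\<in>space M. \<forall>i\<in>{0..int m}. X (k + d * i) \<omega> = s i}))"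

lemma cylinder_in: "{\<omega>\<in>space M. \<forall>i\<in>{0..int m}. X (k + d * i) \<omega> = s i} \<in> cylinders d k"
  unfolding cylinders_def by (rule insertI2) (rule range_eqI[of _ _ "(m, s)"], simp)

lemma Int_stable_cylinders: "Int_stable (cylinders d k)"
proof (rule Int_stableI)
  fix A B assume "A \<in> cylinders d k" "B \<in> cylinders d k"
  then consider "A \<inter> B = {}" | m m' s s'
      where "A = {\<omega>\<in>space M. \<forall>i\<in>{0..int m}. X (k + d * i) \<omega> = s i}"
        "B = {\<omega>\<in>space M. \<forall>i\<in>{0..int m'}. X (k + d * i) \<omega> = s' i}"
    unfolding cylinders_def by auto
  then show "A \<inter> B \<in> cylinders d k"
  proof cases
    case 2
    show ?thesis
    proof (cases "A \<inter> B = {}")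
      case False
      then obtain \<omega>0 where \<omega>0: "\<omega>0 \<in> A \<inter> B" by blast
      \<comment> \<open>A sample point of the intersection provides the merged pattern, which avoids
        gluing \<open>s\<close> and \<open>s'\<close> by hand.\<close>
      have "A \<inter> B = {\<omega>\<in>space M. \<forall>i\<in>{0..int (max m m')}. X (k + d * i) \<omega> = X (k + d * i) \<omega>0}"
      proof (intro equalityI subsetI)
        fix \<omega> assume "\<omega> \<in> A \<inter> B"
        moreover have "i \<in> {0..int m} \<or> i \<in> {0..int m'}" if "i \<in> {0..int (max m m')}" for i
          using that by auto
        ultimately show "\<omega> \<in> {\<omega>\<in>space M. \<forall>i\<in>{0..int (max m m')}. X (k + d * i) \<omega> = X (k + d * i) \<omega>0}"
          using \<omega>0 2 by fastforce
      next
        fix \<omega> assume *: "\<omega> \<in> {\<omega>\<in>space M. \<forall>i\<in>{0..int (max m m')}. X (k + d * i) \<omega> = X (k + d * i) \<omega>0}"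
        have "{0..int m} \<subseteq> {0..int (max m m')}" "{0..int m'} \<subseteq> {0..int (max m m')}" by auto
        then show "\<omega> \<in> A \<inter> B" using \<omega>0 2 * by fastforce
      qed
      then show ?thesis by (simp only: cylinder_in)
    qed (simp add: cylinders_def)
  qed (simp add: cylinders_def)
qed

lemma cylinders_sets: "cylinders d k \<subseteq> events"
proof -
  have "{\<omega>\<in>space M. \<forall>i\<in>{0..int m}. X (k + d * i) \<omega> = s i} \<in> events" for m s
    by (rule sets.sets_Collect_finite_All) auto
  then show ?thesis by (auto simp: cylinders_def)
qed

text \<open>With countably many states, an event about \<open>X j\<close> is a countable union of
  cylinders that fix the whole stretch from k to j.\<close>

lemma generated_by_cylinders:
  assumes d: "\<And>j. j \<in> I \<Longrightarrow> \<exists>i::nat. j = k + d * int i"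
  shows "generated_sigma M X I \<subseteq> sigma_sets (space M) (cylinders d k)"
  unfolding generated_sigma_def
proof (rule sigma_sets_mono, safe)
  fix j and B :: "real set" assume j: "j \<in> I"
  obtain m where m: "j = k + d * int m" using d[OF j] by blast
  define W where "W \<omega> = map (\<lambda>i. X (k + d * int i) \<omega>) [0..<Suc m]" for \<omega>
  define C where "C = W ` (X j -` B \<inter> space M)"
  have "C \<subseteq> lists (set_pmf \<pi>)" by (auto simp: C_def W_def X_in simp del: upt_Suc)
  then have C: "countable C"
    by (rule countable_subset) (intro countable_lists countable_set_pmf)
  have W_iff: "W \<omega> = W \<omega>' \<longleftrightarrow> (\<forall>i\<in>{0..int m}. X (k + d * i) \<omega> = X (k + d * i) \<omega>')" for \<omega> \<omega>'
  proof -
    have "W \<omega> = W \<omega>' \<longleftrightarrow> (\<forall>i\<le>m. X (k + d * int i) \<omega> = X (k + d * int i) \<omega>')"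
      by (auto simp: W_def less_Suc_eq_le simp del: upt_Suc)
    also have "\<dots> \<longleftrightarrow> (\<forall>i\<in>{0..int m}. X (k + d * i) \<omega> = X (k + d * i) \<omega>')"
      by (metis atLeastAtMost_iff nat_0_le nat_le_iff of_nat_0_le_iff of_nat_le_iff)
    finally show ?thesis .
  qed
  have "X j -` B \<inter> space M = (\<Union>xs\<in>C. {\<omega>\<in>space M. W \<omega> = xs})"
  proof (intro equalityI subsetI)
    fix \<omega> assume "\<omega> \<in> (\<Union>xs\<in>C. {\<omega>\<in>space M. W \<omega> = xs})"
    then obtain \<omega>' where *: "\<omega>' \<in> space M" "X j \<omega>' \<in> B" "W \<omega> = W \<omega>'" "\<omega> \<in> space M"
      by (auto simp: C_def)
    then have "X j \<omega> = X j \<omega>'" unfolding W_iff using m by (auto dest: bspec[of _ _ "int m"])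
    then show "\<omega> \<in> X j -` B \<inter> space M" using * by simp
  qed (auto simp: C_def)
  moreover have "{\<omega>\<in>space M. W \<omega> = xs} \<in> cylinders d k" if "xs \<in> C" for xs
  proof -
    from that obtain \<omega>0 where "xs = W \<omega>0" by (auto simp: C_def)
    then show ?thesis
      using cylinder_in[of m k d "\<lambda>i. X (k + d * i) \<omega>0"] by (simp only: W_iff)
  qed
  ultimately show "X j -` B \<inter> space M \<in> sigma_sets (space M) (cylinders d k)"
    using C by (simp only:) (intro sigma_sets_UNION countable_image, auto)
qed

text \<open>The Markov property in product form, which also covers states of mass 0. Under the
  measure conditioned on \<open>X k = x\<close> backward and forward cylinders are independent
  because path probabilities factor at time k; independence passes to the generated sigma-fields by
  stability under intersection.\<close>

lemma past_future_indep:
  assumes A: "A \<in> generated_sigma M X {..k}" and B: "B \<in> generated_sigma M X {k..}"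
  shows "prob (A \<inter> B \<inter> {\<omega>\<in>space M. X k \<omega> = x}) * pmf \<pi> x
    = prob (A \<inter> {\<omega>\<in>space M. X k \<omega> = x}) * prob (B \<inter> {\<omega>\<in>space M. X k \<omega> = x})"
proof (cases "pmf \<pi> x = 0")
  case True
  have "prob (A \<inter> {\<omega>\<in>space M. X k \<omega> = x}) \<le> prob {\<omega>\<in>space M. X k \<omega> = x}"
    by (rule finite_measure_mono) auto
  then have "prob (A \<inter> {\<omega>\<in>space M. X k \<omega> = x}) = 0"
    using True by (simp add: prob_state measure_le_0_iff)
  then show ?thesis using True by simp
next
  case False
  then have pos: "0 < pmf \<pi> x" by (simp add: less_le)
  define D where "D = {\<omega>\<in>space M. X k \<omega> = x}"
  define M' where "M' = uniform_measure M D"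
  have D: "D \<in> events" "prob D = pmf \<pi> x" by (auto simp: D_def prob_state)
  then have eD: "emeasure M D \<noteq> 0" "emeasure M D \<noteq> \<infinity>"
    using pos by (auto simp: emeasure_eq_measure)
  interpret M': prob_space M' unfolding M'_def by (rule prob_space_uniform_measure[OF eD])
  have M': "M'.prob E = prob (D \<inter> E) / pmf \<pi> x" if "E \<in> events" for E
    unfolding M'_def using measure_uniform_measure[OF eD that] D by simp
  have sp: "space M' = space M" "M'.events = events" by (auto simp: M'_def)
  have ind: "M'.indep_set (cylinders (- 1) k) (cylinders 1 k)"
  proof (rule M'.indep_setI)
    show "cylinders (- 1) k \<subseteq> M'.events" "cylinders 1 k \<subseteq> M'.events"
      unfolding sp by (rule cylinders_sets)+
    fix a b assume a: "a \<in> cylinders (- 1) k" and b: "b \<in> cylinders 1 k"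
    have ab: "a \<in> events" "b \<in> events" using a b cylinders_sets by auto
    show "M'.prob (a \<inter> b) = M'.prob a * M'.prob b"
    proof (cases "D \<inter> a = {} \<or> D \<inter> b = {}")
      case True
      then have "D \<inter> (a \<inter> b) = {}" by blast
      then show ?thesis using True ab by (auto simp: M')
    next
      case False
      then obtain m s m' s' where
        a: "a = {\<omega>\<in>space M. \<forall>i\<in>{0..int m}. X (k + (-1) * i) \<omega> = s i}" and
        b: "b = {\<omega>\<in>space M. \<forall>i\<in>{0..int m'}. X (k + 1 * i) \<omega> = s' i}"
        using a b unfolding cylinders_def by auto
      have sk: "s 0 = x" "s' 0 = x"
        using False unfolding a b D_def by (auto dest!: bspec[of _ _ 0])
      \<comment> \<open>The two one-sided patterns agree at time k once the conditioning is imposed,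
        so they form a single pattern around k.\<close>
      define r where "r i = (if i \<le> k then s (k - i) else s' (i - k))" for i
      have ra: "D \<inter> a = {\<omega>\<in>space M. \<forall>i\<in>{k - int m..k - int m + int m}. X i \<omega> = r i}"
      proof (intro equalityI subsetI)
        fix \<omega> assume *: "\<omega> \<in> D \<inter> a"
        have "X i \<omega> = r i" if "i \<in> {k - int m..k - int m + int m}" for i
          using * that unfolding a r_def by (auto dest!: bspec[of _ _ "k - i"])
        then show "\<omega> \<in> {\<omega>\<in>space M. \<forall>i\<in>{k - int m..k - int m + int m}. X i \<omega> = r i}"
          using * by (auto simp: D_def)
      next
        fix \<omega> assume *: "\<omega> \<in> {\<omega>\<in>space M. \<forall>i\<in>{k - int m..k - int m + int m}. X i \<omega> = r i}"
        then have "X (k + (-1) * i) \<omega> = s i" if "i \<in> {0..int m}" for i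
          using that by (auto simp: r_def dest!: bspec[of _ _ "k - i"])
        moreover have "X k \<omega> = x" using * sk by (auto simp: r_def dest!: bspec[of _ _ k])
        ultimately show "\<omega> \<in> D \<inter> a" using * by (auto simp: a D_def)
      qed
      have rb: "D \<inter> b = {\<omega>\<in>space M. \<forall>i\<in>{k..k + int m'}. X i \<omega> = r i}"
      proof (intro equalityI subsetI)
        fix \<omega> assume *: "\<omega> \<in> D \<inter> b"
        have "X i \<omega> = r i" if "i \<in> {k..k + int m'}" for i
          using * that sk unfolding b r_def D_def by (auto dest!: bspec[of _ _ "i - k"])
        then show "\<omega> \<in> {\<omega>\<in>space M. \<forall>i\<in>{k..k + int m'}. X i \<omega> = r i}"
          using * by (auto simp: D_def)
      next
        fix \<omega> assume *: "\<omega> \<in> {\<omega>\<in>space M. \<forall>i\<in>{k..k + int m'}. X i \<omega> = r i}"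
        then have "X (k + 1 * i) \<omega> = s' i" if "i \<in> {0..int m'}" for i
          using that sk by (auto simp: r_def dest!: bspec[of _ _ "k + i"])
        moreover have "X k \<omega> = x" using * sk by (auto simp: r_def dest!: bspec[of _ _ k])
        ultimately show "\<omega> \<in> D \<inter> b" using * by (auto simp: b D_def)
      qed
      have I: "{k - int m..k - int m + int (m + m')} = {k - int m..k - int m + int m} \<union> {k..k + int m'}"
        by auto
      have rab: "D \<inter> (a \<inter> b) = {\<omega>\<in>space M. \<forall>i\<in>{k - int m..k - int m + int (m + m')}. X i \<omega> = r i}"
      proof -
        have "D \<inter> (a \<inter> b) = (D \<inter> a) \<inter> (D \<inter> b)" by blast
        then show ?thesis unfolding I ra rb by auto
      qed
      let ?f = "\<lambda>i. pmf (K (r (k - int m + int i))) (r (k - int m + int (Suc i)))"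
      have "(\<Prod>i<m + m'. ?f i) = (\<Prod>i<m. ?f i) * (\<Prod>i\<in>{m..<m + m'}. ?f i)"
        using prod.atLeastLessThan_concat[of 0 m "m + m'" ?f] by (simp add: atLeast0LessThan)
      also have "(\<Prod>i\<in>{m..<m + m'}. ?f i) = (\<Prod>i<m'. pmf (K (r (k + int i))) (r (k + int (Suc i))))"
        using prod.shift_bounds_nat_ivl[of ?f 0 m m']
        by (simp add: atLeast0LessThan add.commute algebra_simps)
      finally have "prob (D \<inter> (a \<inter> b)) * pmf \<pi> x = prob (D \<inter> a) * prob (D \<inter> b)"
        unfolding rab ra rb cylinder using sk by (simp add: r_def mult_ac)
      then show ?thesis using pos ab by (simp add: M' field_simps)
    qed
  qed
  have "M'.indep_set (sigma_sets (space M') (cylinders (- 1) k)) (sigma_sets (space M') (cylinders 1 k))"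
    by (rule M'.indep_set_sigma_sets[OF ind Int_stable_cylinders Int_stable_cylinders])
  moreover have "A \<in> sigma_sets (space M') (cylinders (- 1) k)"
  proof -
    have "\<exists>i. j = k + (- 1) * int i" if "j \<in> {..k}" for j
      using that by (intro exI[of _ "nat (k - j)"]) simp
    from generated_by_cylinders[OF this] show ?thesis using A unfolding sp by blast
  qed
  moreover have "B \<in> sigma_sets (space M') (cylinders 1 k)"
  proof -
    have "\<exists>i. j = k + 1 * int i" if "j \<in> {k..}" for j
      using that by (intro exI[of _ "nat (j - k)"]) simp
    from generated_by_cylinders[OF this] show ?thesis using B unfolding sp by blast
  qed
  ultimately have "M'.prob (A \<inter> B) = M'.prob A * M'.prob B"
    by (simp add: M'.indep_set_def M'.indep_sets2_eq[symmetric] M'.indep_setD)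
  moreover have "A \<in> events" "B \<in> events" using A B generated_sigma_sets by auto
  ultimately show ?thesis
    using pos by (simp add: M' D_def[symmetric] field_simps Int_commute)
qed

end

text \<open>The cells (U, V) and (U, complement of V) contribute the same amount, and together with
  the factor 1/2 they already give the alpha term. The common bound \<open>c\<close> keeps the
  supremum in \<open>beta_dep\<close> over a bounded set, where it dominates its members.\<close>

lemma (in prob_space) alpha_dep_le_beta_dep:
  assumes A: "sigma_algebra (space M) \<A>" "\<A> \<subseteq> events"
    and B: "sigma_algebra (space M) \<B>" "\<B> \<subseteq> events"
    and bdd: "\<And>P Q. P \<in> finite_partitions M \<A> \<Longrightarrow> Q \<in> finite_partitions M \<B> \<Longrightarrow>
      1/2 * (\<Sum>A\<in>P. \<Sum>B\<in>Q. \<bar>prob (A \<inter> B) - prob A * prob B\<bar>) \<le> c"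
  shows "alpha_dep M \<A> \<B> \<le> beta_dep M \<A> \<B>" and "beta_dep M \<A> \<B> \<le> c"
proof -
  interpret A: sigma_algebra "space M" \<A> by fact
  interpret B: sigma_algebra "space M" \<B> by fact
  let ?s = "\<lambda>(P, Q). 1/2 * (\<Sum>A\<in>P. \<Sum>B\<in>Q. \<bar>prob (A \<inter> B) - prob A * prob B\<bar>)"
  let ?I = "finite_partitions M \<A> \<times> finite_partitions M \<B>"
  have triv: "({space M}, {space M}) \<in> ?I"
    using not_empty by (auto simp: finite_partitions_def partition_on_def)
  have bdd': "bdd_above (?s ` ?I)"
    using bdd by (intro bdd_aboveI2[where M = c]) auto
  have up: "?s w \<le> beta_dep M \<A> \<B>" if "w \<in> ?I" for w
    unfolding beta_dep_def by (rule cSUP_upper[OF that bdd'])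
  show "beta_dep M \<A> \<B> \<le> c"
    unfolding beta_dep_def using triv bdd by (intro cSUP_least) auto
  show "alpha_dep M \<A> \<B> \<le> beta_dep M \<A> \<B>"
    unfolding alpha_dep_def
  proof (rule cSUP_least)
    show "\<A> \<times> \<B> \<noteq> {}" using A.top B.top by blast
    fix w assume "w \<in> \<A> \<times> \<B>"
    then obtain U V where w: "w = (U, V)" and UV: "U \<in> \<A>" "V \<in> \<B>" by blast
    then have ev: "U \<in> events" "V \<in> events" using A B by auto
    then have sub: "U \<subseteq> space M" "V \<subseteq> space M" by (auto dest: sets.sets_into_space)
    let ?d = "\<lambda>A B. \<bar>prob (A \<inter> B) - prob A * prob B\<bar>"
    have "?d U V \<le> beta_dep M \<A> \<B>"
    \<comment> \<open>Parts of a partition are nonempty, so the trivial sets are treated apart; for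
      them the difference is 0.\<close>
    proof (cases "U = {} \<or> U = space M \<or> V = {} \<or> V = space M")
      case True
      then have "?d U V = 0"
        using sub by (auto simp: prob_space Int_absorb1 Int_absorb2)
      also have "0 \<le> beta_dep M \<A> \<B>" using up[OF triv] by (simp add: prob_space)
      finally show ?thesis .
    next
      case False
      let ?P = "{U, space M - U}" and ?Q = "{V, space M - V}"
      have "(?P, ?Q) \<in> ?I"
        using False sub UV by (auto simp: finite_partitions_def partition_on_def disjoint_def)
      then have "?s (?P, ?Q) \<le> beta_dep M \<A> \<B>" by (rule up)
      moreover have "?s (?P, ?Q) = 1/2 * (?d U V + ?d U (space M - V) + ?d (space M - U) V + ?d (space M - U) (space M - V))"
      proof -
        have "U \<noteq> space M - U" "V \<noteq> space M - V" using False sub by auto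
        then show ?thesis by (simp only: prod.case sum.insert finite.intros sum.empty singleton_iff empty_iff not_False_eq_True add_0_right add.assoc)
      qed
      moreover have "?d U (space M - V) = ?d U V"
      proof -
        have a: "prob (U \<inter> (space M - V)) = prob U - prob (U \<inter> V)"
          using ev sub finite_measure_Diff'[of U V] by (simp add: Diff_eq Int_assoc[symmetric] Int_absorb2 Int_commute)
        have b: "prob (space M - V) = 1 - prob V" using ev by (simp add: prob_compl)
        have "prob (U \<inter> (space M - V)) - prob U * prob (space M - V) = - (prob (U \<inter> V) - prob U * prob V)"
          unfolding a b by (simp add: algebra_simps)
        then show ?thesis by (simp only: abs_minus_cancel)
      qed
      moreover have "a \<le> b" if "s \<le> b" "s = 1/2 * (a + a' + \<bar>c\<bar> + \<bar>d\<bar>)" "a' = a" for a a' b c d s :: real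
        using that by simp
      ultimately show ?thesis by blast
    qed
    then show "(case w of (A, B) \<Rightarrow> ?d A B) \<le> beta_dep M \<A> \<B>" by (simp add: w)
  qed
qed

section \<open>Reduction of the beta coefficient to the joint law of two states\<close>

context kernel_process
begin

definition pair_law :: "nat \<Rightarrow> (real \<times> real) pmf" where
  "pair_law n = map_pmf (\<lambda>xs. (hd xs, last xs)) (bind_pmf \<pi> (path K n))"

lemma hd_window: "hd (window X a n \<omega>) = X a \<omega>"
  by (simp add: window_def upt_conv_Cons del: upt_Suc)

lemma last_window: "last (window X a n \<omega>) = X (a + int n) \<omega>"
  by (simp add: window_def)

lemma pmf_pair_law: "pmf (pair_law n) (x, y) = prob {\<omega>\<in>space M. X 0 \<omega> = x \<and> X (int n) \<omega> = y}"
proof -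
  have "pmf (pair_law n) (x, y) = prob {\<omega>\<in>space M. window X 0 n \<omega> \<in> (\<lambda>xs. (hd xs, last xs)) -` {(x, y)}}"
    unfolding pair_law_def pmf_map prob_window ..
  then show ?thesis by (simp add: hd_window last_window)
qed

text \<open>The conditional probability of \<open>E\<close> given \<open>X k = x\<close>, with value
  0 at states of mass 0 by the convention for division.\<close>

definition cond_weight :: "int \<Rightarrow> 'b set \<Rightarrow> real \<Rightarrow> real" where
  "cond_weight k E x = prob (E \<inter> {\<omega>\<in>space M. X k \<omega> = x}) / pmf \<pi> x"

lemma prob_Int_state_le: "prob (E \<inter> {\<omega>\<in>space M. X k \<omega> = x}) \<le> pmf \<pi> x"
  unfolding prob_state[of k, symmetric] by (rule finite_measure_mono) auto

lemma cond_weight_nonneg: "0 \<le> cond_weight k E x"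
  by (simp add: cond_weight_def)

lemma cond_weight_le_1: "cond_weight k E x \<le> 1"
  unfolding cond_weight_def using prob_Int_state_le[of E k x]
  by (cases "pmf \<pi> x = 0") (auto simp: divide_le_eq_1 less_le)

lemma cond_weight_mult: "cond_weight k E x * pmf \<pi> x = prob (E \<inter> {\<omega>\<in>space M. X k \<omega> = x})"
  unfolding cond_weight_def using prob_Int_state_le[of E k x]
  by (cases "pmf \<pi> x = 0") (auto simp: measure_le_0_iff)

lemma emeasure_decompose:
  assumes E: "E \<in> events" and C: "countable C"
    and W: "\<And>\<omega>. \<omega> \<in> space M \<Longrightarrow> W \<omega> \<in> C" "\<And>w. {\<omega>\<in>space M. W \<omega> = w} \<in> events"
  shows "emeasure M E = (\<integral>\<^sup>+w. emeasure M (E \<inter> {\<omega>\<in>space M. W \<omega> = w}) \<partial>count_space C)"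
proof -
  have "E = (\<Union>w\<in>C. E \<inter> {\<omega>\<in>space M. W \<omega> = w})"
    using sets.sets_into_space[OF E] W(1) by auto
  then have "emeasure M E = emeasure M (\<Union>w\<in>C. E \<inter> {\<omega>\<in>space M. W \<omega> = w})" by simp
  also have "\<dots> = (\<integral>\<^sup>+w. emeasure M (E \<inter> {\<omega>\<in>space M. W \<omega> = w}) \<partial>count_space C)"
    by (rule emeasure_UN_countable) (use E C W(2) in \<open>auto simp: disjoint_family_on_def\<close>)
  finally show ?thesis .
qed

lemma nn_integral_pmf_on:
  assumes "set_pmf q \<subseteq> C"
  shows "(\<integral>\<^sup>+w. ennreal (pmf q w) * f w \<partial>count_space C) = (\<integral>\<^sup>+w. f w \<partial>measure_pmf q)"
proof -
  have "(\<integral>\<^sup>+w. f w \<partial>measure_pmf q) = (\<integral>\<^sup>+w. ennreal (pmf q w) * f w * indicator C w \<partial>count_space UNIV)"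
    unfolding nn_integral_measure_pmf using assms
    by (intro nn_integral_cong) (auto simp: indicator_def set_pmf_iff)
  then show ?thesis by (simp add: nn_integral_count_space_indicator)
qed

lemma prob_eq_integral_cond_weight:
  assumes "E \<in> events"
  shows "prob E = (\<integral>x. cond_weight k E x \<partial>\<pi>)"
proof -
  have "emeasure M E = (\<integral>\<^sup>+x. emeasure M (E \<inter> {\<omega>\<in>space M. X k \<omega> = x}) \<partial>count_space (set_pmf \<pi>))"
    by (rule emeasure_decompose[OF assms countable_set_pmf]) (auto simp: X_in)
  also have "\<dots> = (\<integral>\<^sup>+x. ennreal (pmf \<pi> x) * ennreal (cond_weight k E x) \<partial>count_space (set_pmf \<pi>))"
    by (intro nn_integral_cong)
       (simp add: emeasure_eq_measure cond_weight_nonneg mult.commute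
         flip: ennreal_mult cond_weight_mult[of k E])
  also have "\<dots> = (\<integral>\<^sup>+x. ennreal (cond_weight k E x) \<partial>\<pi>)"
    by (rule nn_integral_pmf_on) simp
  finally show ?thesis
    by (subst integral_eq_nn_integral) (auto simp: cond_weight_nonneg measure_def)
qed

text \<open>Past and future interact only through the states at times 0 and n. Conditional
  independence is applied twice, at time n with \<open>A\<close> restricted by the state at time 0
  as the past, and at time 0 with the state at time n as the future.\<close>

lemma prob_past_future:
  assumes A: "A \<in> generated_sigma M X {..0}" and B: "B \<in> generated_sigma M X {int n..}"
  shows "prob (A \<inter> B) = (\<integral>w. cond_weight 0 A (fst w) * cond_weight (int n) B (snd w) \<partial>pair_law n)"
proof -
  let ?D = "\<lambda>k x. {\<omega>\<in>space M. X k \<omega> = x}"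
  let ?c = "\<lambda>w. cond_weight 0 A (fst w) * cond_weight (int n) B (snd w)"
  let ?C = "set_pmf \<pi> \<times> set_pmf \<pi>"
  have AB: "A \<in> events" "B \<in> events" using A B generated_sigma_sets by auto
  have pt: "prob (A \<inter> B \<inter> {\<omega>\<in>space M. (X 0 \<omega>, X (int n) \<omega>) = w}) = pmf (pair_law n) w * ?c w"
    if wC: "w \<in> ?C" for w
  proof -
    obtain x y where w: "w = (x, y)" and xy: "x \<in> set_pmf \<pi>" "y \<in> set_pmf \<pi>"
      using wC by (cases w) auto
    then have pos: "0 < pmf \<pi> x" "0 < pmf \<pi> y" by (auto simp: pmf_positive)
    interpret G: sigma_algebra "space M" "generated_sigma M X {..int n}"
      by (rule sigma_algebra_generated)
    have "A \<inter> ?D 0 x \<in> generated_sigma M X {..int n}"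
      using A generated_sigma_mono[of "{..0}" "{..int n}"] state_in_generated[of 0 "{..int n}" x]
      by (intro G.Int) auto
    from past_future_indep[OF this B, of y]
    have 1: "prob (A \<inter> ?D 0 x \<inter> B \<inter> ?D (int n) y) * pmf \<pi> y
      = prob (A \<inter> ?D 0 x \<inter> ?D (int n) y) * prob (B \<inter> ?D (int n) y)" .
    from past_future_indep[OF A state_in_generated[of "int n" "{0..}" y], of x]
    have 2: "prob (A \<inter> ?D (int n) y \<inter> ?D 0 x) * pmf \<pi> x = prob (A \<inter> ?D 0 x) * prob (?D (int n) y \<inter> ?D 0 x)"
      by simp
    have e: "A \<inter> B \<inter> {\<omega>\<in>space M. (X 0 \<omega>, X (int n) \<omega>) = w} = A \<inter> ?D 0 x \<inter> B \<inter> ?D (int n) y"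
      "A \<inter> ?D (int n) y \<inter> ?D 0 x = A \<inter> ?D 0 x \<inter> ?D (int n) y"
      "?D (int n) y \<inter> ?D 0 x = {\<omega>\<in>space M. X 0 \<omega> = x \<and> X (int n) \<omega> = y}"
      by (auto simp: w)
    have "prob (A \<inter> ?D 0 x \<inter> B \<inter> ?D (int n) y) * pmf \<pi> y * pmf \<pi> x
      = prob (A \<inter> ?D 0 x) * pmf (pair_law n) w * prob (B \<inter> ?D (int n) y)"
      unfolding 1 using 2 by (simp add: e(2,3) w pmf_pair_law mult_ac)
    then show ?thesis
      unfolding e(1) cond_weight_def using pos by (simp add: w field_simps)
  qed
  have sub: "set_pmf (pair_law n) \<subseteq> ?C"
  proof
    fix w assume "w \<in> set_pmf (pair_law n)"
    then have "prob {\<omega>\<in>space M. X 0 \<omega> = fst w \<and> X (int n) \<omega> = snd w} \<noteq> 0"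
      using pmf_pair_law[of n "fst w" "snd w"] by (simp add: set_pmf_iff)
    then have "{\<omega>\<in>space M. X 0 \<omega> = fst w \<and> X (int n) \<omega> = snd w} \<noteq> {}" by (metis measure_empty)
    then obtain \<omega> where "\<omega> \<in> space M" "X 0 \<omega> = fst w" "X (int n) \<omega> = snd w" by blast
    then show "w \<in> ?C" using X_in[of \<omega>] by (metis mem_Times_iff)
  qed
  have c0: "0 \<le> ?c w" for w by (simp add: cond_weight_nonneg)
  have ev: "{\<omega> \<in> space M. (X 0 \<omega>, X (int n) \<omega>) = w} \<in> events" for w
    by (cases w) simp
  have "emeasure M (A \<inter> B) = (\<integral>\<^sup>+w. emeasure M (A \<inter> B \<inter> {\<omega>\<in>space M. (X 0 \<omega>, X (int n) \<omega>) = w}) \<partial>count_space ?C)"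
    by (rule emeasure_decompose) (use AB ev in \<open>auto simp: X_in countable_set_pmf\<close>)
  also have "\<dots> = (\<integral>\<^sup>+w. ennreal (pmf (pair_law n) w) * ennreal (?c w) \<partial>count_space ?C)"
    by (intro nn_integral_cong) (use pt c0 in \<open>simp add: emeasure_eq_measure flip: ennreal_mult\<close>)
  also have "\<dots> = (\<integral>\<^sup>+w. ennreal (?c w) \<partial>pair_law n)"
    by (rule nn_integral_pmf_on[OF sub])
  finally show ?thesis
    using c0 by (subst integral_eq_nn_integral) (auto simp: measure_def)
qed

lemma sum_cond_weight_le:
  assumes P: "P \<in> finite_partitions M \<A>" and "\<A> \<subseteq> events"
  shows "(\<Sum>A\<in>P. cond_weight k A x) \<le> 1"
proof -
  let ?D = "{\<omega>\<in>space M. X k \<omega> = x}"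
  have P': "finite P" "P \<subseteq> events" "disjoint P"
    using assms by (auto simp: finite_partitions_def partition_on_def)
  have "(\<Sum>A\<in>P. prob (A \<inter> ?D)) = prob (\<Union>A\<in>P. A \<inter> ?D)"
    by (rule finite_measure_finite_Union[symmetric])
       (use P' in \<open>auto simp: disjoint_family_on_def disjoint_def\<close>)
  also have "(\<Union>A\<in>P. A \<inter> ?D) = \<Union>P \<inter> ?D" by blast
  also have "prob (\<Union>P \<inter> ?D) \<le> pmf \<pi> x" by (rule prob_Int_state_le)
  finally have "(\<Sum>A\<in>P. prob (A \<inter> ?D)) \<le> pmf \<pi> x" .
  then show ?thesis
    by (cases "pmf \<pi> x = 0") (auto simp: cond_weight_def less_le simp flip: sum_divide_distrib)
qed

text \<open>The signs of the differences turn the sum over two partitions into the integral of one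
  test function. It is bounded by 1 because conditional weights over a partition sum to at most
  1.\<close>

lemma beta_mixing_le:
  assumes C: "\<And>\<Phi>. (\<And>w. \<bar>\<Phi> w\<bar> \<le> 1) \<Longrightarrow>
    (\<integral>w. \<Phi> w \<partial>pair_law n) - (\<integral>w. \<Phi> w \<partial>pair_pmf \<pi> \<pi>) \<le> 2 * c"
  shows "alpha_mixing M X n \<le> beta_mixing M X n" and "beta_mixing M X n \<le> c"
proof -
  let ?A = "generated_sigma M X {..0}" and ?B = "generated_sigma M X {int n..}"
  have main: "1/2 * (\<Sum>A\<in>P. \<Sum>B\<in>Q. \<bar>prob (A \<inter> B) - prob A * prob B\<bar>) \<le> c"
    if P: "P \<in> finite_partitions M ?A" and Q: "Q \<in> finite_partitions M ?B" for P Q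
  proof -
    define g where "g A B w = cond_weight 0 A (fst w) * cond_weight (int n) B (snd w)" for A B w
    define s where "s A B = sgn (prob (A \<inter> B) - prob A * prob B)" for A B
    define \<Phi> where "\<Phi> w = (\<Sum>A\<in>P. \<Sum>B\<in>Q. s A B * g A B w)" for w
    have g0: "0 \<le> g A B w" for A B w by (simp add: g_def cond_weight_nonneg)
    have g1: "\<bar>g A B w\<bar> \<le> 1" for A B w
      using g0 by (auto simp: g_def cond_weight_nonneg cond_weight_le_1 intro!: mult_le_one)
    have ig: "integrable (measure_pmf r) (\<lambda>w. s A B * g A B w)" for A B and r
      by (intro integrable_mult_right integrable_pmf_bounded[where B = 1]) (use g1 in simp)
    have "\<bar>\<Phi> w\<bar> \<le> 1" for w
    proof -
      have "\<bar>\<Phi> w\<bar> \<le> (\<Sum>A\<in>P. \<Sum>B\<in>Q. \<bar>s A B * g A B w\<bar>)"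
        unfolding \<Phi>_def by (intro order_trans[OF sum_abs] sum_mono sum_abs)
      also have "\<dots> \<le> (\<Sum>A\<in>P. \<Sum>B\<in>Q. g A B w)"
        using g0 by (intro sum_mono) (auto simp: s_def abs_mult sgn_if)
      also have "\<dots> = (\<Sum>A\<in>P. cond_weight 0 A (fst w)) * (\<Sum>B\<in>Q. cond_weight (int n) B (snd w))"
        by (simp add: g_def sum_product)
      also have "\<dots> \<le> 1 * 1"
        using sum_cond_weight_le[OF P generated_sigma_sets] sum_cond_weight_le[OF Q generated_sigma_sets]
        by (intro mult_mono) (auto intro!: sum_nonneg cond_weight_nonneg)
      finally show ?thesis by simp
    qed
    then have "(\<integral>w. \<Phi> w \<partial>pair_law n) - (\<integral>w. \<Phi> w \<partial>pair_pmf \<pi> \<pi>) \<le> 2 * c" by (rule C)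
    moreover have "(\<integral>w. \<Phi> w \<partial>measure_pmf r) = (\<Sum>A\<in>P. \<Sum>B\<in>Q. s A B * (\<integral>w. g A B w \<partial>r))" for r
      unfolding \<Phi>_def using ig by simp
    moreover have "(\<integral>w. g A B w \<partial>pair_law n) = prob (A \<inter> B)"
      and "(\<integral>w. g A B w \<partial>pair_pmf \<pi> \<pi>) = prob A * prob B" if "A \<in> P" "B \<in> Q" for A B
    proof -
      have AB: "A \<in> ?A" "B \<in> ?B" using that P Q by (auto simp: finite_partitions_def)
      then have ev: "A \<in> events" "B \<in> events" using generated_sigma_sets by auto
      show "(\<integral>w. g A B w \<partial>pair_law n) = prob (A \<inter> B)"
        unfolding g_def by (rule prob_past_future[OF AB, symmetric])
      show "(\<integral>w. g A B w \<partial>pair_pmf \<pi> \<pi>) = prob A * prob B"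
        unfolding pair_pmf_def using g1[of A B]
        by (simp add: integral_bind_pmf_real[where B = 1])
           (simp add: g_def prob_eq_integral_cond_weight[OF ev(1), of 0]
             prob_eq_integral_cond_weight[OF ev(2), of "int n"])
    qed
    moreover have "(\<Sum>A\<in>P. \<Sum>B\<in>Q. \<bar>prob (A \<inter> B) - prob A * prob B\<bar>)
      = (\<Sum>A\<in>P. \<Sum>B\<in>Q. s A B * prob (A \<inter> B)) - (\<Sum>A\<in>P. \<Sum>B\<in>Q. s A B * (prob A * prob B))"
      unfolding sum_subtractf[symmetric]
      by (intro sum.cong refl) (auto simp: s_def abs_sgn algebra_simps)
    ultimately show ?thesis by simp
  qed
  show "alpha_mixing M X n \<le> beta_mixing M X n" "beta_mixing M X n \<le> c"
    unfolding alpha_mixing_def beta_mixing_def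
    using alpha_dep_le_beta_dep[OF sigma_algebra_generated generated_sigma_sets
        sigma_algebra_generated generated_sigma_sets, OF main] by auto
qed

end

section \<open>Variances of partial sums\<close>

text \<open>The variance of a sum of n variables of unit variance with correlations
  \<open>q ^ |i - j|\<close>. For \<open>q = 1 - p\<close> it grows like the square of n below the
  time 1/p and linearly above it.\<close>

definition lag_sum :: "nat \<Rightarrow> real \<Rightarrow> real" where
  "lag_sum n q = (\<Sum>i<n. \<Sum>j<n. q ^ nat \<bar>int i - int j\<bar>)"

lemma lag_sum_nonneg: "0 \<le> q \<Longrightarrow> 0 \<le> lag_sum n q"
  by (auto simp: lag_sum_def intro!: sum_nonneg)

lemma lag_sum_le_square:
  assumes "0 \<le> q" "q \<le> 1"
  shows "lag_sum n q \<le> (real n)\<^sup>2"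
proof -
  have "lag_sum n q \<le> (\<Sum>i<n. \<Sum>j<n. 1)"
    unfolding lag_sum_def using assms by (intro sum_mono power_le_one)
  then show ?thesis by (simp add: power2_eq_square)
qed

lemma geometric_sum_le:
  fixes p :: real
  assumes "0 < p" "p \<le> 1"
  shows "(\<Sum>i<n. (1 - p) ^ i) \<le> 1 / p"
proof -
  have "(\<Sum>i<n. (1 - p) ^ i) = (1 - (1 - p) ^ n) / p"
    using assms one_diff_power_eq[of "1 - p" n] by (simp add: field_simps)
  then show ?thesis using assms by (simp add: divide_right_mono)
qed

lemma lag_sum_le_linear:
  assumes p: "0 < p" "p \<le> 1"
  shows "lag_sum n (1 - p) \<le> 2 * real n / p"
proof -
  have row: "(\<Sum>j<n. (1 - p) ^ nat \<bar>int i - int j\<bar>) \<le> 2 / p" if i: "i < n" for i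
  proof -
    have "{..<n} = {..<i} \<union> {i..<n}" using i by auto
    then have "(\<Sum>j<n. (1 - p) ^ nat \<bar>int i - int j\<bar>)
       = (\<Sum>j<i. (1 - p) ^ nat \<bar>int i - int j\<bar>) + (\<Sum>j\<in>{i..<n}. (1 - p) ^ nat \<bar>int i - int j\<bar>)"
      by (simp add: sum.union_disjoint ivl_disj_int)
    also have "(\<Sum>j<i. (1 - p) ^ nat \<bar>int i - int j\<bar>) \<le> (\<Sum>j<i. (1 - p) ^ (i - Suc j))"
      using p by (intro sum_mono power_decreasing) auto
    also have "\<dots> = (\<Sum>j<i. (1 - p) ^ j)"
      by (rule sum.nat_diff_reindex)
    also have "\<dots> \<le> 1 / p" by (rule geometric_sum_le[OF p])
    also have "(\<Sum>j\<in>{i..<n}. (1 - p) ^ nat \<bar>int i - int j\<bar>) = (\<Sum>j<n - i. (1 - p) ^ j)"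
      using i by (intro sum.reindex_bij_witness[of _ "\<lambda>j. j + i" "\<lambda>j. j - i"])
        (auto simp: nat_diff_distrib intro!: arg_cong[where f = "(^) (1 - p)"])
    also have "\<dots> \<le> 1 / p" by (rule geometric_sum_le[OF p])
    finally show ?thesis by simp
  qed
  have "lag_sum n (1 - p) \<le> (\<Sum>i<n. 2 / p)"
    unfolding lag_sum_def using row by (intro sum_mono) auto
  then show ?thesis by (simp add: mult.commute)
qed

text \<open>Bernoulli's inequality bounds every correlation inside the window by
  \<open>1 - n p\<close> from below.\<close>

lemma lag_sum_ge_square:
  assumes "0 < p" "p \<le> 1"
  shows "(real n)\<^sup>2 * (1 - real n * p) \<le> lag_sum n (1 - p)"
proof -
  have le: "1 - real n * p \<le> (1 - p) ^ nat \<bar>int i - int j\<bar>" if "i < n" "j < n" for i j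
  proof -
    have "1 - real n * p \<le> (1 - p) ^ n"
      using Bernoulli_inequality[of "- p" n] assms by (simp add: algebra_simps)
    also have "\<dots> \<le> (1 - p) ^ nat \<bar>int i - int j\<bar>"
      using assms that by (intro power_decreasing) auto
    finally show ?thesis .
  qed
  have "(real n)\<^sup>2 * (1 - real n * p) = (\<Sum>i<n. \<Sum>j<n. 1 - real n * p)"
    by (simp add: power2_eq_square)
  also have "\<dots> \<le> lag_sum n (1 - p)"
    unfolding lag_sum_def using le by (intro sum_mono) auto
  finally show ?thesis .
qed

text \<open>Row i keeps only the columns up to i, a geometric sum that falls short of 1/p by
  \<open>(1 - p) ^ i / p\<close>; the shortfalls add up to at most the square of 1/p.\<close>

lemma lag_sum_ge_linear:
  assumes p: "0 < p" "p \<le> 1"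
  shows "(real n - 1 / p) / p \<le> lag_sum n (1 - p)"
proof -
  have row: "(1 - (1 - p) ^ i) / p \<le> (\<Sum>j<n. (1 - p) ^ nat \<bar>int i - int j\<bar>)" if "i < n" for i
  proof -
    have "(1 - (1 - p) ^ i) / p = (\<Sum>j<i. (1 - p) ^ j)"
      using p one_diff_power_eq[of "1 - p" i] by (simp add: field_simps)
    also have "\<dots> \<le> (\<Sum>j<Suc i. (1 - p) ^ j)"
      using p by simp
    also have "\<dots> = (\<Sum>j<Suc i. (1 - p) ^ (Suc i - Suc j))"
      by (rule sum.nat_diff_reindex[symmetric])
    also have "\<dots> = (\<Sum>j<Suc i. (1 - p) ^ nat \<bar>int i - int j\<bar>)"
      by (intro sum.cong refl arg_cong[where f = "(^) (1 - p)"]) auto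
    also have "\<dots> \<le> (\<Sum>j<n. (1 - p) ^ nat \<bar>int i - int j\<bar>)"
      using that p by (intro sum_mono2) auto
    finally show ?thesis .
  qed
  have "(real n - 1 / p) / p \<le> (real n - (\<Sum>i<n. (1 - p) ^ i)) / p"
    using p geometric_sum_le[OF p, of n] by (intro divide_right_mono) auto
  also have "\<dots> = (\<Sum>i<n. (1 - (1 - p) ^ i) / p)"
    by (simp add: sum_subtractf flip: sum_divide_distrib)
  also have "\<dots> \<le> lag_sum n (1 - p)"
    unfolding lag_sum_def using row by (intro sum_mono) auto
  finally show ?thesis .
qed

lemma sum_blocks: "(\<Sum>i<N * n. f i) = (\<Sum>a<N. \<Sum>k<n. f (a * n + k))" for f :: "nat \<Rightarrow> real"
proof (induction N)
  case (Suc N)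
  have "{..<Suc N * n} = {..<N * n} \<union> {N * n..<N * n + n}" by auto
  then have "(\<Sum>i<Suc N * n. f i) = (\<Sum>i<N * n. f i) + (\<Sum>i\<in>{N * n..<N * n + n}. f i)"
    by (simp add: sum.union_disjoint ivl_disj_int)
  also have "(\<Sum>i\<in>{N * n..<N * n + n}. f i) = (\<Sum>k<n. f (N * n + k))"
    using sum.shift_bounds_nat_ivl[of f 0 "N * n" n] by (simp add: atLeast0LessThan add.commute)
  finally show ?case using Suc by simp
qed simp

text \<open>Off-diagonal blocks contribute less than diagonal ones because \<open>\<bar>i - j\<bar>\<close> is at least the
  distance of \<open>i\<close> and \<open>j\<close> to the ends of their blocks.\<close>

lemma lag_sum_mult_le:
  assumes q: "0 \<le> q" "q \<le> 1"
  shows "lag_sum (N * n) q \<le> (real N)\<^sup>2 * lag_sum n q"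
proof -
  let ?S = "\<Sum>k<n. \<Sum>l<n. q ^ (k + l)"
  have diag: "?S \<le> lag_sum n q"
    unfolding lag_sum_def using q by (intro sum_mono power_decreasing) auto
  have low: "(\<Sum>k<n. \<Sum>l<n. q ^ nat \<bar>int (a * n + k) - int (b * n + l)\<bar>) \<le> ?S" if ab: "b < a" for a b
  proof -
    have "(\<Sum>k<n. \<Sum>l<n. q ^ nat \<bar>int (a * n + k) - int (b * n + l)\<bar>) \<le> (\<Sum>k<n. \<Sum>l<n. q ^ (k + (n - Suc l)))"
    proof (intro sum_mono power_decreasing q)
      fix k l assume kl: "k \<in> {..<n}" "l \<in> {..<n}"
      have "Suc b * n \<le> a * n" using ab by (intro mult_right_mono) auto
      then have "b * n + n \<le> a * n" by simp
      moreover have "k + (n - Suc l) \<le> nat \<bar>int (u + k) - int (v + l)\<bar>" if "v + n \<le> u" for u v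
        using that kl by simp
      ultimately show "k + (n - Suc l) \<le> nat \<bar>int (a * n + k) - int (b * n + l)\<bar>" by blast
    qed
    also have "\<dots> = ?S"
    proof (rule sum.cong[OF refl])
      show "(\<Sum>l<n. q ^ (k + (n - Suc l))) = (\<Sum>l<n. q ^ (k + l))" for k
        using sum.nat_diff_reindex[of "\<lambda>l. q ^ (k + l)" n] .
    qed
    finally show ?thesis .
  qed
  have up: "(\<Sum>k<n. \<Sum>l<n. q ^ nat \<bar>int (a * n + k) - int (b * n + l)\<bar>) \<le> ?S" if ab: "a < b" for a b
  proof -
    have "(\<Sum>k<n. \<Sum>l<n. q ^ nat \<bar>int (a * n + k) - int (b * n + l)\<bar>)
      = (\<Sum>l<n. \<Sum>k<n. q ^ nat \<bar>int (b * n + l) - int (a * n + k)\<bar>)"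
      by (subst sum.swap) (simp only: abs_minus_commute)
    also have "\<dots> \<le> ?S" by (rule low[OF ab])
    finally show ?thesis .
  qed
  have block: "(\<Sum>k<n. \<Sum>l<n. q ^ nat \<bar>int (a * n + k) - int (b * n + l)\<bar>) \<le> lag_sum n q" for a b
  proof (cases a b rule: linorder_cases)
    case equal
    then show ?thesis by (simp add: lag_sum_def)
  qed (use low[of b a] up[of a b] diag in auto)
  have "lag_sum (N * n) q = (\<Sum>a<N. \<Sum>k<n. \<Sum>b<N. \<Sum>l<n. q ^ nat \<bar>int (a * n + k) - int (b * n + l)\<bar>)"
    unfolding lag_sum_def by (simp only: sum_blocks)
  also have "\<dots> = (\<Sum>a<N. \<Sum>b<N. \<Sum>k<n. \<Sum>l<n. q ^ nat \<bar>int (a * n + k) - int (b * n + l)\<bar>)"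
    by (intro sum.cong refl sum.swap)
  also have "\<dots> \<le> (\<Sum>a<N. \<Sum>b<N. lag_sum n q)"
    by (intro sum_mono block)
  finally show ?thesis by (simp add: power2_eq_square)
qed

section \<open>Feynman-Kac operators, and odd functions under the refresh chain\<close>

context refresh_chain
begin

text \<open>Iterating on the constant 1 yields the expected product of \<open>g\<close> over
  consecutive states; with \<open>g\<close> a phase this is a characteristic function of a partial
  sum.\<close>

definition FK :: "(real \<Rightarrow> complex) \<Rightarrow> (real \<Rightarrow> complex) \<Rightarrow> real \<Rightarrow> complex" where
  "FK g f x = g x * T f x"

lemma norm_FK_le:
  assumes "\<And>x. norm (g x) \<le> 1" "\<And>x. norm (f x) \<le> B"
  shows "norm (FK g f x) \<le> B"
proof -
  have "norm (FK g f x) \<le> 1 * B"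
    unfolding FK_def norm_mult by (intro mult_mono norm_T_le assms) auto
  then show ?thesis by simp
qed

lemma norm_FK_pow_le:
  assumes "\<And>x. norm (g x) \<le> 1"
  shows "norm ((FK g ^^ n) (\<lambda>_. 1) x) \<le> 1"
  by (induction n arbitrary: x) (auto intro!: norm_FK_le assms)

lemma norm_prod_list_le_1:
  fixes g :: "real \<Rightarrow> complex"
  assumes "\<And>x. norm (g x) \<le> 1"
  shows "norm (prod_list (map g xs)) \<le> 1"
  by (induction xs) (use assms in \<open>auto simp: norm_mult intro!: mult_le_one\<close>)

lemma integral_path_prod:
  assumes g: "\<And>x. norm (g x) \<le> 1"
  shows "(\<integral>xs. prod_list (map g xs) \<partial>path K n x) = (FK g ^^ Suc n) (\<lambda>_. 1) x"
proof (induction n arbitrary: x)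
  case 0
  \<comment> \<open>A path of n steps has n + 1 states, so the operator is applied n + 1 times. The
    innermost average acts on the constant 1 and changes nothing.\<close>
  have "T (\<lambda>_. 1 :: complex) x = 1" by (simp add: T_def flip: scaleR_left_distrib)
  then show ?case by (simp add: FK_def)
next
  case (Suc n)
  have "(\<integral>xs. prod_list (map g xs) \<partial>path K (Suc n) x)
      = (\<integral>y. (\<integral>xs. prod_list (map g xs) \<partial>map_pmf ((#) x) (path K n y)) \<partial>K x)"
    unfolding path.simps
    by (rule integral_bind_pmf_complex[where B = 1]) (rule norm_prod_list_le_1[OF g])
  also have "\<dots> = (\<integral>y. g x * (FK g ^^ Suc n) (\<lambda>_. 1) y \<partial>K x)"
    by (simp add: Suc del: funpow.simps)
  also have "\<dots> = g x * T ((FK g ^^ Suc n) (\<lambda>_. 1)) x"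
    by (subst integral_mult_right_zero, subst integral_K_complex[where B = 1])
       (auto intro: norm_FK_pow_le[OF g] simp del: funpow.simps)
  also have "\<dots> = (FK g ^^ Suc (Suc n)) (\<lambda>_. 1) x"
    using FK_def[of g "(FK g ^^ Suc n) (\<lambda>_. 1)" x] by simp
  finally show ?case .
qed

lemma integral_path_last:
  fixes g :: "real \<Rightarrow> real"
  assumes g: "\<And>x. \<bar>g x\<bar> \<le> B"
  shows "(\<integral>xs. g (last xs) \<partial>path K n x) = (T ^^ n) g x"
proof (induction n arbitrary: x)
  case (Suc n)
  have "(\<integral>xs. g (last xs) \<partial>path K (Suc n) x)
      = (\<integral>y. (\<integral>xs. g (last xs) \<partial>map_pmf ((#) x) (path K n y)) \<partial>K x)"
    unfolding path.simps by (rule integral_bind_pmf_real[where B = B]) (rule g)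
  also have "\<dots> = (\<integral>y. (\<integral>xs. g (last xs) \<partial>path K n y) \<partial>K x)"
  proof (rule Bochner_Integration.integral_cong[OF refl])
    fix y
    have "last (x # xs) = last xs" if "xs \<in> set_pmf (path K n y)" for xs
      using length_path[OF that] by auto
    then show "(\<integral>xs. g (last xs) \<partial>map_pmf ((#) x) (path K n y)) = (\<integral>xs. g (last xs) \<partial>path K n y)"
      unfolding integral_map_pmf by (intro integral_cong_AE AE_pmfI) auto
  qed
  also have "\<dots> = T ((T ^^ n) g) x"
    unfolding Suc using norm_T_pow_le[of g B] g by (intro integral_K_real[where B = B]) simp
  finally show ?case by simp
qed simp

lemma integral_odd:
  fixes h :: "real \<Rightarrow> 'c::{banach, second_countable_topology}"
  assumes "\<And>x. h (- x) = - h x"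
  shows "(\<integral>x. h x \<partial>\<pi>) = 0"
proof -
  have "(\<integral>x. h x \<partial>\<pi>) = (\<integral>x. h x \<partial>map_pmf uminus \<pi>)" by (simp only: symmetric)
  also have "\<dots> = - (\<integral>x. h x \<partial>\<pi>)" by (simp add: assms)
  finally have "2 *\<^sub>R (\<integral>x. h x \<partial>\<pi>) = 0" by (simp only: scaleR_2 eq_neg_iff_add_eq_0)
  then show ?thesis by simp
qed

lemma integral_odd_\<nu>:
  fixes h :: "real \<Rightarrow> 'c::{banach, second_countable_topology}"
  assumes "\<And>x. h (- x) = - h x"
  shows "(\<integral>x. h x \<partial>\<nu>) = 0"
  using integral_odd[of "\<lambda>x. p x *\<^sub>R h x"] assms by (simp add: integral_\<nu> p_even)

text \<open>A refresh destroys odd functions, since \<nu> is symmetric; only the paths without any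
  refresh contribute.\<close>

lemma T_pow_odd:
  fixes h :: "real \<Rightarrow> real"
  assumes "\<And>x. h (- x) = - h x"
  shows "(T ^^ n) h x = (1 - p x) ^ n * h x"
proof (induction n arbitrary: x)
  case (Suc n)
  have "(T ^^ n) h = (\<lambda>x. (1 - p x) ^ n * h x)" using Suc by (simp add: fun_eq_iff)
  moreover have "(\<integral>x. (1 - p x) ^ n * h x \<partial>\<nu>) = 0"
    by (rule integral_odd_\<nu>) (simp add: assms p_even)
  ultimately show ?case using T_def[of "(T ^^ n) h" x] by simp
qed simp

end

locale refresh_process = refresh_chain \<pi> p + kernel_process \<pi> "refresh_chain.K \<pi> p" M X
  for \<pi> p and M :: "'b measure" and X

context refresh_process
begin

lemma bind_path_0: "bind_pmf q (path L 0) = map_pmf (\<lambda>x. [x]) q"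
proof -
  have "path L 0 = (\<lambda>x. return_pmf [x])" by (simp add: fun_eq_iff)
  then show ?thesis by (simp add: map_pmf_def)
qed

lemma expectation_state:
  fixes f :: "real \<Rightarrow> 'c::{banach, second_countable_topology}"
  shows "(\<integral>\<omega>. f (X k \<omega>) \<partial>M) = (\<integral>x. f x \<partial>\<pi>)"
  using expectation_window[of "\<lambda>xs. f (hd xs)" k 0] by (simp only: hd_window bind_path_0) simp

lemma distr_state: "distr M (count_space UNIV) (X k) = measure_pmf \<pi>"
proof -
  have "X k = hd \<circ> window X k 0" by (simp add: window_def fun_eq_iff)
  then have "distr M (count_space UNIV) (X k) = distr M (count_space UNIV) (hd \<circ> window X k 0)"
    by (rule arg_cong)
  also have "\<dots> = distr (distr M (count_space UNIV) (window X k 0)) (count_space UNIV) hd"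
    by (rule distr_distr[symmetric]) auto
  also have "\<dots> = measure_pmf (map_pmf hd (bind_pmf \<pi> (path K 0)))"
    unfolding window_law by (simp only: map_pmf_rep_eq)
  also have "map_pmf hd (bind_pmf \<pi> (path K 0)) = \<pi>"
    by (simp add: bind_path_0 map_pmf_comp del: path.simps)
  finally show ?thesis .
qed

lemma measurable_X_UNIV: "X k \<in> measurable M (count_space UNIV)"
  using measurable_compose[OF measurable_X_count, where g = "\<lambda>x. x" and L = "count_space UNIV"] by auto

lemma measurable_state_fun [measurable]: "(\<lambda>\<omega>. h (X k \<omega>)) \<in> borel_measurable M"
  using measurable_compose[OF measurable_X_UNIV, where g = h and L = borel] by auto

lemma integrable_state:
  fixes f :: "real \<Rightarrow> real"
  shows "integrable M (\<lambda>\<omega>. f (X k \<omega>)) \<longleftrightarrow> integrable (measure_pmf \<pi>) f"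
  unfolding distr_state[of k, symmetric]
  by (rule integrable_distr_eq[symmetric]) (auto intro: measurable_X_UNIV)

lemma expectation_pair:
  fixes \<Phi> :: "real \<times> real \<Rightarrow> real"
  assumes \<Phi>: "\<And>w. \<bar>\<Phi> w\<bar> \<le> B"
  shows "(\<integral>xs. \<Phi> (hd xs, last xs) \<partial>bind_pmf \<pi> (path K n)) = (\<integral>x. (T ^^ n) (\<lambda>y. \<Phi> (x, y)) x \<partial>\<pi>)"
proof -
  have hd: "hd xs = x" if "xs \<in> set_pmf (path K n x)" for xs x
    using that by (cases n) auto
  have "(\<integral>xs. \<Phi> (hd xs, last xs) \<partial>bind_pmf \<pi> (path K n))
    = (\<integral>x. (\<integral>xs. \<Phi> (hd xs, last xs) \<partial>path K n x) \<partial>\<pi>)"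
    by (rule integral_bind_pmf_real[where B = B]) (rule \<Phi>)
  also have "\<dots> = (\<integral>x. (\<integral>xs. \<Phi> (x, last xs) \<partial>path K n x) \<partial>\<pi>)"
  proof (rule Bochner_Integration.integral_cong[OF refl])
    show "(\<integral>xs. \<Phi> (hd xs, last xs) \<partial>path K n x) = (\<integral>xs. \<Phi> (x, last xs) \<partial>path K n x)" for x
      by (intro integral_cong_AE AE_pmfI) (auto simp: hd)
  qed
  also have "\<dots> = (\<integral>x. (T ^^ n) (\<lambda>y. \<Phi> (x, y)) x \<partial>\<pi>)"
    by (subst integral_path_last[where B = B]) (auto intro: \<Phi>)
  finally show ?thesis .
qed

lemma covariance_bounded:
  assumes h: "\<And>x. \<bar>h x\<bar> \<le> B" "\<And>x. h (- x) = - h x"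
  shows "(\<integral>\<omega>. h (X a \<omega>) * h (X (a + int n) \<omega>) \<partial>M) = (\<integral>x. (1 - p x) ^ n * (h x)\<^sup>2 \<partial>\<pi>)"
proof -
  have B: "0 \<le> B" using h(1)[of 0] by linarith
  have "(\<integral>\<omega>. h (X a \<omega>) * h (X (a + int n) \<omega>) \<partial>M)
    = (\<integral>xs. h (hd xs) * h (last xs) \<partial>bind_pmf \<pi> (path K n))"
    using expectation_window[of "\<lambda>xs. h (hd xs) * h (last xs)" a n]
    by (simp only: hd_window last_window)
  also have "\<dots> = (\<integral>x. (T ^^ n) (\<lambda>y. h x * h y) x \<partial>\<pi>)"
  proof -
    have "\<bar>h (fst w) * h (snd w)\<bar> \<le> B * B" for w
      unfolding abs_mult using B by (intro mult_mono h) auto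
    then show ?thesis using expectation_pair[of "\<lambda>w. h (fst w) * h (snd w)" "B * B" n] by simp
  qed
  also have "\<dots> = (\<integral>x. (1 - p x) ^ n * (h x)\<^sup>2 \<partial>\<pi>)"
  proof (rule Bochner_Integration.integral_cong[OF refl])
    show "(T ^^ n) (\<lambda>y. h x * h y) x = (1 - p x) ^ n * (h x)\<^sup>2" for x
      using T_pow_odd[of "\<lambda>y. h x * h y" n x] h(2) by (simp add: power2_eq_square)
  qed
  finally show ?thesis .
qed

text \<open>Square integrable \<open>h\<close> is reached from its bounded odd truncations by
  dominated convergence, on the process and on the level of \<pi> alike.\<close>

lemma covariance_aux:
  assumes odd: "\<And>x. h (- x) = - h x" and int: "integrable (measure_pmf \<pi>) (\<lambda>x. (h x)\<^sup>2)"
  shows "integrable M (\<lambda>\<omega>. h (X a \<omega>) * h (X b \<omega>))"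
    and "(\<integral>\<omega>. h (X a \<omega>) * h (X (a + int n) \<omega>) \<partial>M) = (\<integral>x. (1 - p x) ^ n * (h x)\<^sup>2 \<partial>\<pi>)"
proof -
  have sq: "integrable M (\<lambda>\<omega>. (h (X k \<omega>))\<^sup>2)" for k
    using integrable_state[of "\<lambda>x. (h x)\<^sup>2" k] int by simp
  have ab: "\<bar>u * v\<bar> \<le> u\<^sup>2 + v\<^sup>2" for u v :: real
  proof -
    have "2 * \<bar>u * v\<bar> \<le> u\<^sup>2 + v\<^sup>2"
      using sum_squares_bound[of "\<bar>u\<bar>" "\<bar>v\<bar>"] by (simp add: abs_mult)
    then show ?thesis using abs_ge_zero[of "u * v"] by linarith
  qed
  show "integrable M (\<lambda>\<omega>. h (X a \<omega>) * h (X b \<omega>))"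
    by (rule Bochner_Integration.integrable_bound[OF Bochner_Integration.integrable_add[OF sq[of a] sq[of b]]])
       (use ab in auto)
  define g where "g m x = (if \<bar>h x\<bar> \<le> real m then h x else 0)" for m x
  have g: "\<bar>g m x\<bar> \<le> real m" "g m (- x) = - g m x" "\<bar>g m x\<bar> \<le> \<bar>h x\<bar>" for m x
    by (auto simp: g_def odd)
  have lim: "(\<lambda>m. g m x) \<longlonglongrightarrow> h x" for x
  proof (rule tendsto_eventually)
    show "\<forall>\<^sub>F m in sequentially. g m x = h x"
      using eventually_ge_at_top[of "nat \<lceil>\<bar>h x\<bar>\<rceil>"]
    proof eventually_elim
      case (elim m)
      then have "\<bar>h x\<bar> \<le> real m" by linarith
      then show ?case by (simp add: g_def)
    qed
  qed
  have "(\<lambda>m. \<integral>\<omega>. g m (X a \<omega>) * g m (X (a + int n) \<omega>) \<partial>M) \<longlonglongrightarrow> (\<integral>\<omega>. h (X a \<omega>) * h (X (a + int n) \<omega>) \<partial>M)"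
  proof (rule integral_dominated_convergence)
    show "integrable M (\<lambda>\<omega>. (h (X a \<omega>))\<^sup>2 + (h (X (a + int n) \<omega>))\<^sup>2)" using sq by simp
    show "AE \<omega> in M. (\<lambda>m. g m (X a \<omega>) * g m (X (a + int n) \<omega>)) \<longlonglongrightarrow> h (X a \<omega>) * h (X (a + int n) \<omega>)"
      by (intro AE_I2 tendsto_mult lim)
    show "AE \<omega> in M. norm (g m (X a \<omega>) * g m (X (a + int n) \<omega>)) \<le> (h (X a \<omega>))\<^sup>2 + (h (X (a + int n) \<omega>))\<^sup>2" for m
    proof (rule AE_I2)
      fix \<omega>
      have "\<bar>g m (X a \<omega>) * g m (X (a + int n) \<omega>)\<bar> \<le> \<bar>h (X a \<omega>) * h (X (a + int n) \<omega>)\<bar>"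
        unfolding abs_mult by (intro mult_mono g) auto
      then show "norm (g m (X a \<omega>) * g m (X (a + int n) \<omega>)) \<le> (h (X a \<omega>))\<^sup>2 + (h (X (a + int n) \<omega>))\<^sup>2"
        using ab[of "h (X a \<omega>)" "h (X (a + int n) \<omega>)"] by simp
    qed
  qed auto
  moreover have "(\<lambda>m. \<integral>x. (1 - p x) ^ n * (g m x)\<^sup>2 \<partial>\<pi>) \<longlonglongrightarrow> (\<integral>x. (1 - p x) ^ n * (h x)\<^sup>2 \<partial>\<pi>)"
  proof (rule integral_dominated_convergence)
    show "AE x in measure_pmf \<pi>. (\<lambda>m. (1 - p x) ^ n * (g m x)\<^sup>2) \<longlonglongrightarrow> (1 - p x) ^ n * (h x)\<^sup>2"
      by (intro AE_I2 tendsto_intros lim)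
    show "AE x in measure_pmf \<pi>. norm ((1 - p x) ^ n * (g m x)\<^sup>2) \<le> (h x)\<^sup>2" for m
    proof (rule AE_I2)
      fix x
      have "(1 - p x) ^ n * (g m x)\<^sup>2 \<le> 1 * (h x)\<^sup>2"
        using g(3)[of m x] q_power_bounds[of x n] by (intro mult_mono) (auto simp: abs_le_square_iff)
      then show "norm ((1 - p x) ^ n * (g m x)\<^sup>2) \<le> (h x)\<^sup>2" using q_power_bounds[of x n] by simp
    qed
  qed (use int in auto)
  moreover have "(\<integral>\<omega>. g m (X a \<omega>) * g m (X (a + int n) \<omega>) \<partial>M) = (\<integral>x. (1 - p x) ^ n * (g m x)\<^sup>2 \<partial>\<pi>)" for m
    by (rule covariance_bounded[where B = "real m"]) (rule g)+
  ultimately show "(\<integral>\<omega>. h (X a \<omega>) * h (X (a + int n) \<omega>) \<partial>M) = (\<integral>x. (1 - p x) ^ n * (h x)\<^sup>2 \<partial>\<pi>)"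
    using LIMSEQ_unique by simp
qed

lemma covariance:
  assumes odd: "\<And>x. h (- x) = - h x" and int: "integrable (measure_pmf \<pi>) (\<lambda>x. (h x)\<^sup>2)"
  shows "(\<integral>\<omega>. h (X a \<omega>) * h (X b \<omega>) \<partial>M) = (\<integral>x. (1 - p x) ^ nat \<bar>a - b\<bar> * (h x)\<^sup>2 \<partial>\<pi>)"
proof (cases "a \<le> b")
  case True
  then show ?thesis using covariance_aux(2)[OF assms, where a = a and n = "nat (b - a)"] by simp
next
  case False
  then show ?thesis using covariance_aux(2)[OF assms, where a = b and n = "nat (a - b)"] by (simp add: mult.commute)
qed

lemma second_moment_sum:
  assumes odd: "\<And>x. h (- x) = - h x" and int: "integrable (measure_pmf \<pi>) (\<lambda>x. (h x)\<^sup>2)"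
  shows "integrable M (\<lambda>\<omega>. (\<Sum>k=1..int n. h (X k \<omega>))\<^sup>2)"
    and "(\<integral>\<omega>. (\<Sum>k=1..int n. h (X k \<omega>))\<^sup>2 \<partial>M) = (\<integral>x. lag_sum n (1 - p x) * (h x)\<^sup>2 \<partial>\<pi>)"
proof -
  have re: "(\<Sum>k=1..int n. h (X k \<omega>)) = (\<Sum>i<n. h (X (int i + 1) \<omega>))" for \<omega>
    by (rule sum.reindex_bij_witness[of _ "\<lambda>i. int i + 1" "\<lambda>k. nat (k - 1)"]) auto
  have sq: "(\<Sum>k=1..int n. h (X k \<omega>))\<^sup>2 = (\<Sum>i<n. \<Sum>j<n. h (X (int i + 1) \<omega>) * h (X (int j + 1) \<omega>))" for \<omega>
    unfolding re power2_eq_square sum_product ..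
  note c = covariance_aux(1)[OF assms]
  show "integrable M (\<lambda>\<omega>. (\<Sum>k=1..int n. h (X k \<omega>))\<^sup>2)" unfolding sq using c by simp
  have i: "integrable (measure_pmf \<pi>) (\<lambda>x. (1 - p x) ^ m * (h x)\<^sup>2)" for m
    by (rule Bochner_Integration.integrable_bound[OF int])
       (auto simp: abs_mult q_power_bounds intro!: mult_left_le_one_le)
  have "(\<integral>\<omega>. (\<Sum>k=1..int n. h (X k \<omega>))\<^sup>2 \<partial>M)
     = (\<Sum>i<n. \<Sum>j<n. \<integral>x. (1 - p x) ^ nat \<bar>int i - int j\<bar> * (h x)\<^sup>2 \<partial>\<pi>)"
    unfolding sq using c by (simp add: covariance[OF assms])
  also have "\<dots> = (\<integral>x. lag_sum n (1 - p x) * (h x)\<^sup>2 \<partial>\<pi>)"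
    using i by (simp add: lag_sum_def sum_distrib_right)
  finally show "(\<integral>\<omega>. (\<Sum>k=1..int n. h (X k \<omega>))\<^sup>2 \<partial>M) = (\<integral>x. lag_sum n (1 - p x) * (h x)\<^sup>2 \<partial>\<pi>)" .
qed

lemma norm_var_eq:
  assumes int: "integrable (measure_pmf \<pi>) (\<lambda>x. x\<^sup>2)"
  shows "norm_var M X n = (\<integral>x. lag_sum n (1 - p x) * x\<^sup>2 \<partial>\<pi>) / real n"
proof -
  have i: "integrable M (X k)" for k
    by (rule square_integrable_imp_integrable) (use integrable_state[of "\<lambda>x. x\<^sup>2" k] int in auto)
  have "expectation (partial_sum X n) = (\<Sum>k=1..int n. expectation (X k))"
    unfolding partial_sum_def[abs_def] using i by simp
  also have "\<dots> = 0"
    using expectation_state[of "\<lambda>x. x"] integral_odd[of "\<lambda>x. x"] by simp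
  finally have "variance (partial_sum X n) = (\<integral>\<omega>. (\<Sum>k=1..int n. X k \<omega>)\<^sup>2 \<partial>M)"
    by (simp add: partial_sum_def)
  also have "\<dots> = (\<integral>x. lag_sum n (1 - p x) * x\<^sup>2 \<partial>\<pi>)"
    using second_moment_sum(2)[of "\<lambda>x. x" n] int by simp
  finally show ?thesis by (simp add: norm_var_def)
qed

lemma char_sum:
  "(\<integral>\<omega>. iexp (\<Sum>k=1..int n. h (X k \<omega>)) \<partial>M) = (\<integral>x. (FK (\<lambda>x. iexp (h x)) ^^ n) (\<lambda>_. 1) x \<partial>\<pi>)"
proof (cases n)
  case 0
  then show ?thesis by (simp add: prob_space)
next
  case (Suc m)
  let ?g = "\<lambda>x. iexp (h x)"
  have g: "norm (?g x) \<le> 1" for x by simp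
  have "(\<Sum>k=1..int n. h (X k \<omega>)) = sum_list (map h (window X 1 m \<omega>))" for \<omega>
  proof -
    have "(\<Sum>k=1..int n. h (X k \<omega>)) = (\<Sum>i<Suc m. h (X (1 + int i) \<omega>))"
      unfolding Suc by (rule sum.reindex_bij_witness[of _ "\<lambda>i. 1 + int i" "\<lambda>k. nat (k - 1)"]) auto
    also have "\<dots> = sum_list (map h (window X 1 m \<omega>))"
      unfolding window_def map_map o_def by (simp add: sum_list_distinct_conv_sum_set atLeast0LessThan del: upt_Suc)
    finally show ?thesis .
  qed
  moreover have "iexp (sum_list (map h xs)) = prod_list (map ?g xs)" for xs
    by (induction xs) (auto simp: exp_add distrib_left)
  ultimately have "(\<integral>\<omega>. iexp (\<Sum>k=1..int n. h (X k \<omega>)) \<partial>M) = (\<integral>\<omega>. prod_list (map ?g (window X 1 m \<omega>)) \<partial>M)"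
    by simp
  also have "\<dots> = (\<integral>xs. prod_list (map ?g xs) \<partial>bind_pmf \<pi> (path K m))"
    by (rule expectation_window)
  also have "\<dots> = (\<integral>x. (\<integral>xs. prod_list (map ?g xs) \<partial>path K m x) \<partial>\<pi>)"
    by (rule integral_bind_pmf_complex[where B = 1]) (rule norm_prod_list_le_1[OF g])
  also have "\<dots> = (\<integral>x. (FK ?g ^^ n) (\<lambda>_. 1) x \<partial>\<pi>)"
    unfolding Suc by (simp only: integral_path_prod[OF g])
  finally show ?thesis .
qed

end

section \<open>Anticoncentration\<close>

text \<open>For |x| up to 1 the cubic remainder is at most a sixth of the square, which keeps the
  cosine positive and at most \<open>1 - x^2 / 3\<close>.\<close>

lemma one_minus_abs_cos_ge:
  fixes x :: real
  assumes "\<bar>x\<bar> \<le> 1"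
  shows "x\<^sup>2 / 8 \<le> 1 - \<bar>cos x\<bar>"
proof -
  have "cmod (iexp x - (\<Sum>k\<le>2. (\<i> * x) ^ k / fact k)) \<le> \<bar>x\<bar> ^ 3 / 6"
    using iexp_approx1[of x 2] by (simp add: fact_numeral)
  moreover have "(\<Sum>k\<le>2. (\<i> * x) ^ k / fact k) = Complex (1 - x\<^sup>2 / 2) x"
    by (simp add: numeral_2_eq_2 complex_eq_iff power2_eq_square)
  ultimately have "\<bar>Re (iexp x - Complex (1 - x\<^sup>2 / 2) x)\<bar> \<le> \<bar>x\<bar> ^ 3 / 6"
    using abs_Re_le_cmod order_trans by metis
  then have c: "\<bar>cos x - (1 - x\<^sup>2 / 2)\<bar> \<le> \<bar>x\<bar> ^ 3 / 6" by (simp add: Re_exp)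
  have "\<bar>x\<bar> ^ 3 = \<bar>x\<bar> * x\<^sup>2" by (simp add: power3_eq_cube power2_eq_square abs_mult_self_eq)
  also have "\<dots> \<le> 1 * x\<^sup>2" using assms by (intro mult_right_mono) auto
  finally have 3: "\<bar>x\<bar> ^ 3 \<le> x\<^sup>2" by simp
  have 2: "x\<^sup>2 \<le> 1" using assms by (simp add: abs_square_le_1)
  show ?thesis using c 3 2 zero_le_power2[of x] by (simp add: abs_if split: if_splits)
qed

section \<open>Decay of the characteristic functions of normalised sums\<close>

context refresh_chain
begin

text \<open>Tail of a full holding time, which begins with a draw from \<nu>, whereas
  \<open>H\<close> is the tail of a residual one; \<open>Z_G\<close> is the usual link between the
  two.\<close>

definition G :: "nat \<Rightarrow> real" where "G n = (\<integral>x. (1 - p x) ^ n \<partial>\<nu>)"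

text \<open>A state x held for exactly k + 1 times collects the phase
  \<open>(k + 1) * \<tau> * x\<close>. By symmetry only the cosine survives averaging, and this is
  the resulting loss of modulus.\<close>

definition lag_loss :: "real \<Rightarrow> nat \<Rightarrow> real" where
  "lag_loss \<tau> k = (\<integral>x. (1 - p x) ^ k * p x * (1 - \<bar>cos (real (Suc k) * \<tau> * x)\<bar>) \<partial>\<nu>)"

lemma int_bounded_real:
  fixes f :: "real \<Rightarrow> real"
  assumes "\<And>x. \<bar>f x\<bar> \<le> B"
  shows "integrable (measure_pmf r) f"
  by (rule integrable_pmf_bounded[where B = B]) (use assms in simp)

lemma qp_bounds: "0 \<le> (1 - p x) ^ k * p x" "(1 - p x) ^ k * p x \<le> 1"
  using q_power_bounds[of x k] p_bounds[of x] by (auto intro: mult_le_one)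

lemma Z_G: "Z * G k = H k - H (Suc k)"
  using Z_pos integral_q_p[of k] by (simp add: G_def integral_\<nu> mult.commute)

lemma G_nonneg: "0 \<le> G k"
  unfolding G_def by (intro Bochner_Integration.integral_nonneg) (simp add: q_power_bounds)

lemma G_0: "G 0 = 1" by (simp add: G_def)

lemma H_nonneg: "0 \<le> H k"
  unfolding H_def by (intro Bochner_Integration.integral_nonneg) (simp add: q_power_bounds)

lemma H_0: "H 0 = 1" by (simp add: H_def)

lemma H_1: "H (Suc 0) = 1 - Z" using integrable_p by (simp add: H_def Z_def)

lemma G_diff: "(\<integral>x. (1 - p x) ^ k * p x \<partial>\<nu>) = G k - G (Suc k)"
proof -
  have "(\<lambda>x. (1 - p x) ^ k * p x) = (\<lambda>x. (1 - p x) ^ k - (1 - p x) ^ Suc k)"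
    by (simp add: algebra_simps)
  moreover have "integrable (measure_pmf \<nu>) (\<lambda>x. (1 - p x) ^ m)" for m
    by (rule int_bounded_real[where B = 1]) (rule q_power_bounds)
  ultimately show ?thesis by (simp add: G_def del: power_Suc)
qed

context
  fixes \<tau> :: real
begin

definition g :: "real \<Rightarrow> complex" where "g x = iexp (\<tau> * x)"
text \<open>The characteristic function at \<tau> of the sum of the first m states when the chain
  starts in x; \<open>u m\<close> is the same for a start from \<nu>.\<close>

definition V :: "nat \<Rightarrow> real \<Rightarrow> complex" where "V m = (FK g ^^ m) (\<lambda>_. 1)"
definition u :: "nat \<Rightarrow> complex" where "u m = (\<integral>x. V m x \<partial>\<nu>)"

lemma norm_g: "norm (g x) = 1" by (simp add: g_def)

lemma norm_V: "norm (V m x) \<le> 1"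
  unfolding V_def by (rule norm_FK_pow_le) (simp add: norm_g)

lemma norm_u: "norm (u m) \<le> 1"
  unfolding u_def by (rule norm_integral_pmf_le) (rule norm_V)

lemma V_unroll:
  "V m x = (\<Sum>k<m. g x ^ Suc k * of_real ((1 - p x) ^ k * p x) * u (m - Suc k))
    + g x ^ m * of_real ((1 - p x) ^ m)"
proof (induction m)
  case (Suc m)
  have "V (Suc m) x = g x * (of_real (1 - p x) * V m x + of_real (p x) * u m)"
    by (simp add: V_def FK_def T_def u_def scaleR_conv_of_real)
  also have "\<dots> = (\<Sum>k<m. g x ^ Suc (Suc k) * of_real ((1 - p x) ^ Suc k * p x) * u (m - Suc k))
    + g x * of_real (p x) * u m + g x ^ Suc m * of_real ((1 - p x) ^ Suc m)"
    unfolding Suc.IH by (simp add: algebra_simps sum_distrib_left)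
  finally show ?case by (subst sum.lessThan_Suc_shift) (simp add: algebra_simps)
qed (simp add: V_def)

text \<open>The sine part integrates to 0 because it is odd. What remains is the probability of the
  holding time minus the loss.\<close>

lemma norm_integral_phase:
  "norm (\<integral>x. g x ^ Suc k * of_real ((1 - p x) ^ k * p x) \<partial>\<nu>) \<le> G k - G (Suc k) - lag_loss \<tau> k"
proof -
  let ?c = "\<lambda>x. (1 - p x) ^ k * p x" and ?\<theta> = "\<lambda>x. real (Suc k) * \<tau> * x"
  have gk: "g x ^ Suc k = iexp (?\<theta> x)" for x
    unfolding g_def by (subst exp_of_nat_mult[symmetric]) (simp add: algebra_simps)
  have b: "\<bar>?c x * cos (?\<theta> x)\<bar> \<le> 1" "\<bar>?c x * sin (?\<theta> x)\<bar> \<le> 1"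
    "\<bar>?c x * \<bar>cos (?\<theta> x)\<bar>\<bar> \<le> 1" "\<bar>?c x\<bar> \<le> 1" for x
    unfolding abs_mult[of "?c x"] using qp_bounds[where x = x and k = k]
    by (auto intro!: mult_le_one simp del: abs_mult)
  have i: "integrable (measure_pmf \<nu>) (\<lambda>x. complex_of_real (?c x * cos (?\<theta> x)))"
    "integrable (measure_pmf \<nu>) (\<lambda>x. \<i> * complex_of_real (?c x * sin (?\<theta> x)))"
    "integrable (measure_pmf \<nu>) (\<lambda>x. ?c x * \<bar>cos (?\<theta> x)\<bar>)"
    "integrable (measure_pmf \<nu>) ?c"
    by (rule integrable_of_real int_bounded_real integrable_mult_right b)+
  have "(\<integral>x. \<i> * complex_of_real (?c x * sin (?\<theta> x)) \<partial>\<nu>) = 0"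
    by (rule integral_odd_\<nu>) (simp add: p_even)
  moreover have "g x ^ Suc k * of_real (?c x)
    = complex_of_real (?c x * cos (?\<theta> x)) + \<i> * complex_of_real (?c x * sin (?\<theta> x))" for x
    unfolding gk exp_Euler cos_of_real sin_of_real by (simp add: algebra_simps)
  ultimately have "(\<integral>x. g x ^ Suc k * of_real (?c x) \<partial>\<nu>) = (\<integral>x. complex_of_real (?c x * cos (?\<theta> x)) \<partial>\<nu>)"
    using i by simp
  then have "norm (\<integral>x. g x ^ Suc k * of_real (?c x) \<partial>\<nu>) \<le> (\<integral>x. norm (complex_of_real (?c x * cos (?\<theta> x))) \<partial>\<nu>)"
    by (simp only: integral_norm_bound)
  also have "\<dots> = (\<integral>x. ?c x * \<bar>cos (?\<theta> x)\<bar> \<partial>\<nu>)"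
    unfolding norm_of_real abs_mult[of "?c x" for x] using qp_bounds[where k = k] by simp
  also have "\<dots> = (\<integral>x. ?c x \<partial>\<nu>) - lag_loss \<tau> k"
    unfolding lag_loss_def using i(3,4) by (simp add: right_diff_distrib)
  finally show ?thesis unfolding G_diff .
qed

lemma lag_loss_nonneg: "0 \<le> lag_loss \<tau> k"
  unfolding lag_loss_def
  by (intro Bochner_Integration.integral_nonneg mult_nonneg_nonneg qp_bounds) auto

abbreviation y where "y m \<equiv> norm (u m)"

lemma y_step: "y m \<le> (\<Sum>k<m. (G k - G (Suc k) - lag_loss \<tau> k) * y (m - Suc k)) + G m"
proof -
  have b: "norm (g x ^ Suc k * of_real ((1 - p x) ^ k * p x)) \<le> 1"
    "norm (g x ^ k * of_real ((1 - p x) ^ k)) \<le> 1" for x k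
    unfolding norm_mult norm_power norm_g norm_of_real
    using qp_bounds[of x k] q_power_bounds[of x k] by auto
  have i: "integrable (measure_pmf \<nu>) (\<lambda>x. g x ^ Suc k * of_real ((1 - p x) ^ k * p x))"
    "integrable (measure_pmf \<nu>) (\<lambda>x. g x ^ k * of_real ((1 - p x) ^ k))" for k
    by (rule integrable_pmf_bounded[OF b(1)], rule integrable_pmf_bounded[OF b(2)])
  have eq: "u m = (\<Sum>k<m. (\<integral>x. g x ^ Suc k * of_real ((1 - p x) ^ k * p x) \<partial>\<nu>) * u (m - Suc k))
     + (\<integral>x. g x ^ m * of_real ((1 - p x) ^ m) \<partial>\<nu>)"
    unfolding u_def[of m] V_unroll using i by (simp del: power_Suc of_real_mult of_real_power)
  have "y m \<le> (\<Sum>k<m. norm (\<integral>x. g x ^ Suc k * of_real ((1 - p x) ^ k * p x) \<partial>\<nu>) * y (m - Suc k))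
     + norm (\<integral>x. g x ^ m * complex_of_real ((1 - p x) ^ m) \<partial>\<nu>)"
    unfolding eq
    by (rule order_trans[OF norm_triangle_ineq add_mono[OF order_trans[OF norm_sum] order_refl]])
       (simp only: norm_mult order_refl)
  also have "\<dots> \<le> (\<Sum>k<m. (G k - G (Suc k) - lag_loss \<tau> k) * y (m - Suc k)) + G m"
  proof (rule add_mono)
    show "(\<Sum>k<m. norm (\<integral>x. g x ^ Suc k * of_real ((1 - p x) ^ k * p x) \<partial>\<nu>) * y (m - Suc k))
      \<le> (\<Sum>k<m. (G k - G (Suc k) - lag_loss \<tau> k) * y (m - Suc k))"
      by (intro sum_mono mult_right_mono norm_integral_phase) simp
    have "norm (\<integral>x. g x ^ m * complex_of_real ((1 - p x) ^ m) \<partial>\<nu>)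
      \<le> (\<integral>x. norm (g x ^ m * complex_of_real ((1 - p x) ^ m)) \<partial>\<nu>)"
      by (rule integral_norm_bound)
    also have "\<dots> = G m"
      unfolding norm_mult norm_power norm_g norm_of_real
      using q_power_bounds by (simp add: G_def)
    finally show "norm (\<integral>x. g x ^ m * complex_of_real ((1 - p x) ^ m) \<partial>\<nu>) \<le> G m" .
  qed
  finally show ?thesis .
qed

text \<open>Up to the factor \<open>Z\<close>, the potential \<open>F m\<close> bounds the characteristic function of the sum of
  \<open>m + 1\<close> terms; it is nonincreasing, and its decrements control the sum of the \<open>y m\<close>.\<close>

definition F :: "nat \<Rightarrow> real" where
  "F m = (\<Sum>k\<le>m. G k * y (m - k)) + H (Suc m) / Z"

lemma F_0: "F 0 = 1 / Z"
  using Z_pos by (simp add: F_def G_0 H_1 u_def V_def field_simps)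

lemma F_nonneg: "0 \<le> F m"
  unfolding F_def using Z_pos
  by (intro add_nonneg_nonneg sum_nonneg mult_nonneg_nonneg divide_nonneg_pos G_nonneg H_nonneg) auto

text \<open>The summand k = 0 is \<open>y (Suc m)\<close>, to which the renewal inequality
  \<open>y_step\<close> applies. The differences of \<open>G\<close> then shift the convolution back
  by one, and the leftover \<open>G (Suc m)\<close> is exactly what the last term of
  \<open>F\<close> loses.\<close>

lemma F_Suc_le: "F (Suc m) \<le> F m - (\<Sum>k\<le>m. lag_loss \<tau> k * y (m - k))"
proof -
  have HG: "H (Suc (Suc m)) / Z = H (Suc m) / Z - G (Suc m)"
    using Z_G[of "Suc m"] Z_pos by (simp add: field_simps)
  have "F (Suc m) = y (Suc m) + (\<Sum>k\<le>m. G (Suc k) * y (m - k)) + H (Suc m) / Z - G (Suc m)"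
    unfolding F_def HG by (subst sum.atMost_Suc_shift) (simp add: G_0)
  also have "\<dots> \<le> ((\<Sum>k<Suc m. (G k - G (Suc k) - lag_loss \<tau> k) * y (Suc m - Suc k)) + G (Suc m))
    + (\<Sum>k\<le>m. G (Suc k) * y (m - k)) + H (Suc m) / Z - G (Suc m)"
    using y_step[of "Suc m"] by simp
  also have "\<dots> = F m - (\<Sum>k\<le>m. lag_loss \<tau> k * y (m - k))"
    unfolding F_def lessThan_Suc_atMost
    by (simp add: left_diff_distrib sum_subtractf)
  finally show ?thesis .
qed

lemma F_antimono: "m \<le> n \<Longrightarrow> F n \<le> F m"
proof (induction rule: dec_induct)
  case (step n)
  have "0 \<le> (\<Sum>k\<le>n. lag_loss \<tau> k * y (n - k))"
    by (intro sum_nonneg mult_nonneg_nonneg lag_loss_nonneg) auto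
  then show ?case using F_Suc_le[of n] step by linarith
qed simp

lemma sum_F_decrement: "(\<Sum>m<n. \<Sum>k\<le>m. lag_loss \<tau> k * y (m - k)) \<le> 1 / Z"
proof -
  have "F n + (\<Sum>m<n. \<Sum>k\<le>m. lag_loss \<tau> k * y (m - k)) \<le> F 0"
  proof (induction n)
    case (Suc n)
    then show ?case using F_Suc_le[of n] by simp
  qed simp
  then show ?thesis using F_nonneg[of n] by (simp add: F_0)
qed

lemma sum_convolution:
  fixes a b :: "nat \<Rightarrow> real"
  shows "(\<Sum>m<n. \<Sum>k\<le>m. a k * b (m - k)) = (\<Sum>k<n. a k * (\<Sum>i<n - k. b i))"
proof -
  have "(\<Sum>m<n. \<Sum>k\<le>m. a k * b (m - k)) = (\<Sum>(k, i)\<in>{(k, i). k + i < n}. a k * b i)"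
    by (rule sum.triangle_reindex[symmetric])
  also have "{(k, i). k + i < n} = Sigma {..<n} (\<lambda>k. {..<n - k})" by auto
  also have "(\<Sum>(k, i)\<in>Sigma {..<n} (\<lambda>k. {..<n - k}). a k * b i) = (\<Sum>k<n. \<Sum>i<n - k. a k * b i)"
    by (rule sum.Sigma[symmetric]) auto
  finally show ?thesis by (simp add: sum_distrib_left)
qed

text \<open>All decrements of \<open>F\<close> add up to at most its initial value 1/Z, and they
  form the convolution of \<open>lag_loss\<close> with \<open>y\<close>. Lags below L therefore
  control the sum of \<open>y\<close> up to its last L terms, which are at most 1 each. The bound
  does not depend on n.\<close>

lemma sum_y_le:
  assumes D: "0 < (\<Sum>k<L. lag_loss \<tau> k)"
  shows "(\<Sum>i<n. y i) \<le> 1 / (Z * (\<Sum>k<L. lag_loss \<tau> k)) + real L"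
proof (cases "L \<le> n")
  case True
  let ?D = "\<Sum>k<L. lag_loss \<tau> k"
  have "?D * (\<Sum>i<n - L. y i) = (\<Sum>k<L. lag_loss \<tau> k * (\<Sum>i<n - L. y i))"
    by (simp add: sum_distrib_right)
  also have "\<dots> \<le> (\<Sum>k<L. lag_loss \<tau> k * (\<Sum>i<n - k. y i))"
    by (intro sum_mono mult_left_mono sum_mono2 lag_loss_nonneg) auto
  also have "\<dots> \<le> (\<Sum>k<n. lag_loss \<tau> k * (\<Sum>i<n - k. y i))"
    using True by (intro sum_mono2 mult_nonneg_nonneg sum_nonneg lag_loss_nonneg) auto
  also have "\<dots> \<le> 1 / Z"
    using sum_F_decrement[of n] unfolding sum_convolution[of "lag_loss \<tau>" "\<lambda>i. y i"] .
  finally have 1: "(\<Sum>i<n - L. y i) \<le> 1 / (Z * ?D)"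
    using D Z_pos by (simp add: field_simps)
  have "{..<n} = {..<n - L} \<union> {n - L..<n}" by auto
  then have "(\<Sum>i<n. y i) = (\<Sum>i<n - L. y i) + (\<Sum>i\<in>{n - L..<n}. y i)"
    by (simp add: sum.union_disjoint ivl_disj_int)
  also have "(\<Sum>i\<in>{n - L..<n}. y i) \<le> (\<Sum>i\<in>{n - L..<n}. 1)"
    by (intro sum_mono norm_u)
  finally show ?thesis using 1 True by simp
next
  case False
  have "(\<Sum>i<n. y i) \<le> (\<Sum>i<n. 1)" by (intro sum_mono norm_u)
  then have "(\<Sum>i<n. y i) \<le> real L" using False by simp
  moreover have "0 \<le> 1 / (Z * (\<Sum>k<L. lag_loss \<tau> k))" using D Z_pos by simp
  ultimately show ?thesis by linarith
qed

text \<open>A bound on a sum of moduli says nothing about a single one, but \<open>F\<close> is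
  nonincreasing, so its last value is at most its average.\<close>

lemma norm_integral_V_le:
  assumes D: "0 < (\<Sum>k<L. lag_loss \<tau> k)" and n: "0 < n"
  shows "norm (\<integral>x. V n x \<partial>\<pi>)
    \<le> (1 / (Z * (\<Sum>k<L. lag_loss \<tau> k)) + real L + (\<Sum>m<n. H (Suc m))) / real n"
proof -
  let ?Y = "\<Sum>i<n. y i"
  obtain m where m: "n = Suc m" using n by (cases n) auto
  have i: "integrable (measure_pmf \<pi>) (\<lambda>x. (1 - p x) ^ k * p x)" for k
    by (rule int_bounded_real[where B = 1]) (simp only: abs_of_nonneg qp_bounds)
  have "norm (\<integral>x. V n x \<partial>\<pi>) \<le> (\<integral>x. norm (V n x) \<partial>\<pi>)"
    by (rule integral_norm_bound)
  also have "\<dots> \<le> (\<integral>x. (\<Sum>k<n. (1 - p x) ^ k * p x * y (n - Suc k)) + (1 - p x) ^ n \<partial>\<pi>)"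
  proof (rule integral_mono)
    show "integrable (measure_pmf \<pi>) (\<lambda>x. norm (V n x))"
      by (rule int_bounded_real[where B = 1]) (simp add: norm_V)
    show "norm (V n x) \<le> (\<Sum>k<n. (1 - p x) ^ k * p x * y (n - Suc k)) + (1 - p x) ^ n" for x
    proof -
      have e1: "norm (g x ^ Suc k * of_real ((1 - p x) ^ k * p x) * u (n - Suc k)) = (1 - p x) ^ k * p x * y (n - Suc k)" for k
        unfolding norm_mult norm_power norm_g norm_of_real using qp_bounds[of x k] by simp
      have e2: "norm (g x ^ n * of_real ((1 - p x) ^ n)) = (1 - p x) ^ n"
        unfolding norm_mult norm_power norm_g norm_of_real using q_power_bounds[of x n] by simp
      show ?thesis
        unfolding V_unroll[of n x]
      proof (rule order_trans[OF norm_triangle_ineq add_mono])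
        show "norm (\<Sum>k<n. g x ^ Suc k * of_real ((1 - p x) ^ k * p x) * u (n - Suc k))
          \<le> (\<Sum>k<n. (1 - p x) ^ k * p x * y (n - Suc k))"
          by (rule order_trans[OF norm_sum]) (simp only: e1 order_refl)
      qed (simp only: e2 order_refl)
    qed
  qed (use i H_integrable in auto)
  also have "\<dots> = (\<Sum>k<n. (H k - H (Suc k)) * y (n - Suc k)) + H n"
    using i H_integrable[of n] by (simp add: integral_q_p H_def[of n])
  also have "\<dots> = Z * F m"
    unfolding F_def m lessThan_Suc_atMost using Z_pos
    by (simp add: distrib_left sum_distrib_left Z_G mult.assoc[symmetric])
  finally have 1: "norm (\<integral>x. V n x \<partial>\<pi>) \<le> Z * F m" .
  \<comment> \<open>Here monotonicity replaces the last value of \<open>F\<close> by a Cesaro mean,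
    and the sum over \<open>y\<close> becomes available.\<close>
  have "real n * F m = (\<Sum>j<n. F m)" by simp
  also have "\<dots> \<le> (\<Sum>j<n. F j)"
    by (intro sum_mono F_antimono) (use m in auto)
  also have "\<dots> = (\<Sum>j<n. \<Sum>k\<le>j. G k * y (j - k)) + (\<Sum>j<n. H (Suc j)) / Z"
    by (simp add: F_def sum.distrib sum_divide_distrib)
  also have "(\<Sum>j<n. \<Sum>k\<le>j. G k * y (j - k)) = (\<Sum>k<n. G k * (\<Sum>i<n - k. y i))"
    by (rule sum_convolution[of G "\<lambda>i. y i"])
  also have "\<dots> \<le> (\<Sum>k<n. G k * ?Y)"
    by (intro sum_mono mult_left_mono sum_mono2 G_nonneg) auto
  also have "\<dots> = (\<Sum>k<n. G k) * ?Y" by (simp add: sum_distrib_right)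
  also have "\<dots> \<le> 1 / Z * ?Y"
  proof (rule mult_right_mono)
    have "Z * (\<Sum>k<n. G k) = H 0 - H n"
      unfolding sum_distrib_left Z_G by (rule sum_lessThan_telescope')
    then have "Z * (\<Sum>k<n. G k) \<le> 1" using H_nonneg[of n] by (simp add: H_0)
    then show "(\<Sum>k<n. G k) \<le> 1 / Z" using Z_pos by (simp add: field_simps)
  qed (auto intro: sum_nonneg)
  finally have "real n * F m \<le> (?Y + (\<Sum>j<n. H (Suc j))) / Z"
    by (simp add: add_divide_distrib)
  then have "Z * F m \<le> (?Y + (\<Sum>j<n. H (Suc j))) / real n"
    using Z_pos n by (simp add: field_simps)
  also have "\<dots> \<le> (1 / (Z * (\<Sum>k<L. lag_loss \<tau> k)) + real L + (\<Sum>m<n. H (Suc m))) / real n"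
    using sum_y_le[OF D] by (intro divide_right_mono add_right_mono) auto
  finally show ?thesis using 1 by linarith
qed

end

text \<open>The rates need not be bounded away from 0. In each fixed state the mean is at most
  \<open>(1 / p x) / n\<close>, and dominated convergence does the rest.\<close>

lemma average_H_tendsto_0: "(\<lambda>n. (\<Sum>m<n. H (Suc m)) / real n) \<longlonglongrightarrow> 0"
proof -
  let ?s = "\<lambda>n x. (\<Sum>m<n. (1 - p x) ^ Suc m) / real n"
  have b: "\<bar>?s n x\<bar> \<le> 1" for n x
  proof -
    have "0 \<le> (\<Sum>m<n. (1 - p x) ^ Suc m)" by (intro sum_nonneg q_power_bounds)
    moreover have "(\<Sum>m<n. (1 - p x) ^ Suc m) \<le> (\<Sum>m<n. 1)" by (intro sum_mono q_power_bounds)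
    ultimately show ?thesis by (cases "n = 0") (auto simp: divide_le_eq_1)
  qed
  have "(\<lambda>n. \<integral>x. ?s n x \<partial>\<pi>) \<longlonglongrightarrow> (\<integral>x. 0 \<partial>\<pi>)"
  proof (rule integral_dominated_convergence[where w = "\<lambda>_. 1"])
    show "AE x in measure_pmf \<pi>. (\<lambda>n. ?s n x) \<longlonglongrightarrow> 0"
    proof (rule AE_I2)
      fix x
      show "(\<lambda>n. ?s n x) \<longlonglongrightarrow> 0"
      proof (rule tendsto_sandwich[of "\<lambda>_. 0" _ _ "\<lambda>n. (1 / p x) / real n"])
        show "\<forall>\<^sub>F n in sequentially. 0 \<le> ?s n x"
          by (intro always_eventually allI divide_nonneg_nonneg sum_nonneg q_power_bounds) auto
        have "?s n x \<le> (1 / p x) / real n" for n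
        proof (intro divide_right_mono)
          have "(\<Sum>m<n. (1 - p x) ^ Suc m) \<le> (\<Sum>m<n. (1 - p x) ^ m)"
            using p_bounds[of x] by (intro sum_mono power_decreasing) auto
          then show "(\<Sum>m<n. (1 - p x) ^ Suc m) \<le> 1 / p x"
            using geometric_sum_le[of "p x" n] p_pos[of x] p_bounds[of x] by linarith
        qed auto
        then show "\<forall>\<^sub>F n in sequentially. ?s n x \<le> (1 / p x) / real n" by simp
        show "(\<lambda>n. (1 / p x) / real n) \<longlonglongrightarrow> 0" by (rule lim_const_over_n)
      qed simp
    qed
    show "AE x in measure_pmf \<pi>. norm (?s n x) \<le> 1" for n using b by simp
  qed auto
  moreover have eq: "(\<integral>x. ?s n x \<partial>\<pi>) = (\<Sum>m<n. H (Suc m)) / real n" for n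
    using H_integrable by (simp add: H_def del: power_Suc)
  ultimately show ?thesis unfolding eq by simp
qed

text \<open>Second moment of what one holding period adds to the sum, restricted to states of
  modulus at most a and to holding times of at most L. If these are unbounded, a full period
  contributes infinite variance.\<close>

definition block_variance :: "nat \<Rightarrow> real \<Rightarrow> real" where
  "block_variance L a = (\<Sum>k<L. \<integral>x. (1 - p x) ^ k * p x * ((real (Suc k) * x)\<^sup>2 * indicator {-a..a} x) \<partial>\<nu>)"

text \<open>The first hypothesis keeps all phases that occur within [-1, 1], where the quadratic
  bound on the cosine holds.\<close>

lemma sum_lag_loss_ge:
  assumes "a * real L * \<bar>\<tau>\<bar> \<le> 1" "0 \<le> a"
  shows "\<tau>\<^sup>2 / 8 * block_variance L a \<le> (\<Sum>k<L. lag_loss \<tau> k)"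
proof -
  have "\<tau>\<^sup>2 / 8 * (\<integral>x. (1 - p x) ^ k * p x * ((real (Suc k) * x)\<^sup>2 * indicator {-a..a} x) \<partial>\<nu>) \<le> lag_loss \<tau> k"
    if k: "k < L" for k
  proof -
    have b: "\<bar>(1 - p x) ^ k * p x * ((real (Suc k) * x)\<^sup>2 * indicator {-a..a} x)\<bar> \<le> (real (Suc k) * a)\<^sup>2" for x
    proof -
      have "(real (Suc k) * x)\<^sup>2 * indicator {-a..a} x \<le> (real (Suc k) * a)\<^sup>2"
        by (auto simp: indicator_def power_mult_distrib intro!: mult_left_mono simp flip: abs_le_square_iff)
      then have "(1 - p x) ^ k * p x * ((real (Suc k) * x)\<^sup>2 * indicator {-a..a} x) \<le> 1 * (real (Suc k) * a)\<^sup>2"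
        by (intro mult_mono qp_bounds) auto
      moreover have "0 \<le> (1 - p x) ^ k * p x * ((real (Suc k) * x)\<^sup>2 * indicator {-a..a} x)"
        by (intro mult_nonneg_nonneg[OF qp_bounds(1)]) simp
      ultimately show ?thesis by (simp only: abs_of_nonneg mult_1)
    qed
    have "\<tau>\<^sup>2 / 8 * (\<integral>x. (1 - p x) ^ k * p x * ((real (Suc k) * x)\<^sup>2 * indicator {-a..a} x) \<partial>\<nu>)
      = (\<integral>x. (1 - p x) ^ k * p x * ((real (Suc k) * \<tau> * x)\<^sup>2 / 8 * indicator {-a..a} x) \<partial>\<nu>)"
      by (subst integral_mult_right_zero[symmetric]) (simp add: power_mult_distrib mult_ac)
    also have "\<dots> \<le> lag_loss \<tau> k"
      unfolding lag_loss_def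
    proof (rule integral_mono)
      have "(\<lambda>x. (1 - p x) ^ k * p x * ((real (Suc k) * \<tau> * x)\<^sup>2 / 8 * indicator {-a..a} x))
        = (\<lambda>x. \<tau>\<^sup>2 / 8 * ((1 - p x) ^ k * p x * ((real (Suc k) * x)\<^sup>2 * indicator {-a..a} x)))"
        by (simp add: fun_eq_iff power_mult_distrib mult_ac)
      then show "integrable (measure_pmf \<nu>) (\<lambda>x. (1 - p x) ^ k * p x * ((real (Suc k) * \<tau> * x)\<^sup>2 / 8 * indicator {-a..a} x))"
        using int_bounded_real[OF b] by simp
      show "integrable (measure_pmf \<nu>) (\<lambda>x. (1 - p x) ^ k * p x * (1 - \<bar>cos (real (Suc k) * \<tau> * x)\<bar>))"
      proof (rule int_bounded_real[where B = 1])
        fix x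
        have "0 \<le> 1 - \<bar>cos (real (Suc k) * \<tau> * x)\<bar>" "1 - \<bar>cos (real (Suc k) * \<tau> * x)\<bar> \<le> 1" by auto
        then show "\<bar>(1 - p x) ^ k * p x * (1 - \<bar>cos (real (Suc k) * \<tau> * x)\<bar>)\<bar> \<le> 1"
          unfolding abs_mult[of "(1 - p x) ^ k * p x"] using qp_bounds[of x k] by (intro mult_le_one) auto
      qed
      fix x
      have "(real (Suc k) * \<tau> * x)\<^sup>2 / 8 * indicator {-a..a} x \<le> 1 - \<bar>cos (real (Suc k) * \<tau> * x)\<bar>"
      proof (cases "x \<in> {-a..a}")
        case True
        have "\<bar>real (Suc k) * \<tau> * x\<bar> = real (Suc k) * \<bar>\<tau>\<bar> * \<bar>x\<bar>" by (simp add: abs_mult)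
        also have "\<dots> \<le> real L * \<bar>\<tau>\<bar> * a"
          using k True by (intro mult_mono) auto
        also have "\<dots> \<le> 1" using assms by (simp add: mult_ac)
        finally show ?thesis using one_minus_abs_cos_ge True by simp
      qed simp
      then show "(1 - p x) ^ k * p x * ((real (Suc k) * \<tau> * x)\<^sup>2 / 8 * indicator {-a..a} x)
        \<le> (1 - p x) ^ k * p x * (1 - \<bar>cos (real (Suc k) * \<tau> * x)\<bar>)"
        by (intro mult_left_mono qp_bounds)
    qed
    finally show ?thesis .
  qed
  then show ?thesis
    unfolding block_variance_def sum_distrib_left by (intro sum_mono) auto
qed

text \<open>With \<tau> of order 1 / sqrt n the loss is of order \<open>block_variance / n\<close>.
  Since the block variance can be made as large as desired, the sum of the \<open>y\<close> is small
  compared with n.\<close>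

lemma char_fun_tendsto_0:
  assumes unb: "\<And>C. \<exists>L a. 0 \<le> a \<and> C \<le> block_variance L a" and t: "t \<noteq> 0"
  shows "(\<lambda>n. \<integral>x. V (t / sqrt (real n)) n x \<partial>\<pi>) \<longlonglongrightarrow> 0"
proof (rule tendstoI)
  fix \<epsilon> :: real assume \<epsilon>: "0 < \<epsilon>"
  \<comment> \<open>With \<tau> = t / sqrt n the value 32 makes the total loss at least
    \<open>4 / (Z * \<epsilon> * n)\<close>, and so the first term of the bound at most \<epsilon> /
    4.\<close>
  obtain L a where a: "0 \<le> a" and La: "32 / (Z * t\<^sup>2 * \<epsilon>) \<le> block_variance L a"
    using unb by blast
  have pos: "0 < 32 / (Z * t\<^sup>2 * \<epsilon>)" using Z_pos t \<epsilon> by simp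
  have "(\<lambda>n. real L / real n + (\<Sum>m<n. H (Suc m)) / real n) \<longlonglongrightarrow> 0 + 0"
    by (intro tendsto_add lim_const_over_n average_H_tendsto_0)
  then have "\<forall>\<^sub>F n in sequentially. real L / real n + (\<Sum>m<n. H (Suc m)) / real n < \<epsilon> / 2"
    using \<epsilon> by (intro order_tendstoD(2)[where a = "\<epsilon> / 2"]) auto
  moreover have "\<forall>\<^sub>F n in sequentially. (a * real L * \<bar>t\<bar>)\<^sup>2 \<le> real n"
    by (rule eventually_sequentiallyI[of "nat \<lceil>(a * real L * \<bar>t\<bar>)\<^sup>2\<rceil>"]) linarith
  ultimately show "\<forall>\<^sub>F n in sequentially. dist (\<integral>x. V (t / sqrt (real n)) n x \<partial>\<pi>) 0 < \<epsilon>"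
    using eventually_gt_at_top[of 0]
  proof eventually_elim
    case (elim n)
    let ?\<tau> = "t / sqrt (real n)"
    let ?D = "\<Sum>k<L. lag_loss ?\<tau> k"
    have "a * real L * \<bar>t\<bar> \<le> sqrt (real n)"
      using elim(2) by (rule real_le_rsqrt)
    then have "a * real L * \<bar>?\<tau>\<bar> \<le> 1" using elim(3) by (simp add: field_simps)
    from sum_lag_loss_ge[OF this a] have D: "?\<tau>\<^sup>2 / 8 * block_variance L a \<le> ?D" .
    have "4 / (Z * \<epsilon> * real n) = ?\<tau>\<^sup>2 / 8 * (32 / (Z * t\<^sup>2 * \<epsilon>))"
      using t elim(3) Z_pos \<epsilon> by (simp add: power_divide field_simps)
    also have "\<dots> \<le> ?\<tau>\<^sup>2 / 8 * block_variance L a"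
      by (intro mult_left_mono La) auto
    finally have D': "4 / (Z * \<epsilon> * real n) \<le> ?D" using D by linarith
    have p: "0 < 4 / (Z * \<epsilon> * real n)" using Z_pos \<epsilon> elim(3) by simp
    then have D0: "0 < ?D" using D' by (rule less_le_trans)
    have "1 / (Z * ?D) \<le> 1 / (Z * (4 / (Z * \<epsilon> * real n)))"
      using D' p D0 Z_pos by (intro divide_left_mono mult_left_mono mult_pos_pos) auto
    also have "\<dots> = \<epsilon> * real n / 4" using Z_pos \<epsilon> elim(3) by (simp add: field_simps)
    finally have "1 / (Z * ?D) / real n \<le> \<epsilon> * real n / 4 / real n"
      by (rule divide_right_mono) simp
    then have D2: "1 / (Z * ?D) / real n \<le> \<epsilon> / 4" using elim(3) by simp
    have "norm (\<integral>x. V ?\<tau> n x \<partial>\<pi>) \<le> (1 / (Z * ?D) + real L + (\<Sum>m<n. H (Suc m))) / real n"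
      by (rule norm_integral_V_le[OF D0 elim(3)])
    also have "\<dots> = 1 / (Z * ?D) / real n + (real L / real n + (\<Sum>m<n. H (Suc m)) / real n)"
      by (simp add: add_divide_distrib)
    also have "\<dots> < \<epsilon>" using D2 elim(1) \<epsilon> by linarith
    finally show ?case by simp
  qed
qed

end

text \<open>The indicator of the interval is at most \<open>exp (1/2)\<close> times a Gaussian bump,
  and the bump is the characteristic function of a normal variable. After exchanging integrals the
  centre r appears only in a phase, so the bound is uniform in r.\<close>

lemma (in prob_space) prob_interval_le_char:
  assumes Y [measurable]: "Y \<in> borel_measurable M" and c: "0 < c"
  shows "prob {\<omega>\<in>space M. r - c < Y \<omega> \<and> Y \<omega> < r + c}
    \<le> exp (1/2) * (\<integral>z. norm (\<integral>\<omega>. iexp (z / c * Y \<omega>) \<partial>M) \<partial>std_normal_distribution)"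
proof -
  interpret N: real_distribution std_normal_distribution by (rule real_dist_normal_dist)
  interpret P: pair_prob_space std_normal_distribution M ..
  let ?f = "\<lambda>z \<omega>. iexp (z * ((Y \<omega> - r) / c))"
  have int: "integrable (std_normal_distribution \<Otimes>\<^sub>M M) (\<lambda>(z, \<omega>). ?f z \<omega>)"
    by (rule P.P.integrable_const_bound[where B = 1]) auto
  let ?e = "\<lambda>\<omega>. exp (- (((Y \<omega> - r) / c)\<^sup>2) / 2)"
  have gauss: "(\<integral>z. ?f z \<omega> \<partial>std_normal_distribution) = complex_of_real (?e \<omega>)" for \<omega>
    using fun_cong[OF char_std_normal_distribution, of "(Y \<omega> - r) / c"]
    by (simp add: char_def mult.commute)
  have e1: "?e \<omega> \<le> 1" for \<omega> by simp
  have ie: "integrable M ?e"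
    by (rule integrable_const_bound[where B = 1]) auto
  have "prob {\<omega>\<in>space M. r - c < Y \<omega> \<and> Y \<omega> < r + c}
      = (\<integral>\<omega>. indicator {\<omega>\<in>space M. r - c < Y \<omega> \<and> Y \<omega> < r + c} \<omega> \<partial>M)"
    by simp
  also have "\<dots> \<le> (\<integral>\<omega>. exp (1/2) * ?e \<omega> \<partial>M)"
  proof (rule integral_mono)
    show "indicator {\<omega>\<in>space M. r - c < Y \<omega> \<and> Y \<omega> < r + c} \<omega> \<le> exp (1/2) * ?e \<omega>" for \<omega>
    proof (cases "r - c < Y \<omega> \<and> Y \<omega> < r + c")
      case True
      then have "\<bar>(Y \<omega> - r) / c\<bar> \<le> 1" using c by (simp add: abs_le_iff field_simps)
      then have "((Y \<omega> - r) / c)\<^sup>2 \<le> 1" by (simp only: abs_square_le_1)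
      then have "1 \<le> exp (1/2 + - (((Y \<omega> - r) / c)\<^sup>2) / 2)" by simp
      then have "1 \<le> exp (1/2) * ?e \<omega>" by (simp only: exp_add)
      then show ?thesis by (simp add: indicator_def)
    qed (auto simp: indicator_def)
  qed (use ie in \<open>auto intro!: integrable_real_indicator simp: emeasure_eq_measure\<close>)
  also have "\<dots> = exp (1/2) * (\<integral>\<omega>. ?e \<omega> \<partial>M)" by simp
  also have "(\<integral>\<omega>. ?e \<omega> \<partial>M) = norm (complex_of_real (\<integral>\<omega>. ?e \<omega> \<partial>M))"
    by (simp add: Bochner_Integration.integral_nonneg)
  also have "complex_of_real (\<integral>\<omega>. ?e \<omega> \<partial>M) = (\<integral>\<omega>. (\<integral>z. ?f z \<omega> \<partial>std_normal_distribution) \<partial>M)"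
    unfolding gauss by simp
  also have "\<dots> = (\<integral>z. (\<integral>\<omega>. ?f z \<omega> \<partial>M) \<partial>std_normal_distribution)"
    by (rule P.Fubini_integral[OF int])
  also have "norm \<dots> \<le> (\<integral>z. norm (\<integral>\<omega>. ?f z \<omega> \<partial>M) \<partial>std_normal_distribution)"
    by (rule integral_norm_bound)
  also have "\<dots> = (\<integral>z. norm (\<integral>\<omega>. iexp (z / c * Y \<omega>) \<partial>M) \<partial>std_normal_distribution)"
  proof (rule Bochner_Integration.integral_cong[OF refl])
    fix z
    have "?f z \<omega> = iexp (- (z * r / c)) * iexp (z / c * Y \<omega>)" for \<omega>
      by (simp add: exp_add[symmetric] diff_divide_distrib right_diff_distrib algebra_simps)
    then show "norm (\<integral>\<omega>. ?f z \<omega> \<partial>M) = norm (\<integral>\<omega>. iexp (z / c * Y \<omega>) \<partial>M)"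
      by (simp add: norm_mult)
  qed
  finally show ?thesis by simp
qed

lemma (in refresh_process) concentration_tendsto_0:
  assumes unb: "\<And>C. \<exists>L a. 0 \<le> a \<and> C \<le> block_variance L a" and c: "0 < c"
  shows "(\<lambda>n. SUP r::real. prob {\<omega>\<in>space M.
        r - c < partial_sum X n \<omega> / sqrt (real n) \<and> partial_sum X n \<omega> / sqrt (real n) < r + c}) \<longlonglongrightarrow> 0"
proof -
  interpret N: real_distribution std_normal_distribution by (rule real_dist_normal_dist)
  have [measurable]: "partial_sum X n \<in> borel_measurable M" for n
    unfolding partial_sum_def[abs_def] by measurable
  let ?\<phi> = "\<lambda>n z. \<integral>\<omega>. iexp (z / c * (partial_sum X n \<omega> / sqrt (real n))) \<partial>M"
  have \<phi>: "?\<phi> n z = (\<integral>x. V (z / c / sqrt (real n)) n x \<partial>\<pi>)" for n z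
  proof -
    have "z / c * (partial_sum X n \<omega> / sqrt (real n)) = (\<Sum>k=1..int n. z / c / sqrt (real n) * X k \<omega>)" for \<omega>
      unfolding partial_sum_def sum_distrib_left[symmetric] by simp
    then show ?thesis
      using char_sum[of "\<lambda>x. z / c / sqrt (real n) * x" n]
      by (simp only: V_def g_def[abs_def])
  qed
  have "(\<lambda>n. \<integral>z. norm (?\<phi> n z) \<partial>std_normal_distribution) \<longlonglongrightarrow> (\<integral>z. 0 \<partial>std_normal_distribution)"
  proof (rule integral_dominated_convergence[where w = "\<lambda>_. 1"])
    \<comment> \<open>The point 0 must be left out: there the characteristic function equals 1 for
      every n.\<close>
    have "AE z in std_normal_distribution. z \<noteq> (0::real)"
      by (subst AE_density) (auto intro: AE_mp[OF AE_lborel_singleton])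
    then show "AE z in std_normal_distribution. (\<lambda>n. norm (?\<phi> n z)) \<longlonglongrightarrow> 0"
    proof eventually_elim
      case (elim z)
      then show ?case unfolding \<phi> using char_fun_tendsto_0[OF unb, of "z / c"] c
        by (simp add: tendsto_norm_zero)
    qed
    have "norm (?\<phi> n z) \<le> 1" for n z
      unfolding \<phi> by (rule norm_integral_pmf_le) (rule norm_V)
    then show "AE z in std_normal_distribution. norm (norm (?\<phi> n z)) \<le> 1" for n
      by simp
  qed auto
  then have lim: "(\<lambda>n. exp (1/2) * (\<integral>z. norm (?\<phi> n z) \<partial>std_normal_distribution)) \<longlonglongrightarrow> 0"
    using tendsto_mult_right_zero by fastforce
  let ?Q = "\<lambda>n r. prob {\<omega>\<in>space M.
        r - c < partial_sum X n \<omega> / sqrt (real n) \<and> partial_sum X n \<omega> / sqrt (real n) < r + c}"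
  have Q: "?Q n r \<le> exp (1/2) * (\<integral>z. norm (?\<phi> n z) \<partial>std_normal_distribution)" for n r
    by (rule prob_interval_le_char[OF _ c]) measurable
  show ?thesis
  proof (rule tendsto_sandwich[OF _ _ tendsto_const lim])
    show "\<forall>\<^sub>F n in sequentially. (SUP r. ?Q n r) \<le> exp (1/2) * (\<integral>z. norm (?\<phi> n z) \<partial>std_normal_distribution)"
      by (intro always_eventually allI cSUP_least Q) auto
    have "0 \<le> (SUP r. ?Q n r)" for n
      by (rule cSUP_upper2[where x = 0]) (auto intro!: bdd_aboveI2[where M = 1])
    then show "\<forall>\<^sub>F n in sequentially. 0 \<le> (SUP r. ?Q n r)" by simp
  qed
qed

section \<open>Excursions into a single level\<close>

context refresh_chain
begin

lemma norm_T_le_T_norm: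
  fixes f :: "real \<Rightarrow> complex"
  shows "norm (T f x) \<le> T (\<lambda>x. norm (f x)) x"
proof -
  have "norm (T f x) \<le> (1 - p x) * norm (f x) + p x * norm (\<integral>y. f y \<partial>\<nu>)"
    unfolding T_def using p_bounds[of x] by (intro norm_triangle_le) simp
  also have "\<dots> \<le> (1 - p x) * norm (f x) + p x * (\<integral>y. norm (f y) \<partial>\<nu>)"
    using p_bounds[of x] by (intro add_mono mult_left_mono integral_norm_bound) auto
  finally show ?thesis by (simp add: T_def)
qed

text \<open>Pointwise the modulus is dominated by \<open>T\<close> applied to the modulus of f, and
  \<pi> is invariant.\<close>

lemma FK_contraction:
  fixes g :: "real \<Rightarrow> complex"
  assumes g: "\<And>x. norm (g x) \<le> 1" and f: "\<And>x. norm (f x) \<le> B"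
  shows "(\<integral>x. norm (FK g f x) \<partial>\<pi>) \<le> (\<integral>x. norm (f x) \<partial>\<pi>)"
proof -
  have "(\<integral>x. norm (FK g f x) \<partial>\<pi>) \<le> (\<integral>x. T (\<lambda>x. norm (f x)) x \<partial>\<pi>)"
  proof (rule integral_mono)
    show "integrable (measure_pmf \<pi>) (\<lambda>x. norm (FK g f x))"
      by (rule int_bounded_real[where B = B]) (simp add: norm_FK_le[OF g f])
    show "integrable (measure_pmf \<pi>) (T (\<lambda>x. norm (f x)))"
      by (rule integrable_pmf_bounded[where B = B]) (rule norm_T_le, simp add: f)
    fix x
    have "norm (FK g f x) \<le> 1 * norm (T f x)"
      unfolding FK_def norm_mult by (intro mult_right_mono g) auto
    then show "norm (FK g f x) \<le> T (\<lambda>x. norm (f x)) x"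
      using norm_T_le_T_norm[of f x] by linarith
  qed
  also have "\<dots> = (\<integral>x. norm (f x) \<partial>\<pi>)"
    by (rule integral_T[where B = B]) (simp add: f)
  finally show ?thesis .
qed

lemma FK_diff_scale:
  fixes f h g :: "real \<Rightarrow> complex"
  assumes "\<And>x. norm (f x) \<le> B" "\<And>x. norm (h x) \<le> C"
  shows "FK g (\<lambda>x. f x - c * h x) x = FK g f x - c * FK g h x"
proof -
  have "integrable (measure_pmf \<nu>) f" "integrable (measure_pmf \<nu>) h"
    using integrable_pmf_bounded[of f B] integrable_pmf_bounded[of h C] assms by auto
  then show ?thesis
    by (simp add: FK_def T_def algebra_simps)
qed

text \<open>Errors of an approximate eigenfunction add up over the steps and are not amplified.
  Working in L1 of \<pi>, not in the supremum norm, allows the eigenvalue equation to fail badly on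
  states of small mass.\<close>

lemma FK_pow_approx:
  fixes g :: "real \<Rightarrow> complex"
  assumes g: "\<And>x. norm (g x) \<le> 1" and \<psi>: "\<And>x. norm (\<psi> x) \<le> B" and l: "norm l \<le> 1"
  shows "(\<integral>x. norm ((FK g ^^ n) (\<lambda>_. 1) x - l ^ n * \<psi> x) \<partial>\<pi>)
    \<le> (\<integral>x. norm (1 - \<psi> x) \<partial>\<pi>) + real n * (\<integral>x. norm (FK g \<psi> x - l * \<psi> x) \<partial>\<pi>)"
proof (induction n)
  case (Suc n)
  let ?V = "(FK g ^^ n) (\<lambda>_. 1)"
  let ?d = "\<lambda>x. FK g \<psi> x - l * \<psi> x"
  have V: "norm (?V x) \<le> 1" for x by (rule norm_FK_pow_le[OF g])
  have ln: "norm (l ^ n) \<le> 1" using l by (simp add: norm_power power_le_one)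
  have l\<psi>: "norm (c * \<psi> x) \<le> B" if "norm c \<le> 1" for c x
  proof -
    have "norm (c * \<psi> x) \<le> 1 * B" unfolding norm_mult using that by (intro mult_mono \<psi>) auto
    then show ?thesis by simp
  qed
  have b: "norm (?V x - l ^ n * \<psi> x) \<le> 1 + B" for x
    using V[of x] l\<psi>[OF ln, of x] norm_triangle_ineq4[of "?V x" "l ^ n * \<psi> x"] by linarith
  have d: "norm (?d x) \<le> B + B" for x
    using norm_FK_le[of g \<psi> B x, OF g \<psi>] l\<psi>[OF l, of x] norm_triangle_ineq4[of "FK g \<psi> x" "l * \<psi> x"] by linarith
  have fk: "norm (FK g (\<lambda>x. ?V x - l ^ n * \<psi> x) x) \<le> 1 + B" for x
    by (rule norm_FK_le[OF g b])
  have i1: "integrable (measure_pmf \<pi>) (\<lambda>x. norm (FK g (\<lambda>x. ?V x - l ^ n * \<psi> x) x))"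
    by (rule int_bounded_real[where B = "1 + B"]) (simp add: fk)
  have i2: "integrable (measure_pmf \<pi>) (\<lambda>x. norm (?d x))"
    by (rule int_bounded_real[where B = "B + B"]) (use d in simp)
  have eq: "(FK g ^^ Suc n) (\<lambda>_. 1) x - l ^ Suc n * \<psi> x
    = FK g (\<lambda>x. ?V x - l ^ n * \<psi> x) x + l ^ n * ?d x" for x
    by (subst FK_diff_scale[OF V \<psi>]) (simp add: algebra_simps)
  have "(\<integral>x. norm ((FK g ^^ Suc n) (\<lambda>_. 1) x - l ^ Suc n * \<psi> x) \<partial>\<pi>)
    \<le> (\<integral>x. norm (FK g (\<lambda>x. ?V x - l ^ n * \<psi> x) x) + norm (?d x) \<partial>\<pi>)"
  proof (rule integral_mono)
    fix x
    have "norm (l ^ n * ?d x) \<le> 1 * norm (?d x)"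
      unfolding norm_mult by (intro mult_right_mono ln) auto
    then show le: "norm ((FK g ^^ Suc n) (\<lambda>_. 1) x - l ^ Suc n * \<psi> x)
      \<le> norm (FK g (\<lambda>x. ?V x - l ^ n * \<psi> x) x) + norm (?d x)"
      unfolding eq by (intro norm_triangle_le) simp
    show "integrable (measure_pmf \<pi>) (\<lambda>x. norm ((FK g ^^ Suc n) (\<lambda>_. 1) x - l ^ Suc n * \<psi> x))"
    proof (rule int_bounded_real[where B = "1 + B + (B + B)"])
      fix x
      have "norm (l ^ n * ?d x) \<le> 1 * (B + B)"
        unfolding norm_mult by (intro mult_mono ln d) auto
      then have "norm (l ^ n * ?d x) \<le> B + B" by simp
      then have "norm ((FK g ^^ Suc n) (\<lambda>_. 1) x - l ^ Suc n * \<psi> x) \<le> 1 + B + (B + B)"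
        unfolding eq using fk[of x] by (intro norm_triangle_le) linarith
      then show "\<bar>norm ((FK g ^^ Suc n) (\<lambda>_. 1) x - l ^ Suc n * \<psi> x)\<bar> \<le> 1 + B + (B + B)" by simp
    qed
  qed (use i1 i2 in simp)
  also have "\<dots> = (\<integral>x. norm (FK g (\<lambda>x. ?V x - l ^ n * \<psi> x) x) \<partial>\<pi>) + (\<integral>x. norm (?d x) \<partial>\<pi>)"
    by (rule Bochner_Integration.integral_add[OF i1 i2])
  also have "(\<integral>x. norm (FK g (\<lambda>x. ?V x - l ^ n * \<psi> x) x) \<partial>\<pi>) \<le> (\<integral>x. norm (?V x - l ^ n * \<psi> x) \<partial>\<pi>)"
    by (rule FK_contraction[OF g b])
  finally show ?case using Suc by (simp add: algebra_simps)
qed simp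

lemma integral_FK_pow_approx:
  fixes g :: "real \<Rightarrow> complex"
  assumes g: "\<And>x. norm (g x) \<le> 1" and \<psi>: "\<And>x. norm (\<psi> x) \<le> B" and l: "norm l \<le> 1"
  shows "norm ((\<integral>x. (FK g ^^ n) (\<lambda>_. 1) x \<partial>\<pi>) - l ^ n)
    \<le> 2 * (\<integral>x. norm (1 - \<psi> x) \<partial>\<pi>) + real n * (\<integral>x. norm (FK g \<psi> x - l * \<psi> x) \<partial>\<pi>)"
proof -
  let ?V = "(FK g ^^ n) (\<lambda>_. 1)"
  have ln: "norm (l ^ n) \<le> 1" using l by (simp add: norm_power power_le_one)
  have iV: "integrable (measure_pmf \<pi>) ?V"
    by (rule integrable_pmf_bounded[where B = 1]) (rule norm_FK_pow_le[OF g])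
  have i\<psi>: "integrable (measure_pmf \<pi>) \<psi>" by (rule integrable_pmf_bounded[OF \<psi>])
  have eq: "(\<integral>x. ?V x \<partial>\<pi>) - l ^ n = (\<integral>x. ?V x - l ^ n * \<psi> x \<partial>\<pi>) - l ^ n * (\<integral>x. 1 - \<psi> x \<partial>\<pi>)"
    using iV i\<psi> by (simp add: algebra_simps)
  have 1: "norm ((\<integral>x. ?V x \<partial>\<pi>) - l ^ n)
    \<le> norm (\<integral>x. ?V x - l ^ n * \<psi> x \<partial>\<pi>) + norm (l ^ n * (\<integral>x. 1 - \<psi> x \<partial>\<pi>))"
    unfolding eq by (rule norm_triangle_ineq4)
  have 2: "norm (\<integral>x. ?V x - l ^ n * \<psi> x \<partial>\<pi>) \<le> (\<integral>x. norm (?V x - l ^ n * \<psi> x) \<partial>\<pi>)"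
    by (rule integral_norm_bound)
  have "norm (l ^ n * (\<integral>x. 1 - \<psi> x \<partial>\<pi>)) \<le> 1 * (\<integral>x. norm (1 - \<psi> x) \<partial>\<pi>)"
    unfolding norm_mult by (intro mult_mono ln integral_norm_bound) auto
  then have 3: "norm (l ^ n * (\<integral>x. 1 - \<psi> x \<partial>\<pi>)) \<le> (\<integral>x. norm (1 - \<psi> x) \<partial>\<pi>)" by simp
  show ?thesis
    using 1 2 3 FK_pow_approx[of g \<psi> B l n, OF g \<psi> l] by linarith
qed

end

lemma integrable_indicator_pmf: "integrable (measure_pmf q) (indicator A :: 'b \<Rightarrow> real)"
  by (rule integrable_pmf_bounded[where B = 1]) (simp add: indicator_def)

text \<open>On the distinguished level the eigenvalue equation contains exactly this factor with x =
  t w or - t w. Its second-order size is the price of treating a geometric holding time of rate w as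
  exponential.\<close>

lemma iexp_first_order: "norm (iexp x * (1 - \<i> * complex_of_real x) - 1) \<le> x\<^sup>2 / 2"
proof -
  have "norm (iexp (- x) - (\<Sum>k\<le>1. (\<i> * (- x)) ^ k / fact k)) \<le> \<bar>- x\<bar> ^ Suc 1 / fact (Suc 1)"
    using iexp_approx1[of "- x" 1] by simp
  then have *: "norm (iexp (- x) - (1 - \<i> * x)) \<le> x\<^sup>2 / 2"
    by (simp add: power2_eq_square abs_mult_self_eq)
  have "iexp x * (1 - \<i> * complex_of_real x) - 1 = iexp x * ((1 - \<i> * x) - iexp (- x))"
    by (simp add: right_diff_distrib exp_minus)
  then have "norm (iexp x * (1 - \<i> * complex_of_real x) - 1) = norm (iexp (- x) - (1 - \<i> * x))"
    by (simp add: norm_mult norm_minus_commute)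
  then show ?thesis using * by simp
qed

context refresh_chain
begin

text \<open>The excursions of the chain into the states \<open>\<plusminus>a\<close> are nearly a compound Poisson process with
  Laplace summands. The proof exhibits an approximate eigenfunction \<open>\<psi>\<close> of the Feynman-Kac operator
  with eigenvalue \<open>l\<close>: on \<open>\<plusminus>a\<close> it is the Laplace-type transform of an exponential holding time, on
  the frequently refreshed states it is a first-order corrector solving the Poisson equation, and
  the rarely refreshed states (rates below \<open>\<eta>\<close>) are too unlikely to matter.\<close>

lemma component_char_approx:
  fixes a t \<eta> :: real and n :: nat
  assumes a: "0 < a" and \<eta>: "0 < \<eta>" and Zh: "1/2 \<le> Z"
  defines "P \<equiv> measure_pmf.prob \<pi> {a, - a}"
    and "\<rho> \<equiv> measure_pmf.prob \<pi> {x. \<bar>x\<bar> \<noteq> a \<and> p x < \<eta>}"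
  shows "norm ((\<integral>x. (FK (\<lambda>x. iexp (t * p a * (if \<bar>x\<bar> = a then sgn x else 0))) ^^ n) (\<lambda>_. 1) x \<partial>\<pi>)
      - complex_of_real (1 - P * p a * (t\<^sup>2 / (1 + t\<^sup>2))) ^ n)
    \<le> 4 * P + 4 * P * p a / \<eta>
      + real n * (P * p a) * (12 * P + 10 * \<rho> + 4 * P * p a / \<eta> + t\<^sup>2 * p a / 2)"
proof -
  define w where "w = p a"
  define g where "g x = iexp (t * w * (if \<bar>x\<bar> = a then sgn x else 0))" for x
  \<comment> \<open>The \<nu>-mass of the two states is \<open>P * w / Z\<close>, and the mean of
    \<open>c 1 - 1\<close> and \<open>c (- 1) - 1\<close> is \<open>- t^2 / (1 + t^2)\<close>. With
    this r the function \<psi> has \<nu>-mean 1 + r up to the correction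
    \<open>r * e1\<close>.\<close>
  define r where "r = - (P * w / Z) * (t\<^sup>2 / (1 + t\<^sup>2))"
  define Gd where "Gd = {x. \<bar>x\<bar> \<noteq> a \<and> \<eta> \<le> p x}"
  define R where "R = {x. \<bar>x\<bar> \<noteq> a \<and> p x < \<eta>}"
  \<comment> \<open>The characteristic function of a standard exponential variable at
    \<open>s * t\<close>. It satisfies
    \<open>(1 - w) * c s + w = c s * (1 - \<i> * t * w * s)\<close>, which is the eigenvalue
    equation on the distinguished level up to second order.\<close>
  define c :: "real \<Rightarrow> complex" where "c s = 1 / (1 - \<i> * of_real (s * t))" for s
  \<comment> \<open>The corrector \<open>z = r * (1 - Z / p x)\<close> solves
    \<open>p x * (r - z) = Z * r\<close>, which removes the first-order error. Below the rate \<eta>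
    it could be huge, so it is dropped there.\<close>
  define \<psi> where "\<psi> x = (if \<bar>x\<bar> = a then c (sgn x) else
    if \<eta> \<le> p x then 1 + complex_of_real (r * (1 - Z / p x)) else 1)" for x
  \<comment> \<open>The \<nu>-mean of \<open>1 - Z / p x\<close> over \<open>Gd\<close>. Since
    \<open>p x - Z\<close> has \<pi>-mean 0, it is controlled by the mass outside
    \<open>Gd\<close>.\<close>
  define e1 where "e1 = (\<integral>x. indicator Gd x * (p x - Z) \<partial>\<pi>) / Z"
  define l where "l = complex_of_real (1 + Z * r)"
  have w: "0 < w" "w \<le> 1" "p (- a) = w" using p_pos[of a] p_bounds[of a] p_even[of a] by (auto simp: w_def)
  have P: "0 \<le> P" "P \<le> 1" and \<rho>: "0 \<le> \<rho>" "\<rho> \<le> 1" by (auto simp: P_def \<rho>_def)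
  have \<rho>R: "\<rho> = measure_pmf.prob \<pi> R" by (simp add: \<rho>_def R_def)
  have Pr: "P + \<rho> \<le> 1"
  proof -
    have "P + \<rho> = measure_pmf.prob \<pi> ({a, - a} \<union> R)"
      unfolding P_def \<rho>R by (rule measure_pmf.finite_measure_Union[symmetric]) (use a in \<open>auto simp: R_def\<close>)
    then show ?thesis by simp
  qed
  have tt: "0 \<le> t\<^sup>2 / (1 + t\<^sup>2)" "t\<^sup>2 / (1 + t\<^sup>2) \<le> 1"
    by (auto simp: divide_le_eq_1 add_pos_nonneg)
  have rabs: "\<bar>r\<bar> \<le> 2 * P * w"
  proof -
    have "\<bar>r\<bar> = (P * w / Z) * (t\<^sup>2 / (1 + t\<^sup>2))"
      using P w Z_pos tt by (simp add: r_def abs_mult)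
    also have "\<dots> \<le> (P * w / Z) * 1" using P w Z_pos tt by (intro mult_left_mono) auto
    also have "\<dots> \<le> P * w / (1/2)" unfolding mult_1_right using P w Zh by (intro divide_left_mono) auto
    finally show ?thesis by simp
  qed
  have Zr: "Z * r = - (P * w) * (t\<^sup>2 / (1 + t\<^sup>2))" using Z_pos by (simp add: r_def)
  have l_eq: "l = complex_of_real (1 - P * p a * (t\<^sup>2 / (1 + t\<^sup>2)))"
    by (simp only: l_def Zr w_def) simp
  have l1: "norm l \<le> 1"
  proof -
    have "0 \<le> (P * w) * (t\<^sup>2 / (1 + t\<^sup>2))"
      using P(1) w(1) tt(1) by (intro mult_nonneg_nonneg) auto
    moreover have "(P * w) * (t\<^sup>2 / (1 + t\<^sup>2)) \<le> 1"
      using P w(1,2) tt by (intro mult_le_one mult_nonneg_nonneg) auto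
    ultimately show ?thesis
      unfolding l_def Zr norm_of_real mult_minus_left by (intro abs_leI; linarith)
  qed
  have gn: "norm (g x) \<le> 1" for x by (simp add: g_def)
  have cn: "norm (c s) \<le> 1" for s
  proof -
    have "1 \<le> norm (1 - \<i> * complex_of_real (s * t))"
      using abs_Re_le_cmod[of "1 - \<i> * complex_of_real (s * t)"] by simp
    then show ?thesis by (simp add: c_def norm_divide divide_le_eq_1)
  qed
  have pZ: "\<bar>p x - Z\<bar> \<le> 1" for x using p_bounds[of x] Z_pos Z_le_1 by (simp add: abs_le_iff)
  have zeta: "\<bar>r * (1 - Z / p x)\<bar> \<le> \<bar>r\<bar> / \<eta>" if "\<eta> \<le> p x" for x
  proof -
    have "1 - Z / p x = (p x - Z) / p x" using p_pos[of x] by (simp add: field_simps)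
    then have "\<bar>1 - Z / p x\<bar> = \<bar>p x - Z\<bar> / p x" using p_pos[of x] by simp
    also have "\<dots> \<le> 1 / \<eta>" using pZ[of x] that \<eta> by (intro frac_le) auto
    finally have "\<bar>r\<bar> * \<bar>1 - Z / p x\<bar> \<le> \<bar>r\<bar> * (1 / \<eta>)" by (rule mult_left_mono) simp
    then show ?thesis by (simp add: abs_mult)
  qed
  have \<psi>n: "norm (\<psi> x) \<le> 1 + \<bar>r\<bar> / \<eta>" for x
  proof -
    have "0 \<le> \<bar>r\<bar> / \<eta>" using \<eta> by simp
    moreover have "norm (1 + complex_of_real (r * (1 - Z / p x))) \<le> 1 + \<bar>r\<bar> / \<eta>" if "\<eta> \<le> p x"
      using zeta[OF that] by (intro norm_triangle_le) (simp only: norm_of_real norm_one add_left_mono)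
    ultimately show ?thesis using cn[of "sgn x"] by (auto simp: \<psi>_def)
  qed

  have e1: "\<bar>e1\<bar> \<le> 2 * P + 2 * \<rho>"
  proof -
    have part: "indicator Gd x + (indicator {a, - a} x + indicator R x) = (1::real)" for x
      using a by (auto simp: indicator_def Gd_def R_def)
    have ip: "integrable (measure_pmf \<pi>) (\<lambda>x. indicator A x * (p x - Z))" for A
      by (rule int_bounded_real[where B = 1]) (use pZ in \<open>simp add: indicator_def\<close>)
    have "0 = (\<integral>x. p x - Z \<partial>\<pi>)" using integrable_p by (simp add: Z_def)
    also have "\<dots> = (\<integral>x. indicator Gd x * (p x - Z) + (indicator {a, - a} x * (p x - Z) + indicator R x * (p x - Z)) \<partial>\<pi>)"
      by (rule Bochner_Integration.integral_cong[OF refl])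
         (simp only: distrib_right[symmetric] part mult_1)
    also have "\<dots> = Z * e1 + ((\<integral>x. indicator {a, - a} x * (p x - Z) \<partial>\<pi>) + (\<integral>x. indicator R x * (p x - Z) \<partial>\<pi>))"
      using ip Z_pos by (simp add: e1_def)
    finally have Ze: "Z * e1 = - ((\<integral>x. indicator {a, - a} x * (p x - Z) \<partial>\<pi>) + (\<integral>x. indicator R x * (p x - Z) \<partial>\<pi>))"
      by simp
    have le: "\<bar>\<integral>x. indicator A x * (p x - Z) \<partial>\<pi>\<bar> \<le> measure_pmf.prob \<pi> A" for A
    proof -
      have "\<bar>\<integral>x. indicator A x * (p x - Z) \<partial>\<pi>\<bar> \<le> (\<integral>x. \<bar>indicator A x * (p x - Z)\<bar> \<partial>\<pi>)"
        by (rule integral_abs_bound)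
      also have "\<dots> \<le> (\<integral>x. indicator A x \<partial>\<pi>)"
      proof (rule integral_mono)
        show "\<bar>indicator A x * (p x - Z)\<bar> \<le> indicator A x" for x
          using pZ[of x] by (simp add: indicator_def)
      qed (intro integrable_abs ip integrable_indicator_pmf)+
      finally show ?thesis by simp
    qed
    have "\<bar>Z * e1\<bar> \<le> P + \<rho>"
      unfolding Ze P_def \<rho>R using le[of "{a, - a}"] le[of R] by linarith
    then have "Z * \<bar>e1\<bar> \<le> P + \<rho>" using Z_pos by (simp add: abs_mult)
    moreover have "1/2 * \<bar>e1\<bar> \<le> Z * \<bar>e1\<bar>" using Zh by (intro mult_right_mono) auto
    ultimately show ?thesis by linarith
  qed
  have int\<psi>: "(\<integral>x. \<psi> x \<partial>\<nu>) = complex_of_real (1 + r + r * e1)"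
  proof -
    have split: "\<psi> x = 1 + (indicator {a} x *\<^sub>R (c 1 - 1) + (indicator {- a} x *\<^sub>R (c (- 1) - 1)
        + complex_of_real (r * (indicator Gd x * (1 - Z / p x)))))" for x
      using a by (auto simp: \<psi>_def Gd_def indicator_def sgn_if)
    have b: "\<bar>r * (indicator Gd x * (1 - Z / p x))\<bar> \<le> \<bar>r\<bar> / \<eta>" for x
      using zeta[of x] \<eta> by (auto simp: Gd_def indicator_def)
    have i: "integrable (measure_pmf \<nu>) (\<lambda>x. complex_of_real (r * (indicator Gd x * (1 - Z / p x))))"
      by (intro integrable_of_real int_bounded_real[OF b])
    have i2: "integrable (measure_pmf \<nu>) (\<lambda>x. indicator {y} x *\<^sub>R z)" for y and z :: complex
      by (rule integrable_pmf_bounded[where B = "norm z"]) (auto simp: indicator_def)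
    have "pmf \<pi> (- a) = pmf \<pi> a"
      using pmf_map_inj'[of uminus \<pi> a] symmetric by (simp add: inj_def)
    moreover have "P = pmf \<pi> a + pmf \<pi> (- a)"
      unfolding P_def using a by (subst measure_measure_pmf_finite) auto
    ultimately have \<nu>a: "pmf \<nu> a = P * w / Z / 2" "pmf \<nu> (- a) = P * w / Z / 2"
      using w by (simp_all add: pmf_\<nu> w_def)
    have s: "(\<integral>x. indicator {y} x *\<^sub>R z \<partial>\<nu>) = pmf \<nu> y *\<^sub>R z" for y and z :: complex
      by (simp add: measure_pmf_single measure_pmf.emeasure_eq_measure)
    have re: "(\<integral>x. indicator Gd x * (1 - Z / p x) \<partial>\<nu>) = e1"
    proof -
      have "(\<integral>x. indicator Gd x * (1 - Z / p x) \<partial>\<nu>) = (1 / Z) * (\<integral>x. indicator Gd x * (p x - Z) \<partial>\<pi>)"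
        unfolding integral_\<nu> real_scaleR_def
      proof (intro arg_cong[where f = "\<lambda>z. (1 / Z) * z"] Bochner_Integration.integral_cong refl)
        show "p x * (indicator Gd x * (1 - Z / p x)) = indicator Gd x * (p x - Z)" for x
          using p_pos[of x] by (simp add: field_simps)
      qed
      then show ?thesis by (simp add: e1_def)
    qed
    have "(\<integral>x. \<psi> x \<partial>\<nu>) = 1 + (pmf \<nu> a *\<^sub>R (c 1 - 1) + (pmf \<nu> (- a) *\<^sub>R (c (- 1) - 1) + complex_of_real (r * e1)))"
      unfolding split using i i2 by (simp add: s re del: of_real_mult)
    also have "\<dots> = 1 + complex_of_real (P * w / Z / 2) * (c 1 + c (- 1) - 2) + complex_of_real (r * e1)"
    proof -
      have "1 + (k * (z - 1) + (k * (z' - 1) + d)) = 1 + k * (z + z' - 2) + d" for k z z' d :: complex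
        by (simp add: algebra_simps)
      then show ?thesis unfolding \<nu>a scaleR_conv_of_real .
    qed
    also have "c 1 + c (- 1) - 2 = complex_of_real (- 2 * (t\<^sup>2 / (1 + t\<^sup>2)))"
    proof -
      have nz: "1 - \<i> * complex_of_real t \<noteq> 0" "1 + \<i> * complex_of_real t \<noteq> 0"
        by (auto simp: complex_eq_iff)
      have nz2: "1 + t\<^sup>2 \<noteq> 0" by (simp add: add_nonneg_eq_0_iff)
      then have nz3: "1 + (complex_of_real t)\<^sup>2 \<noteq> 0"
        by (metis of_real_1 of_real_add of_real_eq_0_iff of_real_power)
      have prod: "(1 - \<i> * complex_of_real t) * (1 + \<i> * complex_of_real t) = 1 + (complex_of_real t)\<^sup>2"
        by (simp add: algebra_simps power2_eq_square)
      have "c 1 + c (- 1) = 2 / (1 + (complex_of_real t)\<^sup>2)"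
        unfolding c_def prod[symmetric] using nz by (simp add: field_simps)
      then have "c 1 + c (- 1) - 2 = - 2 * ((complex_of_real t)\<^sup>2 / (1 + (complex_of_real t)\<^sup>2))"
        using nz3 by (simp add: field_simps)
      then show ?thesis by simp
    qed
    also have "1 + complex_of_real (P * w / Z / 2) * complex_of_real (- 2 * (t\<^sup>2 / (1 + t\<^sup>2))) + complex_of_real (r * e1)
      = complex_of_real (1 + r + r * e1)"
    proof -
      have "P * w / Z / 2 * (- 2 * (t\<^sup>2 / (1 + t\<^sup>2))) = r" by (simp add: r_def)
      then show ?thesis by (simp only: of_real_mult[symmetric] of_real_add of_real_1)
    qed
    finally show ?thesis .
  qed
  define D where "D x = FK g \<psi> x - l * \<psi> x" for x
  have T\<psi>: "T \<psi> x = complex_of_real (1 - p x) * \<psi> x + complex_of_real (p x * (1 + r + r * e1))" for x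
    by (simp add: T_def int\<psi> scaleR_conv_of_real)
  have DG: "norm (D x) \<le> \<bar>r\<bar> * (\<bar>e1\<bar> + \<bar>r\<bar> / \<eta>)" if "x \<in> Gd" for x
  proof -
    let ?z = "r * (1 - Z / p x)"
    have x: "\<bar>x\<bar> \<noteq> a" "\<eta> \<le> p x" using that by (auto simp: Gd_def)
    have "D x = complex_of_real ((1 - p x) * (1 + ?z) + p x * (1 + r + r * e1) - (1 + Z * r) * (1 + ?z))"
      using x by (simp add: D_def FK_def T\<psi> g_def \<psi>_def l_def)
    also have "(1 - p x) * (1 + ?z) + p x * (1 + r + r * e1) - (1 + Z * r) * (1 + ?z) = r * (p x * e1 - Z * ?z)"
      using p_pos[of x] by (simp add: field_simps)
    finally have "norm (D x) = \<bar>r\<bar> * \<bar>p x * e1 - Z * ?z\<bar>" by (simp only: norm_of_real abs_mult)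
    also have "\<bar>p x * e1 - Z * ?z\<bar> \<le> \<bar>p x * e1\<bar> + \<bar>Z * ?z\<bar>" by (rule abs_triangle_ineq4)
    also have "\<dots> \<le> 1 * \<bar>e1\<bar> + 1 * (\<bar>r\<bar> / \<eta>)"
      unfolding abs_mult[of "p x" e1] abs_mult[of Z] using Z_pos Z_le_1 p_bounds[of x]
      by (intro add_mono mult_mono zeta x) auto
    finally show ?thesis by (simp add: mult_left_mono)
  qed
  have DR: "norm (D x) \<le> \<bar>r\<bar> * (1 + \<bar>e1\<bar>)" if "x \<in> R" for x
  proof -
    have x: "\<bar>x\<bar> \<noteq> a" "\<not> \<eta> \<le> p x" using that by (auto simp: R_def)
    have "D x = complex_of_real ((1 - p x) + p x * (1 + r + r * e1) - (1 + Z * r))"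
      using x by (simp add: D_def FK_def T\<psi> g_def \<psi>_def l_def)
    also have "(1 - p x) + p x * (1 + r + r * e1) - (1 + Z * r) = r * ((p x - Z) + p x * e1)"
      by (simp add: algebra_simps)
    finally have "norm (D x) = \<bar>r\<bar> * \<bar>(p x - Z) + p x * e1\<bar>" by (simp only: norm_of_real abs_mult)
    also have "\<bar>(p x - Z) + p x * e1\<bar> \<le> \<bar>p x - Z\<bar> + \<bar>p x * e1\<bar>" by (rule abs_triangle_ineq)
    also have "\<dots> \<le> 1 + 1 * \<bar>e1\<bar>"
      unfolding abs_mult using p_bounds[of x] by (intro add_mono pZ mult_right_mono) auto
    finally show ?thesis by (simp add: mult_left_mono)
  qed
  have DE: "norm (D x) \<le> t\<^sup>2 * w\<^sup>2 / 2 + \<bar>r\<bar> * (2 + \<bar>e1\<bar>)" if "x \<in> {a, - a}" for x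
  proof -
    define s where "s = sgn x"
    have x: "\<bar>x\<bar> = a" "p x = w" and s: "s = 1 \<or> s = - 1"
      using that a w by (auto simp: s_def w_def)
    have s2: "(t * w * s)\<^sup>2 = t\<^sup>2 * w\<^sup>2" using s by (auto simp: power_mult_distrib)
    have \<psi>x: "\<psi> x = c s" and gx: "g x = iexp (t * w * s)" using x by (simp_all add: \<psi>_def g_def s_def)
    have nz: "1 - \<i> * complex_of_real (s * t) \<noteq> 0" by (simp add: complex_eq_iff)
    have cs: "c s * (1 - \<i> * complex_of_real (s * t)) = 1" using nz by (simp add: c_def)
    have "complex_of_real (1 - w) * c s + complex_of_real w = c s * (1 - \<i> * complex_of_real (t * w * s))"
    proof -
      have "complex_of_real w = complex_of_real w * (c s * (1 - \<i> * complex_of_real (s * t)))"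
        by (simp only: cs mult_1_right)
      then have "complex_of_real (1 - w) * c s + complex_of_real w
         = complex_of_real (1 - w) * c s + complex_of_real w * (c s * (1 - \<i> * complex_of_real (s * t)))" by simp
      then show ?thesis by (simp add: algebra_simps)
    qed
    note q = this
    have "D x = iexp (t * w * s) * ((complex_of_real (1 - w) * c s + complex_of_real w)
         + complex_of_real (w * (r + r * e1))) - (c s + complex_of_real (Z * r) * c s)"
      by (simp add: D_def FK_def T\<psi> \<psi>x gx x l_def algebra_simps)
    then have main: "D x = c s * (iexp (t * w * s) * (1 - \<i> * complex_of_real (t * w * s)) - 1)
       + (iexp (t * w * s) * complex_of_real (w * (r + r * e1)) - complex_of_real (Z * r) * c s)"
      unfolding q by (simp add: algebra_simps)
    have "norm (D x) \<le> norm (c s * (iexp (t * w * s) * (1 - \<i> * complex_of_real (t * w * s)) - 1))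
       + (norm (iexp (t * w * s) * complex_of_real (w * (r + r * e1))) + norm (complex_of_real (Z * r) * c s))"
      unfolding main by (rule order_trans[OF norm_triangle_ineq add_left_mono[OF norm_triangle_ineq4]])
    also have "norm (c s * (iexp (t * w * s) * (1 - \<i> * complex_of_real (t * w * s)) - 1)) \<le> 1 * (t\<^sup>2 * w\<^sup>2 / 2)"
      unfolding norm_mult[of "c s"] s2[symmetric] by (intro mult_mono cn iexp_first_order) auto
    also have "norm (iexp (t * w * s) * complex_of_real (w * (r + r * e1))) \<le> \<bar>r\<bar> * (1 + \<bar>e1\<bar>)"
    proof -
      have "norm (iexp (t * w * s) * complex_of_real (w * (r + r * e1))) = w * (\<bar>r\<bar> * \<bar>1 + e1\<bar>)"
        using w by (simp add: norm_mult distrib_left[symmetric] abs_mult del: of_real_mult of_real_add)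
           (simp add: abs_mult[symmetric] distrib_left)
      also have "\<dots> \<le> 1 * (\<bar>r\<bar> * (1 + \<bar>e1\<bar>))"
        using w abs_triangle_ineq[of 1 e1] by (intro mult_mono) auto
      finally show ?thesis by simp
    qed
    also have "norm (complex_of_real (Z * r) * c s) \<le> \<bar>r\<bar> * 1"
      unfolding norm_mult norm_of_real abs_mult using Z_pos Z_le_1
      by (intro mult_mono cn) (auto intro: mult_left_le_one_le)
    finally show ?thesis by (simp add: algebra_simps)
  qed
  have part: "indicator Gd x + indicator {a, - a} x + indicator R x = (1::real)" for x
    using a by (auto simp: indicator_def Gd_def R_def)
  have parts: "x \<in> Gd \<or> x \<in> {a, - a} \<or> x \<in> R" for x
    using a by (auto simp: Gd_def R_def)
  have tri: "(\<integral>x. f x \<partial>\<pi>) \<le> A + P * B + \<rho> * C"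
    if "\<And>x. x \<in> Gd \<Longrightarrow> f x \<le> A" "\<And>x. x \<in> {a, - a} \<Longrightarrow> f x \<le> B" "\<And>x. x \<in> R \<Longrightarrow> f x \<le> C"
      "0 \<le> A" "0 \<le> B" "0 \<le> C" "\<And>x. 0 \<le> f x" for f :: "real \<Rightarrow> real" and A B C
  proof -
    have "(\<integral>x. f x \<partial>\<pi>) \<le> (\<integral>x. A + indicator {a, - a} x * B + indicator R x * C \<partial>\<pi>)"
    proof (rule integral_mono)
      show le: "f x \<le> A + indicator {a, - a} x * B + indicator R x * C" for x
        using parts[of x] that(1-3)[of x] that(4-6) by (auto simp: indicator_def)
      show "integrable (measure_pmf \<pi>) f"
      proof (rule int_bounded_real[where B = "A + B + C"])
        fix x
        have "A + indicator {a, - a} x * B + indicator R x * C \<le> A + B + C"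
          using that(4-6) by (auto simp: indicator_def)
        then show "\<bar>f x\<bar> \<le> A + B + C" using le[of x] that(7)[of x] by linarith
      qed
    qed (intro Bochner_Integration.integrable_add integrable_mult_left integrable_indicator_pmf
        measure_pmf.integrable_const)
    also have "\<dots> = A + P * B + \<rho> * C"
      using integrable_indicator_pmf[of \<pi> "{a, - a}"] integrable_indicator_pmf[of \<pi> R]
      by (simp add: P_def \<rho>R)
    finally show ?thesis .
  qed
  have r\<eta>: "\<bar>r\<bar> / \<eta> \<le> 2 * P * w / \<eta>" using rabs \<eta> by (intro divide_right_mono) auto
  have I1: "(\<integral>x. norm (1 - \<psi> x) \<partial>\<pi>) \<le> 2 * P * w / \<eta> + P * 2 + \<rho> * 0"
  proof (rule tri)
    show "norm (1 - \<psi> x) \<le> 2 * P * w / \<eta>" if "x \<in> Gd" for x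
    proof -
      have "1 - \<psi> x = - complex_of_real (r * (1 - Z / p x))"
        using that by (simp add: Gd_def \<psi>_def)
      then have "norm (1 - \<psi> x) = \<bar>r * (1 - Z / p x)\<bar>" by (simp only: norm_minus_cancel norm_of_real)
      then show ?thesis using zeta[of x] that r\<eta> by (simp add: Gd_def)
    qed
    show "norm (1 - \<psi> x) \<le> 2" if "x \<in> {a, - a}" for x
    proof -
      have "\<psi> x = c (sgn x)" using that a by (auto simp: \<psi>_def)
      then show ?thesis using norm_triangle_ineq4[of 1 "\<psi> x"] cn[of "sgn x"] by simp
    qed
    show "norm (1 - \<psi> x) \<le> 0" if "x \<in> R" for x
      using that by (simp add: R_def \<psi>_def)
  qed (use P w \<eta> in auto)
  have e1': "\<bar>e1\<bar> \<le> 2" using e1 Pr by linarith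
  have I2: "(\<integral>x. norm (D x) \<partial>\<pi>) \<le> 2 * P * w * (2 * P + 2 * \<rho> + 2 * P * w / \<eta>)
     + P * (t\<^sup>2 * w\<^sup>2 / 2 + 2 * P * w * 4) + \<rho> * (2 * P * w * 3)"
  proof (rule tri)
    show "norm (D x) \<le> 2 * P * w * (2 * P + 2 * \<rho> + 2 * P * w / \<eta>)" if "x \<in> Gd" for x
    proof -
      have "\<bar>r\<bar> * (\<bar>e1\<bar> + \<bar>r\<bar> / \<eta>) \<le> 2 * P * w * (2 * P + 2 * \<rho> + 2 * P * w / \<eta>)"
        using rabs e1 r\<eta> P w \<eta> by (intro mult_mono add_mono) auto
      then show ?thesis using DG[OF that] by linarith
    qed
    show "norm (D x) \<le> t\<^sup>2 * w\<^sup>2 / 2 + 2 * P * w * 4" if "x \<in> {a, - a}" for x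
    proof -
      have "\<bar>r\<bar> * (2 + \<bar>e1\<bar>) \<le> 2 * P * w * 4"
        using rabs e1' P w by (intro mult_mono) auto
      then show ?thesis using DE[OF that] by linarith
    qed
    show "norm (D x) \<le> 2 * P * w * 3" if "x \<in> R" for x
    proof -
      have "\<bar>r\<bar> * (1 + \<bar>e1\<bar>) \<le> 2 * P * w * 3"
        using rabs e1' P w by (intro mult_mono) auto
      then show ?thesis using DR[OF that] by linarith
    qed
  qed (use P w \<eta> \<rho> in auto)
  have "norm ((\<integral>x. (FK g ^^ n) (\<lambda>_. 1) x \<partial>\<pi>) - l ^ n)
    \<le> 2 * (\<integral>x. norm (1 - \<psi> x) \<partial>\<pi>) + real n * (\<integral>x. norm (D x) \<partial>\<pi>)"
    unfolding D_def by (rule integral_FK_pow_approx[OF gn \<psi>n l1])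
  also have "\<dots> \<le> 2 * (2 * P * w / \<eta> + P * 2 + \<rho> * 0) + real n * (2 * P * w * (2 * P + 2 * \<rho> + 2 * P * w / \<eta>)
     + P * (t\<^sup>2 * w\<^sup>2 / 2 + 2 * P * w * 4) + \<rho> * (2 * P * w * 3))"
    by (intro add_mono mult_left_mono I1 I2) auto
  also have "\<dots> = 4 * P + 4 * P * w / \<eta>
      + real n * (P * w) * (12 * P + 10 * \<rho> + 4 * P * w / \<eta> + t\<^sup>2 * w / 2)"
    by (simp add: algebra_simps power2_eq_square)
  finally show ?thesis unfolding l_eq g_def w_def .
qed

end

lemma norm_iexp_diff_le: "norm (iexp x - iexp y) \<le> \<bar>x - y\<bar>"
proof -
  have "iexp x - iexp y = iexp y * (iexp (x - y) - 1)"
    by (simp add: right_diff_distrib exp_add[symmetric] algebra_simps)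
  then have "norm (iexp x - iexp y) = norm (iexp (x - y) - 1)" by (simp add: norm_mult)
  also have "\<dots> \<le> \<bar>x - y\<bar>" using iexp_approx1[of "x - y" 0] by simp
  finally show ?thesis .
qed

section \<open>Reduction of the partial sums to a single level\<close>

context refresh_process
begin

text \<open>The frequently refreshed states add an odd functional with small second moment, by the
  linear bound on lag sums. The rarely refreshed ones are avoided altogether, except on an event of
  probability at most n times their mass.\<close>

lemma char_single_component:
  fixes a t \<eta> b :: real
  assumes int: "integrable (measure_pmf \<pi>) (\<lambda>x. x\<^sup>2)" and a: "0 < a" and b: "0 < b" and \<eta>: "0 < \<eta>"
    and \<kappa>: "(\<integral>x. indicator {x. \<bar>x\<bar> \<noteq> a \<and> \<eta> \<le> p x} x * (x\<^sup>2 / p x) \<partial>\<pi>) \<le> \<kappa>"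
  shows "norm ((\<integral>\<omega>. iexp (t * (partial_sum X n \<omega> / b)) \<partial>M)
      - (\<integral>\<omega>. iexp (\<Sum>k=1..int n. t * a / b * (if \<bar>X k \<omega>\<bar> = a then sgn (X k \<omega>) else 0)) \<partial>M))
    \<le> \<bar>t\<bar> / b * sqrt (2 * real n * \<kappa>) + 2 * real n * measure_pmf.prob \<pi> {x. \<bar>x\<bar> \<noteq> a \<and> p x < \<eta>}"
proof -
  define Gd where "Gd = {x. \<bar>x\<bar> \<noteq> a \<and> \<eta> \<le> p x}"
  define R where "R = {x. \<bar>x\<bar> \<noteq> a \<and> p x < \<eta>}"
  define h where "h x = indicator Gd x * x" for x :: real
  define B where "B \<omega> = (\<Sum>k=1..int n. t * a / b * (if \<bar>X k \<omega>\<bar> = a then sgn (X k \<omega>) else 0))" for \<omega>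
  define A where "A \<omega> = (\<Sum>k=1..int n. h (X k \<omega>))" for \<omega>
  define E where "E = (\<Union>k\<in>{1..int n}. {\<omega>\<in>space M. X k \<omega> \<in> R})"
  have [measurable]: "A \<in> borel_measurable M" "B \<in> borel_measurable M" "partial_sum X n \<in> borel_measurable M"
    unfolding A_def[abs_def] B_def[abs_def] partial_sum_def[abs_def] by measurable
  have RM: "{\<omega>\<in>space M. X k \<omega> \<in> R} \<in> events" for k
    using measurable_sets[OF measurable_X_UNIV, of R k] by (simp add: vimage_def Int_def conj_commute)
  have E [measurable]: "E \<in> events" unfolding E_def using RM by auto
  have oddh: "h (- x) = - h x" for x by (simp add: h_def Gd_def p_even indicator_def)
  have h2: "(h x)\<^sup>2 = indicator Gd x * x\<^sup>2" for x by (simp add: h_def indicator_def)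
  have inth: "integrable (measure_pmf \<pi>) (\<lambda>x. (h x)\<^sup>2)"
    by (rule Bochner_Integration.integrable_bound[OF int]) (auto simp: h2 indicator_def)
  note A2 = second_moment_sum[OF oddh inth, of n, folded A_def]
  have prob_R: "prob {\<omega>\<in>space M. X k \<omega> \<in> R} = measure_pmf.prob \<pi> R" for k
    using distr_state[of k] measure_distr[OF measurable_X_UNIV[of k], of R]
    by (simp add: vimage_def Int_def conj_commute)
  have PE: "prob E \<le> real n * measure_pmf.prob \<pi> R"
  proof -
    have "prob E \<le> (\<Sum>k\<in>{1..int n}. prob {\<omega>\<in>space M. X k \<omega> \<in> R})"
      unfolding E_def by (rule finite_measure_subadditive_finite) (use RM in auto)
    then show ?thesis by (simp add: prob_R)
  qed
  have EA: "(\<integral>\<omega>. (A \<omega>)\<^sup>2 \<partial>M) \<le> 2 * real n * \<kappa>"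
  proof -
    have bb: "\<bar>indicator Gd x * (x\<^sup>2 / p x)\<bar> \<le> x\<^sup>2 / \<eta>" for x
    proof -
      have "x\<^sup>2 / p x \<le> x\<^sup>2 / \<eta>" if "x \<in> Gd" using that \<eta> by (intro divide_left_mono) (auto simp: Gd_def)
      then show ?thesis using \<eta> p_pos[of x] by (auto simp: indicator_def)
    qed
    have "integrable (measure_pmf \<pi>) (\<lambda>x. x\<^sup>2 / \<eta>)" using int by simp
    then have iG: "integrable (measure_pmf \<pi>) (\<lambda>x. indicator Gd x * (x\<^sup>2 / p x))"
      by (rule Bochner_Integration.integrable_bound) (use bb \<eta> in auto)
    have "(\<integral>x. lag_sum n (1 - p x) * (h x)\<^sup>2 \<partial>\<pi>) \<le> (\<integral>x. 2 * real n * (indicator Gd x * (x\<^sup>2 / p x)) \<partial>\<pi>)"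
    proof (rule integral_mono)
      show le: "lag_sum n (1 - p x) * (h x)\<^sup>2 \<le> 2 * real n * (indicator Gd x * (x\<^sup>2 / p x))" for x
        using mult_right_mono[OF lag_sum_le_linear[OF p_pos p_le_1, of n x], of "(h x)\<^sup>2"]
        by (simp add: h2 mult_ac)
      show "integrable (measure_pmf \<pi>) (\<lambda>x. 2 * real n * (indicator Gd x * (x\<^sup>2 / p x)))"
        by (rule integrable_mult_right) (rule iG)
      then show "integrable (measure_pmf \<pi>) (\<lambda>x. lag_sum n (1 - p x) * (h x)\<^sup>2)"
      proof (rule Bochner_Integration.integrable_bound)
        show "AE x in measure_pmf \<pi>. norm (lag_sum n (1 - p x) * (h x)\<^sup>2) \<le> norm (2 * real n * (indicator Gd x * (x\<^sup>2 / p x)))"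
        proof (rule AE_I2)
          fix x
          have "0 \<le> lag_sum n (1 - p x) * (h x)\<^sup>2" using lag_sum_nonneg[of "1 - p x" n] p_bounds[of x] by simp
          then show "norm (lag_sum n (1 - p x) * (h x)\<^sup>2) \<le> norm (2 * real n * (indicator Gd x * (x\<^sup>2 / p x)))"
            using le[of x] unfolding real_norm_def by linarith
        qed
      qed simp
    qed
    also have "\<dots> = 2 * real n * (\<integral>x. indicator Gd x * (x\<^sup>2 / p x) \<partial>\<pi>)"
      by (rule integral_mult_right_zero)
    also have "\<dots> \<le> 2 * real n * \<kappa>" using \<kappa> unfolding Gd_def by (intro mult_left_mono) auto
    finally show ?thesis unfolding A2(2) .
  qed
  have iA: "integrable M A" by (rule square_integrable_imp_integrable[OF _ A2(1)]) simp
  \<comment> \<open>Nonnegativity of the variance of the modulus serves as the Cauchy-Schwarz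
    inequality.\<close>
  have EA1: "(\<integral>\<omega>. \<bar>A \<omega>\<bar> \<partial>M) \<le> sqrt (2 * real n * \<kappa>)"
  proof (rule real_le_rsqrt)
    have "0 \<le> variance (\<lambda>\<omega>. \<bar>A \<omega>\<bar>)" by (rule variance_positive)
    also have "variance (\<lambda>\<omega>. \<bar>A \<omega>\<bar>) = (\<integral>\<omega>. \<bar>A \<omega>\<bar>\<^sup>2 \<partial>M) - (\<integral>\<omega>. \<bar>A \<omega>\<bar> \<partial>M)\<^sup>2"
      by (rule variance_eq) (use iA A2(1) in auto)
    finally show "(\<integral>\<omega>. \<bar>A \<omega>\<bar> \<partial>M)\<^sup>2 \<le> 2 * real n * \<kappa>" using EA by simp
  qed
  have pt: "norm (iexp (t * (partial_sum X n \<omega> / b)) - iexp (B \<omega>)) \<le> \<bar>t\<bar> / b * \<bar>A \<omega>\<bar> + 2 * indicator E \<omega>"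
    if \<omega>: "\<omega> \<in> space M" for \<omega>
  proof (cases "\<omega> \<in> E")
    case True
    have "norm (iexp (t * (partial_sum X n \<omega> / b)) - iexp (B \<omega>)) \<le> 2"
      using norm_triangle_ineq4[of "iexp (t * (partial_sum X n \<omega> / b))" "iexp (B \<omega>)"] by simp
    moreover have "0 \<le> \<bar>t\<bar> / b * \<bar>A \<omega>\<bar>" using b by simp
    ultimately show ?thesis using True by simp
  next
    case False
    have "X k \<omega> = h (X k \<omega>) + a * (if \<bar>X k \<omega>\<bar> = a then sgn (X k \<omega>) else 0)" if "k \<in> {1..int n}" for k
    proof -
      have "X k \<omega> \<notin> R" using False that \<omega> by (auto simp: E_def)
      then show ?thesis
        using a by (auto simp: h_def Gd_def R_def indicator_def sgn_if abs_if split: if_splits)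
    qed
    then have "partial_sum X n \<omega> = (\<Sum>k=1..int n. h (X k \<omega>) + a * (if \<bar>X k \<omega>\<bar> = a then sgn (X k \<omega>) else 0))"
      unfolding partial_sum_def by (intro sum.cong refl)
    then have ps: "partial_sum X n \<omega> = A \<omega> + a * (\<Sum>k=1..int n. if \<bar>X k \<omega>\<bar> = a then sgn (X k \<omega>) else 0)"
      by (simp only: A_def sum.distrib sum_distrib_left)
    have "B \<omega> = t * a / b * (\<Sum>k=1..int n. if \<bar>X k \<omega>\<bar> = a then sgn (X k \<omega>) else 0)"
      by (simp only: B_def sum_distrib_left)
    then have "t * (partial_sum X n \<omega> / b) - B \<omega> = t / b * A \<omega>"
      unfolding ps using b by (simp add: field_simps)
    then have "norm (iexp (t * (partial_sum X n \<omega> / b)) - iexp (B \<omega>)) \<le> \<bar>t / b * A \<omega>\<bar>"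
      using norm_iexp_diff_le[of "t * (partial_sum X n \<omega> / b)" "B \<omega>"] by simp
    then show ?thesis using b False by (simp add: abs_mult)
  qed
  have iS: "integrable M (\<lambda>\<omega>. iexp (t * (partial_sum X n \<omega> / b)))" "integrable M (\<lambda>\<omega>. iexp (B \<omega>))"
    by (rule integrable_const_bound[where B = 1]; simp)+
  have "norm ((\<integral>\<omega>. iexp (t * (partial_sum X n \<omega> / b)) \<partial>M) - (\<integral>\<omega>. iexp (B \<omega>) \<partial>M))
    = norm (\<integral>\<omega>. iexp (t * (partial_sum X n \<omega> / b)) - iexp (B \<omega>) \<partial>M)"
    by (simp only: Bochner_Integration.integral_diff[OF iS])
  also have "\<dots> \<le> (\<integral>\<omega>. norm (iexp (t * (partial_sum X n \<omega> / b)) - iexp (B \<omega>)) \<partial>M)"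
    by (rule integral_norm_bound)
  also have "\<dots> \<le> (\<integral>\<omega>. \<bar>t\<bar> / b * \<bar>A \<omega>\<bar> + 2 * indicator E \<omega> \<partial>M)"
    by (rule integral_mono) (use pt iA iS E in \<open>auto intro!: integrable_norm Bochner_Integration.integrable_diff integrable_real_indicator simp: emeasure_eq_measure\<close>)
  also have "\<dots> = \<bar>t\<bar> / b * (\<integral>\<omega>. \<bar>A \<omega>\<bar> \<partial>M) + 2 * prob E"
    using iA E by (subst Bochner_Integration.integral_add) (auto intro!: integrable_real_indicator simp: emeasure_eq_measure)
  also have "\<dots> \<le> \<bar>t\<bar> / b * sqrt (2 * real n * \<kappa>) + 2 * (real n * measure_pmf.prob \<pi> R)"
    using EA1 PE b by (intro add_mono mult_left_mono) auto
  finally show ?thesis by (simp add: B_def R_def)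
qed

end

section \<open>The compound Poisson limit law\<close>

lemma real_distribution_laplace: "real_distribution laplace_measure"
  unfolding real_distribution_def real_distribution_axioms_def
  by (intro conjI prob_space_laplace_measure) (auto simp: laplace_measure_def)

text \<open>The transform of the exponential law, obtained from the primitive
  \<open>exp (?c * x) / ?c\<close>, whose modulus decays like \<open>exp (- x)\<close>.\<close>

lemma integral_exp_decay_iexp:
  fixes t :: real
  shows "set_integrable lborel {0<..} (\<lambda>x. complex_of_real (exp (- x)) * iexp (t * x))"
    and "(LBINT x:{0<..}. complex_of_real (exp (- x)) * iexp (t * x)) = 1 / (1 - \<i> * complex_of_real t)"
proof -
  let ?f = "\<lambda>x. complex_of_real (exp (- x)) * iexp (t * x)"
  let ?c = "\<i> * complex_of_real t - 1"
  have nz: "?c \<noteq> 0" by (simp add: complex_eq_iff)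
  have "integrable lborel (exponential_density 1)"
    using prob_space.emeasure_space_1[OF prob_space_exponential_density[of 1]]
    by (intro integrableI_nn_integral_finite[where x = 1])
       (auto simp: emeasure_density exponential_density_nonneg cong: nn_integral_cong)
  then have i: "set_integrable lborel {0<..} (\<lambda>x::real. exp (- x))"
    unfolding set_integrable_def
    by (rule Bochner_Integration.integrable_bound)
       (auto simp: exponential_density_def indicator_def)
  show si: "set_integrable lborel {0<..} ?f"
    using i unfolding set_integrable_def
    by (rule Bochner_Integration.integrable_bound) (auto simp: norm_mult indicator_def)
  define F where "F x = exp (?c * complex_of_real x) / ?c" for x :: real
  have fe: "?f x = exp (?c * complex_of_real x)" for x
    by (simp add: exp_of_real[symmetric] exp_add[symmetric] algebra_simps del: exp_of_real)
  have "(LBINT x=0..\<infinity>. ?f x) = 0 - 1 / ?c"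
  proof (rule interval_integral_FTC_integrable[where F = F])
    show "(0::ereal) < \<infinity>" by simp
    show "(F has_vector_derivative ?f x) (at x)" for x
      unfolding F_def fe using nz
      by (auto intro!: derivative_eq_intros has_vector_derivative_real_field[THEN has_vector_derivative_eq_rhs] simp: o_def)
    show "isCont ?f x" for x by (intro continuous_intros)
    show "set_integrable lborel (einterval 0 \<infinity>) ?f"
      using si by (simp add: einterval_def zero_ereal_def greaterThan_def)
    have "(F \<longlongrightarrow> F 0) (at_right 0)"
      unfolding F_def using nz by (intro tendsto_intros) auto
    then show "((F \<circ> real_of_ereal) \<longlongrightarrow> 1 / ?c) (at_right 0)"
      by (simp add: zero_ereal_def ereal_tendsto_simps F_def)
    have "((\<lambda>x. exp (- x) / norm ?c) \<longlongrightarrow> 0) at_top"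
      using nz by real_asymp
    then have "(F \<longlongrightarrow> 0) at_top"
      by (rule Lim_null_comparison[rotated]) (simp add: F_def norm_divide)
    then show "((F \<circ> real_of_ereal) \<longlongrightarrow> 0) (at_left \<infinity>)"
      by (simp add: ereal_tendsto_simps)
  qed
  then show "(LBINT x:{0<..}. ?f x) = 1 / (1 - \<i> * complex_of_real t)"
    using nz by (simp add: interval_lebesgue_integral_def einterval_def zero_ereal_def greaterThan_def
        minus_divide_right)
qed

lemma char_laplace: "char laplace_measure t = 1 / (1 + complex_of_real t ^ 2)"
proof -
  let ?f = "\<lambda>t x. complex_of_real (exp (- x)) * iexp (t * x)"
  let ?h = "\<lambda>x. complex_of_real (1/2 * exp (- \<bar>x\<bar>)) * iexp (t * x)"
  let ?p = "\<lambda>x. indicator {0<..} x *\<^sub>R ?h x" and ?n = "\<lambda>x. indicator {..<0} x *\<^sub>R ?h x"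
  have p_eq: "?p x = (1/2) *\<^sub>R (indicator {0<..} x *\<^sub>R ?f t x)" for x
    by (simp add: indicator_def scaleR_conv_of_real)
  have n_eq: "?n (- x) = (1/2) *\<^sub>R (indicator {0<..} x *\<^sub>R ?f (- t) x)" for x
    by (simp add: indicator_def scaleR_conv_of_real)
  have hb: "has_bochner_integral lborel (\<lambda>x. indicator {0<..} x *\<^sub>R ?f s x) (1 / (1 - \<i> * complex_of_real s))" for s
    using integral_exp_decay_iexp[of s]
    by (simp add: has_bochner_integral_iff set_integrable_def set_lebesgue_integral_def)
  have ip: "has_bochner_integral lborel ?p ((1/2) *\<^sub>R (1 / (1 - \<i> * complex_of_real t)))"
    unfolding p_eq by (intro has_bochner_integral_scaleR_right hb)
  have "has_bochner_integral lborel (\<lambda>x. ?n (- x)) ((1/2) *\<^sub>R (1 / (1 - \<i> * complex_of_real (- t))))"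
    unfolding n_eq by (intro has_bochner_integral_scaleR_right hb)
  then have "has_bochner_integral lborel ?n ((1/2) *\<^sub>R (1 / (1 - \<i> * complex_of_real (- t))))"
    using lborel_has_bochner_integral_real_affine_iff[of "-1" ?n _ 0] by simp
  from has_bochner_integral_add[OF ip this]
  have s: "has_bochner_integral lborel (\<lambda>x. ?p x + ?n x)
     ((1/2) *\<^sub>R (1 / (1 - \<i> * complex_of_real t)) + (1/2) *\<^sub>R (1 / (1 + \<i> * complex_of_real t)))"
    by simp
  have "char laplace_measure t = (\<integral>x. (1/2 * exp (- \<bar>x\<bar>)) *\<^sub>R iexp (t * x) \<partial>lborel)"
    unfolding char_def laplace_measure_def by (subst integral_density) auto
  also have "\<dots> = (\<integral>x. ?p x + ?n x \<partial>lborel)"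
  proof (rule integral_cong_AE)
    have "AE x in lborel. x \<noteq> (0::real)" by (rule AE_lborel_singleton)
    then show "AE x in lborel. (1/2 * exp (- \<bar>x\<bar>)) *\<^sub>R iexp (t * x) = ?p x + ?n x"
      by eventually_elim (auto simp: indicator_def scaleR_conv_of_real)
  qed auto
  also have "\<dots> = (1/2) *\<^sub>R (1 / (1 - \<i> * complex_of_real t)) + (1/2) *\<^sub>R (1 / (1 + \<i> * complex_of_real t))"
    using s by (rule has_bochner_integral_integral_eq)
  also have "\<dots> = 1 / (1 + complex_of_real t ^ 2)"
  proof -
    have nz: "1 - \<i> * complex_of_real t \<noteq> 0" "1 + \<i> * complex_of_real t \<noteq> 0"
      by (auto simp: complex_eq_iff)
    have prod: "1 + complex_of_real t ^ 2 = (1 - \<i> * complex_of_real t) * (1 + \<i> * complex_of_real t)"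
      by (simp add: algebra_simps power2_eq_square)
    have "(1/2) *\<^sub>R (1 / x) + (1/2) *\<^sub>R (1 / y) = 1 / (x * y)" if "x \<noteq> 0" "y \<noteq> 0" "x + y = 2" for x y :: complex
    proof -
      have "1 / x + 1 / y = 2 / (x * y)" using that by (simp add: add_frac_eq add.commute)
      then show ?thesis by (simp flip: scaleR_right_distrib) (simp add: scaleR_conv_of_real)
    qed
    then show ?thesis unfolding prod using nz by simp
  qed
  finally show ?thesis .
qed

text \<open>Only the first N coordinates enter, so the integral passes to a finite product, where it
  factorises.\<close>

lemma char_laplace_sum:
  "(\<integral>\<eta>. iexp (t * (\<Sum>k=1..N. \<eta> k)) \<partial>PiM {1..} (\<lambda>_::nat. laplace_measure)) = char laplace_measure t ^ N"
proof -
  interpret L: real_distribution laplace_measure by (rule real_distribution_laplace)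
  interpret product_prob_space "\<lambda>_::nat. laplace_measure" "{1..}"
    by (rule product_prob_spaceI) (rule prob_space_laplace_measure)
  let ?P = "PiM {1..} (\<lambda>_::nat. laplace_measure)"
  let ?Q = "PiM {1..N} (\<lambda>_::nat. laplace_measure)"
  have r: "(\<lambda>\<eta>. restrict \<eta> {1..N}) \<in> measurable ?P ?Q" by (rule measurable_restrict_subset) auto
  have m: "(\<lambda>\<eta>. iexp (t * (\<Sum>k=1..N. \<eta> k))) \<in> borel_measurable ?Q" by measurable
  have "(\<integral>\<eta>. iexp (t * (\<Sum>k=1..N. \<eta> k)) \<partial>?P)
    = (\<integral>\<eta>. iexp (t * (\<Sum>k=1..N. restrict \<eta> {1..N} k)) \<partial>?P)"
    by (intro Bochner_Integration.integral_cong refl arg_cong[where f = "\<lambda>s. iexp (t * s)"] sum.cong) auto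
  also have "\<dots> = (\<integral>\<eta>. iexp (t * (\<Sum>k=1..N. \<eta> k)) \<partial>distr ?P ?Q (\<lambda>\<eta>. restrict \<eta> {1..N}))"
    by (rule integral_distr[OF r m, symmetric])
  also have "distr ?P ?Q (\<lambda>\<eta>. restrict \<eta> {1..N}) = ?Q"
    by (rule distr_PiM_restrict_finite) auto
  also have "(\<integral>\<eta>. iexp (t * (\<Sum>k=1..N. \<eta> k)) \<partial>?Q) = (\<integral>\<eta>. (\<Prod>k\<in>{1..N}. iexp (t * \<eta> k)) \<partial>?Q)"
    by (simp add: sum_distrib_left exp_sum)
  also have "\<dots> = (\<Prod>k\<in>{1..N}. \<integral>x. iexp (t * x) \<partial>laplace_measure)"
    by (rule product_integral_prod) (auto intro!: L.integrable_const_bound[where B = 1])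
  finally show ?thesis by (simp add: char_def)
qed

text \<open>Conditioning on the Poisson number turns the characteristic function into the generating
  function \<open>exp (z - 1)\<close> evaluated at that of the Laplace law.\<close>

lemma char_mu_P1sL: "char mu_P1sL t = complex_of_real (exp (1 / (1 + t\<^sup>2) - 1))"
proof -
  let ?P = "PiM {1..} (\<lambda>_::nat. laplace_measure)"
  let ?N = "measure_pmf (poisson_pmf 1)"
  interpret PiM: prob_space ?P by (intro prob_space_PiM prob_space_laplace_measure)
  interpret pair: pair_prob_space ?N ?P ..
  define \<psi> where "\<psi> = 1 / (1 + t\<^sup>2)"
  have \<psi>: "0 \<le> \<psi>" "\<psi> \<le> 1" by (auto simp: \<psi>_def divide_le_eq_1 add_pos_nonneg)
  have ch: "char laplace_measure t = complex_of_real \<psi>" by (simp add: char_laplace \<psi>_def)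
  have m: "(\<lambda>w. iexp (t * (case w of (N, \<eta>) \<Rightarrow> \<Sum>k=1..N. \<eta> k))) \<in> borel_measurable (?N \<Otimes>\<^sub>M ?P)"
    using measurable_random_sum by measurable
  have "char mu_P1sL t = (\<integral>w. iexp (t * (case w of (N, \<eta>) \<Rightarrow> \<Sum>k=1..N. \<eta> k)) \<partial>(?N \<Otimes>\<^sub>M ?P))"
    unfolding char_def mu_P1sL_def by (rule integral_distr[OF measurable_random_sum]) measurable
  also have "\<dots> = (\<integral>w. (case w of (N, \<eta>) \<Rightarrow> iexp (t * (\<Sum>k=1..N. \<eta> k))) \<partial>(?N \<Otimes>\<^sub>M ?P))"
    by (rule Bochner_Integration.integral_cong) (auto split: prod.split)
  also have "\<dots> = (\<integral>N. (\<integral>\<eta>. iexp (t * (\<Sum>k=1..N. \<eta> k)) \<partial>?P) \<partial>?N)"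
  proof -
    have "integrable (?N \<Otimes>\<^sub>M ?P) (\<lambda>w. case w of (N, \<eta>) \<Rightarrow> iexp (t * (\<Sum>k=1..N. \<eta> k)))"
      by (rule pair.integrable_const_bound[where B = 1]) (use m in \<open>auto simp: split_beta'\<close>)
    from pair.integral_fst'[OF this] show ?thesis by simp
  qed
  also have "\<dots> = (\<integral>N. complex_of_real (\<psi> ^ N) \<partial>?N)"
    unfolding char_laplace_sum ch by simp
  also have "\<dots> = complex_of_real (\<integral>N. \<psi> ^ N \<partial>?N)"
    by (rule integral_complex_of_real)
  also have "(\<integral>N. \<psi> ^ N \<partial>?N) = exp (\<psi> - 1)"
  proof -
    have "(\<integral>N. \<psi> ^ N \<partial>?N) = (\<integral>N. exp (- 1) * (\<psi> ^ N / fact N) \<partial>count_space UNIV)"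
      unfolding measure_pmf_eq_density by (subst integral_density) (auto simp: mult_ac)
    also have "\<dots> = exp (- 1) * exp \<psi>"
    proof -
      have "summable (\<lambda>N. norm (exp (- 1) * (\<psi> ^ N / fact N)))"
        using summable_mult[OF summable_norm_exp[of \<psi>], of "exp (- 1)"] \<psi>
        by (simp add: divide_inverse mult.commute)
      then have "integrable (count_space UNIV) (\<lambda>N. exp (- 1) * (\<psi> ^ N / fact N))"
        by (simp add: integrable_count_space_nat_iff)
      from sums_integral_count_space_nat[OF this]
      have "(\<lambda>N. exp (- 1) * (\<psi> ^ N / fact N)) sums (\<integral>N. exp (- 1) * (\<psi> ^ N / fact N) \<partial>count_space UNIV)" .
      moreover have "(\<lambda>N. exp (- 1) * (\<psi> ^ N / fact N)) sums (exp (- 1) * exp \<psi>)"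
        using sums_mult[OF exp_converges[of \<psi>], of "exp (- 1)"] by (simp add: divide_inverse mult.commute)
      ultimately show ?thesis by (rule sums_unique2)
    qed
    also have "\<dots> = exp (\<psi> - 1)" by (simp add: exp_add[symmetric])
    finally show ?thesis .
  qed
  finally show ?thesis by (simp add: \<psi>_def)
qed

lemma real_distribution_mu_P1sL: "real_distribution mu_P1sL"
proof -
  let ?P = "PiM {1..} (\<lambda>_::nat. laplace_measure)"
  interpret PiM: prob_space ?P by (intro prob_space_PiM prob_space_laplace_measure)
  interpret pair: pair_prob_space "measure_pmf (poisson_pmf 1)" ?P ..
  show ?thesis
    unfolding mu_P1sL_def by (rule pair.real_distribution_distr) (rule measurable_random_sum)
qed

section \<open>Quantile functions\<close>

context prob_space
begin

context
  fixes W :: "'a \<Rightarrow> real"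
  assumes W [measurable]: "W \<in> borel_measurable M" and W_nonneg: "\<And>\<omega>. \<omega> \<in> space M \<Longrightarrow> 0 \<le> W \<omega>"
begin

interpretation W: real_distribution "distr M borel W"
  by (rule real_distribution_distr) (rule W)

lemma prob_greater_eq: "prob {\<omega>\<in>space M. W \<omega> > t} = 1 - cdf (distr M borel W) t"
proof -
  have "cdf (distr M borel W) t = prob {\<omega>\<in>space M. W \<omega> \<le> t}"
    unfolding cdf_def by (subst measure_distr) (auto intro!: arg_cong[where f = prob])
  moreover have "prob {\<omega>\<in>space M. W \<omega> > t} = 1 - prob {\<omega>\<in>space M. W \<omega> \<le> t}"
    using prob_neg[of "\<lambda>\<omega>. W \<omega> \<le> t"] by (simp add: not_le)
  ultimately show ?thesis by simp
qed

text \<open>The set under the infimum is closed upwards and nonempty for positive s, and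
  right-continuity of the distribution function puts the infimum into it. All later facts about
  quantiles rest on this equivalence.\<close>

lemma quantile_fun_le_iff:
  assumes s: "0 < s" and v: "0 \<le> v"
  shows "quantile_fun M W s \<le> v \<longleftrightarrow> prob {\<omega>\<in>space M. W \<omega> > v} \<le> s"
proof -
  let ?C = "cdf (distr M borel W)"
  let ?S = "{t. t \<ge> 0 \<and> prob {\<omega>\<in>space M. W \<omega> > t} \<le> s}"
  have bdd: "bdd_below ?S" by (auto intro!: bdd_belowI[of _ 0])
  have ne: "?S \<noteq> {}"
  proof -
    have "(?C \<longlongrightarrow> 1) at_top" by (rule W.cdf_lim_at_top_prob)
    then have "\<forall>\<^sub>F t in at_top. 1 - s < ?C t" using s by (intro order_tendstoD) auto
    then have "\<forall>\<^sub>F t in at_top. 1 - s < ?C t \<and> 0 \<le> t" using eventually_ge_at_top[of 0] by (rule eventually_conj)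
    then obtain t where "1 - s < ?C t" "0 \<le> t" by (auto dest: eventually_happens)
    then show ?thesis by (auto simp: prob_greater_eq intro!: exI[of _ t])
  qed
  show ?thesis
  proof
    assume "prob {\<omega>\<in>space M. W \<omega> > v} \<le> s"
    then show "quantile_fun M W s \<le> v"
      unfolding quantile_fun_def using v bdd by (intro cInf_lower) auto
  next
    assume le: "quantile_fun M W s \<le> v"
    have gt: "1 - s \<le> ?C v'" if "v < v'" for v'
    proof -
      have "Inf ?S < v'" using le that by (simp add: quantile_fun_def)
      then obtain t where t: "t \<in> ?S" "t < v'" using cInf_lessD[OF ne] by blast
      then have "1 - s \<le> ?C t" by (simp add: prob_greater_eq)
      also have "\<dots> \<le> ?C v'" using t by (intro W.cdf_nondecreasing) auto
      finally show ?thesis .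
    qed
    have "(?C \<longlongrightarrow> ?C v) (at_right v)"
      using W.cdf_is_right_cont[of v] by (simp add: continuous_within)
    moreover have "\<forall>\<^sub>F v' in at_right v. 1 - s \<le> ?C v'"
      using eventually_at_right_less[of v] by eventually_elim (rule gt)
    ultimately have "1 - s \<le> ?C v"
      by (rule tendsto_lowerbound) simp
    then show "prob {\<omega>\<in>space M. W \<omega> > v} \<le> s" by (simp add: prob_greater_eq)
  qed
qed

lemma quantile_fun_nonneg:
  assumes "0 < s"
  shows "0 \<le> quantile_fun M W s"
proof (rule ccontr)
  assume "\<not> 0 \<le> quantile_fun M W s"
  then have "prob {\<omega>\<in>space M. W \<omega> > 0} \<le> s"
    using quantile_fun_le_iff[OF assms, of 0] by simp
  then have "0 \<in> {t. t \<ge> 0 \<and> prob {\<omega>\<in>space M. W \<omega> > t} \<le> s}" by simp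
  then have "0 \<le> quantile_fun M W s"
    unfolding quantile_fun_def by (intro cInf_greatest) auto
  then show False using \<open>\<not> 0 \<le> quantile_fun M W s\<close> by simp
qed

abbreviation unit_uniform :: "real measure" where
  "unit_uniform \<equiv> restrict_space lborel {0<..<1}"

lemma quantile_fun_le_set:
  "{s \<in> space unit_uniform. quantile_fun M W s \<le> v}
    = (if v < 0 then {} else {s. 0 < s \<and> s < 1 \<and> prob {\<omega>\<in>space M. W \<omega> > v} \<le> s})"
  using quantile_fun_le_iff quantile_fun_nonneg by (force simp: space_restrict_space)

lemma measurable_quantile_fun [measurable]: "quantile_fun M W \<in> borel_measurable unit_uniform"
  unfolding borel_measurable_iff_le
proof
  fix v
  have "{s. 0 < s \<and> s < 1 \<and> prob {\<omega>\<in>space M. W \<omega> > v} \<le> s} = {0<..<1} \<inter> {prob {\<omega>\<in>space M. W \<omega> > v}..}"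
    by auto
  then show "{s \<in> space unit_uniform. quantile_fun M W s \<le> v} \<in> sets unit_uniform"
    unfolding quantile_fun_le_set by (auto simp: sets_restrict_space)
qed

lemma prob_space_unit_uniform: "prob_space unit_uniform"
  by (rule prob_spaceI) (simp add: emeasure_restrict_space space_restrict_space)

text \<open>For a uniform variable the event that the quantile is at most v is the event that the
  variable is at least \<open>P(W > v)\<close>, whose probability is the distribution function of W
  at v.\<close>

lemma distr_quantile_fun: "distr unit_uniform borel (quantile_fun M W) = distr M borel W"
proof (rule cdf_unique)
  interpret U: prob_space unit_uniform by (rule prob_space_unit_uniform)
  show "real_distribution (distr unit_uniform borel (quantile_fun M W))"
    by (rule U.real_distribution_distr) measurable
  show "real_distribution (distr M borel W)" by unfold_locales
  show "cdf (distr unit_uniform borel (quantile_fun M W)) = cdf (distr M borel W)"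
  proof
    fix v
    have "cdf (distr unit_uniform borel (quantile_fun M W)) v
      = measure unit_uniform {s \<in> space unit_uniform. quantile_fun M W s \<le> v}"
      unfolding cdf_def by (subst measure_distr) (auto intro!: arg_cong[where f = "measure unit_uniform"])
    also have "\<dots> = cdf (distr M borel W) v"
    proof (cases "v < 0")
      case True
      have "cdf (distr M borel W) v = prob {\<omega>\<in>space M. W \<omega> \<le> v}"
        unfolding cdf_def by (subst measure_distr) (auto intro!: arg_cong[where f = prob])
      also have "{\<omega>\<in>space M. W \<omega> \<le> v} = {}" using True W_nonneg by force
      finally show ?thesis using True unfolding quantile_fun_le_set by simp
    next
      case False
      let ?q = "prob {\<omega>\<in>space M. W \<omega> > v}"
      have "{s. 0 < s \<and> s < 1 \<and> ?q \<le> s} = {0<..<1} \<inter> {?q..}" by auto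
      then have "measure unit_uniform {s \<in> space unit_uniform. quantile_fun M W s \<le> v} = measure lborel ({0<..<1} \<inter> {?q..})"
        unfolding quantile_fun_le_set using False by (simp add: measure_restrict_space)
      also have "\<dots> = 1 - ?q"
      proof (cases "?q = 0")
        case True
        then have "{0<..<1} \<inter> {?q..} = {0<..<1}" by auto
        then show ?thesis using True by simp
      next
        case False
        then have "0 < ?q" by (simp add: less_le)
        then have "{0<..<1} \<inter> {?q..} = {?q..<1}" by auto
        then show ?thesis by simp
      qed
      finally show ?thesis by (simp add: prob_greater_eq)
    qed
    finally show "cdf (distr unit_uniform borel (quantile_fun M W)) v = cdf (distr M borel W) v" .
  qed
qed

text \<open>Split the quantile at the level A. Values above A are counted on the whole unit
  interval, where they give a truncated second moment of W; values below A cost at most the square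
  of A on (0, u).\<close>

lemma integral_quantile_square_le:
  assumes int: "integrable M (\<lambda>\<omega>. (W \<omega>)\<^sup>2)" and u: "0 \<le> u" "u \<le> 1" and A: "0 \<le> A"
  shows "0 \<le> (LBINT s:{0<..<u}. (quantile_fun M W s)\<^sup>2)"
    and "(LBINT s:{0<..<u}. (quantile_fun M W s)\<^sup>2)
    \<le> (\<integral>\<omega>. indicator {A<..} (W \<omega>) * (W \<omega>)\<^sup>2 \<partial>M) + u * A\<^sup>2"
proof -
  interpret U: prob_space unit_uniform by (rule prob_space_unit_uniform)
  let ?Q = "quantile_fun M W"
  have eq: "(LBINT s:{0<..<u}. (?Q s)\<^sup>2) = (\<integral>s. indicator {0<..<u} s * (?Q s)\<^sup>2 \<partial>unit_uniform)"
    unfolding set_lebesgue_integral_def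
    by (subst integral_restrict_space) (use u in \<open>auto intro!: Bochner_Integration.integral_cong simp: indicator_def\<close>)
  show "0 \<le> (LBINT s:{0<..<u}. (?Q s)\<^sup>2)"
    unfolding eq by (intro Bochner_Integration.integral_nonneg) auto
  have idistr: "integrable (distr M borel W) (\<lambda>w. w\<^sup>2)"
    using int by (subst integrable_distr_eq) auto
  have iQ: "integrable unit_uniform (\<lambda>s. (?Q s)\<^sup>2)"
    using idistr unfolding distr_quantile_fun[symmetric] by (subst (asm) integrable_distr_eq) auto
  have iQA: "integrable unit_uniform (\<lambda>s. indicator {A<..} (?Q s) * (?Q s)\<^sup>2)"
    by (rule Bochner_Integration.integrable_bound[OF iQ]) (auto simp: indicator_def)
  have mu [measurable]: "{0<..<u} \<in> sets (borel :: real measure)" by simp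
  have iu: "integrable unit_uniform (\<lambda>s. indicator {0<..<u} s * A\<^sup>2)"
    by (rule U.integrable_const_bound[where B = "A\<^sup>2"])
       (auto simp: indicator_def intro!: measurable_restrict_space1)
  have "(LBINT s:{0<..<u}. (?Q s)\<^sup>2)
    \<le> (\<integral>s. indicator {A<..} (?Q s) * (?Q s)\<^sup>2 + indicator {0<..<u} s * A\<^sup>2 \<partial>unit_uniform)"
    unfolding eq
  proof (rule integral_mono)
    show "integrable unit_uniform (\<lambda>s. indicator {0<..<u} s * (?Q s)\<^sup>2)"
    proof (rule Bochner_Integration.integrable_bound[OF iQ])
      have "(\<lambda>s. indicator {0<..<u} s :: real) \<in> borel_measurable unit_uniform"
        by (rule measurable_restrict_space1) simp
      then show "(\<lambda>s. indicator {0<..<u} s * (?Q s)\<^sup>2) \<in> borel_measurable unit_uniform"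
        by (intro borel_measurable_times borel_measurable_power measurable_quantile_fun)
    qed (auto simp: indicator_def)
    fix s assume s: "s \<in> space unit_uniform"
    then have "0 \<le> ?Q s" by (intro quantile_fun_nonneg) (auto simp: space_restrict_space)
    then show "indicator {0<..<u} s * (?Q s)\<^sup>2 \<le> indicator {A<..} (?Q s) * (?Q s)\<^sup>2 + indicator {0<..<u} s * A\<^sup>2"
      by (auto simp: indicator_def intro: power_mono)
  qed (use iQA iu in simp)
  also have "\<dots> = (\<integral>s. indicator {A<..} (?Q s) * (?Q s)\<^sup>2 \<partial>unit_uniform) + (\<integral>s. indicator {0<..<u} s * A\<^sup>2 \<partial>unit_uniform)"
    by (rule Bochner_Integration.integral_add[OF iQA iu])
  also have "(\<integral>s. indicator {0<..<u} s * A\<^sup>2 \<partial>unit_uniform) = u * A\<^sup>2"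
  proof -
    have "(\<integral>s. indicator {0<..<u} s * A\<^sup>2 \<partial>unit_uniform) = (\<integral>s. indicator {0<..<1} s *\<^sub>R (indicator {0<..<u} s * A\<^sup>2) \<partial>lborel)"
      by (rule integral_restrict_space) simp
    also have "\<dots> = (\<integral>s. indicator {0<..<u} s * A\<^sup>2 \<partial>lborel)"
      by (rule Bochner_Integration.integral_cong[OF refl]) (use u in \<open>auto simp: indicator_def\<close>)
    also have "\<dots> = u * A\<^sup>2" using u by simp
    finally show ?thesis .
  qed
  also have "(\<integral>s. indicator {A<..} (?Q s) * (?Q s)\<^sup>2 \<partial>unit_uniform)
    = (\<integral>w. indicator {A<..} w * w\<^sup>2 \<partial>distr unit_uniform borel ?Q)"
    by (rule integral_distr[symmetric]) measurable
  also have "\<dots> = (\<integral>\<omega>. indicator {A<..} (W \<omega>) * (W \<omega>)\<^sup>2 \<partial>M)"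
    unfolding distr_quantile_fun by (rule integral_distr) measurable
  finally show "(LBINT s:{0<..<u}. (?Q s)\<^sup>2)
    \<le> (\<integral>\<omega>. indicator {A<..} (W \<omega>) * (W \<omega>)\<^sup>2 \<partial>M) + u * A\<^sup>2" .
qed

end

end

section \<open>A chain with sparse levels\<close>

lemma halving_summable:
  fixes w :: "nat \<Rightarrow> real"
  assumes "\<And>i. 0 \<le> w i" "\<And>i. w (Suc i) \<le> w i / 2"
  shows "summable w" and "suminf w \<le> 2 * w 0"
proof -
  have le: "w i \<le> w 0 * (1/2) ^ i" for i
  proof (induction i)
    case (Suc i)
    then show ?case using assms(2)[of i] by simp
  qed simp
  have s: "(\<lambda>i. w 0 * (1/2) ^ i) sums (w 0 * (1 / (1 - 1/2)))"
    by (intro sums_mult geometric_sums) simp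
  show "summable w"
    by (rule summable_comparison_test'[OF sums_summable[OF s]]) (use le assms(1) in auto)
  then have "suminf w \<le> (\<Sum>i. w 0 * (1/2) ^ i)"
    by (intro suminf_le le sums_summable[OF s])
  then show "suminf w \<le> 2 * w 0" using sums_unique[OF s] by simp
qed

text \<open>Consecutive values have ratio \<open>(j + 2) ^ 4\<close>. The fourth power leaves room
  for the factors of order j lost when all lower levels are added up or when a time scale is
  shortened by such a factor.\<close>

definition level_var :: "nat \<Rightarrow> real" where "level_var j = real (fact (Suc j)) ^ 4"

lemma level_var_ge_1: "1 \<le> level_var j"
  unfolding level_var_def using fact_ge_1[of "Suc j", where 'a = real] by (intro one_le_power) (simp del: fact_Suc)

lemma level_var_Suc: "level_var (Suc j) = real (j + 2) ^ 4 * level_var j"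
proof -
  have "real (fact (Suc (Suc j))) = real (j + 2) * real (fact (Suc j))"
    unfolding fact_Suc[of "Suc j"] of_nat_mult by simp
  then show ?thesis unfolding level_var_def by (simp only: power_mult_distrib)
qed

lemma level_var_mono: "i \<le> j \<Longrightarrow> level_var i \<le> level_var j"
  unfolding level_var_def by (intro power_mono) (auto intro!: fact_mono simp del: fact_Suc)

lemma level_var_ge: "real (Suc j) \<le> level_var j"
proof -
  have "real (Suc j) \<le> real (fact (Suc j))" by (rule of_nat_mono) (rule fact_ge_self)
  also have "\<dots> = real (fact (Suc j)) ^ 1" by simp
  also have "\<dots> \<le> level_var j"
    unfolding level_var_def using fact_ge_1[of "Suc j", where 'a = real]
    by (intro power_increasing) (simp_all del: fact_Suc)
  finally show ?thesis .
qed

text \<open>Level \<open>j\<close> of the chain consists of the two states \<open>\<plusminus>amp j\<close>, of joint mass \<open>P j\<close>, left at rate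
  \<open>r j\<close>; its contribution to the limiting variance per step is of order \<open>level_var j\<close>. The remaining
  mass sits in the state \<open>0\<close>.\<close>

locale sparse_blocks =
  fixes P r :: "nat \<Rightarrow> real"
  assumes P_pos: "0 < P j" and r_pos: "0 < r j" and r_le: "r j \<le> 1/4"
    and P_le: "P j \<le> (1/2) ^ j / 16"
    and r_Suc: "level_var (Suc j) * r (Suc j) \<le> (1/2) ^ Suc j * r j"
    and P_Suc: "P (Suc j) \<le> (1/2) ^ Suc (Suc j) * P j * r j"
    and amp_increasing: "level_var j * r j / P j < level_var (Suc j) * r (Suc j) / P (Suc j)"
begin

text \<open>A level of mass P and rate r contributes about \<open>2 * P * amp^2 / r\<close> per step
  to the variance of long sums. The amplitude makes this equal to
  \<open>2 * level_var\<close>.\<close>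

definition amp :: "nat \<Rightarrow> real" where "amp j = sqrt (level_var j * r j / P j)"
definition level_mass :: "nat \<Rightarrow> real" where "level_mass j = level_var j * r j"
definition state :: "nat \<Rightarrow> real" where "state i = (case i of 0 \<Rightarrow> 0 | Suc j \<Rightarrow> amp j)"
text \<open>The rate has to be a function of the state, so the level is recovered from the modulus,
  which works because the amplitudes are distinct. State 0 is refreshed at every step.\<close>

definition rate :: "real \<Rightarrow> real" where
  "rate x = (if \<exists>j. \<bar>x\<bar> = amp j then r (THE j. \<bar>x\<bar> = amp j) else 1)"
definition level_pmf :: "nat pmf" where
  "level_pmf = embed_pmf (\<lambda>i. case i of 0 \<Rightarrow> 1 - suminf P | Suc j \<Rightarrow> P j)"
text \<open>An independent fair sign makes the law symmetric; the two signs of the state 0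
  collapse.\<close>

definition stat :: "real pmf" where
  "stat = map_pmf (\<lambda>w. if snd w then state (fst w) else - state (fst w))
    (pair_pmf level_pmf (pmf_of_set (UNIV :: bool set)))"

lemma level_var_pos: "0 < level_var j" using level_var_ge_1[of j] by linarith

lemma amp_pos: "0 < amp j"
  unfolding amp_def using level_var_pos r_pos P_pos by (intro real_sqrt_gt_zero) simp

lemma amp_sq: "(amp j)\<^sup>2 = level_var j * r j / P j"
  unfolding amp_def using level_var_pos[of j] r_pos[of j] P_pos[of j] by (intro real_sqrt_pow2) simp

lemma P_amp: "P j * (amp j)\<^sup>2 = level_mass j"
  unfolding amp_sq level_mass_def using P_pos[of j] by simp

lemma strict_mono_amp: "strict_mono amp"
  unfolding amp_def by (rule strict_mono_Suc_iff[THEN iffD2]) (use amp_increasing in simp)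

lemma amp_less_iff: "amp i < amp j \<longleftrightarrow> i < j" and amp_eq_iff: "amp i = amp j \<longleftrightarrow> i = j"
  using strict_mono_amp strict_mono_less strict_mono_eq by blast+

lemma rate_amp: "\<bar>x\<bar> = amp j \<Longrightarrow> rate x = r j"
  by (auto simp: rate_def amp_eq_iff)

lemma rate_0: "rate 0 = 1"
  using amp_pos by (auto simp: rate_def less_le)

lemma r_Suc_le: "r (Suc j) \<le> (1/2) ^ Suc j * r j"
proof -
  have "1 * r (Suc j) \<le> level_var (Suc j) * r (Suc j)"
    using level_var_ge_1 r_pos[of "Suc j"] by (intro mult_right_mono) auto
  then show ?thesis using r_Suc[of j] by simp
qed

lemma r_Suc_half: "r (Suc j) \<le> r j / 2"
proof -
  have "(1/2) ^ Suc j * r j \<le> (1/2) ^ 1 * r j"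
    using r_pos[of j] by (intro mult_right_mono power_decreasing) auto
  then show ?thesis using r_Suc_le[of j] by simp
qed

lemma r_antimono: "i \<le> j \<Longrightarrow> r j \<le> r i"
proof (rule lift_Suc_antimono_le[of r])
  show "r (Suc n) \<le> r n" for n using r_Suc_half[of n] r_pos[of n] by simp
qed

lemma r_strict: "i < j \<Longrightarrow> r j < r i"
  using r_antimono[of "Suc i" j] r_Suc_half[of i] r_pos[of i] by simp

lemma P_Suc_half: "P (Suc j) \<le> P j / 2"
proof -
  have "(1/2 :: real) ^ Suc (Suc j) \<le> (1/2) ^ 1" by (rule power_decreasing) auto
  then have "(1/2) ^ Suc (Suc j) * (P j * r j) \<le> (1/2) * (P j * 1)"
    using r_pos[of j] r_le[of j] P_pos[of j] by (intro mult_mono) auto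
  then show ?thesis using P_Suc[of j] unfolding mult.assoc mult_1_right by linarith
qed

lemma summable_P: "summable P" and suminf_P: "suminf P \<le> 1/8" "0 \<le> suminf P"
proof -
  show s: "summable P" by (rule halving_summable) (use P_pos P_Suc_half in \<open>auto intro: less_imp_le\<close>)
  show "suminf P \<le> 1/8"
    using halving_summable(2)[of P] P_pos P_Suc_half P_le[of 0] by (force intro: less_imp_le)
  show "0 \<le> suminf P" by (rule suminf_nonneg[OF s]) (use P_pos in \<open>auto intro: less_imp_le\<close>)
qed

lemma level_mass_pos: "0 < level_mass j"
  unfolding level_mass_def using level_var_pos r_pos by simp

lemma level_mass_Suc_half: "level_mass (Suc j) \<le> level_mass j / 2"
proof -
  have "level_mass (Suc j) \<le> (1/2) ^ Suc j * r j" using r_Suc by (simp add: level_mass_def)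
  also have "\<dots> \<le> (1/2) ^ 1 * r j" using r_pos[of j] by (intro mult_right_mono power_decreasing) auto
  also have "\<dots> \<le> (1/2) * level_mass j"
    unfolding level_mass_def using level_var_ge_1[of j] r_pos[of j] mult_right_mono[of 1 "level_var j" "r j"] by simp
  finally show ?thesis by simp
qed

lemma summable_level_mass: "summable level_mass"
  and suminf_level_mass_tail: "(\<Sum>i. level_mass (i + k)) \<le> 2 * level_mass k"
proof -
  show "summable level_mass"
    by (rule halving_summable) (use level_mass_pos level_mass_Suc_half in \<open>auto intro: less_imp_le\<close>)
  show "(\<Sum>i. level_mass (i + k)) \<le> 2 * level_mass k"
    using halving_summable(2)[of "\<lambda>i. level_mass (i + k)"] level_mass_pos level_mass_Suc_half
    by (simp add: less_imp_le)
qed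

lemma pmf_level: "pmf level_pmf i = (case i of 0 \<Rightarrow> 1 - suminf P | Suc j \<Rightarrow> P j)"
  unfolding level_pmf_def
proof (rule pmf_embed_pmf)
  define w where "w i = (case i of 0 \<Rightarrow> 1 - suminf P | Suc j \<Rightarrow> P j)" for i
  have w: "w 0 = 1 - suminf P" "(\<lambda>j. w (Suc j)) = P" by (simp_all add: w_def)
  have nn: "0 \<le> w i" for i
    using suminf_P P_pos by (cases i) (auto simp: w_def intro: less_imp_le)
  then show "0 \<le> (case i of 0 \<Rightarrow> 1 - suminf P | Suc j \<Rightarrow> P j)" for i by (simp only: w_def)
  have "w sums (suminf P + w 0)"
    by (rule sums_Suc) (simp only: w(2) summable_sums[OF summable_P])
  then have "w sums 1" unfolding w(1) by simp
  then have "(\<Sum>i. ennreal (w i)) = ennreal 1"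
    by (intro suminf_ennreal_eq nn)
  then have "(\<integral>\<^sup>+i. ennreal (w i) \<partial>count_space UNIV) = 1"
    by (simp add: nn_integral_count_space_nat)
  then show "(\<integral>\<^sup>+i. ennreal (case i of 0 \<Rightarrow> 1 - suminf P | Suc j \<Rightarrow> P j) \<partial>count_space UNIV) = 1"
    by (simp only: w_def)
qed

lemma level_integral:
  fixes \<psi> :: "nat \<Rightarrow> real"
  assumes s: "summable (\<lambda>j. P j * \<bar>\<psi> (Suc j)\<bar>)"
  shows "integrable (measure_pmf level_pmf) \<psi>"
    and "(\<integral>i. \<psi> i \<partial>level_pmf) = (1 - suminf P) * \<psi> 0 + (\<Sum>j. P j * \<psi> (Suc j))"
proof -
  let ?f = "\<lambda>i. pmf level_pmf i * \<psi> i"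
  have "summable (\<lambda>i. norm (?f i))"
    using s by (subst summable_Suc_iff[symmetric]) (simp add: pmf_level abs_mult abs_of_pos[OF P_pos])
  then have i: "integrable (count_space UNIV) ?f" by (simp add: integrable_count_space_nat_iff)
  then show "integrable (measure_pmf level_pmf) \<psi>"
    unfolding measure_pmf_eq_density by (subst integrable_density) auto
  have "(\<integral>i. \<psi> i \<partial>level_pmf) = (\<integral>i. ?f i \<partial>count_space UNIV)"
    unfolding measure_pmf_eq_density by (subst integral_density) auto
  also have "\<dots> = (\<Sum>i. ?f i)" by (rule integral_count_space_nat[OF i])
  also have "\<dots> = ?f 0 + (\<Sum>j. ?f (Suc j))"
    using suminf_split_head[of ?f] i by (simp add: integrable_count_space_nat_iff summable_norm_cancel)
  finally show "(\<integral>i. \<psi> i \<partial>level_pmf) = (1 - suminf P) * \<psi> 0 + (\<Sum>j. P j * \<psi> (Suc j))"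
    by (simp add: pmf_level)
qed

text \<open>Even integrands do not see the random sign, so integrals become series over the
  levels.\<close>

lemma even_integral:
  fixes \<phi> :: "real \<Rightarrow> real"
  assumes even: "\<And>x. \<phi> (- x) = \<phi> x" and s: "summable (\<lambda>j. P j * \<bar>\<phi> (amp j)\<bar>)"
  shows "integrable (measure_pmf stat) \<phi>"
    and "(\<integral>x. \<phi> x \<partial>stat) = (1 - suminf P) * \<phi> 0 + (\<Sum>j. P j * \<phi> (amp j))"
proof -
  let ?q = "pair_pmf level_pmf (pmf_of_set (UNIV :: bool set))"
  have e: "\<phi> (if snd w then state (fst w) else - state (fst w)) = \<phi> (state (fst w))" for w :: "nat \<times> bool"
    using even by simp
  have s': "summable (\<lambda>j. P j * \<bar>\<phi> (state (Suc j))\<bar>)" using s by (simp add: state_def)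
  have "integrable (measure_pmf (map_pmf fst ?q)) (\<lambda>i. \<phi> (state i))"
    using level_integral(1)[OF s'] by (simp only: map_fst_pair_pmf)
  then show "integrable (measure_pmf stat) \<phi>"
    by (simp only: stat_def integrable_map_pmf_eq e)
  have "(\<integral>x. \<phi> x \<partial>stat) = (\<integral>i. \<phi> (state i) \<partial>map_pmf fst ?q)"
    by (simp only: stat_def integral_map_pmf e)
  also have "\<dots> = (1 - suminf P) * \<phi> (state 0) + (\<Sum>j. P j * \<phi> (state (Suc j)))"
    unfolding map_fst_pair_pmf by (rule level_integral(2)[OF s'])
  finally show "(\<integral>x. \<phi> x \<partial>stat) = (1 - suminf P) * \<phi> 0 + (\<Sum>j. P j * \<phi> (amp j))"
    by (simp add: state_def)
qed

lemma even_integral_bounded: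
  fixes \<phi> :: "real \<Rightarrow> real"
  assumes "\<And>x. \<phi> (- x) = \<phi> x" "\<And>x. \<bar>\<phi> x\<bar> \<le> B"
  shows "summable (\<lambda>j. P j * \<phi> (amp j))"
    and "(\<integral>x. \<phi> x \<partial>stat) = (1 - suminf P) * \<phi> 0 + (\<Sum>j. P j * \<phi> (amp j))"
proof -
  have s: "summable (\<lambda>j. P j * \<bar>\<phi> (amp j)\<bar>)"
  proof (rule summable_comparison_test'[OF summable_mult2[OF summable_P, of B]])
    show "norm (P j * \<bar>\<phi> (amp j)\<bar>) \<le> P j * B" for j
      unfolding real_norm_def abs_mult abs_abs abs_of_pos[OF P_pos]
      by (intro mult_left_mono assms(2) less_imp_le P_pos)
  qed
  show "summable (\<lambda>j. P j * \<phi> (amp j))"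
    by (rule summable_norm_cancel) (use s in \<open>simp only: real_norm_def abs_mult abs_of_pos[OF P_pos]\<close>)
  show "(\<integral>x. \<phi> x \<partial>stat) = (1 - suminf P) * \<phi> 0 + (\<Sum>j. P j * \<phi> (amp j))"
    by (rule even_integral(2)[OF assms(1) s])
qed

sublocale refresh_chain stat rate
proof
  show "0 < rate x" "rate x \<le> 1" for x
    using r_pos r_le order_trans[OF r_le, of 1] by (auto simp: rate_def)
  show "rate (- x) = rate x" for x by (simp add: rate_def)
  let ?B = "pmf_of_set (UNIV :: bool set)" and ?F = "\<lambda>w. if snd w then state (fst w) else - state (fst w)"
  have "map_pmf Not ?B = ?B"
  proof -
    have "range Not = UNIV" by (auto intro: image_eqI[of _ Not "\<not> _"])
    then show ?thesis by (subst map_pmf_of_set_inj) (auto simp: inj_def)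
  qed
  then have "pair_pmf level_pmf ?B = map_pmf (apsnd Not) (pair_pmf level_pmf ?B)"
    using pair_map_pmf2[of level_pmf Not ?B] by simp
  then have "stat = map_pmf ?F (map_pmf (apsnd Not) (pair_pmf level_pmf ?B))"
    unfolding stat_def by simp
  also have "\<dots> = map_pmf uminus stat"
    unfolding stat_def map_pmf_comp by (intro map_pmf_cong) auto
  finally show "map_pmf uminus stat = stat" by simp
qed

lemma Z_ge: "1/2 \<le> Z"
proof -
  have "Z = (1 - suminf P) * rate 0 + (\<Sum>j. P j * rate (amp j))"
    unfolding Z_def by (rule even_integral_bounded(2)[where B = 1]) (auto simp: p_even p_bounds)
  moreover have "0 \<le> (\<Sum>j. P j * rate (amp j))"
    using P_pos p_bounds by (intro suminf_nonneg even_integral_bounded(1)[where B = 1]) (auto simp: p_even less_imp_le)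
  ultimately show ?thesis using suminf_P by (simp add: rate_0)
qed

text \<open>The state 0 is refreshed with certainty and drops out as soon as n is positive.\<close>

lemma H_eq:
  assumes "0 < n"
  shows "summable (\<lambda>j. P j * (1 - r j) ^ n)" and "H n = (\<Sum>j. P j * (1 - r j) ^ n)"
  using even_integral_bounded[of "\<lambda>x. (1 - rate x) ^ n" 1] assms q_power_bounds
  by (simp_all add: p_even rate_0 rate_amp amp_pos less_imp_le H_def)

lemma prob_level: "measure_pmf.prob stat {amp j, - amp j} = P j"
proof -
  have "measure_pmf.prob stat {amp j, - amp j} = (\<integral>x. indicator {amp j, - amp j} x \<partial>stat)" by simp
  also have "\<dots> = (1 - suminf P) * indicator {amp j, - amp j} 0 + (\<Sum>i. P i * indicator {amp j, - amp j} (amp i))"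
    by (rule even_integral_bounded(2)[where B = 1]) (auto simp: indicator_def)
  also have "(\<Sum>i. P i * indicator {amp j, - amp j} (amp i)) = (\<Sum>i. if i = j then P i else 0)"
  proof (rule suminf_cong)
    fix i
    have "amp i \<noteq> - amp j" using amp_pos[of i] amp_pos[of j] by linarith
    then show "P i * indicator {amp j, - amp j} (amp i) = (if i = j then P i else 0)"
      by (simp add: indicator_def amp_eq_iff)
  qed
  also have "\<dots> = P j" using sums_single[of j P] by (rule sums_unique[symmetric])
  finally show ?thesis using amp_pos[of j] by (simp add: indicator_def)
qed

lemma even_weighted_square:
  assumes "\<And>x. \<phi> (- x) = \<phi> x" "\<And>x. \<bar>\<phi> x\<bar> \<le> B"
  shows "summable (\<lambda>j. level_mass j * \<phi> (amp j))"
    and "integrable (measure_pmf stat) (\<lambda>x. \<phi> x * x\<^sup>2)"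
    and "(\<integral>x. \<phi> x * x\<^sup>2 \<partial>stat) = (\<Sum>j. level_mass j * \<phi> (amp j))"
proof -
  have eq: "P j * (c * (amp j)\<^sup>2) = level_mass j * c" for c j
    using P_amp[of j] by (simp add: mult_ac)
  have s: "summable (\<lambda>j. level_mass j * \<bar>\<phi> (amp j)\<bar>)"
  proof (rule summable_comparison_test'[OF summable_mult2[OF summable_level_mass, of B]])
    show "norm (level_mass j * \<bar>\<phi> (amp j)\<bar>) \<le> level_mass j * B" for j
      unfolding real_norm_def abs_mult abs_abs abs_of_pos[OF level_mass_pos]
      by (intro mult_left_mono assms(2) less_imp_le level_mass_pos)
  qed
  show "summable (\<lambda>j. level_mass j * \<phi> (amp j))"
    by (rule summable_norm_cancel) (use s in \<open>simp only: real_norm_def abs_mult abs_of_pos[OF level_mass_pos]\<close>)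
  have s': "summable (\<lambda>j. P j * \<bar>\<phi> (amp j) * (amp j)\<^sup>2\<bar>)"
    using s by (simp add: abs_mult eq)
  show "integrable (measure_pmf stat) (\<lambda>x. \<phi> x * x\<^sup>2)"
    by (rule even_integral(1)[OF _ s']) (simp add: assms)
  show "(\<integral>x. \<phi> x * x\<^sup>2 \<partial>stat) = (\<Sum>j. level_mass j * \<phi> (amp j))"
    using even_integral(2)[OF _ s'] assms by (simp add: eq)
qed

lemma square_integrable: "integrable (measure_pmf stat) (\<lambda>x. x\<^sup>2)"
  using even_weighted_square(2)[of "\<lambda>_. 1" 1] by simp

lemma sum_squares_ge: "real L ^ 3 / 3 \<le> (\<Sum>k<L. (real (Suc k))\<^sup>2)"
proof (induction L)
  case (Suc L)
  have "real (Suc L) ^ 3 / 3 \<le> real L ^ 3 / 3 + (real (Suc L))\<^sup>2"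
    by (simp add: power3_eq_cube power2_eq_square algebra_simps)
  then show ?case using Suc by simp
qed simp

text \<open>Level j alone contributes at least \<open>level_var j / 384\<close>, however small its
  rate. Holding times up to \<open>1 / (2 * r j)\<close> are survived with probability at least 1/2,
  and the sum of their squares is of order \<open>1 / r j ^ 3\<close>, which cancels the powers of
  the rate.\<close>

lemma block_variance_unbounded: "\<exists>L a. 0 \<le> a \<and> C \<le> block_variance L a"
proof -
  \<comment> \<open>384 is the product of 2 from the survival probability, 64 from
    \<open>1 / (4 * r j) \<le> L\<close> cubed, and 3 from the sum of squares.\<close>
  obtain j :: nat where j: "384 * C \<le> real j" using real_arch_simple by blast
  define L where "L = nat \<lfloor>1 / (2 * r j)\<rfloor>"
  have rj: "0 < r j" "r j \<le> 1/4" using r_pos r_le by auto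
  have big: "2 \<le> 1 / (2 * r j)" using rj by (simp add: field_simps)
  have L1: "real L \<le> 1 / (2 * r j)" unfolding L_def using big by linarith
  have L2: "1 / (4 * r j) \<le> real L"
  proof -
    have "1 / (2 * r j) - 1 \<le> real L" unfolding L_def by linarith
    moreover have "1 \<le> 1 / (4 * r j)" using rj by (simp add: field_simps)
    moreover have "1 / (2 * r j) = 1 / (4 * r j) + 1 / (4 * r j)" using rj by (simp add: field_simps)
    ultimately show ?thesis by linarith
  qed
  let ?I = "\<lambda>x. indicator {- amp j..amp j} x :: real"
  have block: "r j ^ 3 * level_var j / 2 * (real (Suc k))\<^sup>2
      \<le> (\<integral>x. (1 - rate x) ^ k * rate x * ((real (Suc k) * x)\<^sup>2 * ?I x) \<partial>\<nu>)" if k: "k < L" for k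
  proof -
    define \<phi> where "\<phi> x = rate x * ((1 - rate x) ^ k * rate x * (real (Suc k))\<^sup>2 * ?I x)" for x
    have \<phi>: "\<phi> (- x) = \<phi> x" "\<bar>\<phi> x\<bar> \<le> (real (Suc k))\<^sup>2" "0 \<le> \<phi> x" for x
    proof -
      show "\<phi> (- x) = \<phi> x" by (auto simp: \<phi>_def p_even indicator_def)
      show nn: "0 \<le> \<phi> x" by (simp add: \<phi>_def p_bounds q_power_bounds)
      have "\<phi> x = (rate x * ((1 - rate x) ^ k * rate x)) * ((real (Suc k))\<^sup>2 * ?I x)" by (simp add: \<phi>_def)
      also have "\<dots> \<le> 1 * ((real (Suc k))\<^sup>2 * 1)"
        using p_bounds[of x] qp_bounds[of x k]
        by (intro mult_mono mult_le_one) (auto simp: indicator_def q_power_bounds)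
      finally show "\<bar>\<phi> x\<bar> \<le> (real (Suc k))\<^sup>2" using nn by simp
    qed
    have "1/2 \<le> 1 - real k * r j"
    proof -
      have "real k \<le> 1 / (2 * r j)" using L1 k by linarith
      then have "real k * r j \<le> 1 / (2 * r j) * r j" using rj by (intro mult_right_mono) auto
      then show ?thesis using rj by simp
    qed
    also have "\<dots> \<le> (1 - r j) ^ k"
      using Bernoulli_inequality[of "- r j" k] rj by (simp add: algebra_simps)
    finally have half: "1/2 \<le> (1 - r j) ^ k" .
    have "r j ^ 3 * level_var j / 2 * (real (Suc k))\<^sup>2 = (level_mass j * (r j * r j * (real (Suc k))\<^sup>2)) * (1/2)"
      by (simp add: level_mass_def power3_eq_cube)
    also have "\<dots> \<le> (level_mass j * (r j * r j * (real (Suc k))\<^sup>2)) * (1 - r j) ^ k"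
      using half level_mass_pos[of j] rj by (intro mult_left_mono) auto
    also have "\<dots> = level_mass j * \<phi> (amp j)"
      using amp_pos[of j] by (simp add: \<phi>_def rate_amp indicator_def)
    also have "\<dots> \<le> (\<Sum>i. level_mass i * \<phi> (amp i))"
    proof -
      have "(\<Sum>i\<in>{j}. level_mass i * \<phi> (amp i)) \<le> (\<Sum>i. level_mass i * \<phi> (amp i))"
        using \<phi> level_mass_pos
        by (intro sum_le_suminf even_weighted_square(1)[where B = "(real (Suc k))\<^sup>2"]) (auto simp: less_imp_le)
      then show ?thesis by simp
    qed
    also have "\<dots> = (\<integral>x. \<phi> x * x\<^sup>2 \<partial>stat)"
      by (rule even_weighted_square(3)[symmetric]) (rule \<phi>)+
    also have "\<dots> \<le> (1 / Z) * (\<integral>x. \<phi> x * x\<^sup>2 \<partial>stat)"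
    proof -
      have "0 \<le> (\<integral>x. \<phi> x * x\<^sup>2 \<partial>stat)" using \<phi>(3) by (intro Bochner_Integration.integral_nonneg) auto
      moreover have "1 \<le> 1 / Z" using Z_pos Z_le_1 by simp
      ultimately show ?thesis using mult_right_mono[of 1 "1 / Z" "\<integral>x. \<phi> x * x\<^sup>2 \<partial>stat"] by simp
    qed
    also have "\<dots> = (\<integral>x. (1 - rate x) ^ k * rate x * ((real (Suc k) * x)\<^sup>2 * ?I x) \<partial>\<nu>)"
      by (simp add: integral_\<nu> \<phi>_def power_mult_distrib mult_ac)
    finally show ?thesis .
  qed
  have "C \<le> level_var j / 384"
    using j level_var_ge[of j] by simp
  also have "\<dots> = r j ^ 3 * level_var j / 2 * ((1 / (4 * r j)) ^ 3 / 3)"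
    using rj by (simp add: power3_eq_cube field_simps)
  also have "\<dots> \<le> r j ^ 3 * level_var j / 2 * (\<Sum>k<L. (real (Suc k))\<^sup>2)"
  proof (rule mult_left_mono)
    have "(1 / (4 * r j)) ^ 3 / 3 \<le> real L ^ 3 / 3"
      using L2 rj by (intro divide_right_mono power_mono) auto
    then show "(1 / (4 * r j)) ^ 3 / 3 \<le> (\<Sum>k<L. (real (Suc k))\<^sup>2)" using sum_squares_ge[of L] by linarith
  qed (use rj level_var_pos[of j] in auto)
  also have "\<dots> \<le> block_variance L (amp j)"
    unfolding block_variance_def sum_distrib_left using block by (intro sum_mono) auto
  finally show ?thesis using amp_pos[of j] by (intro exI[of _ L] exI[of _ "amp j"]) auto
qed

end

lemma (in refresh_chain) ex_refresh_process:
  "\<exists>(M :: (int \<Rightarrow> real) measure) X. refresh_process \<pi> p M X"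
proof -
  obtain M X where "kernel_process \<pi> K (M :: (int \<Rightarrow> real) measure) X"
    using ex_kernel_process by blast
  then have "refresh_process \<pi> p M X"
    by (intro refresh_process.intro refresh_chain_axioms)
  then show ?thesis by blast
qed

section \<open>Log-convex rates\<close>

locale log_convex_rate =
  fixes f :: "real \<Rightarrow> real"
  assumes f_bounds: "\<And>x. x \<ge> 1 \<Longrightarrow> 0 < f x \<and> f x \<le> 1"
    and f_decreasing: "strict_antimono_on {1..} f" and f_null: "(f \<longlongrightarrow> 0) at_top"
    and f_diff: "\<And>x. x > 1 \<Longrightarrow> f differentiable (at x)"
    and f_slow: "\<And>c. c > 0 \<Longrightarrow> filterlim (\<lambda>x. exp (c * x) * f x) at_top at_top"
    and f_hyperbolic: "\<exists>w>1. antimono_on {w..} (\<lambda>x. x * f x)"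
    and f_log_convex: "convex_on {1..} (\<lambda>x. ln (f x))"
begin

definition \<theta> :: "real \<Rightarrow> real" where "\<theta> x = - deriv f x / f x"

lemma f_pos: "x \<ge> 1 \<Longrightarrow> 0 < f x" and f_le_1: "x \<ge> 1 \<Longrightarrow> f x \<le> 1"
  using f_bounds by auto

lemma ln_f_tangent:
  assumes x: "1 < x" and y: "1 \<le> y"
  shows "ln (f x) - \<theta> x * (y - x) \<le> ln (f y)"
proof -
  have "(f has_real_derivative deriv f x) (at x)"
    using f_diff[OF x] by (simp add: DERIV_deriv_iff_real_differentiable)
  then have "((\<lambda>x. ln (f x)) has_real_derivative 1 / f x * deriv f x) (at x)"
    using f_pos[of x] x by (intro DERIV_chain2[OF DERIV_ln_divide]) auto
  then have d: "((\<lambda>x. ln (f x)) has_real_derivative - \<theta> x) (at x within {1..})"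
    by (simp add: \<theta>_def has_field_derivative_at_within)
  have "- \<theta> x * (y - x) \<le> ln (f y) - ln (f x)"
    by (rule convex_on_imp_above_tangent[OF f_log_convex _ _ _ d])
       (use x y in \<open>auto simp: interior_real_atLeast\<close>)
  then show ?thesis by (simp add: algebra_simps)
qed

lemma f_tangent:
  assumes "1 < x" "1 \<le> y"
  shows "f x * exp (- \<theta> x * (y - x)) \<le> f y"
proof -
  have "exp (ln (f x) - \<theta> x * (y - x)) \<le> exp (ln (f y))"
    using ln_f_tangent[OF assms] by (simp only: exp_le_cancel_iff)
  then show ?thesis
    using f_pos[of x] f_pos[of y] assms by (simp add: exp_diff exp_minus divide_inverse)
qed

text \<open>Add the tangent inequalities at x and at y, each evaluated at the other point.\<close>

lemma \<theta>_antimono: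
  assumes "1 < x" "x \<le> y"
  shows "\<theta> y \<le> \<theta> x"
proof (cases "x = y")
  case False
  have "\<theta> y * (y - x) \<le> \<theta> x * (y - x)"
    using ln_f_tangent[of x y] ln_f_tangent[of y x] assms by (simp add: algebra_simps)
  then show ?thesis using False assms by (auto simp: mult_le_cancel_right)
qed simp

lemma \<theta>_pos:
  assumes x: "1 < x"
  shows "0 < \<theta> x"
proof -
  have "f (x + 1) < f x"
    using monotone_onD[OF f_decreasing, of x "x + 1"] x by simp
  then have "ln (f (x + 1)) < ln (f x)" using f_pos[of "x + 1"] x by simp
  then show ?thesis using ln_f_tangent[of x "x + 1"] x by simp
qed

text \<open>If \<theta> exceeded b everywhere, tangents evaluated at 2 would force
  \<open>f x \<le> f 2 * exp (- b * (x - 2))\<close>, against the assumption that f decays more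
  slowly than every exponential.\<close>

lemma \<theta>_null:
  assumes b: "0 < b"
  shows "\<exists>X>1. \<forall>x\<ge>X. \<theta> x \<le> b"
proof (rule ccontr)
  assume "\<not> ?thesis"
  then have ex: "\<exists>x\<ge>X. b < \<theta> x" if "1 < X" for X using that by (force simp: not_le)
  have gt: "b < \<theta> x" if "1 < x" for x
    using ex[OF that] \<theta>_antimono[OF that] by force
  have "\<forall>\<^sub>F x in at_top. f 2 * exp (2 * b) < exp (b * x) * f x"
    using f_slow[OF b] by (simp add: filterlim_at_top_dense)
  then have "\<forall>\<^sub>F x in at_top. f 2 * exp (2 * b) < exp (b * x) * f x \<and> 2 \<le> x"
    using eventually_ge_at_top by (rule eventually_conj)
  then obtain x where x: "f 2 * exp (2 * b) < exp (b * x) * f x" "2 \<le> x"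
    by (auto dest: eventually_happens)
  have "f x * exp (b * (x - 2)) \<le> f x * exp (- \<theta> x * (2 - x))"
  proof -
    have "b * (x - 2) \<le> \<theta> x * (x - 2)" using gt[of x] x by (intro mult_right_mono) auto
    then have "b * (x - 2) \<le> - \<theta> x * (2 - x)" by (simp add: algebra_simps)
    then show ?thesis using f_pos[of x] x by (intro mult_left_mono) auto
  qed
  also have "\<dots> \<le> f 2" using f_tangent[of x 2] x by simp
  finally have "f x * exp (b * (x - 2)) * exp (2 * b) \<le> f 2 * exp (2 * b)" by (rule mult_right_mono) simp
  moreover have "exp (b * (x - 2)) * exp (2 * b) = exp (b * x)"
    by (simp add: exp_add[symmetric] algebra_simps)
  ultimately have "f x * exp (b * x) \<le> f 2 * exp (2 * b)" by (simp only: mult.assoc)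
  then show False using x(1) by (simp add: mult.commute)
qed

text \<open>Compare x with 2x. Monotonicity of \<open>x * f x\<close> gives
  \<open>f (2 * x) \<le> f x / 2\<close>, while the tangent at x gives
  \<open>f (2 * x) \<ge> f x * (1 - \<theta> x * x)\<close>. Hence \<open>\<theta> x * x\<close> is
  at least 1/2 and \<open>f x / \<theta> x\<close> at most \<open>2 * x * f x\<close>.\<close>

lemma f_over_\<theta>_bounded: "\<exists>w>1. \<exists>B. \<forall>x\<ge>w. f x / \<theta> x \<le> B"
proof -
  obtain w where w: "1 < w" and anti: "antimono_on {w..} (\<lambda>x. x * f x)" using f_hyperbolic by blast
  have "f x / \<theta> x \<le> 2 * (w * f w)" if x: "w \<le> x" for x
  proof -
    have x1: "1 < x" using w x by simp
    have "f x * (1 - \<theta> x * x) \<le> f x * exp (- \<theta> x * (2 * x - x))"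
      using exp_ge_add_one_self[of "- \<theta> x * x"] f_pos[of x] x1 by (intro mult_left_mono) auto
    also have "\<dots> \<le> f (2 * x)" using f_tangent[of x "2 * x"] x1 by simp
    finally have "2 * x * (f x * (1 - \<theta> x * x)) \<le> 2 * x * f (2 * x)" using x1 by (intro mult_left_mono) auto
    also have "\<dots> \<le> x * f x" using monotone_onD[OF anti, of x "2 * x"] x x1 by simp
    finally have "(x * f x) * (2 * (1 - \<theta> x * x)) \<le> (x * f x) * 1" by (simp add: mult_ac)
    then have "2 * (1 - \<theta> x * x) \<le> 1"
      using f_pos[of x] x1 by (subst (asm) mult_le_cancel_left_pos) auto
    then have "1 \<le> 2 * x * \<theta> x" by (simp add: algebra_simps)
    then have "f x * 1 \<le> f x * (2 * x * \<theta> x)" using f_pos[of x] x1 by (intro mult_left_mono) auto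
    then have "f x / \<theta> x \<le> 2 * (x * f x)" using \<theta>_pos[OF x1] by (simp add: divide_le_eq mult_ac)
    also have "\<dots> \<le> 2 * (w * f w)" using monotone_onD[OF anti, of w x] x by simp
    finally show ?thesis .
  qed
  then show ?thesis using w by blast
qed

text \<open>Tangent points are taken where \<open>f / \<theta>\<close> is, up to a factor \<open>2\<close>, as large as it will ever be
  again.\<close>

lemma ex_tangent_point:
  assumes b: "0 < b"
  shows "\<exists>x>X. 1 < x \<and> \<theta> x \<le> b \<and> f x \<le> b \<and> (\<forall>y\<ge>x. f y / \<theta> y \<le> 2 * (f x / \<theta> x))"
proof -
  obtain w B where w: "1 < w" and B: "\<And>x. w \<le> x \<Longrightarrow> f x / \<theta> x \<le> B" using f_over_\<theta>_bounded by blast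
  obtain X1 where X1: "1 < X1" "\<And>x. X1 \<le> x \<Longrightarrow> \<theta> x \<le> b" using \<theta>_null[OF b] by blast
  have "\<forall>\<^sub>F x in at_top. f x < b" using f_null b by (rule order_tendstoD)
  then obtain X2 where X2: "\<And>x. X2 \<le> x \<Longrightarrow> f x < b" by (auto simp: eventually_at_top_linorder)
  define T where "T = max (max (X + 1) w) (max X1 X2)"
  have T: "X < T" "w \<le> T" "X1 \<le> T" "X2 \<le> T" "1 < T" using w by (auto simp: T_def)
  define s where "s = (SUP y\<in>{T..}. f y / \<theta> y)"
  have pos: "0 < f y / \<theta> y" if "T \<le> y" for y
    using f_pos[of y] \<theta>_pos[of y] T that by simp
  have bdd: "bdd_above ((\<lambda>y. f y / \<theta> y) ` {T..})"
    using B T by (intro bdd_aboveI2[where M = B]) auto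
  have up: "f y / \<theta> y \<le> s" if "T \<le> y" for y
    unfolding s_def using that by (intro cSUP_upper bdd) auto
  have "s / 2 < s" using up[of T] pos[of T] by simp
  then have "s / 2 < (SUP y\<in>{T..}. f y / \<theta> y)" by (simp only: s_def)
  then obtain x where x: "T \<le> x" "s / 2 < f x / \<theta> x"
    using less_cSUP_iff[OF _ bdd, of "s / 2"] by auto
  have "f y / \<theta> y \<le> 2 * (f x / \<theta> x)" if "x \<le> y" for y
    using up[of y] x that by linarith
  then show ?thesis
    using x(1) T X1(2)[of x] X2[of x] by (intro exI[of _ x]) auto
qed

text \<open>Both a and b lie between 1 and a + b - 1, with complementary weights; the two convexity
  inequalities for \<open>ln f\<close> add up. The shift by 1 reflects that f starts at 1.\<close>

lemma f_supermultiplicative: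
  assumes a: "1 \<le> a" and b: "1 \<le> b"
  shows "f a * f b \<le> f (a + b - 1) * f 1"
proof (cases "a + b = 2")
  case True
  then have "a = 1" "b = 1" using a b by auto
  then show ?thesis by simp
next
  case False
  define m where "m = a + b - 1"
  define s where "s = (a - 1) / (m - 1)"
  have m: "1 < m" using False a b by (simp add: m_def)
  have s: "0 \<le> s" "s \<le> 1" using a b m by (auto simp: s_def m_def divide_le_eq_1)
  have sm: "s * (m - 1) = a - 1" using m by (simp add: s_def)
  have ab: "(1 - s) * 1 + s * m = a" "(1 - (1 - s)) * 1 + (1 - s) * m = b"
    using sm by (simp_all add: algebra_simps m_def)
  have "ln (f a) \<le> (1 - s) * ln (f 1) + s * ln (f m)"
    using convex_onD[OF f_log_convex s, of 1 m] m ab(1) by simp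
  moreover have "ln (f b) \<le> s * ln (f 1) + (1 - s) * ln (f m)"
    using convex_onD[OF f_log_convex, of "1 - s" 1 m] s m ab(2) by simp
  ultimately have "ln (f a) + ln (f b) \<le> ln (f m) + ln (f 1)" by (simp add: algebra_simps)
  then have "ln (f a * f b) \<le> ln (f m * f 1)"
    using f_pos[OF a] f_pos[OF b] f_pos[of m] f_pos[of 1] m by (simp add: ln_mult_pos)
  then show ?thesis
    using f_pos[OF a] f_pos[OF b] f_pos[of m] f_pos[of 1] m by (simp add: m_def)
qed

end

section \<open>Mixing, variances and limit law of the sparse chain\<close>

lemma (in refresh_process) beta_mixing_le_mixing_rate:
  "alpha_mixing M X n \<le> beta_mixing M X n" "beta_mixing M X n \<le> mixing_rate n"
proof -
  have "(\<integral>w. \<Phi> w \<partial>pair_law n) - (\<integral>w. \<Phi> w \<partial>pair_pmf \<pi> \<pi>) \<le> 2 * mixing_rate n"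
    if "\<And>w. \<bar>\<Phi> w\<bar> \<le> 1" for \<Phi> :: "real \<times> real \<Rightarrow> real"
    using mixing_pair[of \<Phi> n, OF that] expectation_pair[of \<Phi> 1 n, OF that]
    by (simp add: pair_law_def)
  note C = this
  show "alpha_mixing M X n \<le> beta_mixing M X n" "beta_mixing M X n \<le> mixing_rate n"
    using beta_mixing_le[OF C] by simp_all
qed

text \<open>By \<open>1 + s \<le> exp s\<close> each summand is at most an increment of
  \<open>- exp (- s k)\<close>, so the sum telescopes.\<close>

lemma sum_exp_decay_le:
  fixes s :: real
  assumes "0 < s"
  shows "(\<Sum>k=1..<Suc n. s * exp (- s * real k)) \<le> 1 - exp (- s * real n)"
proof (induction n)
  case (Suc n)
  have "exp (- s * real (Suc n)) * (1 + s) \<le> exp (- s * real (Suc n)) * exp s"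
    using exp_ge_add_one_self[of s] by (intro mult_left_mono) auto
  also have "\<dots> = exp (- s * real n)" by (simp add: exp_add[symmetric] algebra_simps)
  finally show ?case using Suc by (simp add: algebra_simps)
qed simp

lemma half_power_sums: "(\<lambda>j. (1/2 :: real) ^ j) sums 2"
  using geometric_sums[of "1/2 :: real"] by simp

context sparse_blocks
begin

text \<open>In the decay hypothesis \<open>F\<close> carries the size and the extra exponential
  makes the refresh probabilities summable: weighted by \<open>r j\<close> it sums over all times to
  at most 2, whatever the rate. The renewal convolution is then a constant times
  \<open>\<epsilon>^2 * F (n - 1) * F 1\<close>. In total the bound is
  \<open>1/8 + 1/8 + 1/2\<close> times \<open>F n\<close>.\<close>

lemma mixing_rate_le:
  fixes F :: "nat \<Rightarrow> real" and \<epsilon> :: real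
  assumes \<epsilon>: "0 < \<epsilon>" "\<epsilon> \<le> 1/16" and F_pos: "\<And>m. 1 \<le> m \<Longrightarrow> 0 < F m" and F_1: "F 1 \<le> 1"
    and F_2: "F 2 = 16 * \<epsilon> * F 1"
    and super: "\<And>k l. 1 \<le> k \<Longrightarrow> 1 \<le> l \<Longrightarrow> F k * F l \<le> F (k + l - 1) * F 1"
    and decay: "\<And>j m. 1 \<le> m \<Longrightarrow> P j * (1 - r j) ^ m \<le> \<epsilon> * (1/2) ^ j * (F m * exp (- (r j / 2) * real m))"
    and n: "1 \<le> n"
  shows "mixing_rate n \<le> F n"
proof -
  define S where "S k = (\<Sum>j. (1/2) ^ j * (r j * exp (- (r j / 2) * real k)))" for k :: nat
  have half: "summable (\<lambda>j. (1/2 :: real) ^ j)" "(\<Sum>j. (1/2 :: real) ^ j) = 2"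
    using half_power_sums by (auto simp: sums_iff)
  have S_nn: "0 \<le> (1/2) ^ j * (r j * exp (- (r j / 2) * real k))" for j k
    using r_pos[of j] by simp
  have S_summable: "summable (\<lambda>j. (1/2) ^ j * (r j * exp (- (r j / 2) * real k)))" for k
  proof (rule summable_comparison_test'[OF half(1)])
    fix j
    have "r j * exp (- (r j / 2) * real k) \<le> 1 * 1"
      using r_pos[of j] r_le[of j] by (intro mult_mono) auto
    then have "(1/2) ^ j * (r j * exp (- (r j / 2) * real k)) \<le> (1/2) ^ j * 1"
      by (intro mult_left_mono) auto
    then show "norm ((1/2) ^ j * (r j * exp (- (r j / 2) * real k))) \<le> (1/2) ^ j"
      using S_nn[of j k] by (simp only: real_norm_def abs_of_nonneg mult_1_right)
  qed
  have H_le: "H m \<le> 2 * \<epsilon> * F m" if m: "1 \<le> m" for m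
  proof -
    have "P j * (1 - r j) ^ m \<le> \<epsilon> * F m * (1/2) ^ j" for j
    proof -
      have "F m * exp (- (r j / 2) * real m) \<le> F m * 1"
        using F_pos[OF m] r_pos[of j] by (intro mult_left_mono) auto
      then have "\<epsilon> * (1/2) ^ j * (F m * exp (- (r j / 2) * real m)) \<le> \<epsilon> * (1/2) ^ j * (F m * 1)"
        by (rule mult_left_mono) (use \<epsilon> in auto)
      then show ?thesis using decay[OF m, of j] by (simp add: mult_ac)
    qed
    then have "(\<Sum>j. P j * (1 - r j) ^ m) \<le> (\<Sum>j. \<epsilon> * F m * (1/2) ^ j)"
      using H_eq(1)[of m] m by (intro suminf_le summable_mult half) auto
    then show ?thesis using H_eq(2)[of m] m half by (simp add: suminf_mult)
  qed
  have D_le: "H k - H (Suc k) \<le> \<epsilon> * F k * S k" if k: "1 \<le> k" for k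
  proof -
    have "H k - H (Suc k) = (\<Sum>j. P j * (1 - r j) ^ k - P j * (1 - r j) ^ Suc k)"
      using H_eq[of k] H_eq[of "Suc k"] k by (simp add: suminf_diff)
    also have "\<dots> \<le> (\<Sum>j. \<epsilon> * F k * ((1/2) ^ j * (r j * exp (- (r j / 2) * real k))))"
    proof (intro suminf_le summable_mult S_summable summable_diff H_eq)
      fix j
      have "P j * (1 - r j) ^ k - P j * (1 - r j) ^ Suc k = (P j * (1 - r j) ^ k) * r j"
        by (simp add: algebra_simps)
      also have "\<dots> \<le> (\<epsilon> * (1/2) ^ j * (F k * exp (- (r j / 2) * real k))) * r j"
        using decay[OF k, of j] r_pos[of j] by (intro mult_right_mono) auto
      finally show "P j * (1 - r j) ^ k - P j * (1 - r j) ^ Suc k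
          \<le> \<epsilon> * F k * ((1/2) ^ j * (r j * exp (- (r j / 2) * real k)))" by (simp add: mult_ac)
    qed (use k in auto)
    also have "\<dots> = \<epsilon> * F k * S k" unfolding S_def by (rule suminf_mult[OF S_summable])
    finally show ?thesis .
  qed
  have sum_S: "(\<Sum>k=1..<n. S k) \<le> 4"
  proof -
    have "(\<Sum>k=1..<n. S k) = (\<Sum>j. \<Sum>k=1..<n. (1/2) ^ j * (r j * exp (- (r j / 2) * real k)))"
      unfolding S_def by (rule suminf_sum[symmetric]) (rule S_summable)
    also have "\<dots> \<le> (\<Sum>j. 2 * (1/2) ^ j)"
    proof (intro suminf_le summable_sum S_summable summable_mult half)
      fix j
      obtain m where m: "n = Suc m" using n by (cases n) auto
      have "(\<Sum>k=1..<n. (r j / 2) * exp (- (r j / 2) * real k)) \<le> 1 - exp (- (r j / 2) * real m)"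
        unfolding m by (rule sum_exp_decay_le) (use r_pos[of j] in simp)
      then have "(r j / 2) * (\<Sum>k=1..<n. exp (- (r j / 2) * real k)) \<le> 1"
        unfolding sum_distrib_left[symmetric] using exp_ge_zero[of "- (r j / 2) * real m"] by linarith
      then have "(\<Sum>k=1..<n. r j * exp (- (r j / 2) * real k)) \<le> 2"
        unfolding sum_distrib_left[symmetric] by linarith
      then have "(1/2) ^ j * (\<Sum>k=1..<n. r j * exp (- (r j / 2) * real k)) \<le> (1/2) ^ j * 2"
        by (intro mult_left_mono) auto
      then show "(\<Sum>k=1..<n. (1/2) ^ j * (r j * exp (- (r j / 2) * real k))) \<le> 2 * (1/2) ^ j"
        by (simp only: sum_distrib_left mult.commute[of 2])
    qed
    also have "\<dots> = 4" using half by (simp add: suminf_mult)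
    finally show ?thesis .
  qed
  have tail: "(\<Sum>k=1..<n. (H k - H (Suc k)) * H (n - k)) \<le> F n / 2"
  proof (cases "n = 1")
    case True
    then show ?thesis using F_pos[of 1] by simp
  next
    case False
    then have n2: "2 \<le> n" using n by simp
    have F1: "0 < F 1" by (rule F_pos) simp
    \<comment> \<open>The relation between \<open>F 2\<close> and \<open>F 1\<close> is used here:
      going from n - 1 to n costs a factor \<open>16 * \<epsilon>\<close>, one of the two factors
      \<epsilon> at hand.\<close>
    have Fn: "16 * \<epsilon> * F (n - 1) \<le> F n"
    proof -
      have "F (n - 1) * F 2 \<le> F n * F 1" using super[of "n - 1" 2] n2 by simp
      then have "(16 * \<epsilon> * F (n - 1)) * F 1 \<le> F n * F 1" by (simp add: F_2 mult_ac)
      then show ?thesis using F1 by simp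
    qed
    have "(\<Sum>k=1..<n. (H k - H (Suc k)) * H (n - k)) \<le> (\<Sum>k=1..<n. (2 * \<epsilon>\<^sup>2 * (F (n - 1) * F 1)) * S k)"
    proof (rule sum_mono)
      fix k assume k: "k \<in> {1..<n}"
      have S0: "0 \<le> S k" unfolding S_def by (rule suminf_nonneg[OF S_summable S_nn])
      have "(H k - H (Suc k)) * H (n - k) \<le> (\<epsilon> * F k * S k) * (2 * \<epsilon> * F (n - k))"
        using k D_le[of k] H_le[of "n - k"] H_nonneg S0 \<epsilon> F_pos[of k]
        by (intro mult_mono) auto
      also have "\<dots> = (F k * F (n - k)) * (2 * \<epsilon>\<^sup>2 * S k)" by (simp add: power2_eq_square)
      also have "\<dots> \<le> (F (n - 1) * F 1) * (2 * \<epsilon>\<^sup>2 * S k)"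
        using super[of k "n - k"] k S0 by (intro mult_right_mono) auto
      finally show "(H k - H (Suc k)) * H (n - k) \<le> (2 * \<epsilon>\<^sup>2 * (F (n - 1) * F 1)) * S k"
        by (simp add: mult_ac)
    qed
    also have "\<dots> = (2 * \<epsilon>\<^sup>2 * (F (n - 1) * F 1)) * (\<Sum>k=1..<n. S k)" by (simp only: sum_distrib_left)
    also have "\<dots> \<le> (2 * \<epsilon>\<^sup>2 * (F (n - 1) * F 1)) * 4"
    proof (rule mult_left_mono[OF sum_S])
      have "0 < F (n - 1)" by (rule F_pos) (use n2 in simp)
      then show "0 \<le> 2 * \<epsilon>\<^sup>2 * (F (n - 1) * F 1)" using F1 by simp
    qed
    also have "\<dots> = (16 * \<epsilon> * F (n - 1)) * (\<epsilon> * F 1 / 2)" by (simp add: power2_eq_square)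
    also have "\<dots> \<le> F n * (1 / 2)"
      using Fn \<epsilon> F1 F_1 F_pos[of n] n mult_le_one[of \<epsilon> "F 1"] by (intro mult_mono) auto
    finally show ?thesis by simp
  qed
  \<comment> \<open>The summand k = 0 is kept apart because \<open>F\<close> controls
    \<open>H\<close> only from time 1 on; the jump of \<open>H\<close> at 0 is mainly due to the
    state 0.\<close>
  have "mixing_rate n = H n + ((H 0 - H (Suc 0)) * H n + (\<Sum>k=1..<n. (H k - H (Suc k)) * H (n - k)))"
    unfolding mixing_rate_def lessThan_atLeast0 using n by (subst sum.atLeast_Suc_lessThan) auto
  moreover have "(H 0 - H (Suc 0)) * H n \<le> H n"
    using mult_right_mono[of "H 0 - H (Suc 0)" 1 "H n"] H_nonneg by (simp add: H_0)
  moreover have "2 * \<epsilon> * F n \<le> 1/8 * F n"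
    using \<epsilon> F_pos[OF n] by (intro mult_right_mono) auto
  ultimately show ?thesis using H_le[OF n] tail F_pos[OF n] by linarith
qed

end

section \<open>Growth of the variance, level by level\<close>

locale sparse_process = sparse_blocks P r +
  refresh_process "sparse_blocks.stat P r" "sparse_blocks.rate P r" M X
  for P r and M :: "'b measure" and X
begin

definition level_term :: "nat \<Rightarrow> nat \<Rightarrow> real" where
  "level_term n j = level_mass j * lag_sum n (1 - r j)"

lemma r_le_1: "r j \<le> 1" using r_le[of j] by simp

lemma level_term_nonneg: "0 \<le> level_term n j"
  unfolding level_term_def using level_mass_pos r_le_1 by (intro mult_nonneg_nonneg lag_sum_nonneg) (auto simp: less_imp_le)

lemma level_term_le_square: "level_term n j \<le> level_mass j * (real n)\<^sup>2"
  unfolding level_term_def using level_mass_pos r_pos r_le_1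
  by (intro mult_left_mono lag_sum_le_square) (auto simp: less_imp_le)

lemma level_term_le_linear: "level_term n j \<le> 2 * level_var j * real n"
proof -
  have "level_term n j \<le> level_mass j * (2 * real n / r j)"
    unfolding level_term_def using level_mass_pos r_pos r_le_1
    by (intro mult_left_mono lag_sum_le_linear) (auto simp: less_imp_le)
  then show ?thesis using r_pos[of j] by (simp add: level_mass_def mult_ac)
qed

lemma level_term_ge_square: "level_mass j * ((real n)\<^sup>2 * (1 - real n * r j)) \<le> level_term n j"
  unfolding level_term_def using level_mass_pos r_pos r_le_1
  by (intro mult_left_mono lag_sum_ge_square) (auto simp: less_imp_le)

lemma level_term_ge_linear: "level_var j * (real n - 1 / r j) \<le> level_term n j"
proof -
  have "level_mass j * ((real n - 1 / r j) / r j) \<le> level_term n j"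
    unfolding level_term_def using level_mass_pos r_pos r_le_1
    by (intro mult_left_mono lag_sum_ge_linear) (auto simp: less_imp_le)
  then show ?thesis using r_pos[of j] by (simp add: level_mass_def)
qed

lemma norm_var_series:
  shows "summable (level_term n)" and "norm_var M X n = suminf (level_term n) / real n"
proof -
  have B: "\<bar>lag_sum n (1 - rate x)\<bar> \<le> (real n)\<^sup>2" for x
    using lag_sum_nonneg[of "1 - rate x" n] lag_sum_le_square[of "1 - rate x" n] p_bounds[of x] by simp
  have eq: "level_mass j * lag_sum n (1 - rate (amp j)) = level_term n j" for j
    using amp_pos[of j] by (simp add: level_term_def rate_amp)
  note series = even_weighted_square[of "\<lambda>x. lag_sum n (1 - rate x)", OF _ B, unfolded eq]
  show "summable (level_term n)" using series(1) by (simp add: p_even)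
  show "norm_var M X n = suminf (level_term n) / real n"
    using norm_var_eq[OF square_integrable, of n] series(3) by (simp add: p_even)
qed

lemma norm_var_ge_level: "level_term n j / real n \<le> norm_var M X n"
proof -
  have "(\<Sum>j\<in>{j}. level_term n j) \<le> suminf (level_term n)"
    by (intro sum_le_suminf norm_var_series) (auto simp: level_term_nonneg)
  then show ?thesis unfolding norm_var_series(2) by (simp add: divide_right_mono)
qed

lemma norm_var_nonneg: "0 \<le> norm_var M X n"
  unfolding norm_var_series(2)
  by (intro divide_nonneg_nonneg suminf_nonneg norm_var_series) (auto simp: level_term_nonneg)

lemma norm_var_at_top: "filterlim (norm_var M X) at_top sequentially"
  unfolding filterlim_at_top
proof
  fix C :: real
  obtain j :: nat where j: "2 * C \<le> real j" using real_arch_simple by blast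
  obtain n0 :: nat where n0: "2 / r j \<le> real n0" using real_arch_simple by blast
  have "C \<le> norm_var M X n" if n: "n0 \<le> n" for n
  proof -
    have n': "2 / r j \<le> real n" using n0 n by linarith
    moreover have "0 < 2 / r j" using r_pos by simp
    ultimately have n_pos: "0 < real n" by linarith
    have "1 / r j \<le> real n / 2" using n' by simp
    then have "level_var j * (real n / 2) \<le> level_var j * (real n - 1 / r j)"
      using level_var_pos[of j] by (intro mult_left_mono) auto
    then have "level_var j * (real n / 2) \<le> level_term n j" using level_term_ge_linear[of j n] by linarith
    then have "level_var j * (real n / 2) / real n \<le> level_term n j / real n"
      by (intro divide_right_mono) auto
    moreover have "level_var j * (real n / 2) / real n = level_var j / 2" using n_pos by simp
    ultimately have "level_var j / 2 \<le> norm_var M X n" using norm_var_ge_level[of n j] by linarith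
    then show ?thesis using level_var_ge[of j] j by simp
  qed
  then show "\<forall>\<^sub>F n in sequentially. C \<le> norm_var M X n" by (auto simp: eventually_sequentially)
qed

text \<open>From level i on the quadratic bound is used, since the level masses sum to at most twice
  the first one. Lower levels can then be estimated linearly.\<close>

lemma suminf_level_term_le:
  "suminf (level_term n) \<le> (\<Sum>k<i. level_term n k) + (real n)\<^sup>2 * (2 * level_mass i)"
proof -
  have "(\<Sum>k. level_term n (k + i)) \<le> (\<Sum>k. (real n)\<^sup>2 * level_mass (k + i))"
  proof (rule suminf_le)
    show "level_term n (k + i) \<le> (real n)\<^sup>2 * level_mass (k + i)" for k
      using level_term_le_square[of n "k + i"] by (simp only: mult.commute)
    show "summable (\<lambda>k. level_term n (k + i))"
      by (rule summable_ignore_initial_segment) (rule norm_var_series)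
    show "summable (\<lambda>k. (real n)\<^sup>2 * level_mass (k + i))"
      by (rule summable_mult, rule summable_ignore_initial_segment) (rule summable_level_mass)
  qed
  moreover have "(\<Sum>k. (real n)\<^sup>2 * level_mass (k + i)) = (real n)\<^sup>2 * (\<Sum>k. level_mass (k + i))"
    by (rule suminf_mult, rule summable_ignore_initial_segment) (rule summable_level_mass)
  moreover have "(real n)\<^sup>2 * (\<Sum>k. level_mass (k + i)) \<le> (real n)\<^sup>2 * (2 * level_mass i)"
    by (intro mult_left_mono suminf_level_mass_tail) simp
  moreover have "suminf (level_term n) = (\<Sum>k. level_term n (k + i)) + (\<Sum>k<i. level_term n k)"
    by (rule suminf_split_initial_segment) (rule norm_var_series)
  ultimately show ?thesis by linarith
qed

lemma sum_level_term_le: "(\<Sum>k<i. level_term n k) \<le> (\<Sum>k<i. 2 * level_var k) * real n"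
  unfolding sum_distrib_right by (rule sum_mono) (rule level_term_le_linear)

lemma norm_var_le:
  assumes n: "1 \<le> n"
  shows "norm_var M X n \<le> (\<Sum>k<i. 2 * level_var k) + 2 * real n * level_mass i"
proof -
  have "(real n)\<^sup>2 * (2 * level_mass i) = (2 * real n * level_mass i) * real n"
    by (simp add: power2_eq_square)
  then have "suminf (level_term n) \<le> ((\<Sum>k<i. 2 * level_var k) + 2 * real n * level_mass i) * real n"
    unfolding distrib_right using suminf_level_term_le[of n i] sum_level_term_le[of n i] by linarith
  then show ?thesis unfolding norm_var_series(2) using n by (subst pos_divide_le_eq) auto
qed

lemma norm_var_le_single_level:
  assumes n: "1 \<le> n"
  shows "norm_var M X n \<le> (\<Sum>k<i. 2 * level_var k) + level_mass i * real n
    + real n * (2 * level_mass (Suc i))"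
proof -
  let ?s = "\<Sum>k<i. 2 * level_var k"
  have "(\<Sum>k<Suc i. level_term n k) \<le> ?s * real n + level_mass i * real n * real n"
    using sum_level_term_le[of n i] level_term_le_square[of n i] by (simp add: power2_eq_square)
  then have "suminf (level_term n) \<le> ?s * real n + level_mass i * real n * real n
      + real n * (2 * level_mass (Suc i)) * real n"
    using suminf_level_term_le[of n "Suc i"] by (simp add: power2_eq_square mult_ac)
  then have "suminf (level_term n) \<le> (?s + level_mass i * real n + real n * (2 * level_mass (Suc i))) * real n"
    unfolding distrib_right .
  then show ?thesis unfolding norm_var_series(2) using n by (subst pos_divide_le_eq) auto
qed

text \<open>Level i stays invisible until time \<open>Th i\<close>, because its mass times that time
  is at most 1/2. The levels below the first invisible one have passed their thresholds, so
  \<open>G\<close> has already grown enough to pay for them.\<close>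

lemma norm_var_le_threshold:
  fixes G :: "nat \<Rightarrow> real" and Th :: "nat \<Rightarrow> real"
  assumes Th: "\<And>i. real i \<le> Th i" "\<And>i. level_mass i * Th i \<le> 1/2"
    and G: "\<And>n. 1 \<le> n \<Longrightarrow> 1 \<le> G n" "\<And>i n. Th i \<le> real n \<Longrightarrow> 1 + (\<Sum>k\<le>i. 2 * level_var k) \<le> G n"
    and n: "1 \<le> n"
  shows "norm_var M X n \<le> G n"
proof -
  \<comment> \<open>Such a level exists because the thresholds grow at least like their
    index.\<close>
  define i where "i = (LEAST i. real n < Th i)"
  have "real n < Th (Suc n)" using Th(1)[of "Suc n"] by simp
  then have i: "real n < Th i" unfolding i_def by (rule LeastI)
  have "level_mass i * real n \<le> level_mass i * Th i"
    using i level_mass_pos[of i] by (intro mult_left_mono) auto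
  then have "2 * real n * level_mass i \<le> 1" using Th(2)[of i] by (simp add: mult_ac)
  then have le: "norm_var M X n \<le> (\<Sum>k<i. 2 * level_var k) + 1"
    using norm_var_le[OF n, of i] by linarith
  show ?thesis
  proof (cases i)
    case 0
    then show ?thesis using le G(1)[OF n] by simp
  next
    case (Suc k)
    then have "k < (LEAST i. real n < Th i)" by (simp add: i_def)
    then have "Th k \<le> real n" using not_less_Least not_less by blast
    then have "1 + (\<Sum>k\<le>k. 2 * level_var k) \<le> G n" by (rule G(2))
    then show ?thesis using le by (simp add: Suc lessThan_Suc_atMost)
  qed
qed

lemma norm_var_mult_le:
  assumes "1 \<le> N"
  shows "norm_var M X (N * n) \<le> real N * norm_var M X n"
proof -
  have "suminf (level_term (N * n)) \<le> (\<Sum>j. (real N)\<^sup>2 * level_term n j)"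
  proof (intro suminf_le norm_var_series summable_mult)
    fix j
    have "lag_sum (N * n) (1 - r j) \<le> (real N)\<^sup>2 * lag_sum n (1 - r j)"
      using r_pos[of j] r_le_1[of j] by (intro lag_sum_mult_le) auto
    then have "level_mass j * lag_sum (N * n) (1 - r j) \<le> level_mass j * ((real N)\<^sup>2 * lag_sum n (1 - r j))"
      using level_mass_pos[of j] by (intro mult_left_mono) auto
    then show "level_term (N * n) j \<le> (real N)\<^sup>2 * level_term n j"
      unfolding level_term_def by (simp add: mult_ac)
  qed
  also have "\<dots> = (real N)\<^sup>2 * suminf (level_term n)" by (rule suminf_mult) (rule norm_var_series)
  finally have "suminf (level_term (N * n)) / real (N * n) \<le> (real N)\<^sup>2 * suminf (level_term n) / real (N * n)"
    by (intro divide_right_mono) auto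
  also have "\<dots> = real N * (suminf (level_term n) / real n)"
    using assms by (simp add: power2_eq_square)
  finally show ?thesis by (simp only: norm_var_series(2))
qed

text \<open>Between \<open>1 / r j\<close> and \<open>1 / r (Suc j)\<close> the variance of the partial sums changes from linear to
  quadratic growth; just below \<open>1 / r (Suc j)\<close> it is quadratic up to a factor tending to \<open>1\<close>.\<close>

lemma norm_var_quadratic_regime:
  defines "n \<equiv> \<lambda>j. nat \<lfloor>1 / (real (Suc j) * r (Suc j))\<rfloor>"
  shows "j \<le> n j"
    and "norm_var M X (n j) \<le> level_mass (Suc j) * real (n j) * (1 + 5 / real (Suc j))"
    and "real N * (level_mass (Suc j) * real (n j) * (1 - real N / real (Suc j))) \<le> norm_var M X (N * n j)"
proof -
  define i where "i = real (Suc j)"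
  have i: "1 \<le> i" by (simp add: i_def)
  let ?r = "r (Suc j)" and ?v = "level_var (Suc j)" and ?m = "level_mass (Suc j)"
  have i4: "(i + 1) ^ 4 * level_var j = ?v" unfolding level_var_Suc by (simp add: i_def add.commute)
  have pw: "1 \<le> (i + 1) ^ k" for k using i by (intro one_le_power) simp
  have "(i + 1) ^ 4 * 1 \<le> (i + 1) ^ 4 * level_var j"
    using level_var_ge_1[of j] i by (intro mult_left_mono) auto
  then have v_ge: "(i + 1) ^ 4 \<le> ?v" using i4 by simp
  have m_le: "?m \<le> 1/2"
  proof -
    have "level_mass (Suc j) \<le> (1/2) ^ Suc j * r j" using r_Suc by (simp add: level_mass_def)
    also have "\<dots> \<le> 1 * (1/2)"
      using r_pos[of j] r_le[of j] by (intro mult_mono power_le_one) auto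
    finally show ?thesis by simp
  qed
  have r2: "(i + 1) ^ 2 * ?r \<le> 1/2"
  proof -
    have "(i + 1) ^ 2 * ?r \<le> (i + 1) ^ 4 * ?r"
      using i r_pos[of "Suc j"] by (intro mult_right_mono power_increasing) auto
    also have "\<dots> \<le> ?m" unfolding level_mass_def using v_ge r_pos[of "Suc j"] by (intro mult_right_mono) auto
    finally show ?thesis using m_le by linarith
  qed
  have ir: "0 < i * ?r" using i r_pos[of "Suc j"] by simp
  have big: "2 * i \<le> 1 / (i * ?r)"
  proof -
    have "2 * i * (i * ?r) = 2 * (i ^ 2 * ?r)" by (simp add: power2_eq_square)
    also have "\<dots> \<le> 2 * ((i + 1) ^ 2 * ?r)"
      using i r_pos[of "Suc j"] by (intro mult_left_mono mult_right_mono power_mono) auto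
    finally show ?thesis using r2 ir by (simp add: le_divide_eq)
  qed
  have n_le: "real (n j) \<le> 1 / (i * ?r)" and n_ge: "1 / (i * ?r) - 1 \<le> real (n j)"
    using big i unfolding n_def i_def[symmetric] by linarith+
  have "i \<le> real (n j)" using big n_ge i by linarith
  then show jn: "j \<le> n j" by (simp add: i_def)
  have n1: "1 \<le> n j" using \<open>i \<le> real (n j)\<close> i by linarith
  have half: "1 / (2 * (i * ?r)) \<le> real (n j)"
  proof -
    define z where "z = 1 / (i * ?r)"
    have "2 * i \<le> z" "z - 1 \<le> real (n j)" using big n_ge by (simp_all only: z_def)
    then have "z / 2 \<le> real (n j)" using i by linarith
    then show ?thesis by (simp add: z_def)
  qed
  \<comment> \<open>At this time level j + 1 contributes about \<open>?m * n\<close>, which is of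
    order \<open>?v / i\<close>. The lower levels total at most \<open>2 * i * level_var j\<close>,
    smaller by a factor 4 / i thanks to the fourth power in \<open>i4\<close>.\<close>
  have quad: "?v \<le> 2 * i * (?m * real (n j))"
  proof -
    have "?v = 2 * i * (?m * (1 / (2 * (i * ?r))))"
      using i r_pos[of "Suc j"] by (simp add: level_mass_def)
    also have "\<dots> \<le> 2 * i * (?m * real (n j))"
      using half i level_mass_pos[of "Suc j"] by (intro mult_left_mono) auto
    finally show ?thesis .
  qed
  have "(\<Sum>k<Suc j. 2 * level_var k) \<le> (\<Sum>k<Suc j. 2 * level_var j)"
    by (intro sum_mono mult_left_mono level_var_mono) auto
  then have "(\<Sum>k<Suc j. 2 * level_var k) \<le> 2 * i * level_var j" by (simp add: i_def mult_ac)
  moreover have "2 * i * level_var j \<le> 4 / i * (?m * real (n j))"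
  proof -
    have "i ^ 3 * (i * level_var j) \<le> (i + 1) ^ 4 * level_var j"
    proof -
      have "i ^ 3 * (i * level_var j) = i ^ 4 * level_var j" by (simp add: power_numeral_reduce)
      also have "\<dots> \<le> (i + 1) ^ 4 * level_var j"
        using i level_var_pos[of j] by (intro mult_right_mono power_mono) auto
      finally show ?thesis .
    qed
    also have "\<dots> \<le> i * (2 * (?m * real (n j)))" using quad i4 by (simp add: mult_ac)
    finally have "i * (i ^ 2 * (i * level_var j)) \<le> i * (2 * (?m * real (n j)))"
      by (simp add: power3_eq_cube power2_eq_square)
    then have "i ^ 2 * (i * level_var j) \<le> 2 * (?m * real (n j))"
      using i by (subst (asm) mult_le_cancel_left_pos) auto
    moreover have "i * (i * level_var j) \<le> i ^ 2 * (i * level_var j)"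
      using i level_var_pos[of j] by (intro mult_right_mono) (auto simp: power2_eq_square)
    ultimately have "i * (i * level_var j) \<le> 2 * (?m * real (n j))" by linarith
    then show ?thesis using i by (simp add: le_divide_eq mult_ac)
  qed
  ultimately have low: "(\<Sum>k<Suc j. 2 * level_var k) \<le> 4 / i * (?m * real (n j))" by linarith
  have "2 * level_mass (Suc (Suc j)) \<le> 1 / i * ?m"
  proof -
    have "level_mass (Suc (Suc j)) \<le> (1/2) ^ Suc (Suc j) * ?r" using r_Suc[of "Suc j"] by (simp add: level_mass_def)
    also have "\<dots> \<le> (1/2) ^ Suc (Suc j) * ?m"
      using level_var_ge_1[of "Suc j"] r_pos[of "Suc j"] mult_right_mono[of 1 ?v ?r]
      by (intro mult_left_mono) (auto simp: level_mass_def)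
    finally have "2 * level_mass (Suc (Suc j)) \<le> (1/2) ^ Suc j * ?m" by simp
    also have "(1/2) ^ Suc j \<le> 1 / i"
    proof -
      have "i \<le> 2 ^ Suc j" unfolding i_def using of_nat_less_two_power[of "Suc j", where 'a = real] by linarith
      then show ?thesis using i by (simp add: field_simps)
    qed
    finally show ?thesis using level_mass_pos[of "Suc j"] by (simp add: mult_right_mono)
  qed
  then have high: "real (n j) * (2 * level_mass (Suc (Suc j))) \<le> real (n j) * (1 / i * ?m)"
    by (intro mult_left_mono) auto
  \<comment> \<open>The 5 in the statement is 4 from the lower levels plus 1 from the higher
    ones.\<close>
  have "norm_var M X (n j) \<le> 4 / i * (?m * real (n j)) + ?m * real (n j) + real (n j) * (1 / i * ?m)"
    using norm_var_le_single_level[OF n1, of "Suc j"] low high by linarith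
  also have "\<dots> = ?m * real (n j) * (1 + 5 / i)" by (simp add: field_simps)
  finally show "norm_var M X (n j) \<le> ?m * real (n j) * (1 + 5 / real (Suc j))" by (simp only: i_def)
  have nr: "real (n j) * ?r \<le> 1 / i"
    using mult_right_mono[OF n_le, of ?r] r_pos[of "Suc j"] by simp
  show "real N * (?m * real (n j) * (1 - real N / real (Suc j))) \<le> norm_var M X (N * n j)"
  proof (cases "N = 0")
    case True
    then show ?thesis using norm_var_nonneg by simp
  next
    case False
    let ?n = "N * n j"
    have pos: "0 < real ?n" using False n1 by simp
    have "real N * (real (n j) * ?r) \<le> real N * (1 / i)" using nr by (intro mult_left_mono) auto
    then have "?m * (real ?n * (1 - real N / i)) \<le> ?m * (real ?n * (1 - real ?n * ?r))"
      using level_mass_pos[of "Suc j"] pos by (intro mult_left_mono) (auto simp: mult_ac)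
    also have "\<dots> = ?m * ((real ?n)\<^sup>2 * (1 - real ?n * ?r)) / real ?n"
      using pos by (simp add: power2_eq_square)
    also have "\<dots> \<le> level_term ?n (Suc j) / real ?n"
      using pos by (intro divide_right_mono level_term_ge_square) auto
    also have "\<dots> \<le> norm_var M X ?n" by (rule norm_var_ge_level)
    finally show ?thesis by (simp add: i_def mult_ac)
  qed
qed

text \<open>The upper bound holds for every n by the block comparison of lag sums. It is approached
  along times just below \<open>1 / r (Suc j)\<close>, where the variance of the sums is nearly
  quadratic, both at n and at N n.\<close>

lemma limsup_norm_var_ratio:
  assumes N: "1 \<le> N"
  shows "limsup (\<lambda>n. ereal (norm_var M X (N * n) / norm_var M X n)) = ereal (real N)"
proof (rule antisym)
  let ?R = "\<lambda>n. norm_var M X (N * n) / norm_var M X n"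
  have "?R n \<le> real N" for n
  proof (cases "norm_var M X n = 0")
    case False
    then have "0 < norm_var M X n" using norm_var_nonneg[of n] by simp
    then show ?thesis using norm_var_mult_le[OF N, of n] by (simp add: divide_le_eq)
  qed simp
  then show "limsup (\<lambda>n. ereal (?R n)) \<le> ereal (real N)"
    by (intro Limsup_bounded always_eventually) simp
  show "ereal (real N) \<le> limsup (\<lambda>n. ereal (?R n))"
  proof (rule ccontr)
    assume "\<not> ?thesis"
    then obtain y where y: "limsup (\<lambda>n. ereal (?R n)) < y" "y < ereal (real N)"
      using dense[of "limsup (\<lambda>n. ereal (?R n))" "ereal (real N)"] by (auto simp: not_le)
    define n where "n j = nat \<lfloor>1 / (real (Suc j) * r (Suc j))\<rfloor>" for j
    note regime = norm_var_quadratic_regime[folded n_def]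
    let ?l = "\<lambda>j. real N * (1 - real N / real (Suc j)) / (1 + 5 / real (Suc j))"
    have "?l \<longlonglongrightarrow> real N * (1 - 0) / (1 + 0)"
      by (intro tendsto_intros LIMSEQ_Suc[OF lim_const_over_n]) simp
    then have "(\<lambda>j. ereal (?l j)) \<longlonglongrightarrow> ereal (real N)" by simp
    then have "\<forall>\<^sub>F j in sequentially. y < ereal (?l j)" using y(2) by (rule order_tendstoD)
    moreover have "filterlim n sequentially sequentially"
      by (rule filterlim_at_top_mono[OF filterlim_ident]) (use regime(1) in simp)
    with Limsup_lessD[OF y(1)] have "\<forall>\<^sub>F j in sequentially. ereal (?R (n j)) < y"
      by (rule eventually_compose_filterlim)
    moreover have "\<forall>\<^sub>F j in sequentially. N \<le> j" by (rule eventually_ge_at_top)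
    ultimately have "\<forall>\<^sub>F j in sequentially. False"
    proof eventually_elim
      case (elim j)
      let ?b = "level_mass (Suc j) * real (n j)"
      \<comment> \<open>A zero denominator would give the quotient 0 and has to be excluded; it
        contradicts the lower bound with N = 1.\<close>
      have "0 < norm_var M X (n j) \<or> norm_var M X (n j) = 0" using norm_var_nonneg[of "n j"] by linarith
      then have "?l j \<le> ?R (n j)"
      proof
        assume pos: "0 < norm_var M X (n j)"
        have b: "0 < ?b * (1 + 5 / real (Suc j))" using pos regime(2)[of j] by linarith
        have "?l j = real N * (?b * (1 - real N / real (Suc j))) / (?b * (1 + 5 / real (Suc j)))"
        proof -
          have "c * (b * u) / (b * v) = c * u / v" if "b \<noteq> 0" for b c u v :: real using that by simp
          moreover have "?b \<noteq> 0" using b by (metis mult_zero_left less_irrefl)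
          ultimately show ?thesis by metis
        qed
        also have "\<dots> \<le> ?R (n j)"
          using elim(3) b pos regime(2)[of j] regime(3)[of N j] norm_var_nonneg[of "N * n j"]
          by (intro frac_le) auto
        finally show ?thesis .
      next
        assume 0: "norm_var M X (n j) = 0"
        have "1 \<le> n j" "1 / real (Suc j) < 1" using elim(3) N regime(1)[of j] by simp_all
        then have "0 < ?b * (1 - 1 / real (Suc j))" using level_mass_pos[of "Suc j"] by simp
        then show ?thesis using regime(3)[of 1 j] 0 by simp
      qed
      then have "ereal (?l j) \<le> ereal (?R (n j))" by simp
      then show ?case using elim(1,2) by (meson less_le_trans less_trans less_irrefl)
    qed
    then show False by simp
  qed
qed

end

section \<open>The stationary law split at one level\<close>

context sparse_process
begin

text \<open>The truncation level is \<open>amp j\<close>: what exceeds it are exactly the levels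
  after j, whose second moments sum to at most twice the first.\<close>

lemma integral_quantile_le:
  fixes u :: real
  assumes u: "0 \<le> u" "u \<le> 1"
  shows "0 \<le> (LBINT s:{0<..<u}. (quantile_fun M (\<lambda>\<omega>. \<bar>X 0 \<omega>\<bar>) s)\<^sup>2)"
    and "(LBINT s:{0<..<u}. (quantile_fun M (\<lambda>\<omega>. \<bar>X 0 \<omega>\<bar>) s)\<^sup>2)
      \<le> 2 * level_mass (Suc j) + u * (amp j)\<^sup>2"
proof -
  let ?W = "\<lambda>\<omega>. \<bar>X 0 \<omega>\<bar>"
  define \<phi> :: "real \<Rightarrow> real" where "\<phi> x = indicator {amp j<..} \<bar>x\<bar>" for x
  have W: "?W \<in> borel_measurable M" by measurable
  have int: "integrable M (\<lambda>\<omega>. (?W \<omega>)\<^sup>2)"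
    using integrable_state[of "\<lambda>x. x\<^sup>2" 0] square_integrable by simp
  have \<phi>: "\<phi> (- x) = \<phi> x" "\<bar>\<phi> x\<bar> \<le> 1" for x by (auto simp: \<phi>_def indicator_def)
  have "(\<integral>\<omega>. indicator {amp j<..} (?W \<omega>) * (?W \<omega>)\<^sup>2 \<partial>M) = (\<integral>x. \<phi> x * x\<^sup>2 \<partial>stat)"
    using expectation_state[of "\<lambda>x. \<phi> x * x\<^sup>2" 0] by (simp add: \<phi>_def)
  also have "\<dots> = (\<Sum>k. level_mass k * \<phi> (amp k))"
    by (rule even_weighted_square(3)) (rule \<phi>)+
  also have "\<dots> = (\<Sum>k. level_mass (k + Suc j) * \<phi> (amp (k + Suc j))) + (\<Sum>k<Suc j. level_mass k * \<phi> (amp k))"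
    by (rule suminf_split_initial_segment) (rule even_weighted_square(1)[of \<phi> 1, OF \<phi>])
  also have "(\<Sum>k<Suc j. level_mass k * \<phi> (amp k)) = 0"
    using amp_pos amp_less_iff by (intro sum.neutral) (auto simp: \<phi>_def indicator_def abs_of_pos)
  also have "(\<Sum>k. level_mass (k + Suc j) * \<phi> (amp (k + Suc j))) = (\<Sum>k. level_mass (k + Suc j))"
    using amp_pos amp_less_iff by (intro suminf_cong) (auto simp: \<phi>_def indicator_def abs_of_pos)
  finally have "(\<integral>\<omega>. indicator {amp j<..} (?W \<omega>) * (?W \<omega>)\<^sup>2 \<partial>M) \<le> 2 * level_mass (Suc j)"
    using suminf_level_mass_tail[of "Suc j"] by simp
  moreover have "0 \<le> amp j" using amp_pos[of j] by simp
  ultimately show "0 \<le> (LBINT s:{0<..<u}. (quantile_fun M ?W s)\<^sup>2)"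
    "(LBINT s:{0<..<u}. (quantile_fun M ?W s)\<^sup>2) \<le> 2 * level_mass (Suc j) + u * (amp j)\<^sup>2"
    using integral_quantile_square_le[OF W _ int u, of "amp j"] by auto
qed

text \<open>With level j + 1 singled out, the threshold \<open>r j\<close> separates the levels up
  to j from those after j + 1. The state 0 counts as frequently refreshed.\<close>

lemma prob_rarer_levels:
  "measure_pmf.prob stat {x. \<bar>x\<bar> \<noteq> amp (Suc j) \<and> rate x < r j} \<le> 2 * P (Suc (Suc j))"
proof -
  define E where "E = {x. \<bar>x\<bar> \<noteq> amp (Suc j) \<and> rate x < r j}"
  have E: "amp k \<in> E \<longleftrightarrow> Suc j < k" "0 \<notin> E" for k
  proof -
    have "r k < r j \<longleftrightarrow> j < k" using r_strict[of j k] r_antimono[of k j] by (cases "j < k") auto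
    then show "amp k \<in> E \<longleftrightarrow> Suc j < k"
      using amp_pos[of k] by (auto simp: E_def rate_amp amp_eq_iff)
    show "0 \<notin> E" using r_le_1[of j] by (simp add: E_def rate_0 not_less)
  qed
  have even: "indicat_real E (- x) = indicat_real E x" for x
    by (auto simp: E_def p_even indicator_def)
  have bnd: "\<bar>indicat_real E x\<bar> \<le> 1" for x by (simp add: indicator_def)
  note bounded = even_integral_bounded[of "indicat_real E" 1, OF even bnd]
  let ?f = "\<lambda>k. P k * indicator E (amp k)"
  have "measure_pmf.prob stat E = (\<integral>x. indicator E x \<partial>stat)" by simp
  also have "\<dots> = (1 - suminf P) * indicator E 0 + suminf ?f"
    by (rule bounded(2))
  also have "\<dots> = suminf ?f" using E(2) by simp
  also have "\<dots> = (\<Sum>k. ?f (k + Suc (Suc j))) + (\<Sum>k<Suc (Suc j). ?f k)"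
    by (rule suminf_split_initial_segment) (rule bounded(1))
  also have "(\<Sum>k<Suc (Suc j). ?f k) = 0"
    by (intro sum.neutral) (auto simp: indicator_def E)
  also have "(\<Sum>k. ?f (k + Suc (Suc j))) = (\<Sum>k. P (k + Suc (Suc j)))"
    by (intro suminf_cong) (auto simp: indicator_def E)
  also have "\<dots> + 0 \<le> 2 * P (Suc (Suc j))"
    using halving_summable(2)[of "\<lambda>k. P (k + Suc (Suc j))"] P_pos P_Suc_half by (simp add: less_imp_le)
  finally show ?thesis by (simp add: E_def)
qed

text \<open>Dividing by the rate turns the mass of a level into \<open>level_var\<close>, and the
  last of the j + 1 values is the largest.\<close>

lemma frequent_levels_variance:
  "(\<integral>x. indicator {x. \<bar>x\<bar> \<noteq> amp (Suc j) \<and> r j \<le> rate x} x * (x\<^sup>2 / rate x) \<partial>stat)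
    \<le> real (Suc j) * level_var j"
proof -
  define E where "E = {x. \<bar>x\<bar> \<noteq> amp (Suc j) \<and> r j \<le> rate x}"
  define \<phi> where "\<phi> x = indicator E x / rate x" for x
  have E: "amp k \<in> E \<longleftrightarrow> k \<le> j" for k
  proof -
    have "r j \<le> r k \<longleftrightarrow> k \<le> j" using r_strict[of j k] r_antimono[of k j] by (cases "j < k") auto
    then show ?thesis using amp_pos[of k] by (auto simp: E_def rate_amp amp_eq_iff)
  qed
  have \<phi>: "\<phi> (- x) = \<phi> x" "\<bar>\<phi> x\<bar> \<le> 1 / r j" for x
  proof -
    show "\<phi> (- x) = \<phi> x" by (auto simp: \<phi>_def E_def p_even indicator_def)
    show "\<bar>\<phi> x\<bar> \<le> 1 / r j"
      using r_pos[of j] p_pos[of x] by (auto simp: \<phi>_def E_def indicator_def intro: divide_left_mono)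
  qed
  have "(\<integral>x. indicator E x * (x\<^sup>2 / rate x) \<partial>stat) = (\<integral>x. \<phi> x * x\<^sup>2 \<partial>stat)" by (simp add: \<phi>_def)
  also have "\<dots> = (\<Sum>k. level_mass k * \<phi> (amp k))"
    by (rule even_weighted_square(3)) (rule \<phi>)+
  also have "\<dots> = (\<Sum>k\<in>{..j}. level_mass k * \<phi> (amp k))"
    by (rule suminf_finite) (auto simp: \<phi>_def E)
  also have "\<dots> = (\<Sum>k\<in>{..j}. level_var k)"
  proof (rule sum.cong[OF refl])
    fix k assume "k \<in> {..j}"
    then show "level_mass k * \<phi> (amp k) = level_var k"
      using amp_pos[of k] r_pos[of k] by (simp add: \<phi>_def E rate_amp level_mass_def)
  qed
  also have "\<dots> \<le> (\<Sum>k\<in>{..j}. level_var j)" by (intro sum_mono level_var_mono) auto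
  finally show ?thesis by (simp add: E_def)
qed

lemma P_r_pos: "0 < P j * r j" and P_r_le: "P j * r j \<le> 1"
proof -
  show "0 < P j * r j" using P_pos r_pos by simp
  have "(1/2 :: real) ^ j \<le> 1" by (rule power_le_one) auto
  then have "P j \<le> 1" using P_le[of j] by simp
  then show "P j * r j \<le> 1" using P_pos[of j] r_pos[of j] r_le_1[of j] by (intro mult_le_one) auto
qed

lemma r_le_half_power: "r j \<le> (1/2) ^ j"
proof (induction j)
  case (Suc j)
  then show ?case using r_Suc_half[of j] by simp
qed (use r_le_1 in simp)

lemma P_le_half_power: "P j \<le> (1/2) ^ j"
  using P_le[of j] zero_le_power[of "1/2 :: real" j] by linarith

lemma half_power_tendsto: "(\<lambda>j. (1/2 :: real) ^ j) \<longlonglongrightarrow> 0"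
  by (rule LIMSEQ_power_zero) simp

lemma P_tendsto: "P \<longlonglongrightarrow> 0" and r_tendsto: "r \<longlonglongrightarrow> 0"
  by (rule tendsto_sandwich[OF _ _ tendsto_const half_power_tendsto];
      use P_pos P_le_half_power r_pos r_le_half_power in \<open>auto intro!: always_eventually less_imp_le\<close>)+

end

text \<open>Sandwich \<open>1 - x\<close> between \<open>exp (- x / (1 - x))\<close> and
  \<open>exp (- x)\<close>. The two-sided hypothesis on \<open>n * s\<close> is what rounding 1 / s
  up to an integer yields.\<close>

lemma power_compl_tendsto_exp:
  fixes s :: "nat \<Rightarrow> real" and n :: "nat \<Rightarrow> nat"
  assumes s: "\<And>j. 0 < s j" "\<And>j. s j \<le> 1" "s \<longlonglongrightarrow> 0"
    and n: "\<And>j. 1 \<le> real (n j) * s j" "\<And>j. real (n j) * s j \<le> 1 + s j" and c: "0 \<le> c" "c < 1"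
  shows "(\<lambda>j. (1 - s j * c) ^ n j) \<longlonglongrightarrow> exp (- c)"
proof (rule tendsto_sandwich)
  have sc: "0 \<le> s j * c" "s j * c < 1" for j
    using s(1)[of j] s(2)[of j] c mult_mono[of "s j" 1 c c] by auto
  show "\<forall>\<^sub>F j in sequentially. exp (- ((1 + s j) * c / (1 - s j * c))) \<le> (1 - s j * c) ^ n j"
  proof (intro always_eventually allI)
    fix j
    let ?x = "s j * c"
    have "1 + ?x / (1 - ?x) = 1 / (1 - ?x)" using sc[of j] by (simp add: field_simps)
    then have "1 / (1 - ?x) \<le> exp (?x / (1 - ?x))"
      using exp_ge_add_one_self[of "?x / (1 - ?x)"] by linarith
    then have "1 / exp (?x / (1 - ?x)) \<le> 1 / (1 / (1 - ?x))"
      using sc[of j] by (intro divide_left_mono) auto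
    then have base: "exp (- (?x / (1 - ?x))) \<le> 1 - ?x"
      by (simp add: exp_minus inverse_eq_divide)
    have "real (n j) * ?x \<le> (1 + s j) * c"
      using mult_right_mono[OF n(2)[of j] c(1)] by (simp add: mult_ac)
    then have "real (n j) * (?x / (1 - ?x)) \<le> (1 + s j) * c / (1 - ?x)"
      using sc[of j] by (simp add: divide_right_mono)
    then have "exp (- ((1 + s j) * c / (1 - ?x))) \<le> exp (real (n j) * - (?x / (1 - ?x)))" by simp
    also have "\<dots> = exp (- (?x / (1 - ?x))) ^ n j" by (rule exp_of_nat_mult)
    also have "\<dots> \<le> (1 - ?x) ^ n j" by (rule power_mono[OF base]) simp
    finally show "exp (- ((1 + s j) * c / (1 - ?x))) \<le> (1 - ?x) ^ n j" .
  qed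
  show "\<forall>\<^sub>F j in sequentially. (1 - s j * c) ^ n j \<le> exp (- c)"
  proof (intro always_eventually allI)
    fix j
    have "(1 - s j * c) ^ n j \<le> exp (- (s j * c)) ^ n j"
      using exp_ge_add_one_self[of "- (s j * c)"] sc[of j] by (intro power_mono) auto
    also have "\<dots> = exp (real (n j) * - (s j * c))" by (rule exp_of_nat_mult[symmetric])
    also have "\<dots> \<le> exp (- c)" using mult_right_mono[OF n(1)[of j] c(1)] by (simp add: mult_ac)
    finally show "(1 - s j * c) ^ n j \<le> exp (- c)" .
  qed
  have "(\<lambda>j. exp (- ((1 + s j) * c / (1 - s j * c)))) \<longlonglongrightarrow> exp (- ((1 + 0) * c / (1 - 0 * c)))"
    by (intro tendsto_intros s(3)) simp
  then show "(\<lambda>j. exp (- ((1 + s j) * c / (1 - s j * c)))) \<longlonglongrightarrow> exp (- c)" by simp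
qed simp

section \<open>Compound Poisson limit along the block lengths\<close>

context sparse_process
begin

text \<open>On the time scale \<open>block_length j\<close> the chain visits level \<open>Suc j\<close> about a Poisson number of times, each
  visit contributing \<open>\<plusminus>amp\<close> times a geometric, hence nearly exponential, holding time. Lower levels
  are negligible in \<open>L\<^sup>2\<close> after division by \<open>block_scale j\<close>, and higher levels are not seen at all.\<close>

definition block_length :: "nat \<Rightarrow> nat" where
  "block_length j = nat \<lceil>1 / (P (Suc j) * r (Suc j))\<rceil>"

definition block_scale :: "nat \<Rightarrow> real" where "block_scale j = amp (Suc j) / r (Suc j)"

lemma block_length_bounds:
  "1 / (P (Suc j) * r (Suc j)) \<le> real (block_length j)"
  "real (block_length j) < 1 / (P (Suc j) * r (Suc j)) + 1"
proof -
  have "0 < 1 / (P (Suc j) * r (Suc j))" using P_r_pos[of "Suc j"] by simp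
  then show "1 / (P (Suc j) * r (Suc j)) \<le> real (block_length j)"
    "real (block_length j) < 1 / (P (Suc j) * r (Suc j)) + 1"
    unfolding block_length_def by linarith+
qed

lemma block_length_mult:
  "1 \<le> real (block_length j) * (P (Suc j) * r (Suc j))"
  "real (block_length j) * (P (Suc j) * r (Suc j)) \<le> 1 + P (Suc j) * r (Suc j)"
proof -
  let ?q = "P (Suc j) * r (Suc j)"
  have q: "0 < ?q" by (rule P_r_pos)
  show "1 \<le> real (block_length j) * ?q"
    using block_length_bounds(1)[of j] q by (subst (asm) pos_divide_le_eq) auto
  have "real (block_length j) * ?q \<le> (1 / ?q + 1) * ?q"
    using block_length_bounds(2)[of j] q by (intro mult_right_mono) auto
  also have "\<dots> = 1 + ?q"
  proof -
    have "?q \<noteq> 0" using q by linarith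
    then have "1 / ?q * ?q = 1" by (metis nonzero_eq_divide_eq)
    then show ?thesis unfolding distrib_right by simp
  qed
  finally show "real (block_length j) * ?q \<le> 1 + ?q" .
qed

lemma block_length_pos: "0 < block_length j"
  using block_length_mult(1)[of j] by (cases "block_length j") auto

lemma strict_mono_block_length: "strict_mono block_length"
proof (rule strict_mono_Suc_iff[THEN iffD2], rule allI)
  fix j
  define s where "s = P (Suc j) * r (Suc j)"
  define s' where "s' = P (Suc (Suc j)) * r (Suc (Suc j))"
  have s: "0 < s" "s \<le> 1" "0 < s'" using P_r_pos P_r_le by (simp_all add: s_def s'_def)
  \<comment> \<open>The resulting factor 4 leaves room for the rounding in the ceiling.\<close>
  have "s' \<le> (P (Suc j) / 2) * (r (Suc j) / 2)"
    unfolding s'_def using P_Suc_half r_Suc_half P_pos r_pos by (intro mult_mono) (auto simp: less_imp_le)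
  then have "s' \<le> s / 4" by (simp add: s_def)
  then have "1 / (s / 4) \<le> 1 / s'" using s by (intro divide_left_mono) auto
  moreover have "1 \<le> 1 / s" using s by simp
  ultimately have "1 / s + 1 \<le> 1 / s'" by simp
  then show "block_length j < block_length (Suc j)"
    using block_length_bounds(2)[of j] block_length_bounds(1)[of "Suc j"] unfolding s_def s'_def by linarith
qed

lemma block_scale_pos: "0 < block_scale j"
  unfolding block_scale_def using amp_pos r_pos by simp

lemma block_scale_sq: "(block_scale j)\<^sup>2 = level_var (Suc j) / (P (Suc j) * r (Suc j))"
  unfolding block_scale_def power_divide amp_sq using r_pos[of "Suc j"] by (simp add: power2_eq_square)

lemma block_scale_at_top: "filterlim block_scale at_top sequentially"
proof (rule filterlim_at_top_mono)
  show "filterlim (\<lambda>j. amp 0 * real j) at_top sequentially"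
    by (rule filterlim_tendsto_pos_mult_at_top[OF tendsto_const amp_pos filterlim_real_sequentially])
  show "\<forall>\<^sub>F j in sequentially. amp 0 * real j \<le> block_scale j"
  proof (intro always_eventually allI)
    fix j
    have "amp 0 \<le> amp (Suc j)" using amp_less_iff[of 0 "Suc j"] by simp
    moreover have "real j \<le> 1 / r (Suc j)"
    proof -
      have "(2::real) ^ Suc j \<le> 1 / r (Suc j)"
        using r_le_half_power[of "Suc j"] r_pos[of "Suc j"] by (simp add: field_simps)
      moreover have "real (Suc j) < 2 ^ Suc j" by (rule of_nat_less_two_power)
      ultimately show ?thesis by simp
    qed
    ultimately have "amp 0 * real j \<le> amp (Suc j) * (1 / r (Suc j))"
      using amp_pos by (intro mult_mono) (auto simp: less_imp_le)
    then show "amp 0 * real j \<le> block_scale j" by (simp add: block_scale_def)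
  qed
qed

text \<open>The square root comes from the lower levels, the power of 1/2 from the higher ones, and
  the last two terms from the approximate eigenfunction of the level itself. The threshold for
  frequent refreshing is the rate of the level just below.\<close>

lemma char_block_approx:
  defines "q \<equiv> \<lambda>j. P (Suc j) * r (Suc j)"
  shows "norm ((\<integral>\<omega>. iexp (t * (partial_sum X (block_length j) \<omega> / block_scale j)) \<partial>M)
      - complex_of_real (1 - q j * (t\<^sup>2 / (1 + t\<^sup>2))) ^ block_length j)
    \<le> \<bar>t\<bar> * sqrt (4 / real (Suc j)) + (1/2) ^ j + 60 * P (Suc j) + t\<^sup>2 * r (Suc j)"
proof -
  let ?n = "block_length j" and ?b = "block_scale j" and ?a = "amp (Suc j)" and ?P = "P (Suc j)" and ?r = "r (Suc j)"
  let ?h = "\<lambda>x. t * rate ?a * (if \<bar>x\<bar> = ?a then sgn x else 0)"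
  define \<rho> where "\<rho> = measure_pmf.prob stat {x. \<bar>x\<bar> \<noteq> ?a \<and> rate x < r j}"
  have pos: "0 < ?P" "0 < ?r" "?r \<le> 1" "0 < ?a" using P_pos r_pos r_le_1 amp_pos by auto
  have q: "0 < q j" "q j \<le> 1" using P_r_pos P_r_le by (auto simp: q_def)
  have nq: "real ?n * q j \<le> 2" using block_length_mult(2)[of j] q by (simp add: q_def)
  have rate_a: "rate ?a = ?r" using pos by (intro rate_amp) simp
  \<comment> \<open>The scale is the amplitude times the mean holding time, so a phase of
    \<open>t * rate ?a\<close> per step accumulates to order t during one visit.\<close>
  have scale: "t * ?a / ?b = t * rate ?a" using pos by (simp add: block_scale_def rate_a)
  have \<rho>0: "0 \<le> \<rho>" by (simp add: \<rho>_def)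
  have "\<rho> \<le> 2 * P (Suc (Suc j))" unfolding \<rho>_def by (rule prob_rarer_levels)
  also have "\<dots> \<le> 2 * ((1/2) ^ Suc (Suc (Suc j)) * ?P * ?r)" by (intro mult_left_mono P_Suc) simp
  also have "\<dots> = (1/2) ^ Suc (Suc j) * q j" by (simp add: q_def)
  finally have \<rho>q: "\<rho> \<le> (1/2) ^ Suc (Suc j) * q j" .
  have "(1/2) ^ Suc (Suc j) * q j \<le> 1 * ?P"
    using pos q unfolding q_def by (intro mult_mono power_le_one) (auto intro: mult_left_le)
  then have \<rho>P: "\<rho> \<le> ?P" using \<rho>q by simp
  have I: "(\<integral>\<omega>. iexp (\<Sum>k=1..int ?n. t * ?a / ?b * (if \<bar>X k \<omega>\<bar> = ?a then sgn (X k \<omega>) else 0)) \<partial>M)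
      = (\<integral>x. (FK (\<lambda>x. iexp (?h x)) ^^ ?n) (\<lambda>_. 1) x \<partial>stat)"
    using char_sum[where n = ?n and h = ?h] by (simp only: scale)
  have "norm ((\<integral>\<omega>. iexp (t * (partial_sum X ?n \<omega> / ?b)) \<partial>M)
      - (\<integral>x. (FK (\<lambda>x. iexp (?h x)) ^^ ?n) (\<lambda>_. 1) x \<partial>stat))
    \<le> \<bar>t\<bar> / ?b * sqrt (2 * real ?n * (real (Suc j) * level_var j)) + 2 * real ?n * \<rho>"
    unfolding I[symmetric] \<rho>_def
    by (rule char_single_component[OF square_integrable _ block_scale_pos _ frequent_levels_variance])
      (use amp_pos r_pos in auto)
  moreover have "\<bar>t\<bar> / ?b * sqrt (2 * real ?n * (real (Suc j) * level_var j)) \<le> \<bar>t\<bar> * sqrt (4 / real (Suc j))"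
  proof -
    let ?i = "real (Suc j)"
    have "sqrt (2 * real ?n * (?i * level_var j)) / ?b = sqrt (2 * real ?n * (?i * level_var j) / ?b\<^sup>2)"
      using block_scale_pos[of j] by (simp add: real_sqrt_divide)
    also have "\<dots> \<le> sqrt (4 / ?i)"
    proof (rule real_sqrt_le_mono)
      have v: "0 < level_var j" by (rule level_var_pos)
      have "2 * real ?n * (?i * level_var j) / ?b\<^sup>2 = 2 * (real ?n * q j) * (?i * level_var j / level_var (Suc j))"
        unfolding block_scale_sq q_def using pos level_var_pos[of "Suc j"] by (simp add: field_simps)
      also have "\<dots> = 2 * (real ?n * q j) * (?i / (?i + 1) ^ 4)"
        unfolding level_var_Suc using v by (simp add: add.commute)
      also have "\<dots> \<le> 2 * 2 * (1 / ?i)"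
      proof (intro mult_mono)
        have "?i * ?i \<le> (?i + 1) ^ 2" by (simp add: power2_eq_square algebra_simps)
        also have "\<dots> \<le> (?i + 1) ^ 4" by (rule power_increasing) auto
        finally show "?i / (?i + 1) ^ 4 \<le> 1 / ?i" by (subst frac_le_eq) (auto simp: divide_le_0_iff)
      qed (use nq q in auto)
      finally show "2 * real ?n * (?i * level_var j) / ?b\<^sup>2 \<le> 4 / ?i" by simp
    qed
    finally have "\<bar>t\<bar> * (sqrt (2 * real ?n * (?i * level_var j)) / ?b) \<le> \<bar>t\<bar> * sqrt (4 / ?i)"
      by (rule mult_left_mono) simp
    then show ?thesis by simp
  qed
  moreover have "2 * real ?n * \<rho> \<le> (1/2) ^ j"
  proof -
    have "2 * real ?n * \<rho> \<le> 2 * real ?n * ((1/2) ^ Suc (Suc j) * q j)" using \<rho>q by (intro mult_left_mono) auto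
    also have "\<dots> = (real ?n * q j) * ((1/2) ^ j / 2)" by simp
    also have "\<dots> \<le> 2 * ((1/2) ^ j / 2)" using nq by (intro mult_right_mono) auto
    finally show ?thesis by simp
  qed
  moreover have "norm ((\<integral>x. (FK (\<lambda>x. iexp (?h x)) ^^ ?n) (\<lambda>_. 1) x \<partial>stat)
      - complex_of_real (1 - q j * (t\<^sup>2 / (1 + t\<^sup>2))) ^ ?n) \<le> 60 * ?P + t\<^sup>2 * ?r"
  proof -
    have "norm ((\<integral>x. (FK (\<lambda>x. iexp (?h x)) ^^ ?n) (\<lambda>_. 1) x \<partial>stat)
        - complex_of_real (1 - q j * (t\<^sup>2 / (1 + t\<^sup>2))) ^ ?n)
      \<le> 4 * ?P + 4 * ?P * ?r / r j + real ?n * q j * (12 * ?P + 10 * \<rho> + 4 * ?P * ?r / r j + t\<^sup>2 * ?r / 2)"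
      using component_char_approx[OF pos(4) r_pos[of j] Z_ge, where t = t and n = ?n]
      unfolding prob_level rate_a \<rho>_def q_def .
    \<comment> \<open>Uses that rates decrease, that \<rho> is at most the mass of the level and
      that \<open>n * q\<close> is at most 2; the masses add up to 8 + 2 * 26 = 60.\<close>
    also have "\<dots> \<le> 4 * ?P + 4 * ?P + 2 * (12 * ?P + 10 * ?P + 4 * ?P + t\<^sup>2 * ?r / 2)"
    proof -
      have "?r / r j \<le> 1" using r_antimono[of j "Suc j"] r_pos[of j] by simp
      then have x: "4 * ?P * (?r / r j) \<le> 4 * ?P * 1" using pos by (intro mult_left_mono) auto
      have x0: "0 \<le> 4 * ?P * (?r / r j)" using pos r_pos[of j] by simp
      have "12 * ?P + 10 * \<rho> + 4 * ?P * (?r / r j) + t\<^sup>2 * ?r / 2 \<le> 12 * ?P + 10 * ?P + 4 * ?P + t\<^sup>2 * ?r / 2"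
        using x \<rho>P by linarith
      moreover have "0 \<le> 12 * ?P + 10 * \<rho> + 4 * ?P * (?r / r j) + t\<^sup>2 * ?r / 2"
        using x0 \<rho>0 pos by simp
      ultimately have "real ?n * q j * (12 * ?P + 10 * \<rho> + 4 * ?P * (?r / r j) + t\<^sup>2 * ?r / 2)
          \<le> 2 * (12 * ?P + 10 * ?P + 4 * ?P + t\<^sup>2 * ?r / 2)"
        using nq by (intro mult_mono) auto
      then show ?thesis using x by simp
    qed
    also have "\<dots> = 60 * ?P + t\<^sup>2 * ?r" by simp
    finally show ?thesis .
  qed
  ultimately show ?thesis
    by (rule_tac norm_diff_triangle_le[THEN order_trans]) (assumption+, linarith)
qed

text \<open>Levy continuity: the eigenvalue \<open>1 - q * c\<close>, raised to a power of about 1 /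
  q, tends to \<open>exp (- c)\<close>, and \<open>1 - c\<close> is the characteristic function of
  the Laplace law.\<close>

lemma weak_conv_blocks:
  "weak_conv_m (\<lambda>j. distr M borel (\<lambda>\<omega>. partial_sum X (block_length j) \<omega> / block_scale j)) mu_P1sL"
proof (rule levy_continuity)
  have [measurable]: "partial_sum X n \<in> borel_measurable M" for n
    unfolding partial_sum_def[abs_def] by measurable
  show "real_distribution (distr M borel (\<lambda>\<omega>. partial_sum X (block_length j) \<omega> / block_scale j))" for j
    by (rule real_distribution_distr) measurable
  show "real_distribution mu_P1sL" by (rule real_distribution_mu_P1sL)
  fix t :: real
  define c where "c = t\<^sup>2 / (1 + t\<^sup>2)"
  define q where "q j = P (Suc j) * r (Suc j)" for j
  have t2: "0 \<le> t\<^sup>2" by simp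
  have c: "0 \<le> c" "c < 1" unfolding c_def using t2 by (simp_all add: divide_less_eq add_pos_nonneg)
  let ?\<phi> = "\<lambda>j. \<integral>\<omega>. iexp (t * (partial_sum X (block_length j) \<omega> / block_scale j)) \<partial>M"
  have char: "char (distr M borel (\<lambda>\<omega>. partial_sum X (block_length j) \<omega> / block_scale j)) t = ?\<phi> j" for j
    unfolding char_def by (subst integral_distr) auto
  have "q \<longlonglongrightarrow> 0 * 0"
    unfolding q_def by (intro tendsto_mult LIMSEQ_Suc P_tendsto r_tendsto)
  then have "q \<longlonglongrightarrow> 0" by simp
  then have "(\<lambda>j. (1 - q j * c) ^ block_length j) \<longlonglongrightarrow> exp (- c)"
    by (rule power_compl_tendsto_exp[rotated 2])
      (use P_r_pos P_r_le block_length_mult c in \<open>auto simp: q_def\<close>)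
  then have main: "(\<lambda>j. complex_of_real (1 - q j * c) ^ block_length j) \<longlonglongrightarrow> complex_of_real (exp (- c))"
    unfolding of_real_power[symmetric] by (rule tendsto_of_real)
  have err: "(\<lambda>j. ?\<phi> j - complex_of_real (1 - q j * c) ^ block_length j) \<longlonglongrightarrow> 0"
  proof (rule Lim_null_comparison)
    show "\<forall>\<^sub>F j in sequentially. norm (?\<phi> j - complex_of_real (1 - q j * c) ^ block_length j)
        \<le> \<bar>t\<bar> * sqrt (4 / real (Suc j)) + (1/2) ^ j + 60 * P (Suc j) + t\<^sup>2 * r (Suc j)"
      unfolding q_def c_def by (intro always_eventually allI char_block_approx)
    have "(\<lambda>j. \<bar>t\<bar> * sqrt (4 / real (Suc j)) + (1/2) ^ j + 60 * P (Suc j) + t\<^sup>2 * r (Suc j))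
        \<longlonglongrightarrow> \<bar>t\<bar> * sqrt 0 + 0 + 60 * 0 + t\<^sup>2 * 0"
      by (intro tendsto_intros half_power_tendsto LIMSEQ_Suc[OF P_tendsto] LIMSEQ_Suc[OF r_tendsto]
          LIMSEQ_Suc[OF lim_const_over_n])
    then show "(\<lambda>j. \<bar>t\<bar> * sqrt (4 / real (Suc j)) + (1/2) ^ j + 60 * P (Suc j) + t\<^sup>2 * r (Suc j)) \<longlonglongrightarrow> 0"
      by simp
  qed
  have "?\<phi> \<longlonglongrightarrow> complex_of_real (exp (- c))"
    using tendsto_add[OF err main] by simp
  moreover have "complex_of_real (exp (- c)) = char mu_P1sL t"
  proof -
    have "1 + t\<^sup>2 \<noteq> 0" using t2 by linarith
    then have "- c = 1 / (1 + t\<^sup>2) - 1" by (simp add: c_def field_simps)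
    then show ?thesis by (simp add: char_mu_P1sL)
  qed
  ultimately show "(\<lambda>j. char (distr M borel (\<lambda>\<omega>. partial_sum X (block_length j) \<omega> / block_scale j)) t)
      \<longlonglongrightarrow> char mu_P1sL t"
    unfolding char by simp
qed

end

section \<open>Choice of the levels\<close>

context log_convex_rate
begin

text \<open>\<open>T i\<close> is the time before which level i must not show in the variance. The
  choice is dependent: each new point must be so far out that its rate and mass are tiny compared
  with those of the preceding level.\<close>

lemma ex_tangent_sequence:
  fixes g T :: "_ \<Rightarrow> real" and \<epsilon> :: real
  assumes g: "filterlim g at_top at_top" and T: "\<And>i. 0 < T i" and \<epsilon>: "0 < \<epsilon>"
  shows "\<exists>x :: nat \<Rightarrow> real. \<forall>i. (1 < x i \<and> \<theta> (x i) \<le> 1/8 \<and> (\<forall>y\<ge>x i. f y / \<theta> y \<le> 2 * (f (x i) / \<theta> (x i))) \<and>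
      (\<forall>y\<ge>x i. level_var (Suc i) * 2 ^ Suc i \<le> g y) \<and> level_var i * (2 * \<theta> (x i)) * T i \<le> 1/2) \<and>
    (x i + 1 \<le> x (Suc i) \<and> level_var (Suc i) * (2 * \<theta> (x (Suc i))) \<le> (1/2) ^ Suc i * (2 * \<theta> (x i)) \<and>
      f (x (Suc i)) \<le> (1/2) ^ Suc (Suc i) * (\<epsilon> * (1/2) ^ i * f (x i)) * (2 * \<theta> (x i)))"
proof -
  define good where "good i x \<longleftrightarrow> 1 < x \<and> \<theta> x \<le> 1/8 \<and> (\<forall>y\<ge>x. f y / \<theta> y \<le> 2 * (f x / \<theta> x)) \<and>
      (\<forall>y\<ge>x. level_var (Suc i) * 2 ^ Suc i \<le> g y) \<and> level_var i * (2 * \<theta> x) * T i \<le> 1/2" for i x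
  have v: "0 < level_var i" for i using level_var_ge_1[of i] by linarith
  have ex: "\<exists>x>X. good i x \<and> \<theta> x \<le> B \<and> f x \<le> B" if B: "0 < B" for i X B
  proof -
    have "\<forall>\<^sub>F y in at_top. level_var (Suc i) * 2 ^ Suc i \<le> g y" using g by (simp add: filterlim_at_top)
    then obtain Y where Y: "\<And>y. Y \<le> y \<Longrightarrow> level_var (Suc i) * 2 ^ Suc i \<le> g y"
      by (auto simp: eventually_at_top_linorder)
    \<comment> \<open>The bound 1/8 keeps the rate \<open>2 * \<theta>\<close> below 1/4, and the
      last entry makes \<open>level_var i * 2 * \<theta> * T i\<close> at most 1/2.\<close>
    define b where "b = min B (min (1/8) (1 / (4 * level_var i * T i)))"
    have b: "0 < b" using B v[of i] T[of i] by (simp add: b_def)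
    obtain x where x: "max X Y < x" "1 < x" "\<theta> x \<le> b" "f x \<le> b" "\<forall>y\<ge>x. f y / \<theta> y \<le> 2 * (f x / \<theta> x)"
      using ex_tangent_point[OF b, of "max X Y"] by blast
    have "\<theta> x \<le> 1 / (4 * level_var i * T i)" using x(3) by (simp add: b_def)
    then have "(4 * level_var i * T i) * \<theta> x \<le> 1"
      using v[of i] T[of i] by (simp add: le_divide_eq mult_ac)
    then have "level_var i * (2 * \<theta> x) * T i \<le> 1/2" by (simp add: mult_ac)
    then have "good i x" unfolding good_def using x Y by (auto simp: b_def)
    then show ?thesis using x by (intro exI[of _ x]) (auto simp: b_def)
  qed
  have "\<exists>x. \<forall>i. good i (x i) \<and> (x i + 1 \<le> x (Suc i) \<and> level_var (Suc i) * (2 * \<theta> (x (Suc i))) \<le> (1/2) ^ Suc i * (2 * \<theta> (x i)) \<and>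
      f (x (Suc i)) \<le> (1/2) ^ Suc (Suc i) * (\<epsilon> * (1/2) ^ i * f (x i)) * (2 * \<theta> (x i)))"
  proof (rule dependent_nat_choice)
    show "\<exists>x. good 0 x" using ex[of 1 0 0] by auto
    fix x i assume x: "good i x"
    have pos: "0 < f x" "0 < \<theta> x" using x f_pos[of x] \<theta>_pos[of x] by (auto simp: good_def)
    \<comment> \<open>The first entry separates the rates of the two levels. The second makes the
      next level so rare that it is hardly ever met during about \<open>1 / (P i * r i)\<close>
      steps.\<close>
    let ?B = "min ((1/2) ^ Suc i * \<theta> x / level_var (Suc i)) ((1/2) ^ Suc (Suc i) * (\<epsilon> * (1/2) ^ i * f x) * (2 * \<theta> x))"
    have "0 < ?B" using pos \<epsilon> v[of "Suc i"] by simp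
    then obtain y where y: "x + 1 < y" "good (Suc i) y" "\<theta> y \<le> ?B" "f y \<le> ?B"
      using ex[of ?B "x + 1" "Suc i"] by blast
    have "\<theta> y \<le> (1/2) ^ Suc i * \<theta> x / level_var (Suc i)" using y(3) by (simp only: min.bounded_iff)
    then have "\<theta> y * level_var (Suc i) \<le> (1/2) ^ Suc i * \<theta> x" using v[of "Suc i"] by (simp only: pos_le_divide_eq)
    then have "level_var (Suc i) * (2 * \<theta> y) \<le> (1/2) ^ Suc i * (2 * \<theta> x)" by (simp add: mult_ac)
    moreover have "f y \<le> (1/2) ^ Suc (Suc i) * (\<epsilon> * (1/2) ^ i * f x) * (2 * \<theta> x)"
      using y(4) by (simp only: min.bounded_iff)
    ultimately show "\<exists>y. good (Suc i) y \<and> (x + 1 \<le> y \<and> level_var (Suc i) * (2 * \<theta> y) \<le> (1/2) ^ Suc i * (2 * \<theta> x) \<and>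
      f y \<le> (1/2) ^ Suc (Suc i) * (\<epsilon> * (1/2) ^ i * f x) * (2 * \<theta> x))"
      using y(1,2) by (intro exI[of _ y]) simp
  qed
  then show ?thesis unfolding good_def .
qed

end

theorem theorem5p5:
  fixes f g :: "real \<Rightarrow> real"
  assumes a: "\<And>x. x \<ge> 1 \<Longrightarrow> 0 < f x \<and> f x \<le> 1"
    and b: "continuous_on {1..} f" "strict_antimono_on {1..} f" "(f \<longlongrightarrow> 0) at_top"
    and c: "\<And>x. x > 1 \<Longrightarrow> f differentiable (at x)"
           "\<And>x. x > 1 \<Longrightarrow> deriv f differentiable (at x)"
           "continuous_on {1<..} (deriv (deriv f))"
    and d: "\<And>c. c > 0 \<Longrightarrow> filterlim (\<lambda>x. exp (c * x) * f x) at_top at_top"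
    and e: "\<exists>w>1. antimono_on {w..} (\<lambda>x. x * f x)"
    and f: "convex_on {1..} (\<lambda>x. ln (f x))"
    and g1: "\<And>x. x \<ge> 1 \<Longrightarrow> g x \<ge> 1"
    and g2: "filterlim g at_top at_top"
  shows "\<exists>(M :: (int \<Rightarrow> real) measure) (X :: int \<Rightarrow> (int \<Rightarrow> real) \<Rightarrow> real) (S :: real set).
    prob_space M \<and>
    strictly_stationary M X \<and>
    countable_state_markov_chain M X S \<and>
    irreducible_chain M X S \<and>
    aperiodic_chain M X S \<and>
    reversible M X \<and>
    integrable M (\<lambda>\<omega>. (X 0 \<omega>)\<^sup>2) \<and>
    prob_space.expectation M (X 0) = 0 \<and>
    \<comment> \<open>(1)\<close>
    (\<lambda>x. LBINT u:{0<..<f x}. (quantile_fun M (\<lambda>\<omega>. \<bar>X 0 \<omega>\<bar>) u)\<^sup>2)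
      \<in> O[at_top](\<lambda>x. (- deriv f x) / f x * g x) \<and>
    \<comment> \<open>(2)\<close>
    (\<forall>n::nat. n \<ge> 1 \<longrightarrow>
       alpha_mixing M X n \<le> beta_mixing M X n \<and> beta_mixing M X n \<le> f (real n)) \<and>
    \<comment> \<open>(3)\<close>
    filterlim (norm_var M X) at_top sequentially \<and>
    (\<forall>c>0. (\<lambda>n. SUP r::real. measure M {\<omega>\<in>space M.
        r - c < partial_sum X n \<omega> / sqrt (real n) \<and> partial_sum X n \<omega> / sqrt (real n) < r + c})
      \<longlonglongrightarrow> 0) \<and>
    \<comment> \<open>(4)\<close>
    (\<exists>(J :: nat \<Rightarrow> nat) (b :: nat \<Rightarrow> real).
       strict_mono J \<and> (\<forall>n. J n > 0) \<and> (\<forall>n. b n > 0) \<and>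
       filterlim b at_top sequentially \<and>
       weak_conv_m (\<lambda>n. distr M borel (\<lambda>\<omega>. partial_sum X (J n) \<omega> / b n)) mu_P1sL) \<and>
    \<comment> \<open>(5)\<close>
    (\<forall>n::nat. n \<ge> 1 \<longrightarrow> norm_var M X n \<le> g (real n)) \<and>
    (\<forall>N::nat. N \<ge> 1 \<longrightarrow>
       limsup (\<lambda>n. ereal (norm_var M X (N * n) / norm_var M X n)) = ereal (real N))"
proof -
  interpret log_convex_rate f
    by unfold_locales (use a b c(1) d e f in auto)
  have v1: "1 \<le> level_var i" for i by (rule level_var_ge_1)
  \<comment> \<open>From this time on g exceeds the variance that the levels up to i can produce,
    plus 1 for all later levels.\<close>
  have "\<exists>T\<ge>real i. 0 < T \<and> (\<forall>y\<ge>T. 1 + (\<Sum>k\<le>i. 2 * level_var k) \<le> g y)" for i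
  proof -
    have "\<forall>\<^sub>F y in at_top. 1 + (\<Sum>k\<le>i. 2 * level_var k) \<le> g y" using g2 by (simp add: filterlim_at_top)
    then obtain Y where "\<And>y. Y \<le> y \<Longrightarrow> 1 + (\<Sum>k\<le>i. 2 * level_var k) \<le> g y"
      by (auto simp: eventually_at_top_linorder)
    then show ?thesis by (intro exI[of _ "max Y (real i + 1)"]) auto
  qed
  then obtain T where T: "\<And>i. real i \<le> T i" "\<And>i. 0 < T i"
    "\<And>i y. T i \<le> y \<Longrightarrow> 1 + (\<Sum>k\<le>i. 2 * level_var k) \<le> g y"
    by metis
  \<comment> \<open>Dictated by \<open>mixing_rate_le\<close>: it makes f 2 equal to
    \<open>16 * \<epsilon> * f 1\<close>, and strict decrease of f keeps it below 1/16.\<close>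
  define \<epsilon> where "\<epsilon> = f 2 / (16 * f 1)"
  have f12: "0 < f 1" "0 < f 2" "f 1 \<le> 1" by (simp_all add: f_pos f_le_1)
  have "f 2 < f 1" using monotone_onD[OF f_decreasing, of 1 2] by simp
  then have \<epsilon>: "0 < \<epsilon>" "\<epsilon> \<le> 1/16" using f12 by (simp_all add: \<epsilon>_def divide_le_eq)
  obtain x :: "nat \<Rightarrow> real" where x: "\<And>i. 1 < x i" "\<And>i. \<theta> (x i) \<le> 1/8"
      "\<And>i y. x i \<le> y \<Longrightarrow> f y / \<theta> y \<le> 2 * (f (x i) / \<theta> (x i))"
      "\<And>i y. x i \<le> y \<Longrightarrow> level_var (Suc i) * 2 ^ Suc i \<le> g y"
      "\<And>i. level_var i * (2 * \<theta> (x i)) * T i \<le> 1/2"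
      "\<And>i. x i + 1 \<le> x (Suc i)"
      "\<And>i. level_var (Suc i) * (2 * \<theta> (x (Suc i))) \<le> (1/2) ^ Suc i * (2 * \<theta> (x i))"
      "\<And>i. f (x (Suc i)) \<le> (1/2) ^ Suc (Suc i) * (\<epsilon> * (1/2) ^ i * f (x i)) * (2 * \<theta> (x i))"
    using ex_tangent_sequence[OF g2, of T \<epsilon>] T(2) \<epsilon>(1) by metis
  define P where "P i = \<epsilon> * (1/2) ^ i * f (x i)" for i
  define r where "r i = 2 * \<theta> (x i)" for i
  have fx: "0 < f (x i)" "f (x i) \<le> 1" and \<theta>x: "0 < \<theta> (x i)" for i
    using x(1)[of i] by (auto intro: f_pos f_le_1 \<theta>_pos)
  interpret sparse_blocks P r
  proof
    fix j
    show P0: "0 < P j" using \<epsilon> fx by (simp add: P_def)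
    show r0: "0 < r j" using \<theta>x by (simp add: r_def)
    show "r j \<le> 1/4" using x(2)[of j] by (simp add: r_def)
    have "\<epsilon> * (1/2) ^ j * f (x j) \<le> (1/16) * (1/2) ^ j * 1"
      using \<epsilon> fx[of j] by (intro mult_mono) auto
    then show "P j \<le> (1/2) ^ j / 16" by (simp add: P_def)
    show "level_var (Suc j) * r (Suc j) \<le> (1/2) ^ Suc j * r j" using x(7)[of j] by (simp only: r_def)
    have "\<epsilon> * (1/2) ^ Suc j * f (x (Suc j)) \<le> 1 * f (x (Suc j))"
      using \<epsilon> fx[of "Suc j"] by (intro mult_right_mono mult_le_one power_le_one) auto
    then show "P (Suc j) \<le> (1/2) ^ Suc (Suc j) * P j * r j"
      using x(8)[of j] unfolding P_def r_def by linarith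
    \<comment> \<open>Near-maximality of \<open>f / \<theta>\<close> at \<open>x j\<close> costs a
      factor 2, which the halving in the masses compensates. So \<open>r / P\<close> is
      nondecreasing, and the growth of \<open>level_var\<close> makes the amplitudes strictly
      increasing.\<close>
    have "f (x (Suc j)) / \<theta> (x (Suc j)) \<le> 2 * (f (x j) / \<theta> (x j))"
      using x(3)[of j "x (Suc j)"] x(6)[of j] by simp
    then have "\<theta> (x j) * f (x (Suc j)) \<le> 2 * f (x j) * \<theta> (x (Suc j))"
      using \<theta>x[of j] \<theta>x[of "Suc j"] by (simp add: field_simps)
    then have "\<epsilon> * (1/2) ^ j * (\<theta> (x j) * f (x (Suc j))) \<le> \<epsilon> * (1/2) ^ j * (2 * f (x j) * \<theta> (x (Suc j)))"
      using \<epsilon> by (intro mult_left_mono) auto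
    then have "r j * P (Suc j) \<le> r (Suc j) * P j" by (simp add: P_def r_def mult_ac)
    moreover have "0 < P (Suc j)" using \<epsilon> fx[of "Suc j"] by (simp add: P_def)
    ultimately have le: "r j / P j \<le> r (Suc j) / P (Suc j)"
      using P0 by (simp only: pos_divide_le_eq pos_le_divide_eq times_divide_eq_left)
    have "level_var j < level_var (Suc j)"
    proof -
      have "1 < real (j + 2) ^ 4" by (intro one_less_power) auto
      then have "1 * level_var j < real (j + 2) ^ 4 * level_var j"
        using v1[of j] by (intro mult_strict_right_mono) auto
      then show ?thesis by (simp add: level_var_Suc)
    qed
    then have "level_var j * (r j / P j) < level_var (Suc j) * (r j / P j)"
      using P0 r0 by (intro mult_strict_right_mono) auto
    also have "\<dots> \<le> level_var (Suc j) * (r (Suc j) / P (Suc j))"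
      using le v1[of "Suc j"] by (intro mult_left_mono) auto
    finally show "level_var j * r j / P j < level_var (Suc j) * r (Suc j) / P (Suc j)" by simp
  qed
  obtain M :: "(int \<Rightarrow> real) measure" and X where "refresh_process stat rate M X"
    using ex_refresh_process by blast
  then interpret refresh_process stat rate M X .
  interpret sparse_process P r M X ..
  have mean: "expectation (X 0) = 0"
    using expectation_state[of "\<lambda>x. x" 0] integral_odd[of "\<lambda>x. x"] by simp
  have square: "integrable M (\<lambda>\<omega>. (X 0 \<omega>)\<^sup>2)"
    using integrable_state[of "\<lambda>x. x\<^sup>2" 0] square_integrable by simp
  have quantile: "(\<lambda>y. LBINT u:{0<..<f y}. (quantile_fun M (\<lambda>\<omega>. \<bar>X 0 \<omega>\<bar>) u)\<^sup>2)
      \<in> O[at_top](\<lambda>y. (- deriv f y) / f y * g y)"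
  proof (rule bigoI)
    show "\<forall>\<^sub>F y in at_top. norm (LBINT u:{0<..<f y}. (quantile_fun M (\<lambda>\<omega>. \<bar>X 0 \<omega>\<bar>) u)\<^sup>2)
        \<le> (4 + 4 / \<epsilon>) * norm ((- deriv f y) / f y * g y)"
    proof (rule eventually_mono[OF eventually_gt_at_top[of "x 0"]])
      fix y assume y: "x 0 < y"
      \<comment> \<open>Spacing of at least 1 sends the points to infinity, so y lies between two
        consecutive ones.\<close>
      have xk: "x 0 + real k \<le> x k" for k
      proof (induction k)
        case (Suc k)
        then show ?case using x(6)[of k] by simp
      qed simp
      obtain k0 :: nat where "y \<le> real k0" using real_arch_simple by blast
      then have ex: "y \<le> x k0" using xk[of k0] x(1)[of 0] by simp
      define k where "k = (LEAST k. y \<le> x k)"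
      have k: "y \<le> x k" unfolding k_def by (rule LeastI[of _ k0]) (rule ex)
      with y obtain j where j: "k = Suc j" by (cases k) auto
      have "j < (LEAST k. y \<le> x k)" using j by (simp add: k_def)
      then have lo: "x j < y" using not_less_Least not_le by blast
      have hi: "y \<le> x (Suc j)" using k by (simp add: j)
      have y1: "1 < y" using lo x(1)[of j] by simp
      have fy: "0 < f y" "f y \<le> 1" and \<theta>y: "0 < \<theta> y" using y1 by (auto intro: f_pos f_le_1 \<theta>_pos)
      have gy: "level_var (Suc j) * 2 ^ Suc j \<le> g y" using x(4)[of j y] lo by simp
      have gy1: "level_var (Suc j) \<le> g y"
      proof -
        have "level_var (Suc j) * 1 \<le> level_var (Suc j) * 2 ^ Suc j"
          using v1[of "Suc j"] by (intro mult_left_mono one_le_power) auto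
        then show ?thesis using gy unfolding mult_1_right by (rule order_trans)
      qed
      have gy2: "level_var j * 2 ^ j \<le> g y"
      proof -
        have "level_var j * 2 ^ j \<le> level_var (Suc j) * 2 ^ Suc j"
          using v1[of j] v1[of "Suc j"] by (intro mult_mono level_var_mono power_increasing) auto
        then show ?thesis using gy by (rule order_trans)
      qed
      let ?I = "LBINT u:{0<..<f y}. (quantile_fun M (\<lambda>\<omega>. \<bar>X 0 \<omega>\<bar>) u)\<^sup>2"
      have I: "0 \<le> ?I" "?I \<le> 2 * level_mass (Suc j) + f y * (amp j)\<^sup>2"
        using integral_quantile_le(1)[of "f y"] integral_quantile_le(2)[of "f y" j] fy by simp_all
      \<comment> \<open>The rarer levels are handled by the right end point:
        \<open>y \<le> x (Suc j)\<close> and \<theta> is nonincreasing.\<close>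
      have "level_mass (Suc j) \<le> g y * (2 * \<theta> y)"
        unfolding level_mass_def r_def using gy1 \<theta>_antimono[OF y1 hi] \<theta>x[of "Suc j"] v1[of "Suc j"]
        by (intro mult_mono) auto
      then have "2 * level_mass (Suc j) \<le> 4 * (\<theta> y * g y)" by (simp add: mult_ac)
      \<comment> \<open>The left end point enters here: beyond \<open>x j\<close> the quotient
        \<open>f / \<theta>\<close> is at most twice its value there, and g absorbs the variance
        factor together with the power of 2 from the mass.\<close>
      moreover have "f y * (amp j)\<^sup>2 \<le> 4 / \<epsilon> * (\<theta> y * g y)"
      proof -
        have "f y / \<theta> y \<le> 2 * (f (x j) / \<theta> (x j))" using x(3)[of j y] lo by simp
        then have A: "f y * \<theta> (x j) / f (x j) \<le> 2 * \<theta> y"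
          using \<theta>y \<theta>x[of j] fx[of j] by (simp add: field_simps)
        have "f y * (amp j)\<^sup>2 = (f y * \<theta> (x j) / f (x j)) * (2 / \<epsilon> * (level_var j * 2 ^ j))"
          unfolding amp_sq P_def r_def by (simp add: power_one_over field_simps)
        also have "\<dots> \<le> (2 * \<theta> y) * (2 / \<epsilon> * g y)"
          using A gy2 \<theta>y \<epsilon> v1[of j] by (intro mult_mono mult_left_mono) auto
        finally show ?thesis by (simp add: mult_ac)
      qed
      ultimately have "?I \<le> (4 + 4 / \<epsilon>) * (\<theta> y * g y)"
        unfolding distrib_right using I(2) by linarith
      moreover have "0 \<le> \<theta> y * g y" using \<theta>y gy1 v1[of "Suc j"] by (intro mult_nonneg_nonneg) auto
      ultimately show "norm ?I \<le> (4 + 4 / \<epsilon>) * norm ((- deriv f y) / f y * g y)"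
        using I(1) unfolding \<theta>_def[symmetric] by simp
    qed
  qed
  have mixing: "beta_mixing M X n \<le> f (real n)" if n: "1 \<le> n" for n
  proof -
    have "mixing_rate n \<le> f (real n)"
    proof (rule mixing_rate_le[OF \<epsilon> _ _ _ _ _ n])
      show "0 < f (real m)" if "1 \<le> m" for m :: nat using that by (intro f_pos) simp
      show "f (real 1) \<le> 1" using f12 by simp
      show "f (real 2) = 16 * \<epsilon> * f (real 1)" using f12 by (simp add: \<epsilon>_def)
      show "f (real k) * f (real l) \<le> f (real (k + l - 1)) * f (real 1)" if "1 \<le> k" "1 \<le> l" for k l
        using f_supermultiplicative[of "real k" "real l"] that by (simp add: of_nat_diff)
      show "P j * (1 - r j) ^ m \<le> \<epsilon> * (1/2) ^ j * (f (real m) * exp (- (r j / 2) * real m))"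
        if m: "1 \<le> m" for j m
      proof -
        \<comment> \<open>As r is twice \<theta>, the exponential splits into two equal factors. One
          is compared with f along the tangent at \<open>x j\<close>, the other is kept for the
          summation over time.\<close>
        have "(1 - r j) ^ m \<le> exp (- r j) ^ m"
          using exp_ge_add_one_self[of "- r j"] x(2)[of j] by (intro power_mono) (auto simp: r_def)
        also have "\<dots> = exp (real m * - r j)" by (rule exp_of_nat_mult[symmetric])
        also have "\<dots> = exp (- \<theta> (x j) * real m) * exp (- \<theta> (x j) * real m)"
          by (simp add: exp_add[symmetric] r_def mult_ac)
        also have "\<dots> \<le> exp (- \<theta> (x j) * (real m - x j)) * exp (- \<theta> (x j) * real m)"
          using \<theta>x[of j] x(1)[of j] by (intro mult_right_mono) (auto simp: algebra_simps)
        finally have "f (x j) * (1 - r j) ^ m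
            \<le> f (x j) * (exp (- \<theta> (x j) * (real m - x j)) * exp (- \<theta> (x j) * real m))"
          using fx[of j] by (intro mult_left_mono) auto
        also have "\<dots> = (f (x j) * exp (- \<theta> (x j) * (real m - x j))) * exp (- \<theta> (x j) * real m)"
          by (simp only: mult.assoc)
        also have "\<dots> \<le> f (real m) * exp (- \<theta> (x j) * real m)"
          using f_tangent[OF x(1)[of j], of "real m"] m by (intro mult_right_mono) auto
        also have "- \<theta> (x j) * real m = - (r j / 2) * real m" by (simp add: r_def)
        finally have "\<epsilon> * (1/2) ^ j * (f (x j) * (1 - r j) ^ m)
            \<le> \<epsilon> * (1/2) ^ j * (f (real m) * exp (- (r j / 2) * real m))"
          using \<epsilon> by (intro mult_left_mono) auto
        then show ?thesis by (simp only: P_def mult.assoc)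
      qed
    qed
    then show ?thesis using beta_mixing_le_mixing_rate(2)[of n] by linarith
  qed
  have variance: "norm_var M X n \<le> g (real n)" if "1 \<le> n" for n
  proof (rule norm_var_le_threshold[of T, OF T(1) _ _ _ that])
    show "level_mass i * T i \<le> 1/2" for i using x(5)[of i] by (simp only: level_mass_def r_def)
  qed (use g1 T(3) in auto)
  show ?thesis
  proof (intro exI[of _ M] exI[of _ X] exI[of _ "set_pmf stat"] conjI)
    show "irreducible_chain M X (set_pmf stat)" "aperiodic_chain M X (set_pmf stat)"
      by (rule irreducible_aperiodic, rule K_pos, assumption+)+
    show "\<exists>(J :: nat \<Rightarrow> nat) (b :: nat \<Rightarrow> real).
       strict_mono J \<and> (\<forall>n. J n > 0) \<and> (\<forall>n. b n > 0) \<and> filterlim b at_top sequentially \<and>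
       weak_conv_m (\<lambda>n. distr M borel (\<lambda>\<omega>. partial_sum X (J n) \<omega> / b n)) mu_P1sL"
      using strict_mono_block_length block_length_pos block_scale_pos block_scale_at_top weak_conv_blocks
      by (intro exI[of _ block_length] exI[of _ block_scale]) simp
  qed (use prob_space_axioms strictly_stationary countable_state_markov_chain reversible square mean quantile
      beta_mixing_le_mixing_rate(1) mixing norm_var_at_top concentration_tendsto_0[OF block_variance_unbounded]
      variance limsup_norm_var_ratio in auto)
qed

end
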